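(* Let $N\colon M^n=M_0^{n-1}\times I\to \mathbb{S}^{n}$ be a Ribaucour partial tube over a unit-speed curve $\beta\colon I\to \mathbb{S}^{n}$, and write the metric $d\sigma^2$ induced by $N$ as $d\sigma^2=v_0^2d\sigma_0^2+\nu^2ds^2$. Given $V\in C^{\infty}(I)$ and $U\in C^{\infty}(M_0)$, define $\gamma\in C^\infty(M)$ by $$ \gamma(x, s)=v_0(x,s)\left(U(x)+\int_0^{s}\frac{V(\tau)\nu(x,\tau)}{v_0(x,\tau)}d\tau\right). $$ Then the map $f\colon M^n\to \mathbb{R}^{n+1}$ given by $$ f=\gamma (i\circ N)+i_*N_*\mathrm{grad}\,\gamma, $$ where $i\colon \mathbb{S}^{n}\to \mathbb{R}^{n+1}$ is the inclusion and $\mathrm{grad}\,\gamma$ is computed with respect to the metric $d\sigma^2$ on $M^n$, defines, on the subset of its regular points, a hypersurface satisfying the following conditions with respect to the product net $\mathcal{E}=(E_0,E_1)$ of $M_0^{n-1}\times I$: (i) $\mathcal{E}$ is orthogonal with respect to the metric induced by $f$; (ii) the second fundamental form of $f$ is adapted to $\mathcal{E}$; (iii'') the image by $f$ of each leaf of $E_0$ is contained in an affine hyperplane of $\mathbb{R}^{n+1}$. Conversely, any hypersurface $f\colon M_0^{n-1}\times I\to \mathbb{R}^{n+1}$ satisfying conditions (i), (ii) and (iii'') whose shape operator has rank $n$ everywhere is given locally in this way.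
   Context: $I\subset\mathbb{R}$ is an open interval (with $0\in I$). The product net $(E_0,E_1)$ of $M_0^{n-1}\times I$ consists of the distributions formed by the tangent spaces to $M_0$ and to $I$, respectively; the leaves of $E_0$ are the sets $M_0\times\{s\}$. The second fundamental form $\alpha^f$ is adapted to $\mathcal{E}$ if $\alpha^f(X_0,X_1)=0$ for $X_0\in\Gamma(E_0)$, $X_1\in\Gamma(E_1)$. Ribaucour partial tube in $\mathbb{S}^n$ over a curve: let $\beta\colon I\to\mathbb{S}^n\subset\mathbb{R}^{n+1}$ be a unit-speed curve, $\xi_1,\dots,\xi_{n-1}$ an orthonormal frame of its normal bundle in $\mathbb{S}^n$ that is parallel in the normal connection, $f_0=(f_0^1,\dots,f_0^{n-1})\colon M_0^{n-1}\to\mathbb{R}^{n-1}$ a local isometry (local diffeomorphism with induced metric), and let $\phi\in C^\infty(I)$ and a normal vector field $\omega$ along $\beta$ satisfy $\alpha^\beta(\mathrm{grad}\,\phi,X)+\nabla^\perp_X\omega=0$ for all $X$, where $\alpha^\beta,\nabla^\perp$ are the second fundamental form and normal connection of $\beta$ in $\mathbb{S}^n$. Put $\mathcal{G}(x,s)=\phi'(s)\beta'(s)+\omega(s)+\sum_{j=1}^{n-1}f_0^j(x)\xi_j(s)+\phi(s)\beta(s)\in\mathbb{R}^{n+1}$. The map $N(x,s)=\beta(s)-2\phi(s)\,\mathcal{G}(x,s)/\|\mathcal{G}(x,s)\|^2$, which takes values in $\mathbb{S}^n$, is called a Ribaucour partial tube over $\beta$ if it is an immersion (hence a local diffeomorphism).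 For such $N$, the metric induced on $M_0\times I$ has the form $d\sigma^2=v_0^2d\sigma_0^2+\nu^2ds^2$, where $d\sigma_0^2$ is a metric of constant curvature $1$ on $M_0$, $ds^2$ is the standard metric on $I$, and $v_0,\nu$ are positive smooth functions on $M_0\times I$; this is the meaning of $v_0$ and $\nu$. *)

theory Defs
  imports "HOL-Analysis.Analysis"
begin

text \<open>Only used on open sets \<open>S\<close> of finite-dimensional spaces, where it is the usual notion.\<close>

primrec Ck_on :: "nat \<Rightarrow> 'a::real_normed_vector set \<Rightarrow> ('a \<Rightarrow> 'b::real_normed_vector) \<Rightarrow> bool" where
  "Ck_on 0 S f \<longleftrightarrow> continuous_on S f"
| "Ck_on (Suc k) S f \<longleftrightarrow>
     (\<forall>x\<in>S. f differentiable (at x)) \<and> (\<forall>v. Ck_on k S (\<lambda>x. frechet_derivative f (at x) v))"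

definition smooth_on :: "'a::real_normed_vector set \<Rightarrow> ('a \<Rightarrow> 'b::real_normed_vector) \<Rightarrow> bool" where
  "smooth_on S f \<longleftrightarrow> (\<forall>k. Ck_on k S f)"

text \<open>A chart is a pair of a domain and a coordinate map. A manifold is given by a smooth atlas
  \<open>A\<close> on open subsets of a Hausdorff, second countable type; its underlying set is \<open>points A\<close>.\<close>

type_synonym ('q, 'v) chart = "'q set \<times> ('q \<Rightarrow> 'v)"

definition chart_inv :: "('q, 'v) chart \<Rightarrow> 'v \<Rightarrow> 'q" where
  "chart_inv c = inv_into (fst c) (snd c)"

definition points :: "('q, 'v) chart set \<Rightarrow> 'q set" where
  "points A = (\<Union>c\<in>A. fst c)"

definition is_chart :: "('q::topological_space, 'v::euclidean_space) chart \<Rightarrow> bool" where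
  "is_chart c \<longleftrightarrow> open (fst c) \<and> open (snd c ` fst c) \<and>
     homeomorphism (fst c) (snd c ` fst c) (snd c) (chart_inv c)"

definition smooth_atlas ::
  "('q::{t2_space, second_countable_topology}, 'v::euclidean_space) chart set \<Rightarrow> bool" where
  "smooth_atlas A \<longleftrightarrow> (\<forall>c\<in>A. is_chart c) \<and>
     (\<forall>c\<in>A. \<forall>c'\<in>A. smooth_on (snd c ` (fst c \<inter> fst c')) (snd c' \<circ> chart_inv c))"

definition restrict_atlas :: "('q, 'v) chart set \<Rightarrow> 'q set \<Rightarrow> ('q, 'v) chart set" where
  "restrict_atlas A W = (\<lambda>c. (fst c \<inter> W, snd c)) ` A"

text \<open>In the chart \<open>prod_chart c I\<close> a tangent vector
  is a pair \<open>(u, a)\<close> of a tangent vector of the first factor (in the chart \<open>c\<close>) and a real number.\<close>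

definition prod_chart :: "('q, 'v) chart \<Rightarrow> real set \<Rightarrow> ('q \<times> real, 'v \<times> real) chart" where
  "prod_chart c I = (fst c \<times> I, map_prod (snd c) id)"

definition prod_atlas :: "('q, 'v) chart set \<Rightarrow> real set \<Rightarrow> ('q \<times> real, 'v \<times> real) chart set" where
  "prod_atlas A I = (\<lambda>c. prod_chart c I) ` A"

definition smooth_map ::
  "('q, 'v::euclidean_space) chart set \<Rightarrow> ('q \<Rightarrow> 'b::real_normed_vector) \<Rightarrow> bool" where
  "smooth_map A F \<longleftrightarrow> (\<forall>c\<in>A. smooth_on (snd c ` fst c) (F \<circ> chart_inv c))"

text \<open>\<open>differential c F x v\<close> is \<open>dF\<^sub>x\<close> applied to the tangent vector at \<open>x\<close> with components \<open>v\<close> in the chart \<open>c\<close>.\<close>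

definition differential ::
  "('q, 'v::euclidean_space) chart \<Rightarrow> ('q \<Rightarrow> 'b::real_normed_vector) \<Rightarrow> 'q \<Rightarrow> 'v \<Rightarrow> 'b" where
  "differential c F x = frechet_derivative (F \<circ> chart_inv c) (at (snd c x))"

definition regular_point ::
  "('q, 'v::euclidean_space) chart set \<Rightarrow> ('q \<Rightarrow> 'b::real_normed_vector) \<Rightarrow> 'q \<Rightarrow> bool" where
  "regular_point A F x \<longleftrightarrow>
     (\<forall>c\<in>A. x \<in> fst c \<longrightarrow> (F \<circ> chart_inv c) differentiable (at (snd c x)) \<and> inj (differential c F x))"

definition immersion ::
  "('q, 'v::euclidean_space) chart set \<Rightarrow> ('q \<Rightarrow> 'b::real_normed_vector) \<Rightarrow> bool" where
  "immersion A F \<longleftrightarrow> smooth_map A F \<and> (\<forall>x\<in>points A. regular_point A F x)"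

definition local_diffeo ::
  "('q::topological_space, 'v::euclidean_space) chart set \<Rightarrow> ('q \<Rightarrow> 'v) \<Rightarrow> bool" where
  "local_diffeo A F \<longleftrightarrow> smooth_map A F \<and>
     (\<forall>x\<in>points A. \<exists>W. open W \<and> x \<in> W \<and> W \<subseteq> points A \<and> open (F ` W) \<and> inj_on F W \<and>
        (\<forall>c\<in>A. smooth_on (F ` (W \<inter> fst c)) (snd c \<circ> inv_into W F)))"

text \<open>\<open>g c x u v\<close> is the inner product of the tangent vectors at \<open>x\<close> with components \<open>u\<close>, \<open>v\<close> in the chart \<open>c\<close>.\<close>

type_synonym ('q, 'v) metric = "('q, 'v) chart \<Rightarrow> 'q \<Rightarrow> 'v \<Rightarrow> 'v \<Rightarrow> real"

definition riemannian_metric ::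
  "('q, 'v::euclidean_space) chart set \<Rightarrow> ('q, 'v) metric \<Rightarrow> bool" where
  "riemannian_metric A g \<longleftrightarrow>
     (\<forall>c\<in>A. \<forall>x\<in>fst c. bilinear (g c x) \<and> (\<forall>u v. g c x u v = g c x v u) \<and>
        (\<forall>u. u \<noteq> 0 \<longrightarrow> g c x u u > 0)) \<and>
     (\<forall>c\<in>A. \<forall>u v. smooth_on (snd c ` fst c) (\<lambda>z. g c (chart_inv c z) u v)) \<and>
     (\<forall>c\<in>A. \<forall>c'\<in>A. \<forall>x\<in>fst c \<inter> fst c'. \<forall>u v.
        g c x u v = g c' x (differential c (snd c') x u) (differential c (snd c') x v))"

definition gradient ::
  "('q, 'v::euclidean_space) metric \<Rightarrow> ('q, 'v) chart \<Rightarrow> ('q \<Rightarrow> real) \<Rightarrow> 'q \<Rightarrow> 'v" where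
  "gradient g c h x = (THE w. \<forall>v. g c x w v = differential c h x v)"

text \<open>\<open>levi_civita g c x u v\<close> is \<open>\<nabla>\<^sub>u v\<close> for \<open>u\<close>, \<open>v\<close> extended with constant components
  (Christoffel symbols, by the Koszul formula); \<open>curvature g c x u v w\<close> is
  \<open>R(u,v)w = \<nabla>\<^sub>u \<nabla>\<^sub>v w - \<nabla>\<^sub>v \<nabla>\<^sub>u w\<close> for such fields, whose brackets vanish.\<close>

definition levi_civita ::
  "('q, 'v::euclidean_space) metric \<Rightarrow> ('q, 'v) chart \<Rightarrow> 'q \<Rightarrow> 'v \<Rightarrow> 'v \<Rightarrow> 'v" where
  "levi_civita g c x u v = (THE w. \<forall>y. g c x w y =
     (differential c (\<lambda>x. g c x v y) x u + differential c (\<lambda>x. g c x u y) x v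
        - differential c (\<lambda>x. g c x u v) x y) / 2)"

definition curvature ::
  "('q, 'v::euclidean_space) metric \<Rightarrow> ('q, 'v) chart \<Rightarrow> 'q \<Rightarrow> 'v \<Rightarrow> 'v \<Rightarrow> 'v \<Rightarrow> 'v" where
  "curvature g c x u v w =
     differential c (\<lambda>x. levi_civita g c x v w) x u - differential c (\<lambda>x. levi_civita g c x u w) x v
     + levi_civita g c x u (levi_civita g c x v w) - levi_civita g c x v (levi_civita g c x u w)"

definition sectional_curvature ::
  "('q, 'v::euclidean_space) metric \<Rightarrow> ('q, 'v) chart \<Rightarrow> 'q \<Rightarrow> 'v \<Rightarrow> 'v \<Rightarrow> real" where
  "sectional_curvature g c x u v =
     g c x (curvature g c x u v v) u / (g c x u u * g c x v v - (g c x u v)\<^sup>2)"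

text \<open>The condition is void in dimension one.\<close>

definition constant_curvature ::
  "('q, 'v::euclidean_space) chart set \<Rightarrow> ('q, 'v) metric \<Rightarrow> real \<Rightarrow> bool" where
  "constant_curvature A g \<kappa> \<longleftrightarrow>
     (\<forall>c\<in>A. \<forall>x\<in>fst c. \<forall>u v. u \<noteq> v \<and> independent {u, v} \<longrightarrow> sectional_curvature g c x u v = \<kappa>)"

definition induced_metric :: "('q \<Rightarrow> 'a::euclidean_space) \<Rightarrow> ('q, 'v::euclidean_space) metric" where
  "induced_metric F c x u v = differential c F x u \<bullet> differential c F x v"

text \<open>The component normal to \<open>F\<close> of the derivative of \<open>F\<^sub>* v\<close> in the direction \<open>u\<close>, with \<open>v\<close> extended with
  constant components; \<open>closest_point\<close> is here the orthogonal projection onto the tangent space.\<close>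

definition second_fundamental_form ::
  "('q \<Rightarrow> 'a::euclidean_space) \<Rightarrow> ('q, 'v::euclidean_space) chart \<Rightarrow> 'q \<Rightarrow> 'v \<Rightarrow> 'v \<Rightarrow> 'a" where
  "second_fundamental_form F c x u v =
     (let w = differential c (\<lambda>y. differential c F y v) x u
      in w - closest_point (range (differential c F x)) w)"

definition unit_normal ::
  "('q \<Rightarrow> 'a::euclidean_space) \<Rightarrow> ('q, 'v::euclidean_space) chart \<Rightarrow> 'q \<Rightarrow> 'a \<Rightarrow> bool" where
  "unit_normal F c x \<zeta> \<longleftrightarrow> norm \<zeta> = 1 \<and> (\<forall>v. \<zeta> \<bullet> differential c F x v = 0)"

definition shape_operator ::
  "('q \<Rightarrow> 'a::euclidean_space) \<Rightarrow> ('q, 'v::euclidean_space) chart \<Rightarrow> 'q \<Rightarrow> 'a \<Rightarrow> 'v \<Rightarrow> 'v" where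
  "shape_operator F c x \<zeta> u =
     (THE w. \<forall>v. induced_metric F c x w v = second_fundamental_form F c x u v \<bullet> \<zeta>)"

definition shape_operator_rank ::
  "('q, 'v::euclidean_space) chart set \<Rightarrow> ('q \<Rightarrow> 'a::euclidean_space) \<Rightarrow> nat \<Rightarrow> bool" where
  "shape_operator_rank A F r \<longleftrightarrow>
     (\<forall>c\<in>A. \<forall>x\<in>fst c. \<forall>\<zeta>. unit_normal F c x \<zeta> \<longrightarrow> dim (range (shape_operator F c x \<zeta>)) = r)"

text \<open>The fibres of \<open>E\<^sub>0\<close> and \<open>E\<^sub>1\<close> in a product chart.\<close>

definition E0 :: "('v::euclidean_space \<times> real) set" where "E0 = UNIV \<times> {0}"
definition E1 :: "('v::euclidean_space \<times> real) set" where "E1 = {0} \<times> UNIV"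

definition net_orthogonal ::
  "('p \<times> real, 'v::euclidean_space \<times> real) chart set \<Rightarrow> ('p \<times> real \<Rightarrow> 'a::euclidean_space) \<Rightarrow> bool" where
  "net_orthogonal B f \<longleftrightarrow>
     (\<forall>c\<in>B. \<forall>p\<in>fst c. \<forall>X0\<in>E0. \<forall>X1\<in>E1. induced_metric f c p X0 X1 = 0)"

definition second_form_adapted ::
  "('p \<times> real, 'v::euclidean_space \<times> real) chart set \<Rightarrow> ('p \<times> real \<Rightarrow> 'a::euclidean_space) \<Rightarrow> bool" where
  "second_form_adapted B f \<longleftrightarrow>
     (\<forall>c\<in>B. \<forall>p\<in>fst c. \<forall>X0\<in>E0. \<forall>X1\<in>E1. second_fundamental_form f c p X0 X1 = 0)"

definition leaves_in_hyperplanes ::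
  "('p \<times> real, 'v::euclidean_space \<times> real) chart set \<Rightarrow> ('p \<times> real \<Rightarrow> 'a::euclidean_space) \<Rightarrow> bool" where
  "leaves_in_hyperplanes B f \<longleftrightarrow>
     (\<forall>s. \<exists>a b. a \<noteq> 0 \<and> f ` (points B \<inter> UNIV \<times> {s}) \<subseteq> {y. a \<bullet> y = b})"

abbreviation velocity :: "(real \<Rightarrow> 'a::real_normed_vector) \<Rightarrow> real \<Rightarrow> 'a" where
  "velocity \<beta> s \<equiv> vector_derivative \<beta> (at s)"

text \<open>For a unit-speed curve \<open>\<beta>\<close> in the unit sphere: the orthogonal projection of an ambient vector onto
  the normal space of \<open>\<beta>\<close> in the sphere, the orthogonal complement of \<open>\<beta>(s)\<close> and \<open>\<beta>'(s)\<close>. The second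
  fundamental form and the normal connection are those of \<open>\<beta>\<close> as a submanifold of the sphere, evaluated
  on \<open>a \<partial>\<^sub>s\<close>, \<open>b \<partial>\<^sub>s\<close>.\<close>

definition normal_part :: "(real \<Rightarrow> 'a::euclidean_space) \<Rightarrow> real \<Rightarrow> 'a \<Rightarrow> 'a" where
  "normal_part \<beta> s w = w - (w \<bullet> \<beta> s) *\<^sub>R \<beta> s - (w \<bullet> velocity \<beta> s) *\<^sub>R velocity \<beta> s"

definition curve_second_form :: "(real \<Rightarrow> 'a::euclidean_space) \<Rightarrow> real \<Rightarrow> real \<Rightarrow> real \<Rightarrow> 'a" where
  "curve_second_form \<beta> s a b = (a * b) *\<^sub>R normal_part \<beta> s (velocity (velocity \<beta>) s)"

definition normal_connection ::
  "(real \<Rightarrow> 'a::euclidean_space) \<Rightarrow> (real \<Rightarrow> 'a) \<Rightarrow> real \<Rightarrow> real \<Rightarrow> 'a" where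
  "normal_connection \<beta> \<omega> s a = a *\<^sub>R normal_part \<beta> s (velocity \<omega> s)"

definition unit_speed_in_sphere :: "real set \<Rightarrow> (real \<Rightarrow> 'a::euclidean_space) \<Rightarrow> bool" where
  "unit_speed_in_sphere I \<beta> \<longleftrightarrow>
     smooth_on I \<beta> \<and> (\<forall>s\<in>I. \<beta> s \<in> sphere 0 1 \<and> norm (velocity \<beta> s) = 1)"

definition normal_field :: "real set \<Rightarrow> (real \<Rightarrow> 'a::euclidean_space) \<Rightarrow> (real \<Rightarrow> 'a) \<Rightarrow> bool" where
  "normal_field I \<beta> \<omega> \<longleftrightarrow>
     smooth_on I \<omega> \<and> (\<forall>s\<in>I. \<omega> s \<bullet> \<beta> s = 0 \<and> \<omega> s \<bullet> velocity \<beta> s = 0)"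

definition parallel_normal_frame ::
  "real set \<Rightarrow> (real \<Rightarrow> 'a::euclidean_space) \<Rightarrow> ('m \<Rightarrow> real \<Rightarrow> 'a) \<Rightarrow> bool" where
  "parallel_normal_frame I \<beta> \<xi> \<longleftrightarrow>
     (\<forall>j. normal_field I \<beta> (\<xi> j)) \<and>
     (\<forall>s\<in>I. \<forall>i j. \<xi> i s \<bullet> \<xi> j s = (if i = j then 1 else 0)) \<and>
     (\<forall>s\<in>I. \<forall>j a. normal_connection \<beta> (\<xi> j) s a = 0)"

text \<open>Since \<open>\<beta>\<close> has unit speed, \<open>grad \<phi> = \<phi>'(s) \<partial>\<^sub>s\<close>.\<close>

definition ribaucour_pair ::
  "real set \<Rightarrow> (real \<Rightarrow> 'a::euclidean_space) \<Rightarrow> (real \<Rightarrow> real) \<Rightarrow> (real \<Rightarrow> 'a) \<Rightarrow> bool" where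
  "ribaucour_pair I \<beta> \<phi> \<omega> \<longleftrightarrow> smooth_on I \<phi> \<and> normal_field I \<beta> \<omega> \<and>
     (\<forall>s\<in>I. \<forall>a. curve_second_form \<beta> s (deriv \<phi> s) a + normal_connection \<beta> \<omega> s a = 0)"

definition tube_vector ::
  "(real \<Rightarrow> 'a::euclidean_space) \<Rightarrow> ('m::finite \<Rightarrow> real \<Rightarrow> 'a) \<Rightarrow> ('p \<Rightarrow> real^'m) \<Rightarrow>
    (real \<Rightarrow> real) \<Rightarrow> (real \<Rightarrow> 'a) \<Rightarrow> 'p \<Rightarrow> real \<Rightarrow> 'a" where
  "tube_vector \<beta> \<xi> f0 \<phi> \<omega> x s =
     deriv \<phi> s *\<^sub>R velocity \<beta> s + \<omega> s + (\<Sum>j\<in>UNIV. (f0 x $ j) *\<^sub>R \<xi> j s) + \<phi> s *\<^sub>R \<beta> s"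

text \<open>The immersion condition forces \<open>\<phi> \<noteq> 0\<close> (if \<open>\<phi>(s) = 0\<close> then \<open>N\<close> is constant on the leaf through
  \<open>s\<close>), hence the denominator does not vanish.\<close>

definition ribaucour_partial_tube ::
  "('p::topological_space, real^'m) chart set \<Rightarrow> real set \<Rightarrow> (real \<Rightarrow> 'a::euclidean_space) \<Rightarrow>
    ('p \<times> real \<Rightarrow> 'a) \<Rightarrow> bool" where
  "ribaucour_partial_tube A I \<beta> N \<longleftrightarrow> unit_speed_in_sphere I \<beta> \<and>
     (\<exists>\<xi> f0 \<phi> \<omega>. parallel_normal_frame I \<beta> \<xi> \<and> local_diffeo A f0 \<and> ribaucour_pair I \<beta> \<phi> \<omega> \<and>
        (\<forall>x\<in>points A. \<forall>s\<in>I. N (x, s) =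
           \<beta> s - (2 * \<phi> s / (norm (tube_vector \<beta> \<xi> f0 \<phi> \<omega> x s))\<^sup>2) *\<^sub>R tube_vector \<beta> \<xi> f0 \<phi> \<omega> x s)) \<and>
     immersion (prod_atlas A I) N"

text \<open>The metric induced by \<open>N\<close> is \<open>v\<^sub>0\<^sup>2 d\<sigma>\<^sub>0\<^sup>2 + \<nu>\<^sup>2 ds\<^sup>2\<close>, with \<open>d\<sigma>\<^sub>0\<^sup>2 = g0\<close> of constant curvature 1.\<close>

definition metric_decomposition ::
  "('p, 'v::euclidean_space) chart set \<Rightarrow> real set \<Rightarrow> ('p \<times> real \<Rightarrow> 'a::euclidean_space) \<Rightarrow>
    ('p, 'v) metric \<Rightarrow> ('p \<times> real \<Rightarrow> real) \<Rightarrow> ('p \<times> real \<Rightarrow> real) \<Rightarrow> bool" where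
  "metric_decomposition A I N g0 v0 \<nu> \<longleftrightarrow>
     riemannian_metric A g0 \<and> constant_curvature A g0 1 \<and>
     smooth_map (prod_atlas A I) v0 \<and> smooth_map (prod_atlas A I) \<nu> \<and>
     (\<forall>x\<in>points A. \<forall>s\<in>I. v0 (x, s) > 0 \<and> \<nu> (x, s) > 0) \<and>
     (\<forall>c\<in>A. \<forall>x\<in>fst c. \<forall>s\<in>I. \<forall>u v a b.
        induced_metric N (prod_chart c I) (x, s) (u, a) (v, b) =
          (v0 (x, s))\<^sup>2 * g0 c x u v + (\<nu> (x, s))\<^sup>2 * (a * b))"

text \<open>The interval integral is oriented, so this is also right for \<open>s < 0\<close>.\<close>

definition gamma_fun ::
  "('p \<times> real \<Rightarrow> real) \<Rightarrow> ('p \<times> real \<Rightarrow> real) \<Rightarrow> ('p \<Rightarrow> real) \<Rightarrow> (real \<Rightarrow> real) \<Rightarrow> 'p \<times> real \<Rightarrow> real" where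
  "gamma_fun v0 \<nu> U V =
     (\<lambda>(x, s). v0 (x, s) * (U x + (LBINT \<tau>=0..ereal s. V \<tau> * \<nu> (x, \<tau>) / v0 (x, \<tau>))))"

text \<open>\<open>\<gamma> N + N\<^sub>* grad \<gamma>\<close>, with the gradient of the metric induced by \<open>N\<close>. The gradient is computed in an
  arbitrary chart around the point; on a smooth atlas the result does not depend on it.\<close>

definition gauss_parametrization ::
  "('q, 'v::euclidean_space) chart set \<Rightarrow> ('q \<Rightarrow> 'a::euclidean_space) \<Rightarrow> ('q \<Rightarrow> real) \<Rightarrow> 'q \<Rightarrow> 'a" where
  "gauss_parametrization B N \<gamma> p =
     (let c = (SOME c. c \<in> B \<and> p \<in> fst c)
      in \<gamma> p *\<^sub>R N p + differential c N p (gradient (induced_metric N) c \<gamma> p))"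

definition interval_diffeo :: "real set \<Rightarrow> real set \<Rightarrow> (real \<Rightarrow> real) \<Rightarrow> bool" where
  "interval_diffeo J K h \<longleftrightarrow> bij_betw h J K \<and> smooth_on J h \<and> smooth_on K (inv_into J h)"

end

theory Submission
  imports Defs
begin

text \<open>A tube \<open>N\<close> is the reflection of \<open>\<beta>\<close> in the hyperplane orthogonal to \<open>G\<close>, so \<open>N(x, s) \<bullet> C(s) = - \<phi>'(s)\<close> for
  \<open>C = \<phi> \<beta>' - \<phi>' \<beta>\<close>: each leaf is part of a small hypersphere, and its mean curvature
  \<open>(\<partial>\<^sub>s v\<^sub>0) / (v\<^sub>0 \<nu>)\<close> depends on \<open>s\<close> only. The vector \<open>f\<close> is characterised by \<open>f \<bullet> N = \<gamma>\<close> and \<open>f \<bullet> dN = d\<gamma>\<close>, so \<open>N\<close> is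
  normal to \<open>f\<close>. The formula for \<open>\<gamma>\<close> says \<open>\<partial>\<^sub>s \<gamma> = (\<partial>\<^sub>s v\<^sub>0 / v\<^sub>0) \<gamma> + V \<nu>\<close>; together with the constancy of the mean
  curvature this makes the mixed Hessian of \<open>\<gamma>\<close> vanish, which gives all three conditions.

  Conversely, rank \<open>n\<close> makes the Gauss map \<open>N\<close> of \<open>f\<close> an immersion, the first two conditions make the net orthogonal
  for \<open>N\<close>, and the third one yields \<open>\<partial>\<^sub>s N = \<nu> (c(s) - \<mu>(s) N)\<close>. No differential equation has to be solved to recover the
  tube: \<open>\<beta>(s) = N(x\<^sup>*, s)\<close> for a point \<open>x\<^sup>*\<close> outside a small neighbourhood, parametrized by arc length, is an orthogonal
  trajectory of the leaves; \<open>\<phi>\<close> and the parallel frame are the length and the direction of \<open>\<partial>\<^sub>X N\<close> along \<open>\<beta>\<close>; and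
  \<open>G = \<phi> (\<beta> - N) / (1 - N \<bullet> \<beta>)\<close> satisfies \<open>\<partial>\<^sub>s G \<parallel> \<beta>'\<close>, so its normal components split as a function of \<open>x\<close> plus a
  function of \<open>s\<close>.\<close>

subsection \<open>Directional derivatives\<close>

text \<open>In the direct part \<open>f\<close> is known only through its products with
  \<open>N\<close> and \<open>dN\<close>, so vector identities are checked by pairing with
  \<open>N\<close>, \<open>\<partial>\<^sub>s N\<close> and the vectors tangent to the leaf; these
  span the ambient space. In the converse the obstacle is the denominator
  \<open>1 - N \<bullet> \<beta>\<close> of \<open>G\<close>, which vanishes where
  \<open>N = \<beta>\<close>. Therefore the base point of the trajectory is taken on the boundary of
  the final neighbourhood, inside a larger one on which the Gauss map is injective. The hyperplanes
  are given leaf by leaf without regularity in \<open>s\<close>, so \<open>c\<close> and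
  \<open>\<mu>\<close> are rebuilt from the Gauss map along one trajectory. Uniqueness for equations
  in \<open>s\<close> is replaced by quotients and differences with zero
  \<open>s\<close>-derivative. The curvature-one metric comes from the leaf at parameter 0: it lies
  in the intersection of the unit sphere with a hyperplane, and moving the centre of that
  intersection to the origin and rescaling puts it into a great sphere.\<close>

definition dd :: "'a::real_normed_vector \<Rightarrow> ('a \<Rightarrow> 'b::real_normed_vector) \<Rightarrow> 'a \<Rightarrow> 'b" where
  "dd v f x = frechet_derivative f (at x) v"

lemma dd_has_derivative:
  assumes "f differentiable (at x)"
  shows "(f has_derivative (\<lambda>v. dd v f x)) (at x)"
  using assms by (simp add: dd_def frechet_derivative_works)

lemma dd_eq: "(f has_derivative f') (at x) \<Longrightarrow> dd v f x = f' v"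
  unfolding dd_def using frechet_derivative_at by metis

text \<open>\<open>frechet_derivative\<close> is a choice from the set of derivatives, and that set
  depends only on the germ; so the rule also covers points where there is no derivative.\<close>

lemma dd_cong:
  assumes "open S" "x \<in> S" "\<And>y. y \<in> S \<Longrightarrow> f y = g y"
  shows "dd v f x = dd v g x"
proof -
  have "(f has_derivative f') (at x) \<longleftrightarrow> (g has_derivative f') (at x)" for f'
    using assms has_derivative_transform_within_open[of f f' x UNIV S g]
      has_derivative_transform_within_open[of g f' x UNIV S f] by auto
  then show ?thesis
    by (simp add: dd_def frechet_derivative_def)
qed

lemma differentiable_cong_open:
  assumes "open S" "x \<in> S" "\<And>y. y \<in> S \<Longrightarrow> f y = g y"
  shows "f differentiable (at x) \<longleftrightarrow> g differentiable (at x)"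
  unfolding differentiable_def
  using assms has_derivative_transform_within_open[of f _ x UNIV S g]
    has_derivative_transform_within_open[of g _ x UNIV S f] by metis

lemma linear_dd: "f differentiable (at x) \<Longrightarrow> linear (\<lambda>v. dd v f x)"
  by (simp add: dd_def linear_frechet_derivative)

lemma dd_add_dir: "f differentiable (at x) \<Longrightarrow> dd (u + v) f x = dd u f x + dd v f x"
  using linear_add[OF linear_dd] .

lemma dd_scaleR_dir: "f differentiable (at x) \<Longrightarrow> dd (r *\<^sub>R v) f x = r *\<^sub>R dd v f x"
  using linear_scale[OF linear_dd] .

lemma dd_zero_dir: "f differentiable (at x) \<Longrightarrow> dd 0 f x = 0"
  using linear_0[OF linear_dd] .

text \<open>Turns a derivative in a point-dependent direction into derivatives in fixed directions,
  the only ones that \<open>Ck_on\<close> speaks about.\<close>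

lemma dd_basis:
  fixes f :: "'a::euclidean_space \<Rightarrow> 'b::real_normed_vector"
  assumes "f differentiable (at x)"
  shows "dd v f x = (\<Sum>b\<in>Basis. (v \<bullet> b) *\<^sub>R dd b f x)"
proof -
  have "dd v f x = dd (\<Sum>b\<in>Basis. (v \<bullet> b) *\<^sub>R b) f x"
    by (simp add: euclidean_representation)
  also have "\<dots> = (\<Sum>b\<in>Basis. (v \<bullet> b) *\<^sub>R dd b f x)"
    by (simp only: linear_sum[OF linear_dd[OF assms]] linear_scale[OF linear_dd[OF assms]])
  finally show ?thesis .
qed

lemma dd_const [simp]: "dd v (\<lambda>x. c) x = 0"
  by (simp add: dd_def)

lemma dd_bilinear:
  assumes "bounded_bilinear B" "f differentiable (at x)" "g differentiable (at x)"
  shows "dd v (\<lambda>x. B (f x) (g x)) x = B (f x) (dd v g x) + B (dd v f x) (g x)"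
  by (rule dd_eq, rule bounded_bilinear.FDERIV[OF assms(1)]) (use assms dd_has_derivative in auto)

lemmas dd_inner = dd_bilinear[OF bounded_bilinear_inner]
lemmas dd_scaleR = dd_bilinear[OF bounded_bilinear_scaleR]
lemmas dd_mult = dd_bilinear[OF bounded_bilinear_mult]

lemma dd_linear:
  assumes "bounded_linear L" "f differentiable (at x)"
  shows "dd v (\<lambda>x. L (f x)) x = L (dd v f x)"
  by (rule dd_eq, rule bounded_linear.has_derivative[OF assms(1)]) (use assms dd_has_derivative in auto)

lemma dd_add:
  assumes "f differentiable (at x)" "g differentiable (at x)"
  shows "dd v (\<lambda>x. f x + g x) x = dd v f x + dd v g x"
  by (rule dd_eq, rule has_derivative_add) (use assms dd_has_derivative in auto)

lemma dd_diff:
  assumes "f differentiable (at x)" "g differentiable (at x)"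
  shows "dd v (\<lambda>x. f x - g x) x = dd v f x - dd v g x"
  by (rule dd_eq, rule has_derivative_diff) (use assms dd_has_derivative in auto)

lemma dd_inverse:
  fixes f :: "'a::real_normed_vector \<Rightarrow> real"
  assumes "f differentiable (at x)" "f x \<noteq> 0"
  shows "dd v (\<lambda>x. inverse (f x)) x = - (inverse (f x) * dd v f x * inverse (f x))"
  by (rule dd_eq, rule Deriv.has_derivative_inverse) (use assms dd_has_derivative in auto)

lemma dd_divide:
  fixes f :: "'a::real_normed_vector \<Rightarrow> real"
  assumes "f differentiable (at x)" "g differentiable (at x)" "g x \<noteq> 0"
  shows "dd v (\<lambda>x. f x / g x) x = (dd v f x * g x - f x * dd v g x) / (g x)\<^sup>2"
proof -
  have "((\<lambda>x. f x / g x) has_derivative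
      (\<lambda>h. - f x * (inverse (g x) * dd h g x * inverse (g x)) + dd h f x / g x)) (at x)"
    by (rule has_derivative_divide) (use assms dd_has_derivative in auto)
  from dd_eq[OF this] show ?thesis
    using assms(3) by (simp add: field_simps power2_eq_square)
qed

lemma dd_compose:
  assumes "f differentiable (at x)" "g differentiable (at (f x))"
  shows "dd v (\<lambda>x. g (f x)) x = dd (dd v f x) g (f x)"
  by (rule dd_eq, rule has_derivative_compose[of f _ x UNIV g, simplified])
     (use assms dd_has_derivative in auto)

lemma velocity_eq_dd:
  assumes "f differentiable (at t)"
  shows "velocity f t = dd 1 f t"
  using frechet_derivative_eq_vector_derivative[OF assms] by (simp add: dd_def)

lemma deriv_eq_dd:
  fixes f :: "real \<Rightarrow> real"
  assumes "f differentiable (at t)"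
  shows "deriv f t = dd 1 f t"
proof -
  have "(\<lambda>v. dd v f t) = (*) (dd 1 f t)"
  proof
    fix v show "dd v f t = dd 1 f t * v"
      using dd_scaleR_dir[OF assms, of v 1] by (metis mult.commute mult.right_neutral real_scaleR_def)
  qed
  then have "(f has_derivative (*) (dd 1 f t)) (at t)"
    using dd_has_derivative[OF assms] by simp
  then have "(f has_field_derivative dd 1 f t) (at t)"
    by (simp add: has_field_derivative_def)
  then show ?thesis by (rule DERIV_imp_deriv)
qed


subsection \<open>Functions of class \<open>C\<^sup>k\<close>\<close>

text \<open>With the direction as first argument of \<open>dd\<close>, the partial application
  \<open>dd v f\<close> is again a function, and higher derivatives are iterated
  applications.\<close>

lemma Ck_on_Suc: "Ck_on (Suc k) S f \<longleftrightarrow> (\<forall>x\<in>S. f differentiable (at x)) \<and> (\<forall>v. Ck_on k S (dd v f))"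
  by (simp add: dd_def[abs_def])

declare Ck_on.simps(2) [simp del]

lemma Ck_on_subset: "Ck_on k S f \<Longrightarrow> T \<subseteq> S \<Longrightarrow> Ck_on k T f"
  by (induction k arbitrary: f) (auto simp: Ck_on_Suc intro: continuous_on_subset)

lemma Ck_on_cong:
  assumes "open S" "\<And>x. x \<in> S \<Longrightarrow> f x = g x"
  shows "Ck_on k S f \<longleftrightarrow> Ck_on k S g"
  using assms(2)
proof (induction k arbitrary: f g)
  case 0
  then show ?case by (auto cong: continuous_on_cong)
next
  case (Suc k)
  have "Ck_on k S (dd v f) = Ck_on k S (dd v g)" for v
    by (rule Suc.IH) (use dd_cong[OF assms(1)] Suc.prems in auto)
  moreover have "\<forall>x\<in>S. f differentiable (at x) \<longleftrightarrow> g differentiable (at x)"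
    using differentiable_cong_open[OF assms(1)] Suc.prems by blast
  ultimately show ?case by (auto simp: Ck_on_Suc)
qed

lemma Ck_on_SucD: "Ck_on (Suc k) S f \<Longrightarrow> Ck_on k S f"
proof (induction k arbitrary: f)
  case 0
  then show ?case
    by (auto simp: Ck_on_Suc intro!: continuous_at_imp_continuous_on differentiable_imp_continuous_within)
next
  case (Suc k)
  then show ?case unfolding Ck_on_Suc[of "Suc k"] by (auto simp: Ck_on_Suc[of k])
qed

text \<open>Form used by the closure proofs below: a derivative formula and the class of that
  formula, so an induction on \<open>k\<close> only has to look at the right-hand side of a
  differentiation rule.\<close>

lemma Ck_on_SucI:
  assumes "open S" "\<And>x. x \<in> S \<Longrightarrow> (f has_derivative f' x) (at x)"
    "\<And>v. Ck_on k S (\<lambda>x. f' x v)"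
  shows "Ck_on (Suc k) S f"
  unfolding Ck_on_Suc
proof (intro conjI ballI allI)
  show "f differentiable (at x)" if "x \<in> S" for x
    using assms(2)[OF that] by (auto simp: differentiable_def)
  show "Ck_on k S (dd v f)" for v
    using assms(3)[of v] Ck_on_cong[OF assms(1), of "dd v f" "\<lambda>x. f' x v" k] dd_eq[OF assms(2)]
    by auto
qed

lemma Ck_on_has_derivative:
  "Ck_on (Suc k) S f \<Longrightarrow> x \<in> S \<Longrightarrow> (f has_derivative (\<lambda>v. dd v f x)) (at x)"
  by (auto simp: Ck_on_Suc intro: dd_has_derivative)

lemma Ck_on_const [intro, simp]: "Ck_on k S (\<lambda>x. c)"
  by (induction k arbitrary: c) (auto simp: Ck_on_Suc dd_def[abs_def])

lemma Ck_on_linear: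
  assumes "open S" "bounded_linear L" "Ck_on k S f"
  shows "Ck_on k S (\<lambda>x. L (f x))"
  using assms(3)
proof (induction k arbitrary: f)
  case 0
  then show ?case by (auto intro: bounded_linear.continuous_on[OF assms(2)])
next
  case (Suc k)
  show ?case
    by (rule Ck_on_SucI[OF assms(1) bounded_linear.has_derivative[OF assms(2) Ck_on_has_derivative[OF Suc.prems]]])
       (use Suc in \<open>auto simp: Ck_on_Suc\<close>)
qed

lemma Ck_on_ident: "open S \<Longrightarrow> Ck_on k S (\<lambda>x. x)"
  by (cases k) (auto intro!: Ck_on_SucI[where f' = "\<lambda>x v. v"] derivative_eq_intros)

lemma Ck_on_add:
  assumes "open S" "Ck_on k S f" "Ck_on k S g"
  shows "Ck_on k S (\<lambda>x. f x + g x)"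
  using assms(2,3)
proof (induction k arbitrary: f g)
  case 0
  then show ?case by (auto intro: continuous_intros)
next
  case (Suc k)
  show ?case
    by (rule Ck_on_SucI[OF assms(1) has_derivative_add[OF Ck_on_has_derivative[OF Suc.prems(1)]
          Ck_on_has_derivative[OF Suc.prems(2)]]])
       (use Suc in \<open>auto simp: Ck_on_Suc\<close>)
qed

lemma Ck_on_bilinear:
  assumes "open S" "bounded_bilinear B" "Ck_on k S f" "Ck_on k S g"
  shows "Ck_on k S (\<lambda>x. B (f x) (g x))"
  using assms(3,4)
proof (induction k arbitrary: f g)
  case 0
  then show ?case by (auto intro: bounded_bilinear.continuous_on[OF assms(2)])
next
  case (Suc k)
  show ?case
  proof (rule Ck_on_SucI[OF assms(1) bounded_bilinear.FDERIV[OF assms(2) Ck_on_has_derivative[OF Suc.prems(1)]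
          Ck_on_has_derivative[OF Suc.prems(2)]]])
    fix v
    show "Ck_on k S (\<lambda>x. B (f x) (dd v g x) + B (dd v f x) (g x))"
      using Suc Ck_on_SucD[OF Suc.prems(1)] Ck_on_SucD[OF Suc.prems(2)]
      by (intro Ck_on_add[OF assms(1)]) (auto simp: Ck_on_Suc)
  qed auto
qed

lemma Ck_on_sum:
  assumes "open S" "\<And>i. i \<in> T \<Longrightarrow> Ck_on k S (f i)"
  shows "Ck_on k S (\<lambda>x. \<Sum>i\<in>T. f i x)"
  using assms(2) by (induction T rule: infinite_finite_induct) (auto intro: Ck_on_add[OF assms(1)])

text \<open>The induction varies \<open>g\<close> and keeps \<open>f\<close>: the chain rule
  produces \<open>dd b g (f x)\<close>, again a composition with \<open>f\<close>, and the moving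
  direction \<open>dd v f x\<close> is expanded in the basis.\<close>

lemma Ck_on_compose:
  fixes f :: "'a::real_normed_vector \<Rightarrow> 'b::euclidean_space" and g :: "'b \<Rightarrow> 'c::real_normed_vector"
  assumes "open S" "open T" "f ` S \<subseteq> T" "Ck_on k S f" "Ck_on k T g"
  shows "Ck_on k S (\<lambda>x. g (f x))"
  using assms(4,5)
proof (induction k arbitrary: g)
  case 0
  then show ?case using assms(3) by (auto intro: continuous_on_compose2)
next
  case (Suc k)
  have f: "(f has_derivative (\<lambda>v. dd v f x)) (at x)" if "x \<in> S" for x
    using Ck_on_has_derivative[OF Suc.prems(1) that] .
  have g: "g differentiable (at (f x))" if "x \<in> S" for x
    using Suc.prems(2) that assms(3) by (auto simp: Ck_on_Suc)
  have gf: "((\<lambda>x. g (f x)) has_derivative (\<lambda>v. \<Sum>b\<in>Basis. (dd v f x \<bullet> b) *\<^sub>R dd b g (f x))) (at x)"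
    if "x \<in> S" for x
    using has_derivative_compose[OF f[OF that] dd_has_derivative[OF g[OF that]]]
    by (simp add: dd_basis[OF g[OF that], of "dd _ f x"])
  show ?case
  proof (rule Ck_on_SucI[OF assms(1) gf])
    fix v
    show "Ck_on k S (\<lambda>x. \<Sum>b\<in>Basis. (dd v f x \<bullet> b) *\<^sub>R dd b g (f x))"
      using Suc.prems
      by (intro Ck_on_sum[OF assms(1)] Ck_on_bilinear[OF assms(1) bounded_bilinear_scaleR]
          Ck_on_linear[OF assms(1) bounded_linear_inner_left] Suc.IH Ck_on_SucD[OF Suc.prems(1)])
         (auto simp: Ck_on_Suc)
  qed
qed

text \<open>The derivative is a polynomial in the function itself, so the induction hypothesis
  applies to it directly.\<close>

lemma Ck_on_inverse: "Ck_on k (- {0}) (inverse :: real \<Rightarrow> real)"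
proof (induction k)
  case 0
  then show ?case by (auto intro!: continuous_intros)
next
  case (Suc k)
  show ?case
    by (rule Ck_on_SucI[where f' = "\<lambda>x v. - (inverse x * v * inverse x)"])
       (auto intro!: derivative_eq_intros Ck_on_linear[OF _ bounded_linear_minus[OF bounded_linear_ident]]
          Ck_on_bilinear[OF _ bounded_bilinear_mult] Suc)
qed

lemma Ck_on_sqrt: "Ck_on k {0<..} sqrt"
proof (induction k)
  case 0
  then show ?case by (auto intro!: continuous_intros)
next
  case (Suc k)
  have "Ck_on k {0<..} (\<lambda>x. inverse (sqrt x))"
    by (rule Ck_on_compose[OF _ _ _ Suc Ck_on_inverse]) auto
  then have *: "Ck_on k {0<..} (\<lambda>x. (v / 2) * inverse (sqrt x))" for v
    by (intro Ck_on_bilinear[OF _ bounded_bilinear_mult]) auto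
  show ?case
    by (rule Ck_on_SucI[OF _ _ *])
       (auto intro!: derivative_eq_intros simp: field_simps)
qed

lemma smooth_on_subset: "smooth_on S f \<Longrightarrow> T \<subseteq> S \<Longrightarrow> smooth_on T f"
  by (auto simp: smooth_on_def intro: Ck_on_subset)

lemma smooth_on_cong: "open S \<Longrightarrow> (\<And>x. x \<in> S \<Longrightarrow> f x = g x) \<Longrightarrow> smooth_on S f \<longleftrightarrow> smooth_on S g"
  unfolding smooth_on_def using Ck_on_cong by blast

lemma smooth_on_dd: "smooth_on S f \<Longrightarrow> smooth_on S (dd v f)"
  unfolding smooth_on_def using Ck_on_Suc by blast

lemma smooth_on_differentiable: "smooth_on S f \<Longrightarrow> x \<in> S \<Longrightarrow> f differentiable (at x)"
  unfolding smooth_on_def using Ck_on_Suc by blast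

lemma smooth_on_continuous: "smooth_on S f \<Longrightarrow> continuous_on S f"
  unfolding smooth_on_def using Ck_on.simps(1) by blast

lemma smooth_onI_dd:
  assumes "\<And>x. x \<in> S \<Longrightarrow> f differentiable (at x)" "\<And>v. smooth_on S (dd v f)"
  shows "smooth_on S f"
  unfolding smooth_on_def
proof
  fix k
  have "Ck_on (Suc k) S f" using assms by (auto simp: Ck_on_Suc smooth_on_def)
  then show "Ck_on k S f" by (rule Ck_on_SucD)
qed

lemma smooth_on_const: "smooth_on S (\<lambda>x. c)"
  by (simp add: smooth_on_def)

lemma smooth_on_ident: "open S \<Longrightarrow> smooth_on S (\<lambda>x. x)"
  by (simp add: smooth_on_def Ck_on_ident)

lemma smooth_on_linear: "bounded_linear L \<Longrightarrow> open S \<Longrightarrow> smooth_on S f \<Longrightarrow> smooth_on S (\<lambda>x. L (f x))"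
  by (simp add: smooth_on_def Ck_on_linear)

lemma smooth_on_bilinear:
  "bounded_bilinear B \<Longrightarrow> open S \<Longrightarrow> smooth_on S f \<Longrightarrow> smooth_on S g \<Longrightarrow> smooth_on S (\<lambda>x. B (f x) (g x))"
  by (simp add: smooth_on_def Ck_on_bilinear)

lemma smooth_on_add: "open S \<Longrightarrow> smooth_on S f \<Longrightarrow> smooth_on S g \<Longrightarrow> smooth_on S (\<lambda>x. f x + g x)"
  by (simp add: smooth_on_def Ck_on_add)

lemma smooth_on_minus: "open S \<Longrightarrow> smooth_on S f \<Longrightarrow> smooth_on S (\<lambda>x. - f x)"
  by (rule smooth_on_linear[OF bounded_linear_minus[OF bounded_linear_ident]])

lemma smooth_on_diff: "open S \<Longrightarrow> smooth_on S f \<Longrightarrow> smooth_on S g \<Longrightarrow> smooth_on S (\<lambda>x. f x - g x)"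
  using smooth_on_add[of S f "\<lambda>x. - g x"] smooth_on_minus by auto

lemma smooth_on_sum:
  "open S \<Longrightarrow> (\<And>i. i \<in> T \<Longrightarrow> smooth_on S (f i)) \<Longrightarrow> smooth_on S (\<lambda>x. \<Sum>i\<in>T. f i x)"
  by (simp add: smooth_on_def Ck_on_sum)

lemmas smooth_on_inner = smooth_on_bilinear[OF bounded_bilinear_inner]
lemmas smooth_on_scaleR = smooth_on_bilinear[OF bounded_bilinear_scaleR]
lemmas smooth_on_mult = smooth_on_bilinear[OF bounded_bilinear_mult]

lemma smooth_on_compose:
  fixes f :: "'a::real_normed_vector \<Rightarrow> 'b::euclidean_space" and g :: "'b \<Rightarrow> 'c::real_normed_vector"
  assumes "open S" "open T" "f ` S \<subseteq> T" "smooth_on S f" "smooth_on T g"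
  shows "smooth_on S (\<lambda>x. g (f x))"
  using assms unfolding smooth_on_def by (blast intro: Ck_on_compose)

lemma smooth_on_inverse:
  fixes f :: "'a::real_normed_vector \<Rightarrow> real"
  assumes "open S" "smooth_on S f" "\<And>x. x \<in> S \<Longrightarrow> f x \<noteq> 0"
  shows "smooth_on S (\<lambda>x. inverse (f x))"
  by (rule smooth_on_compose[where T = "- {0}"]) (use assms Ck_on_inverse in \<open>auto simp: smooth_on_def[of _ inverse]\<close>)

lemma smooth_on_divide:
  fixes f :: "'a::real_normed_vector \<Rightarrow> real"
  assumes "open S" "smooth_on S f" "smooth_on S g" "\<And>x. x \<in> S \<Longrightarrow> g x \<noteq> 0"
  shows "smooth_on S (\<lambda>x. f x / g x)"
  unfolding divide_inverse by (intro smooth_on_mult smooth_on_inverse assms)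

lemma smooth_on_sqrt:
  fixes f :: "'a::real_normed_vector \<Rightarrow> real"
  assumes "open S" "smooth_on S f" "\<And>x. x \<in> S \<Longrightarrow> f x > 0"
  shows "smooth_on S (\<lambda>x. sqrt (f x))"
  by (rule smooth_on_compose[where T = "{0<..}"]) (use assms Ck_on_sqrt in \<open>auto simp: smooth_on_def[of _ sqrt]\<close>)

lemma smooth_on_power:
  fixes f :: "'a::real_normed_vector \<Rightarrow> real"
  assumes "open S" "smooth_on S f"
  shows "smooth_on S (\<lambda>x. f x ^ n)"
  by (induction n) (auto intro: smooth_on_const smooth_on_mult assms)

lemma smooth_on_norm:
  fixes f :: "'a::real_normed_vector \<Rightarrow> 'b::real_inner"
  assumes "open S" "smooth_on S f" "\<And>x. x \<in> S \<Longrightarrow> f x \<noteq> 0"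
  shows "smooth_on S (\<lambda>x. norm (f x))"
  unfolding norm_eq_sqrt_inner by (intro smooth_on_sqrt smooth_on_inner assms) (use assms in auto)

lemma smooth_on_Pair:
  fixes f :: "'a::real_normed_vector \<Rightarrow> 'b::real_normed_vector" and g :: "'a \<Rightarrow> 'c::real_normed_vector"
  assumes "open S" "smooth_on S f" "smooth_on S g"
  shows "smooth_on S (\<lambda>x. (f x, g x))"
proof -
  have "smooth_on S (\<lambda>x. (f x, 0) + (0, g x))"
    by (intro smooth_on_add smooth_on_linear[of "\<lambda>y. (y, 0)"] smooth_on_linear[of "\<lambda>y. (0, y)"] assms)
       (auto intro!: bounded_linear_intros)
  then show ?thesis by simp
qed

lemma smooth_on_fst: "open S \<Longrightarrow> smooth_on S f \<Longrightarrow> smooth_on S (\<lambda>x. fst (f x))"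
  by (rule smooth_on_linear[OF bounded_linear_fst])

lemma smooth_on_snd: "open S \<Longrightarrow> smooth_on S f \<Longrightarrow> smooth_on S (\<lambda>x. snd (f x))"
  by (rule smooth_on_linear[OF bounded_linear_snd])

lemmas smooth_intros = smooth_on_const smooth_on_ident smooth_on_add smooth_on_minus smooth_on_diff
  smooth_on_sum smooth_on_inner smooth_on_scaleR smooth_on_mult smooth_on_inverse smooth_on_divide
  smooth_on_sqrt smooth_on_norm smooth_on_Pair smooth_on_fst smooth_on_snd smooth_on_dd

subsection \<open>Symmetry of second derivatives\<close>

text \<open>Mean value theorem twice: first in the direction \<open>u\<close> for the difference of
  \<open>f\<close> along two opposite sides of the parallelogram, then in the direction
  \<open>v\<close> for \<open>dd u f\<close>.\<close>

lemma second_difference_mvt: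
  fixes f :: "'a::real_normed_vector \<Rightarrow> real"
  assumes f: "\<And>y. y \<in> S \<Longrightarrow> f differentiable (at y)"
    and fu: "\<And>y. y \<in> S \<Longrightarrow> dd u f differentiable (at y)"
    and S: "\<And>a b. \<lbrakk>0 \<le> a; a \<le> h; 0 \<le> b; b \<le> h\<rbrakk> \<Longrightarrow> x + a *\<^sub>R u + b *\<^sub>R v \<in> S"
    and h: "h > 0"
  obtains a b where "0 < a" "a < h" "0 < b" "b < h"
    "f (x + h *\<^sub>R u + h *\<^sub>R v) - f (x + h *\<^sub>R u) - f (x + h *\<^sub>R v) + f x
      = h * h * dd v (dd u f) (x + a *\<^sub>R u + b *\<^sub>R v)"
proof -
  define \<phi> where "\<phi> s = f (x + s *\<^sub>R u + h *\<^sub>R v) - f (x + s *\<^sub>R u)" for s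
  have d1: "((\<lambda>s. f (x + s *\<^sub>R u + b *\<^sub>R v)) has_real_derivative dd u f (x + s *\<^sub>R u + b *\<^sub>R v)) (at s)"
    if "0 \<le> s" "s \<le> h" "0 \<le> b" "b \<le> h" for s b
  proof -
    have df: "f differentiable (at (x + s *\<^sub>R u + b *\<^sub>R v))" using f S that by auto
    have "((\<lambda>s. f (x + s *\<^sub>R u + b *\<^sub>R v)) has_derivative (\<lambda>t. dd (t *\<^sub>R u) f (x + s *\<^sub>R u + b *\<^sub>R v))) (at s)"
      by (rule has_derivative_compose[of "\<lambda>s. x + s *\<^sub>R u + b *\<^sub>R v" "\<lambda>t. t *\<^sub>R u" s UNIV f, OF _ dd_has_derivative[OF df]])
         (auto intro!: derivative_eq_intros)
    then show ?thesis
      by (simp add: has_field_derivative_def dd_scaleR_dir[OF df] mult_commute_abs)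
  qed
  have d0: "((\<lambda>s. f (x + s *\<^sub>R u)) has_real_derivative dd u f (x + s *\<^sub>R u)) (at s)"
    if "0 \<le> s" "s \<le> h" for s
    using d1[OF that, of 0] h by simp
  have "\<exists>a>0. a < h \<and> \<phi> h - \<phi> 0 = (h - 0) * (dd u f (x + a *\<^sub>R u + h *\<^sub>R v) - dd u f (x + a *\<^sub>R u))"
    by (rule MVT2[OF h]) (unfold \<phi>_def, auto intro!: DERIV_diff d1 d0 simp: h less_imp_le)
  then obtain a where a: "a > 0" "a < h"
    "\<phi> h - \<phi> 0 = h * (dd u f (x + a *\<^sub>R u + h *\<^sub>R v) - dd u f (x + a *\<^sub>R u))" by auto
  have d2: "((\<lambda>t. dd u f (x + a *\<^sub>R u + t *\<^sub>R v)) has_real_derivative dd v (dd u f) (x + a *\<^sub>R u + b *\<^sub>R v)) (at b)"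
    if "0 \<le> b" "b \<le> h" for b
  proof -
    have df: "dd u f differentiable (at (x + a *\<^sub>R u + b *\<^sub>R v))" using fu S that a by auto
    have "((\<lambda>t. dd u f (x + a *\<^sub>R u + t *\<^sub>R v)) has_derivative (\<lambda>t. dd (t *\<^sub>R v) (dd u f) (x + a *\<^sub>R u + b *\<^sub>R v))) (at b)"
      by (rule has_derivative_compose[of "\<lambda>t. x + a *\<^sub>R u + t *\<^sub>R v" "\<lambda>t. t *\<^sub>R v" b UNIV "dd u f", OF _ dd_has_derivative[OF df]])
         (auto intro!: derivative_eq_intros)
    then show ?thesis
      by (simp add: has_field_derivative_def dd_scaleR_dir[OF df] mult_commute_abs)
  qed
  have "\<exists>b>0. b < h \<and> dd u f (x + a *\<^sub>R u + h *\<^sub>R v) - dd u f (x + a *\<^sub>R u + 0 *\<^sub>R v)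
      = (h - 0) * dd v (dd u f) (x + a *\<^sub>R u + b *\<^sub>R v)"
    by (rule MVT2[OF h]) (auto intro!: d2)
  then obtain b where "b > 0" "b < h"
    "dd u f (x + a *\<^sub>R u + h *\<^sub>R v) - dd u f (x + a *\<^sub>R u) = h * dd v (dd u f) (x + a *\<^sub>R u + b *\<^sub>R v)" by auto
  with a that show ?thesis by (simp add: \<phi>_def algebra_simps)
qed

text \<open>Both mixed derivatives, taken at suitable nearby points, equal the same second
  difference divided by \<open>h * h\<close>. If they differed at \<open>x\<close>, continuity would
  keep them in disjoint intervals of radius \<open>\<bar>A - B\<bar> / 2\<close>.\<close>

lemma dd_symmetric_real:
  fixes f :: "'a::real_normed_vector \<Rightarrow> real"
  assumes S: "open S" "x \<in> S" and f: "smooth_on S f"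
  shows "dd u (dd v f) x = dd v (dd u f) x"
proof (rule ccontr)
  define A where "A = dd u (dd v f) x"
  define B where "B = dd v (dd u f) x"
  assume "dd u (dd v f) x \<noteq> dd v (dd u f) x"
  then have e: "\<bar>A - B\<bar> / 2 > 0" by (simp add: A_def B_def)
  have sm: "smooth_on S (dd u (dd v f))" "smooth_on S (dd v (dd u f))"
    using f by (auto intro: smooth_on_dd)
  then have "continuous (at x) (dd u (dd v f))" "continuous (at x) (dd v (dd u f))"
    using S by (auto dest!: smooth_on_continuous simp: continuous_on_eq_continuous_at)
  moreover have "\<exists>d>0. \<forall>y. dist y x < d \<longrightarrow> \<bar>g y - g x\<bar> < \<bar>A - B\<bar> / 2"
    if "continuous (at x) g" for g :: "'a \<Rightarrow> real"
    using that e unfolding continuous_at_eps_delta by (metis dist_real_def)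
  ultimately obtain d1 d2 where d: "d1 > 0" "d2 > 0"
    "\<And>y. dist y x < d1 \<Longrightarrow> \<bar>dd u (dd v f) y - A\<bar> < \<bar>A - B\<bar> / 2"
    "\<And>y. dist y x < d2 \<Longrightarrow> \<bar>dd v (dd u f) y - B\<bar> < \<bar>A - B\<bar> / 2"
    unfolding A_def B_def by meson
  obtain d3 where d3: "d3 > 0" "ball x d3 \<subseteq> S" using S openE by blast
  define d where "d = min d1 (min d2 d3)"
  \<comment> \<open>The summand 1 keeps \<open>M\<close> positive when \<open>u\<close> and
    \<open>v\<close> vanish; \<open>h = d / (2 * M)\<close> puts the whole parallelogram within
    distance \<open>d / 2\<close> of \<open>x\<close>.\<close>
  define M where "M = norm u + norm v + 1"
  define h where "h = d / (2 * M)"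
  have nn: "M > 0" by (smt (verit) M_def norm_ge_zero)
  have dpos: "d > 0" using d d3 by (simp add: d_def)
  then have h: "h > 0" using nn by (simp add: h_def)
  have near: "dist (x + a *\<^sub>R u + b *\<^sub>R v) x < d" if "0 \<le> a" "a \<le> h" "0 \<le> b" "b \<le> h" for a b
  proof -
    have "dist (x + a *\<^sub>R u + b *\<^sub>R v) x = norm (a *\<^sub>R u + b *\<^sub>R v)" by (simp add: dist_norm add.assoc)
    also have "\<dots> \<le> a * norm u + b * norm v"
      using norm_triangle_ineq[of "a *\<^sub>R u" "b *\<^sub>R v"] that by simp
    also have "\<dots> \<le> h * norm u + h * norm v" using that by (intro add_mono mult_right_mono) auto
    also have "\<dots> \<le> h * M" using h by (simp add: M_def algebra_simps)
    also have "\<dots> = d / 2" using nn by (simp add: h_def)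
    finally show ?thesis using dpos by simp
  qed
  have inS: "x + a *\<^sub>R u + b *\<^sub>R v \<in> S" if "0 \<le> a" "a \<le> h" "0 \<le> b" "b \<le> h" for a b
    using near[OF that] d3 by (auto simp: d_def dist_commute subset_iff)
  have inS': "x + a *\<^sub>R v + b *\<^sub>R u \<in> S" if "0 \<le> a" "a \<le> h" "0 \<le> b" "b \<le> h" for a b
    using inS[of b a] that by (simp add: add.commute add.left_commute)
  have diffs: "\<And>y. y \<in> S \<Longrightarrow> f differentiable (at y)" "\<And>y w. y \<in> S \<Longrightarrow> dd w f differentiable (at y)"
    using f by (auto intro: smooth_on_differentiable smooth_on_dd)
  obtain a b where ab: "0 < a" "a < h" "0 < b" "b < h"
    "f (x + h *\<^sub>R u + h *\<^sub>R v) - f (x + h *\<^sub>R u) - f (x + h *\<^sub>R v) + f x = h * h * dd v (dd u f) (x + a *\<^sub>R u + b *\<^sub>R v)"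
    using second_difference_mvt[of S f u h x v, OF diffs(1) diffs(2) inS h] by blast
  obtain a' b' where ab': "0 < a'" "a' < h" "0 < b'" "b' < h"
    "f (x + h *\<^sub>R v + h *\<^sub>R u) - f (x + h *\<^sub>R v) - f (x + h *\<^sub>R u) + f x = h * h * dd u (dd v f) (x + a' *\<^sub>R v + b' *\<^sub>R u)"
    using second_difference_mvt[of S f v h x u, OF diffs(1) diffs(2) inS' h] by blast
  have "h * h * dd v (dd u f) (x + a *\<^sub>R u + b *\<^sub>R v) = h * h * dd u (dd v f) (x + a' *\<^sub>R v + b' *\<^sub>R u)"
    using ab(5) ab'(5) by (simp add: algebra_simps)
  then have "dd v (dd u f) (x + a *\<^sub>R u + b *\<^sub>R v) = dd u (dd v f) (x + a' *\<^sub>R v + b' *\<^sub>R u)"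
    using h by simp
  moreover have "\<bar>dd v (dd u f) (x + a *\<^sub>R u + b *\<^sub>R v) - B\<bar> < \<bar>A - B\<bar> / 2"
    by (rule d(4)) (use near[of a b] ab in \<open>auto simp: d_def\<close>)
  moreover have "\<bar>dd u (dd v f) (x + b' *\<^sub>R u + a' *\<^sub>R v) - A\<bar> < \<bar>A - B\<bar> / 2"
    by (rule d(3)) (use near[of b' a'] ab' in \<open>auto simp: d_def\<close>)
  moreover have "x + b' *\<^sub>R u + a' *\<^sub>R v = x + a' *\<^sub>R v + b' *\<^sub>R u" by (simp add: algebra_simps)
  ultimately show False by (simp add: abs_if split: if_splits)
qed

lemma dd_symmetric:
  fixes f :: "'a::real_normed_vector \<Rightarrow> 'b::euclidean_space"
  assumes S: "open S" "x \<in> S" and f: "smooth_on S f"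
  shows "dd u (dd v f) x = dd v (dd u f) x"
proof (rule euclidean_eqI)
  fix b :: 'b
  have comm: "dd u (dd v f) x \<bullet> b = dd u (dd v (\<lambda>y. f y \<bullet> b)) x" for u v
  proof -
    have 1: "dd v (\<lambda>y. f y \<bullet> b) y = dd v f y \<bullet> b" if "y \<in> S" for y
      by (rule dd_linear[OF bounded_linear_inner_left smooth_on_differentiable[OF f that]])
    have "dd u (dd v (\<lambda>y. f y \<bullet> b)) x = dd u (\<lambda>y. dd v f y \<bullet> b) x"
      by (rule dd_cong[OF S 1])
    also have "\<dots> = dd u (dd v f) x \<bullet> b"
      by (rule dd_linear[OF bounded_linear_inner_left smooth_on_differentiable[OF smooth_on_dd[OF f] S(2)]])
    finally show ?thesis by simp
  qed
  have "smooth_on S (\<lambda>y. f y \<bullet> b)"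
    by (intro smooth_intros S f)
  then show "dd u (dd v f) x \<bullet> b = dd v (dd u f) x \<bullet> b"
    unfolding comm by (rule dd_symmetric_real[OF S])
qed

subsection \<open>Moving frames, inverse functions and parameter integrals\<close>

text \<open>One Gram-Schmidt step per index: the component \<open>Z\<close> of the new vector
  orthogonal to the earlier ones never vanishes, so the coefficient along \<open>Z\<close> is a
  smooth quotient. Independence is stated for the indexed family, because the set of values would
  shrink if two fields agreed at a point.\<close>

lemma smooth_projection:
  fixes X :: "'i \<Rightarrow> 'a::real_normed_vector \<Rightarrow> 'b::real_inner"
  assumes S: "open S" and "finite T" and X: "\<And>i. i \<in> T \<Longrightarrow> smooth_on S (X i)"
    and indep: "\<And>i x. i \<in> T \<Longrightarrow> x \<in> S \<Longrightarrow> X i x \<notin> span ((\<lambda>j. X j x) ` (T - {i}))"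
    and y: "smooth_on S y"
  shows "\<exists>p. smooth_on S p \<and>
    (\<forall>x\<in>S. p x \<in> span ((\<lambda>j. X j x) ` T) \<and> (\<forall>w\<in>span ((\<lambda>j. X j x) ` T). (y x - p x) \<bullet> w = 0))"
  using \<open>finite T\<close> X indep y
proof (induction T arbitrary: y rule: finite_induct)
  case empty
  show ?case by (rule exI[of _ "\<lambda>x. 0"]) (auto intro: smooth_on_const)
next
  case (insert j T)
  have indep: "X i x \<notin> span ((\<lambda>j. X j x) ` (T - {i}))" if "i \<in> T" "x \<in> S" for i x
  proof -
    have "span ((\<lambda>j. X j x) ` (T - {i})) \<subseteq> span ((\<lambda>j. X j x) ` (insert j T - {i}))"
      by (intro span_mono image_mono) auto
    then show ?thesis using insert.prems(2)[of i x] that by auto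
  qed
  note IH = insert.IH[OF insert.prems(1)[OF insertI2] indep]
  obtain r where r: "smooth_on S r" "\<And>x. x \<in> S \<Longrightarrow> r x \<in> span ((\<lambda>j. X j x) ` T)"
    "\<And>x w. x \<in> S \<Longrightarrow> w \<in> span ((\<lambda>j. X j x) ` T) \<Longrightarrow> (X j x - r x) \<bullet> w = 0"
    using IH[of "X j"] insert.prems(1) by auto
  obtain p where p: "smooth_on S p" "\<And>x. x \<in> S \<Longrightarrow> p x \<in> span ((\<lambda>j. X j x) ` T)"
    "\<And>x w. x \<in> S \<Longrightarrow> w \<in> span ((\<lambda>j. X j x) ` T) \<Longrightarrow> (y x - p x) \<bullet> w = 0"
    using IH[of y] insert.prems(3) by auto
  define Z where "Z x = X j x - r x" for x
  have Z0: "Z x \<noteq> 0" if "x \<in> S" for x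
  proof
    assume "Z x = 0"
    then have "X j x \<in> span ((\<lambda>j. X j x) ` T)" using r(2)[OF that] by (simp add: Z_def)
    moreover have "insert j T - {j} = T" using insert.hyps by auto
    ultimately show False using insert.prems(2)[of j x] that by simp
  qed
  have Zs: "smooth_on S Z" unfolding Z_def[abs_def] by (intro smooth_intros S insert.prems r) auto
  define q where "q x = p x + ((y x \<bullet> Z x) / (Z x \<bullet> Z x)) *\<^sub>R Z x" for x
  have q1: "q x \<in> span ((\<lambda>j. X j x) ` insert j T)" if x: "x \<in> S" for x
  proof -
    have sub: "span ((\<lambda>j. X j x) ` T) \<subseteq> span ((\<lambda>j. X j x) ` insert j T)" by (intro span_mono) auto
    have "Z x \<in> span ((\<lambda>j. X j x) ` insert j T)"
      unfolding Z_def using sub r(2)[OF x] by (intro span_diff) (auto intro: span_base)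
    then show ?thesis unfolding q_def using sub p(2)[OF x] by (intro span_add span_scale) auto
  qed
  have q2: "(y x - q x) \<bullet> w = 0" if x: "x \<in> S" and w: "w \<in> span ((\<lambda>j. X j x) ` insert j T)" for x w
  proof -
    have a: "(y x - q x) \<bullet> w = 0" if "w \<in> span ((\<lambda>j. X j x) ` T)" for w
      using p(3)[OF x that] r(3)[OF x that] by (simp add: q_def Z_def inner_diff_left inner_add_left)
    have "p x \<bullet> Z x = 0" using r(3)[OF x p(2)[OF x]] by (simp add: Z_def inner_commute)
    then have "(y x - q x) \<bullet> Z x = 0" using Z0[OF x] by (simp add: q_def inner_diff_left inner_add_left)
    then have "(y x - q x) \<bullet> X j x = 0" using a[OF r(2)[OF x]] by (simp add: Z_def inner_diff_right)
    moreover obtain c where "w - c *\<^sub>R X j x \<in> span ((\<lambda>j. X j x) ` T)"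
      using w by (auto simp: span_insert)
    ultimately show ?thesis using a[of "w - c *\<^sub>R X j x"] by (simp add: inner_diff_right)
  qed
  have "smooth_on S q" unfolding q_def[abs_def]
    by (intro smooth_intros S insert.prems p Zs) (use Z0 in auto)
  then show ?case using q1 q2 by blast
qed

text \<open>\<open>E i\<close> is the component \<open>Z\<close> of \<open>X i\<close> orthogonal to
  the other fields, divided by \<open>Z \<bullet> Z\<close>; the normalization is right because
  \<open>Z \<bullet> X i = Z \<bullet> Z\<close>.\<close>

lemma smooth_dual_frame:
  fixes X :: "'i \<Rightarrow> 'a::real_normed_vector \<Rightarrow> 'b::real_inner"
  assumes S: "open S" and T: "finite T" and X: "\<And>i. i \<in> T \<Longrightarrow> smooth_on S (X i)"
    and indep: "\<And>i x. i \<in> T \<Longrightarrow> x \<in> S \<Longrightarrow> X i x \<notin> span ((\<lambda>j. X j x) ` (T - {i}))"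
  shows "\<exists>E. \<forall>i\<in>T. smooth_on S (E i) \<and> (\<forall>x\<in>S. E i x \<in> span ((\<lambda>j. X j x) ` T) \<and>
    (\<forall>j\<in>T. E i x \<bullet> X j x = (if i = j then 1 else 0)))"
proof (rule bchoice, intro ballI)
  fix i assume i: "i \<in> T"
  have "X k x \<notin> span ((\<lambda>j. X j x) ` (T - {i} - {k}))" if "k \<in> T - {i}" "x \<in> S" for k x
  proof -
    have "span ((\<lambda>j. X j x) ` (T - {i} - {k})) \<subseteq> span ((\<lambda>j. X j x) ` (T - {k}))"
      by (intro span_mono image_mono) auto
    then show ?thesis using indep[of k x] that by auto
  qed
  then obtain p where p: "smooth_on S p" "\<And>x. x \<in> S \<Longrightarrow> p x \<in> span ((\<lambda>j. X j x) ` (T - {i}))"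
    "\<And>x w. x \<in> S \<Longrightarrow> w \<in> span ((\<lambda>j. X j x) ` (T - {i})) \<Longrightarrow> (X i x - p x) \<bullet> w = 0"
    using smooth_projection[OF S, of "T - {i}" X "X i"] X T i by auto
  define Z where "Z x = X i x - p x" for x
  have Z0: "Z x \<noteq> 0" if "x \<in> S" for x
    using indep[OF i that] p(2)[OF that] by (auto simp: Z_def)
  have Zi: "Z x \<bullet> X i x = Z x \<bullet> Z x" if "x \<in> S" for x
    using p(3)[OF that p(2)[OF that]] by (simp add: Z_def inner_diff_right)
  have "smooth_on S (\<lambda>x. inverse (Z x \<bullet> Z x) *\<^sub>R Z x)"
    unfolding Z_def using Z0 unfolding Z_def by (intro smooth_intros S X p i) auto
  moreover have "inverse (Z x \<bullet> Z x) *\<^sub>R Z x \<in> span ((\<lambda>j. X j x) ` T)" if "x \<in> S" for x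
    unfolding Z_def using p(2)[OF that] span_mono[of "(\<lambda>j. X j x) ` (T - {i})" "(\<lambda>j. X j x) ` T"] i
    by (intro span_scale span_diff) (auto intro: span_base)
  moreover have "(inverse (Z x \<bullet> Z x) *\<^sub>R Z x) \<bullet> X j x = (if i = j then 1 else 0)" if "x \<in> S" "j \<in> T" for x j
    using Zi[OF that(1)] Z0[OF that(1)] p(3)[OF that(1), of "X j x"] that(2)
    by (auto simp: Z_def intro: span_base)
  ultimately show "\<exists>E. smooth_on S E \<and> (\<forall>x\<in>S. E x \<in> span ((\<lambda>j. X j x) ` T) \<and>
    (\<forall>j\<in>T. E x \<bullet> X j x = (if i = j then 1 else 0)))"
    by (intro exI[of _ "\<lambda>x. inverse (Z x \<bullet> Z x) *\<^sub>R Z x"]) blast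
qed

lemma range_dd_span:
  fixes F :: "'a::euclidean_space \<Rightarrow> 'b::real_normed_vector"
  assumes "F differentiable (at x)"
  shows "range (\<lambda>v. dd v F x) = span ((\<lambda>b. dd b F x) ` Basis)"
  using linear_span_image[OF linear_dd[OF assms], of Basis] by simp

text \<open>A smooth left inverse of the differential, playing the part of the inverse Gram matrix:
  pairing with \<open>E b\<close> reads off the \<open>b\<close>-coordinate of a tangent vector.
  Gradients, Christoffel symbols, unit normals and local inverses are built from it.\<close>

lemma immersion_dual_frame:
  fixes F :: "'a::euclidean_space \<Rightarrow> 'b::euclidean_space"
  assumes S: "open S" and F: "smooth_on S F" and inj: "\<And>x. x \<in> S \<Longrightarrow> inj (\<lambda>v. dd v F x)"
  shows "\<exists>E. \<forall>b\<in>Basis. smooth_on S (E b) \<and>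
    (\<forall>x\<in>S. E b x \<in> range (\<lambda>v. dd v F x) \<and> (\<forall>v. E b x \<bullet> dd v F x = v \<bullet> b))"
proof -
  have diff: "F differentiable (at x)" if "x \<in> S" for x by (rule smooth_on_differentiable[OF F that])
  have "dd b F x \<notin> span ((\<lambda>j. dd j F x) ` (Basis - {b}))" if bx: "b \<in> Basis" "x \<in> S" for b x
  proof
    assume "dd b F x \<in> span ((\<lambda>j. dd j F x) ` (Basis - {b}))"
    then obtain w where "w \<in> span (Basis - {b})" "dd b F x = dd w F x"
      using linear_span_image[OF linear_dd[OF diff[OF bx(2)]], of "Basis - {b}"] by auto
    then have "b \<in> span (Basis - {b})" using inj[OF bx(2)] by (auto dest: injD)
    then show False using independent_Basis bx(1) by (auto simp: dependent_def)
  qed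
  then have "\<exists>E. \<forall>b\<in>Basis. smooth_on S (E b) \<and> (\<forall>x\<in>S. E b x \<in> span ((\<lambda>j. dd j F x) ` Basis) \<and>
    (\<forall>j\<in>Basis. E b x \<bullet> dd j F x = (if b = j then 1 else 0)))"
    by (intro smooth_dual_frame S smooth_on_dd F) auto
  then obtain E where E: "\<And>b. b \<in> Basis \<Longrightarrow> smooth_on S (E b)"
    "\<And>b x. b \<in> Basis \<Longrightarrow> x \<in> S \<Longrightarrow> E b x \<in> span ((\<lambda>j. dd j F x) ` Basis)"
    "\<And>b x j. b \<in> Basis \<Longrightarrow> x \<in> S \<Longrightarrow> j \<in> Basis \<Longrightarrow> E b x \<bullet> dd j F x = (if b = j then 1 else 0)"
    by blast
  have "E b x \<bullet> dd v F x = v \<bullet> b" if "b \<in> Basis" "x \<in> S" for b x v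
  proof -
    have "E b x \<bullet> dd v F x = (\<Sum>j\<in>Basis. (v \<bullet> j) * (E b x \<bullet> dd j F x))"
      by (simp add: dd_basis[OF diff[OF that(2)], of v] inner_sum_right)
    also have "\<dots> = (\<Sum>j\<in>Basis. if b = j then v \<bullet> j else 0)"
      by (rule sum.cong) (use E(3)[OF that] in auto)
    also have "\<dots> = v \<bullet> b" using that(1) by simp
    finally show ?thesis .
  qed
  with E range_dd_span[OF diff] show ?thesis by (intro exI[of _ E]) blast
qed

lemma range_dd_recover:
  fixes F :: "'a::euclidean_space \<Rightarrow> 'b::euclidean_space"
  assumes "F differentiable (at x)"
    and E: "\<And>b v. b \<in> Basis \<Longrightarrow> E b \<bullet> dd v F x = v \<bullet> b"
    and w: "w \<in> range (\<lambda>v. dd v F x)"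
  shows "w = dd (\<Sum>b\<in>Basis. (E b \<bullet> w) *\<^sub>R b) F x"
proof -
  obtain v where v: "w = dd v F x" using w by auto
  have "(\<Sum>b\<in>Basis. (E b \<bullet> w) *\<^sub>R b) = (\<Sum>b\<in>Basis. (v \<bullet> b) *\<^sub>R b)"
    by (rule sum.cong) (auto simp: v E)
  then show ?thesis by (simp add: v euclidean_representation)
qed

text \<open>Local injectivity and the inverse function theorem ask for continuity in operator norm;
  in finite dimension the values on basis vectors decide it.\<close>

lemma continuous_on_Blinfun_dd:
  fixes F :: "'a::euclidean_space \<Rightarrow> 'b::euclidean_space"
  assumes "\<And>x. x \<in> S \<Longrightarrow> F differentiable (at x)" "\<And>v. continuous_on S (dd v F)"
  shows "continuous_on S (\<lambda>x. Blinfun (\<lambda>v. dd v F x))"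
proof (rule continuous_on_blinfun_componentwise)
  fix i :: 'a assume "i \<in> Basis"
  have "continuous_on S (dd i F)" by (rule assms)
  moreover have "blinfun_apply (Blinfun (\<lambda>v. dd v F x)) i = dd i F x" if "x \<in> S" for x
    using bounded_linear_Blinfun_apply[OF linear_conv_bounded_linear[THEN iffD1, OF linear_dd[OF assms(1)[OF that]]]]
    by simp
  ultimately show "continuous_on S (\<lambda>x. blinfun_apply (Blinfun (\<lambda>v. dd v F x)) i)"
    by (simp cong: continuous_on_cong)
qed

lemma Blinfun_dd_apply:
  fixes F :: "'a::euclidean_space \<Rightarrow> 'b::real_normed_vector"
  assumes "F differentiable (at x)"
  shows "blinfun_apply (Blinfun (\<lambda>v. dd v F x)) = (\<lambda>v. dd v F x)"
  using bounded_linear_Blinfun_apply[OF linear_conv_bounded_linear[THEN iffD1, OF linear_dd[OF assms]]] .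

lemma Blinfun_dd_diff:
  fixes F :: "'a::euclidean_space \<Rightarrow> 'b::real_normed_vector"
  assumes "F differentiable (at x)" "F differentiable (at y)"
  shows "onorm (\<lambda>v. dd v F x - dd v F y) = dist (Blinfun (\<lambda>v. dd v F x)) (Blinfun (\<lambda>v. dd v F y))"
  by (simp add: dist_norm norm_blinfun.rep_eq blinfun.diff_left[abs_def] Blinfun_dd_apply[OF assms(1)]
      Blinfun_dd_apply[OF assms(2)])

text \<open>An injective linear map is bounded below by some \<open>c > 0\<close>, and a
  perturbation of operator norm less than \<open>c\<close> cannot acquire a kernel.\<close>

lemma open_injective_dd:
  fixes F :: "'a::euclidean_space \<Rightarrow> 'b::euclidean_space"
  assumes S: "open S" and F: "smooth_on S F"
  shows "open {x \<in> S. inj (\<lambda>v. dd v F x)}"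
  unfolding open_dist
proof (intro ballI)
  fix a assume "a \<in> {x \<in> S. inj (\<lambda>v. dd v F x)}"
  then have a: "a \<in> S" "inj (\<lambda>v. dd v F a)" by auto
  have diff: "F differentiable (at x)" if "x \<in> S" for x by (rule smooth_on_differentiable[OF F that])
  obtain c where c: "c > 0" "\<And>v. norm (dd v F a) \<ge> c * norm v"
    using linear_inj_bounded_below_pos[OF linear_dd[OF diff[OF a(1)]] a(2)] by (metis mult.commute)
  have "continuous_on S (\<lambda>x. Blinfun (\<lambda>v. dd v F x))"
    by (intro continuous_on_Blinfun_dd diff smooth_on_continuous smooth_on_dd F)
  then obtain d where d: "d > 0"
    "\<And>x. x \<in> S \<Longrightarrow> dist x a < d \<Longrightarrow> dist (Blinfun (\<lambda>v. dd v F x)) (Blinfun (\<lambda>v. dd v F a)) < c"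
    using a(1) c(1) unfolding continuous_on_iff by meson
  obtain e where e: "e > 0" "ball a e \<subseteq> S" using S a openE by blast
  show "\<exists>e>0. \<forall>y. dist y a < e \<longrightarrow> y \<in> {x \<in> S. inj (\<lambda>v. dd v F x)}"
  proof (intro exI[of _ "min d e"] conjI allI impI)
    fix y assume y: "dist y a < min d e"
    then have yS: "y \<in> S" using e by (auto simp: dist_commute)
    have on: "onorm (\<lambda>v. dd v F y - dd v F a) < c"
      using Blinfun_dd_diff[OF diff diff, of y a] yS a(1) d(2)[OF yS] y by simp
    have bl: "bounded_linear (\<lambda>v. dd v F y - dd v F a)"
      by (intro bounded_linear_sub linear_conv_bounded_linear[THEN iffD1] linear_dd diff yS a)
    have "v = 0" if "dd v F y = 0" for v
    proof (rule ccontr)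
      assume "v \<noteq> 0"
      have "c * norm v \<le> norm (dd v F y - dd v F a)" using c(2)[of v] that by simp
      also have "\<dots> \<le> onorm (\<lambda>v. dd v F y - dd v F a) * norm v" by (rule onorm[OF bl])
      also have "\<dots> < c * norm v" using on \<open>v \<noteq> 0\<close> by simp
      finally show False by simp
    qed
    then show "y \<in> {x \<in> S. inj (\<lambda>v. dd v F x)}"
      using yS linear_injective_0[OF linear_dd[OF diff[OF yS]]] by auto
  qed (use d e in auto)
qed

text \<open>The dual frame at \<open>a\<close> supplies the left inverse of the differential. In the
  converse this is applied to the Gauss map: injectivity on a ball is what separates
  \<open>N\<close> from the base curve.\<close>

lemma immersion_locally_injective:
  fixes F :: "'a::euclidean_space \<Rightarrow> 'b::euclidean_space"
  assumes S: "open S" and F: "smooth_on S F" and inj: "\<And>x. x \<in> S \<Longrightarrow> inj (\<lambda>v. dd v F x)"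
    and a: "a \<in> S"
  obtains r where "r > 0" "ball a r \<subseteq> S" "inj_on F (ball a r)"
proof -
  obtain E where E: "\<And>b x v. b \<in> Basis \<Longrightarrow> x \<in> S \<Longrightarrow> E b x \<bullet> dd v F x = v \<bullet> b"
    using immersion_dual_frame[OF S F inj] by auto
  have diff: "F differentiable (at x)" if "x \<in> S" for x by (rule smooth_on_differentiable[OF F that])
  define g' where "g' w = (\<Sum>b\<in>Basis. (E b a \<bullet> w) *\<^sub>R b)" for w
  have "bounded_linear g'" unfolding linear_conv_bounded_linear[symmetric]
    by (rule linearI) (auto simp: g'_def inner_add_right scaleR_add_left sum.distrib scaleR_sum_right)
  moreover have "g' \<circ> (\<lambda>v. dd v F a) = id"
    by (auto simp: g'_def E[OF _ a] euclidean_representation)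
  moreover have "\<exists>d>0. \<forall>x. dist a x < d \<longrightarrow> onorm (\<lambda>v. dd v F x - dd v F a) < e" if e0: "e > 0" for e
  proof -
    have "continuous_on S (\<lambda>x. Blinfun (\<lambda>v. dd v F x))"
      by (intro continuous_on_Blinfun_dd diff smooth_on_continuous smooth_on_dd F)
    then obtain d where d: "d > 0"
      "\<And>x. x \<in> S \<Longrightarrow> dist x a < d \<Longrightarrow> dist (Blinfun (\<lambda>v. dd v F x)) (Blinfun (\<lambda>v. dd v F a)) < e"
      using a e0 unfolding continuous_on_iff by meson
    obtain e' where e': "e' > 0" "ball a e' \<subseteq> S" using S a openE by blast
    have "onorm (\<lambda>v. dd v F x - dd v F a) < e" if "dist a x < min d e'" for x
    proof -
      have "x \<in> S" using that e' by auto
      then show ?thesis using Blinfun_dd_diff[OF diff diff, of x a] a d(2)[of x] that by (simp add: dist_commute)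
    qed
    then show ?thesis using d e' by (intro exI[of _ "min d e'"]) auto
  qed
  ultimately show ?thesis
    using has_derivative_locally_injective[OF a S, of g' "\<lambda>x v. dd v F x" F] dd_has_derivative[OF diff] that by blast
qed

text \<open>The inverse function theorem yields a continuous inverse \<open>g\<close>, with
  derivative \<open>G (g y)\<close>. As \<open>G\<close> is smooth in its base point,
  \<open>g\<close> of class \<open>k\<close> makes this derivative of class \<open>k\<close>, and
  the class of \<open>g\<close> rises without bound.\<close>

lemma inverse_function_smooth:
  fixes F :: "'a::euclidean_space \<Rightarrow> 'a"
  assumes S: "open S" and F: "smooth_on S F" and inj: "\<And>x. x \<in> S \<Longrightarrow> inj (\<lambda>v. dd v F x)"
    and a: "a \<in> S"
  obtains W where "open W" "a \<in> W" "W \<subseteq> S" "open (F ` W)" "inj_on F W" "smooth_on (F ` W) (inv_into W F)"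
proof -
  obtain E where E: "\<And>b. b \<in> Basis \<Longrightarrow> smooth_on S (E b)"
    "\<And>b x v. b \<in> Basis \<Longrightarrow> x \<in> S \<Longrightarrow> E b x \<bullet> dd v F x = v \<bullet> b"
    using immersion_dual_frame[OF S F inj] by auto
  have diff: "F differentiable (at x)" if "x \<in> S" for x by (rule smooth_on_differentiable[OF F that])
  have lin: "linear (\<lambda>v. dd v F x)" if "x \<in> S" for x by (rule linear_dd[OF diff[OF that]])
  have surj: "surj (\<lambda>v. dd v F x)" if "x \<in> S" for x
    using linear_injective_imp_surjective[OF lin inj] that by blast
  define G where "G x w = (\<Sum>b\<in>Basis. (E b x \<bullet> w) *\<^sub>R b)" for x w
  have blG: "bounded_linear (G x)" for x unfolding linear_conv_bounded_linear[symmetric]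
    by (rule linearI) (auto simp: G_def inner_add_right scaleR_add_left sum.distrib scaleR_sum_right)
  have GF: "G x (dd v F x) = v" if "x \<in> S" for x v
    by (simp add: G_def E(2)[OF _ that] euclidean_representation)
  have invf: "Blinfun (G a) o\<^sub>L Blinfun (\<lambda>v. dd v F a) = id_blinfun"
    by (rule blinfun_eqI) (simp add: Blinfun_dd_apply[OF diff[OF a]] bounded_linear_Blinfun_apply[OF blG] GF[OF a])
  have derf: "(F has_derivative blinfun_apply (Blinfun (\<lambda>v. dd v F x))) (at x)" if "x \<in> S" for x
    using dd_has_derivative[OF diff[OF that]] by (simp add: Blinfun_dd_apply[OF diff[OF that]])
  have contf: "continuous_on S (\<lambda>x. Blinfun (\<lambda>v. dd v F x))"
    by (intro continuous_on_Blinfun_dd diff smooth_on_continuous smooth_on_dd F)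
  have "\<exists>U' V g. open U' \<and> U' \<subseteq> S \<and> a \<in> U' \<and> open V \<and> homeomorphism U' V F g"
    by (rule inverse_function_theorem[OF S derf contf a invf]) blast+
  then obtain U' V g where U': "open U'" "U' \<subseteq> S" "a \<in> U'" "open V" "homeomorphism U' V F g"
    by auto
  have V: "V = F ` U'" using U'(5) by (auto simp: homeomorphism_def)
  have injU: "inj_on F U'" using U'(5) by (metis homeomorphism_def inj_on_inverseI)
  have gU: "g y \<in> U'" "F (g y) = y" if "y \<in> V" for y using U'(5) that by (auto simp: homeomorphism_def)
  have contg: "continuous_on V g" using U'(5) by (auto simp: homeomorphism_def)
  have der: "(g has_derivative G (g y)) (at y)" if y: "y \<in> V" for y
  proof -
    have gy: "g y \<in> S" using gU(1)[OF y] U' by auto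
    have "G (g y) \<circ> (\<lambda>v. dd v F (g y)) = id" using GF[OF gy] by auto
    then show ?thesis
      using has_derivative_inverse_basic[of F "\<lambda>v. dd v F (g y)" g y "G (g y)" V]
        dd_has_derivative[OF diff[OF gy]] blG contg U'(4) y gU(2)
      by (simp add: continuous_on_eq_continuous_at)
  qed
  have "Ck_on k V g" for k
  proof (induction k)
    case 0
    then show ?case using contg by simp
  next
    case (Suc k)
    show ?case
    proof (rule Ck_on_SucI[OF U'(4) der])
      fix w
      show "Ck_on k V (\<lambda>y. G (g y) w)"
        unfolding G_def
      proof (intro Ck_on_sum Ck_on_bilinear[OF _ bounded_bilinear_scaleR] Ck_on_bilinear[OF _ bounded_bilinear_inner] Ck_on_const U')
        fix b :: 'a assume "b \<in> Basis"
        then show "Ck_on k V (\<lambda>x. E b (g x))"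
          by (intro Ck_on_compose[OF U'(4) S _ Suc]) (use E(1) gU U' in \<open>auto simp: smooth_on_def\<close>)
      qed
    qed
  qed
  moreover have "inv_into U' F y = g y" if "y \<in> V" for y
    using gU[OF that] injU by (metis inv_into_f_f)
  ultimately have "smooth_on V (inv_into U' F)"
    using smooth_on_cong[OF U'(4), of "inv_into U' F" g] by (auto simp: smooth_on_def)
  then show ?thesis using that[of U'] U' V injU by auto
qed

text \<open>Differentiation under the integral sign, on a ball inside \<open>Y\<close>. The
  integrand is given on an open set around \<open>Y \<times> {0..1}\<close>, since
  \<open>Ck_on\<close> is meaningful only on open sets.\<close>

lemma has_derivative_integral_param:
  fixes H :: "'a::euclidean_space \<times> real \<Rightarrow> 'b::euclidean_space"
  assumes \<Omega>: "open \<Omega>" and Y: "open Y" "Y \<times> {0..1} \<subseteq> \<Omega>" and H: "Ck_on (Suc 0) \<Omega> H" and x: "x \<in> Y"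
  shows "((\<lambda>y. integral {0..1} (\<lambda>t. H (y, t))) has_derivative
    (\<lambda>v. integral {0..1} (\<lambda>t. dd (v, 0) H (x, t)))) (at x)"
proof -
  obtain r where r: "r > 0" "ball x r \<subseteq> Y" using Y x openE by blast
  define U where "U = ball x r"
  have UO: "(y, t) \<in> \<Omega>" if "y \<in> U" "t \<in> {0..1}" for y t
    using that r(2) Y(2) unfolding U_def by blast
  have diff: "H differentiable (at p)" if "p \<in> \<Omega>" for p using H that by (auto simp: Ck_on_Suc)
  have cont: "continuous_on \<Omega> H" using Ck_on_SucD[OF H] by simp
  have contd: "continuous_on \<Omega> (dd w H)" for w
    using H unfolding Ck_on_Suc Ck_on.simps(1) by blast
  define L where "L y t = Blinfun (\<lambda>v. dd (v, 0) H (y, t))" for y :: 'a and t :: real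
  have bl: "bounded_linear (\<lambda>v. dd (v, 0) H p)" if "p \<in> \<Omega>" for p
  proof -
    have "bounded_linear (\<lambda>w. dd w H p)"
      using linear_conv_bounded_linear linear_dd[OF diff[OF that]] by blast
    then show ?thesis
      by (rule bounded_linear_compose) (auto intro!: bounded_linear_intros)
  qed
  have La: "blinfun_apply (L y t) = (\<lambda>v. dd (v, 0) H (y, t))" if "y \<in> U" "t \<in> {0..1}" for y t
    unfolding L_def using bounded_linear_Blinfun_apply[OF bl[OF UO[OF that]]] .
  have contL: "continuous_on (U \<times> {0..1}) (\<lambda>(y, t). L y t)"
    unfolding split_beta
  proof (rule continuous_on_blinfun_componentwise)
    fix i :: 'a assume "i \<in> Basis"
    have "continuous_on (U \<times> {0..1}) (dd (i, 0) H)" using contd by (rule continuous_on_subset) (use UO in auto)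
    moreover have "blinfun_apply (L (fst p) (snd p)) i = dd (i, 0) H p" if "p \<in> U \<times> {0..1}" for p
      using La[of "fst p" "snd p"] that by auto
    ultimately show "continuous_on (U \<times> {0..1}) (\<lambda>p. blinfun_apply (L (fst p) (snd p)) i)"
      by (simp cong: continuous_on_cong)
  qed
  have xU: "x \<in> U" using r by (simp add: U_def)
  have "((\<lambda>y. integral (cbox 0 1) (\<lambda>t. H (y, t))) has_derivative integral (cbox 0 1) (L x)) (at x within U)"
  proof (rule leibniz_rule)
    fix y :: 'a and t :: real assume yt: "y \<in> U" "t \<in> cbox 0 1"
    then have t: "t \<in> {0..1}" by simp
    have "((\<lambda>y. H (y, t)) has_derivative (\<lambda>v. dd (v, 0) H (y, t))) (at y within U)"
      by (rule has_derivative_compose[of "\<lambda>y. (y, t)" "\<lambda>v. (v, 0)" y U H, OF _ dd_has_derivative[OF diff[OF UO[OF yt(1) t]]]])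
         (auto intro!: derivative_eq_intros)
    then show "((\<lambda>y. H (y, t)) has_derivative blinfun_apply (L y t)) (at y within U)"
      using La[OF yt(1) t] by simp
  next
    fix y assume y: "y \<in> U"
    have "continuous_on {0..1} (\<lambda>t. H (y, t))"
      by (rule continuous_on_compose2[OF cont]) (use UO y in \<open>auto intro!: continuous_intros\<close>)
    then show "(\<lambda>t. H (y, t)) integrable_on cbox 0 1" by (simp add: integrable_continuous_real)
  qed (use contL xU U_def in auto)
  then have 1: "((\<lambda>y. integral {0..1} (\<lambda>t. H (y, t))) has_derivative blinfun_apply (integral {0..1} (L x))) (at x)"
    using at_within_open[OF xU] by (simp add: U_def)
  have "blinfun_apply (integral {0..1} (L x)) v = integral {0..1} (\<lambda>t. dd (v, 0) H (x, t))" for v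
  proof -
    have "continuous_on {0..1} (L x)"
      using continuous_on_compose2[OF contL continuous_on_Pair[OF continuous_on_const[of _ x] continuous_on_id]] xU
      by auto
    then have "L x integrable_on {0..1}" by (rule integrable_continuous_real)
    then have "blinfun_apply (integral {0..1} (L x)) v = integral {0..1} (\<lambda>t. blinfun_apply (L x t) v)"
      using integral_linear[of "L x" "{0..1}" "\<lambda>l. blinfun_apply l v"] by (simp add: o_def blinfun.bounded_linear_left)
    also have "\<dots> = integral {0..1} (\<lambda>t. dd (v, 0) H (x, t))"
      by (rule integral_cong) (simp add: La[OF xU])
    finally show ?thesis .
  qed
  then have "blinfun_apply (integral {0..1} (L x)) = (\<lambda>v. integral {0..1} (\<lambda>t. dd (v, 0) H (x, t)))"
    by (rule ext)
  with 1 show ?thesis by simp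
qed

lemma Ck_on_integral_param:
  fixes H :: "'a::euclidean_space \<times> real \<Rightarrow> 'b::euclidean_space"
  assumes \<Omega>: "open \<Omega>" and Y: "open Y" "Y \<times> {0..1} \<subseteq> \<Omega>" and "Ck_on k \<Omega> H"
  shows "Ck_on k Y (\<lambda>y. integral {0..1} (\<lambda>t. H (y, t)))"
  using assms(4)
proof (induction k arbitrary: H)
  case 0
  have "continuous_on (Y \<times> cbox 0 1) (\<lambda>(y, t). H (y, t))"
    using 0 Y by (auto intro: continuous_on_subset)
  from integral_continuous_on_param[OF this] show ?case by simp
next
  case (Suc k)
  have "Ck_on (Suc 0) \<Omega> H"
    using Suc.prems Ck_on.simps(1) by (induction k) (auto dest: Ck_on_SucD)
  from has_derivative_integral_param[OF \<Omega> Y this]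
  show ?case
    by (rule Ck_on_SucI[OF Y(1)]) (use Suc in \<open>auto simp: Ck_on_Suc\<close>)
qed

lemma smooth_on_integral_param:
  fixes H :: "'a::euclidean_space \<times> real \<Rightarrow> 'b::euclidean_space"
  assumes "open \<Omega>" "open Y" "Y \<times> {0..1} \<subseteq> \<Omega>" "smooth_on \<Omega> H"
  shows "smooth_on Y (\<lambda>y. integral {0..1} (\<lambda>t. H (y, t)))"
  using assms by (auto simp: smooth_on_def intro: Ck_on_integral_param)

subsection \<open>Charts and atlases\<close>

lemma chart_inv_right: "z \<in> snd c ` fst c \<Longrightarrow> chart_inv c z \<in> fst c \<and> snd c (chart_inv c z) = z"
  by (simp add: chart_inv_def f_inv_into_f inv_into_into)

lemma chart_inv_left: "is_chart c \<Longrightarrow> x \<in> fst c \<Longrightarrow> chart_inv c (snd c x) = x"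
  by (auto simp: is_chart_def homeomorphism_def)

lemma is_chart_inj: "is_chart c \<Longrightarrow> inj_on (snd c) (fst c)"
  by (metis chart_inv_left inj_on_inverseI)

lemma chart_inv_image:
  assumes "is_chart c" "W \<subseteq> fst c"
  shows "chart_inv c ` (snd c ` W) = W"
  using chart_inv_left[OF assms(1)] assms(2) by (force simp: image_image)

lemma is_chart_open: "is_chart c \<Longrightarrow> open (fst c)" "is_chart c \<Longrightarrow> open (snd c ` fst c)"
  by (auto simp: is_chart_def)

lemma is_chart_continuous:
  "is_chart c \<Longrightarrow> continuous_on (fst c) (snd c)" "is_chart c \<Longrightarrow> continuous_on (snd c ` fst c) (chart_inv c)"
  by (auto simp: is_chart_def homeomorphism_def)

lemma open_chart_image:
  assumes c: "is_chart c" and W: "open W" "W \<subseteq> fst c"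
  shows "open (snd c ` W)"
proof -
  have "snd c ` W = snd c ` fst c \<inter> chart_inv c -` W"
    using chart_inv_left[OF c] W(2) by (auto intro!: image_eqI)
  then show ?thesis
    using continuous_on_open_vimage[OF is_chart_open(2)[OF c]] is_chart_continuous(2)[OF c] W(1)
    by (metis inf_commute)
qed

lemma open_chart_preimage:
  assumes c: "is_chart c" and V: "open V" "V \<subseteq> snd c ` fst c"
  shows "open (chart_inv c ` V)"
proof -
  have "chart_inv c ` V = fst c \<inter> snd c -` V"
  proof (intro set_eqI iffI)
    fix y assume "y \<in> chart_inv c ` V"
    then obtain z where "z \<in> V" "y = chart_inv c z" by auto
    then show "y \<in> fst c \<inter> snd c -` V" using chart_inv_right[of z c] V(2) by auto
  next
    fix y assume y: "y \<in> fst c \<inter> snd c -` V"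
    then have "y = chart_inv c (snd c y)" using chart_inv_left[OF c, of y] by simp
    then show "y \<in> chart_inv c ` V" using y by blast
  qed
  then show ?thesis
    using continuous_on_open_vimage[OF is_chart_open(1)[OF c]] is_chart_continuous(1)[OF c] V(1)
    by (metis inf_commute)
qed

lemma differential_eq_dd: "differential c F x u = dd u (F \<circ> chart_inv c) (snd c x)"
  by (simp add: differential_def dd_def)

lemma second_differential_eq_dd:
  assumes "is_chart c" "x \<in> fst c"
  shows "differential c (\<lambda>y. differential c F y v) x u = dd u (dd v (F \<circ> chart_inv c)) (snd c x)"
proof -
  have "snd c (chart_inv c z) = z" if "z \<in> snd c ` fst c" for z using chart_inv_right[OF that] by simp
  then show ?thesis unfolding differential_eq_dd
    by (intro dd_cong[OF is_chart_open(2)[OF assms(1)]]) (use assms(2) in auto)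
qed

lemma chart_rep_cong:
  assumes c: "is_chart c" and W: "open W" "W \<subseteq> fst c" and eq: "\<And>y. y \<in> W \<Longrightarrow> F y = G y"
  shows "open (snd c ` W)" "\<And>z. z \<in> snd c ` W \<Longrightarrow> (F \<circ> chart_inv c) z = (G \<circ> chart_inv c) z"
  using open_chart_image[OF c W] chart_inv_left[OF c] W(2) eq by (auto simp: subset_iff)

lemma differential_cong:
  assumes c: "is_chart c" and W: "open W" "W \<subseteq> fst c" and "x \<in> W" and eq: "\<And>y. y \<in> W \<Longrightarrow> F y = G y"
  shows "differential c F x u = differential c G x u"
  unfolding differential_eq_dd
  by (rule dd_cong[OF open_chart_image[OF c W] _ chart_rep_cong(2)[of c W F G, OF c W eq]]) (use assms in auto)

lemma smooth_map_cong:
  assumes "\<And>c. c \<in> A \<Longrightarrow> is_chart c" "\<And>y. y \<in> points A \<Longrightarrow> F y = G y"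
  shows "smooth_map A F \<longleftrightarrow> smooth_map A G"
proof -
  have "smooth_on (snd c ` fst c) (F \<circ> chart_inv c) = smooth_on (snd c ` fst c) (G \<circ> chart_inv c)" if "c \<in> A" for c
    by (rule smooth_on_cong[OF chart_rep_cong[OF assms(1)[OF that] is_chart_open(1)[OF assms(1)[OF that]]]])
       (use assms(2) that in \<open>auto simp: points_def\<close>)
  then show ?thesis by (auto simp: smooth_map_def)
qed

lemma smooth_atlas_chart: "smooth_atlas A \<Longrightarrow> c \<in> A \<Longrightarrow> is_chart c"
  by (simp add: smooth_atlas_def)

lemma smooth_atlas_transition:
  "smooth_atlas A \<Longrightarrow> c \<in> A \<Longrightarrow> c' \<in> A \<Longrightarrow> smooth_on (snd c ` (fst c \<inter> fst c')) (snd c' \<circ> chart_inv c)"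
  by (simp add: smooth_atlas_def)

lemma overlap_open:
  assumes "smooth_atlas A" "c \<in> A" "c' \<in> A"
  shows "open (fst c \<inter> fst c')" "open (snd c ` (fst c \<inter> fst c'))"
  using assms by (auto intro!: open_chart_image is_chart_open open_Int dest: smooth_atlas_chart)

section \<open>Restriction of an atlas to an open set\<close>

lemma restrict_chart_inv:
  assumes "is_chart c" "z \<in> snd c ` (fst c \<inter> W)"
  shows "chart_inv (fst c \<inter> W, snd c) z = chart_inv c z"
proof -
  obtain x where x: "x \<in> fst c \<inter> W" "z = snd c x" using assms(2) by auto
  have "inj_on (snd c) (fst c \<inter> W)" using is_chart_inj[OF assms(1)] by (rule inj_on_subset) auto
  then show ?thesis using x chart_inv_left[OF assms(1)] by (simp add: chart_inv_def)
qed

lemma restrict_is_chart: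
  assumes c: "is_chart c" and W: "open W"
  shows "is_chart (fst c \<inter> W, snd c)"
proof -
  have o: "open (fst c \<inter> W)" using is_chart_open[OF c] W by auto
  have "homeomorphism (fst c \<inter> W) (snd c ` (fst c \<inter> W)) (snd c) (chart_inv (fst c \<inter> W, snd c))"
    unfolding homeomorphism_def
  proof (intro conjI ballI)
    show "chart_inv (fst c \<inter> W, snd c) (snd c x) = x" if "x \<in> fst c \<inter> W" for x
      using restrict_chart_inv[OF c, of "snd c x" W] chart_inv_left[OF c] that by auto
    show "snd c (chart_inv (fst c \<inter> W, snd c) y) = y" if "y \<in> snd c ` (fst c \<inter> W)" for y
      using restrict_chart_inv[OF c that] chart_inv_right[of y c] that by auto
    have "chart_inv (fst c \<inter> W, snd c) ` snd c ` (fst c \<inter> W) = chart_inv c ` snd c ` (fst c \<inter> W)"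
      using restrict_chart_inv[OF c] by (intro image_cong) auto
    then show "chart_inv (fst c \<inter> W, snd c) ` snd c ` (fst c \<inter> W) = fst c \<inter> W"
      using chart_inv_image[OF c] by auto
    show "continuous_on (fst c \<inter> W) (snd c)"
      using is_chart_continuous(1)[OF c] by (rule continuous_on_subset) auto
    have "continuous_on (snd c ` (fst c \<inter> W)) (chart_inv c)"
      using is_chart_continuous(2)[OF c] by (rule continuous_on_subset) auto
    then show "continuous_on (snd c ` (fst c \<inter> W)) (chart_inv (fst c \<inter> W, snd c))"
      using restrict_chart_inv[OF c] by (simp cong: continuous_on_cong)
  qed auto
  then show ?thesis using o open_chart_image[OF c o] by (simp add: is_chart_def)
qed

lemma restrict_rep:
  assumes c: "is_chart c" and W: "open W"
  shows "open (snd c ` (fst c \<inter> W))"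
    "\<And>z. z \<in> snd c ` (fst c \<inter> W) \<Longrightarrow> (F \<circ> chart_inv (fst c \<inter> W, snd c)) z = (F \<circ> chart_inv c) z"
  using restrict_chart_inv[OF c] open_chart_image[OF c, of "fst c \<inter> W"] is_chart_open[OF c] W
  by (auto simp: open_Int)

lemma restrict_differential:
  assumes c: "is_chart c" and W: "open W" and x: "x \<in> fst c \<inter> W"
  shows "differential (fst c \<inter> W, snd c) F x = differential c F x"
proof
  fix u show "differential (fst c \<inter> W, snd c) F x u = differential c F x u"
    unfolding differential_eq_dd snd_conv
    by (rule dd_cong[OF restrict_rep(1)[OF c W] _ restrict_rep(2)[OF c W]]) (use x in auto)
qed

lemma restrict_smooth_atlas:
  assumes A: "smooth_atlas A" and W: "open W"
  shows "smooth_atlas (restrict_atlas A W)"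
  unfolding smooth_atlas_def
proof (intro conjI ballI)
  show "is_chart c" if "c \<in> restrict_atlas A W" for c
    using that restrict_is_chart[OF smooth_atlas_chart[OF A] W] by (auto simp: restrict_atlas_def)
  fix d d' assume "d \<in> restrict_atlas A W" "d' \<in> restrict_atlas A W"
  then obtain c c' where d: "d = (fst c \<inter> W, snd c)" "d' = (fst c' \<inter> W, snd c')" and c: "c \<in> A" "c' \<in> A"
    by (auto simp: restrict_atlas_def)
  have "smooth_on (snd c ` (fst c \<inter> fst c' \<inter> W)) (snd c' \<circ> chart_inv c)"
    using smooth_atlas_transition[OF A c] by (rule smooth_on_subset) auto
  moreover have "open (snd c ` (fst c \<inter> fst c' \<inter> W))"
    using overlap_open[OF A c] W open_chart_image[OF smooth_atlas_chart[OF A c(1)]] by auto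
  ultimately have "smooth_on (snd c ` (fst c \<inter> fst c' \<inter> W)) (snd c' \<circ> chart_inv (fst c \<inter> W, snd c))"
    using smooth_on_cong restrict_rep(2)[OF smooth_atlas_chart[OF A c(1)] W, where F = "snd c'"]
    by (smt (verit, best) Int_iff image_iff)
  moreover have "fst c \<inter> W \<inter> (fst c' \<inter> W) = fst c \<inter> fst c' \<inter> W" by auto
  ultimately show "smooth_on (snd d ` (fst d \<inter> fst d')) (snd d' \<circ> chart_inv d)"
    by (simp add: d)
qed

lemma points_restrict: "points (restrict_atlas A W) = points A \<inter> W"
  by (auto simp: points_def restrict_atlas_def)

lemma restrict_smooth_map:
  assumes A: "smooth_atlas A" and W: "open W"
  shows "smooth_map (restrict_atlas A W) F \<longleftrightarrow> (\<forall>c\<in>A. smooth_on (snd c ` (fst c \<inter> W)) (F \<circ> chart_inv c))"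
proof -
  have "smooth_on (snd c ` (fst c \<inter> W)) (F \<circ> chart_inv (fst c \<inter> W, snd c))
      = smooth_on (snd c ` (fst c \<inter> W)) (F \<circ> chart_inv c)" if "c \<in> A" for c
    by (rule smooth_on_cong) (use restrict_rep[OF smooth_atlas_chart[OF A that] W] in auto)
  then show ?thesis by (simp add: smooth_map_def restrict_atlas_def)
qed

lemma restrict_smooth_mapI:
  assumes A: "smooth_atlas A" and W: "open W" and F: "smooth_map A F"
  shows "smooth_map (restrict_atlas A W) F"
  unfolding restrict_smooth_map[OF A W]
  using F unfolding smooth_map_def by (blast intro: smooth_on_subset)

section \<open>Change of chart\<close>

lemma chart_change_rep:
  assumes A: "smooth_atlas A" "c \<in> A" "c' \<in> A" and z: "z \<in> snd c ` (fst c \<inter> fst c')"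
  shows "(F \<circ> chart_inv c) z = (F \<circ> chart_inv c') ((snd c' \<circ> chart_inv c) z)"
proof -
  have "chart_inv c z \<in> fst c'" using z chart_inv_left[OF smooth_atlas_chart[OF A(1,2)]] by auto
  then show ?thesis using chart_inv_left[OF smooth_atlas_chart[OF A(1,3)]] by simp
qed

lemma chart_change:
  assumes A: "smooth_atlas A" "c \<in> A" "c' \<in> A" and x: "x \<in> fst c" "x \<in> fst c'"
    and F: "(F \<circ> chart_inv c') differentiable (at (snd c' x))"
  shows "(F \<circ> chart_inv c) differentiable (at (snd c x))"
    "differential c F x u = differential c' F x (differential c (snd c') x u)"
proof -
  let ?S = "snd c ` (fst c \<inter> fst c')" and ?t = "snd c' \<circ> chart_inv c"
  have z: "snd c x \<in> ?S" using x by auto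
  have t: "?t differentiable (at (snd c x))"
    by (rule smooth_on_differentiable[OF smooth_atlas_transition[OF A] z])
  have tx: "?t (snd c x) = snd c' x" using chart_inv_left[OF smooth_atlas_chart[OF A(1,2)] x(1)] by simp
  have F': "(F \<circ> chart_inv c') differentiable (at (?t (snd c x)))" using F tx by simp
  note ov = overlap_open(2)[OF A]
  have eq: "(F \<circ> chart_inv c) w = (F \<circ> chart_inv c') (?t w)" if "w \<in> ?S" for w
    by (rule chart_change_rep[OF A that])
  have "(\<lambda>w. (F \<circ> chart_inv c') (?t w)) differentiable (at (snd c x))"
    using differentiable_chain_at[OF t F'] by (simp add: o_def)
  then show "(F \<circ> chart_inv c) differentiable (at (snd c x))"
    using differentiable_cong_open[of ?S "snd c x" "F \<circ> chart_inv c" "\<lambda>w. (F \<circ> chart_inv c') (?t w)", OF ov z eq]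
    by simp
  have "dd u (F \<circ> chart_inv c) (snd c x) = dd u (\<lambda>w. (F \<circ> chart_inv c') (?t w)) (snd c x)"
    by (rule dd_cong[OF ov z eq])
  also have "\<dots> = dd (dd u ?t (snd c x)) (F \<circ> chart_inv c') (?t (snd c x))"
    by (rule dd_compose[OF t F'])
  finally show "differential c F x u = differential c' F x (differential c (snd c') x u)"
    by (simp only: differential_eq_dd tx)
qed

text \<open>The change-of-chart formula applied to the coordinate map \<open>snd c\<close>, whose
  representation in \<open>c\<close> is the identity.\<close>

lemma chart_change_inverse:
  assumes A: "smooth_atlas A" "c \<in> A" "c' \<in> A" and x: "x \<in> fst c" "x \<in> fst c'"
  shows "differential c' (snd c) x (differential c (snd c') x u) = u"
proof -
  have d: "(snd c \<circ> chart_inv c') differentiable (at (snd c' x))"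
    by (rule smooth_on_differentiable[OF smooth_atlas_transition[OF A(1,3,2)]]) (use x in auto)
  have "differential c (snd c) x u = differential c' (snd c) x (differential c (snd c') x u)"
    by (rule chart_change(2)[OF A x d])
  moreover have "snd c (chart_inv c z) = z" if "z \<in> snd c ` fst c" for z using chart_inv_right[OF that] by simp
  then have "differential c (snd c) x u = dd u (\<lambda>z. z) (snd c x)"
    unfolding differential_eq_dd
    by (intro dd_cong[OF is_chart_open(2)[OF smooth_atlas_chart[OF A(1,2)]]]) (use x in auto)
  moreover have "dd u (\<lambda>z. z) (snd c x) = u" by (simp add: dd_def)
  ultimately show ?thesis by simp
qed

lemma chart_change_linear:
  assumes A: "smooth_atlas A" "c \<in> A" "c' \<in> A" and x: "x \<in> fst c" "x \<in> fst c'"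
  shows "linear (differential c (snd c') x)" "bij (differential c (snd c') x)"
proof -
  have "(snd c' \<circ> chart_inv c) differentiable (at (snd c x))"
    by (rule smooth_on_differentiable[OF smooth_atlas_transition[OF A]]) (use x in auto)
  then show "linear (differential c (snd c') x)"
    unfolding differential_def by (rule linear_frechet_derivative)
  show "bij (differential c (snd c') x)"
    by (rule bijI', metis chart_change_inverse[OF A x], metis chart_change_inverse[OF A(1,3,2) x(2,1)])
qed

lemma smooth_map_differentiable:
  assumes "smooth_map A F" "c \<in> A" "x \<in> fst c"
  shows "(F \<circ> chart_inv c) differentiable (at (snd c x))"
  using assms by (auto simp: smooth_map_def intro: smooth_on_differentiable)

lemma smooth_map_linear:
  assumes "smooth_map A F" "c \<in> A" "x \<in> fst c"
  shows "linear (differential c F x)"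
  using linear_dd[OF smooth_map_differentiable[OF assms]] by (simp add: differential_eq_dd[abs_def])

lemma chart_change_smooth:
  assumes A: "smooth_atlas A" "c \<in> A" "c' \<in> A" and x: "x \<in> fst c" "x \<in> fst c'" and F: "smooth_map A F"
  shows "differential c F x u = differential c' F x (differential c (snd c') x u)"
  by (rule chart_change(2)[OF A x smooth_map_differentiable[OF F A(3) x(2)]])

text \<open>Differentials of transition maps are bijective, so injectivity in one chart passes to
  all charts around the point.\<close>

lemma regular_point_chart:
  assumes A: "smooth_atlas A" "c \<in> A" and x: "x \<in> fst c" and F: "smooth_map A F"
  shows "regular_point A F x \<longleftrightarrow> inj (differential c F x)"
proof
  assume inj: "inj (differential c F x)"
  show "regular_point A F x" unfolding regular_point_def
  proof (intro ballI impI conjI)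
    fix c' assume c': "c' \<in> A" and x': "x \<in> fst c'"
    show "(F \<circ> chart_inv c') differentiable (at (snd c' x))" by (rule smooth_map_differentiable[OF F c' x'])
    have "differential c' F x = differential c F x \<circ> differential c' (snd c) x"
      using chart_change_smooth[OF A(1) c' A(2) x' x F] by auto
    moreover have "inj (differential c' (snd c) x)"
      using chart_change_linear(2)[OF A(1) c' A(2) x' x] by (rule bij_is_inj)
    ultimately show "inj (differential c' F x)" using inj by (simp add: inj_compose)
  qed
qed (use assms in \<open>auto simp: regular_point_def\<close>)

lemma open_regular_set:
  fixes F :: "'q::{t2_space, second_countable_topology} \<Rightarrow> 'b::euclidean_space"
    and A :: "('q, 'v::euclidean_space) chart set"
  assumes A: "smooth_atlas A" and F: "smooth_map A F"
  shows "open {p \<in> points A. regular_point A F p}"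
proof -
  define V where "V c = {z \<in> snd c ` fst c. inj (\<lambda>v. dd v (F \<circ> chart_inv c) z)}" for c :: "('q, 'v) chart"
  have V: "open (V c)" "V c \<subseteq> snd c ` fst c" if "c \<in> A" for c
    using open_injective_dd[OF is_chart_open(2)[OF smooth_atlas_chart[OF A that]]] F that
    by (auto simp: V_def smooth_map_def)
  have "{p \<in> points A. regular_point A F p} = (\<Union>c\<in>A. chart_inv c ` V c)"
  proof safe
    fix p assume p: "p \<in> points A" "regular_point A F p"
    then obtain c where c: "c \<in> A" "p \<in> fst c" by (auto simp: points_def)
    have "inj (differential c F p)" using regular_point_chart[OF A c F] p by blast
    then have "snd c p \<in> V c" using c by (auto simp: V_def differential_eq_dd[abs_def])
    then show "p \<in> (\<Union>c\<in>A. chart_inv c ` V c)"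
      using c chart_inv_left[OF smooth_atlas_chart[OF A c(1)] c(2)] by (metis UN_iff imageI)
  next
    fix c z assume c: "c \<in> A" and z: "z \<in> V c"
    then have zi: "chart_inv c z \<in> fst c" "snd c (chart_inv c z) = z"
      using chart_inv_right[of z c] by (auto simp: V_def)
    then show "chart_inv c z \<in> points A" using c by (auto simp: points_def)
    show "regular_point A F (chart_inv c z)"
      unfolding regular_point_chart[OF A c zi(1) F] differential_eq_dd[abs_def] zi(2)
      using z by (simp add: V_def)
  qed
  also have "open \<dots>" by (intro open_UN ballI open_chart_preimage smooth_atlas_chart[OF A] V)
  finally show ?thesis .
qed

section \<open>Products with an interval\<close>

lemma prod_chart_simps: "fst (prod_chart c I) = fst c \<times> I" "snd (prod_chart c I) (x, s) = (snd c x, s)"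
  "snd (prod_chart c I) ` fst (prod_chart c I) = (snd c ` fst c) \<times> I"
  by (force simp: prod_chart_def image_iff map_prod_def)+

lemma prod_chart_inv:
  assumes "is_chart c" "z \<in> snd c ` fst c" "s \<in> I"
  shows "chart_inv (prod_chart c I) (z, s) = (chart_inv c z, s)"
proof -
  have "inj_on (map_prod (snd c) id) (fst c \<times> I)"
    using map_prod_inj_on[OF is_chart_inj[OF assms(1)] inj_on_id[of I]] .
  moreover have "(chart_inv c z, s) \<in> fst c \<times> I"
    using chart_inv_right[OF assms(2)] assms(3) by auto
  ultimately have "inv_into (fst c \<times> I) (map_prod (snd c) id) (map_prod (snd c) id (chart_inv c z, s)) = (chart_inv c z, s)"
    by (rule inv_into_f_f)
  then show ?thesis
    using chart_inv_right[OF assms(2)] unfolding chart_inv_def[of "prod_chart c I"] prod_chart_def by (simp add: chart_inv_def)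
qed

lemma prod_is_chart:
  assumes c: "is_chart c" and I: "open I"
  shows "is_chart (prod_chart c I)"
proof -
  let ?p = "prod_chart c I"
  have "homeomorphism (fst ?p) (snd ?p ` fst ?p) (snd ?p) (chart_inv ?p)"
    unfolding homeomorphism_def
  proof (intro conjI ballI)
    show "chart_inv ?p (snd ?p x) = x" if "x \<in> fst ?p" for x
      using that prod_chart_inv[OF c] chart_inv_left[OF c] by (auto simp: prod_chart_simps)
    then show "chart_inv ?p ` snd ?p ` fst ?p = fst ?p" by (force simp: image_image)
    show "snd ?p (chart_inv ?p y) = y" if "y \<in> snd ?p ` fst ?p" for y using chart_inv_right[OF that] by simp
    have "continuous_on (fst c \<times> I) (\<lambda>x. (snd c (fst x), snd x))"
      by (intro continuous_intros continuous_on_compose2[OF is_chart_continuous(1)[OF c]]) auto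
    then show "continuous_on (fst ?p) (snd ?p)"
      by (simp add: prod_chart_def map_prod_def split_beta id_def)
    have "continuous_on (snd c ` fst c \<times> I) (\<lambda>x. (chart_inv c (fst x), snd x))"
      by (intro continuous_intros continuous_on_compose2[OF is_chart_continuous(2)[OF c]]) auto
    moreover have "chart_inv ?p x = (chart_inv c (fst x), snd x)" if "x \<in> snd c ` fst c \<times> I" for x
      using prod_chart_inv[OF c, of "fst x" "snd x" I] that by auto
    ultimately show "continuous_on (snd ?p ` fst ?p) (chart_inv ?p)"
      unfolding prod_chart_simps(3) by (simp cong: continuous_on_cong)
  qed auto
  moreover have "open (snd ?p ` fst ?p)"
    unfolding prod_chart_simps(3) by (intro open_Times is_chart_open(2)[OF c] I)
  moreover have "open (fst ?p)"
    unfolding prod_chart_simps(1) by (intro open_Times is_chart_open(1)[OF c] I)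
  ultimately show ?thesis unfolding is_chart_def by blast
qed

lemma prod_rep:
  assumes "is_chart c" "open I"
  shows "open (snd c ` fst c \<times> I)"
    "\<And>p. p \<in> snd c ` fst c \<times> I \<Longrightarrow> (F \<circ> chart_inv (prod_chart c I)) p = F (chart_inv c (fst p), snd p)"
  using prod_chart_inv[OF assms(1)] is_chart_open[OF assms(1)] assms(2) by (auto simp: open_Times)

lemma prod_smooth_atlas:
  assumes A: "smooth_atlas A" and I: "open I"
  shows "smooth_atlas (prod_atlas A I)"
  unfolding smooth_atlas_def
proof (intro conjI ballI)
  show "is_chart c" if "c \<in> prod_atlas A I" for c
    using that prod_is_chart[OF smooth_atlas_chart[OF A] I] by (auto simp: prod_atlas_def)
  fix d d' assume "d \<in> prod_atlas A I" "d' \<in> prod_atlas A I"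
  then obtain c c' where d: "d = prod_chart c I" "d' = prod_chart c' I" and c: "c \<in> A" "c' \<in> A"
    by (auto simp: prod_atlas_def)
  let ?S = "snd c ` (fst c \<inter> fst c')"
  have S: "open ?S" by (rule overlap_open(2)[OF A c])
  have SI: "open (?S \<times> I)" using S I by (simp add: open_Times)
  have "smooth_on (?S \<times> I) (\<lambda>p. ((snd c' \<circ> chart_inv c) (fst p), snd p))"
    by (intro smooth_on_Pair smooth_on_compose[OF SI S _ _ smooth_atlas_transition[OF A c]] smooth_on_fst smooth_on_snd
        smooth_on_ident SI) auto
  moreover have "(snd d' \<circ> chart_inv d) p = ((snd c' \<circ> chart_inv c) (fst p), snd p)" if "p \<in> ?S \<times> I" for p
    using prod_chart_inv[OF smooth_atlas_chart[OF A c(1)], of "fst p" "snd p" I] that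
    by (auto simp: d prod_chart_simps)
  moreover have "snd d ` (fst d \<inter> fst d') = ?S \<times> I"
    by (force simp: d prod_chart_def image_iff map_prod_def)
  ultimately show "smooth_on (snd d ` (fst d \<inter> fst d')) (snd d' \<circ> chart_inv d)"
    using smooth_on_cong[OF SI, of "snd d' \<circ> chart_inv d" "\<lambda>p. ((snd c' \<circ> chart_inv c) (fst p), snd p)"] by simp
qed

lemma points_prod: "points (prod_atlas A I) = points A \<times> I"
  by (auto simp: points_def prod_atlas_def prod_chart_simps)

text \<open>\<open>gauss_parametrization\<close> computes the gradient in a chart picked by
  \<open>SOME\<close>. The term \<open>Y\<close> is pinned down without a chart, as the vector
  tangent to \<open>N\<close> that pairs with \<open>dN\<close> to \<open>d\<gamma>\<close>; so it
  may be identified in any convenient chart \<open>c\<close>.\<close>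

lemma gauss_parametrization_eq:
  fixes N :: "'q::{t2_space, second_countable_topology} \<Rightarrow> 'b::euclidean_space"
  assumes A: "smooth_atlas A" "c \<in> A" and p: "p \<in> fst c" and N: "immersion A N" and \<gamma>: "smooth_map A \<gamma>"
    and Y: "Y \<in> range (differential c N p)" "\<And>v. Y \<bullet> differential c N p v = differential c \<gamma> p v"
  shows "gauss_parametrization A N \<gamma> p = \<gamma> p *\<^sub>R N p + Y"
proof -
  define d where "d = (SOME c. c \<in> A \<and> p \<in> fst c)"
  have d: "d \<in> A" "p \<in> fst d" using someI[of "\<lambda>c. c \<in> A \<and> p \<in> fst c" c] A p by (auto simp: d_def)
  have Ns: "smooth_map A N" using N by (simp add: immersion_def)
  have injd: "inj (differential d N p)"
    using N d by (auto simp: immersion_def regular_point_def points_def)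
  let ?L = "differential d (snd c) p"
  have cd: "differential d F p u = differential c F p (?L u)" if "smooth_map A F" for F :: "_ \<Rightarrow> 'x::real_normed_vector" and u
    by (rule chart_change_smooth[OF A(1) d(1) A(2) d(2) p that])
  have bij: "bij ?L" by (rule chart_change_linear(2)[OF A(1) d(1) A(2) d(2) p])
  obtain w where w: "Y = differential c N p w" using Y(1) by auto
  obtain w' where w': "w = ?L w'" using bij by (metis bij_pointE)
  have Yw: "Y = differential d N p w'" by (simp add: w w' cd[OF Ns])
  have ex: "induced_metric N d p w' v = differential d \<gamma> p v" for v
    unfolding induced_metric_def using Y(2)[of "?L v"] by (simp add: Yw[symmetric] cd[OF Ns, of v] cd[OF \<gamma>])
  have lin: "linear (differential d N p)" by (rule smooth_map_linear[OF Ns d])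
  have "gradient (induced_metric N) d \<gamma> p = w'"
    unfolding gradient_def
  proof (rule the_equality)
    show "\<forall>v. induced_metric N d p w' v = differential d \<gamma> p v" using ex by simp
    fix u assume u: "\<forall>v. induced_metric N d p u v = differential d \<gamma> p v"
    have "(differential d N p u - differential d N p w') \<bullet> differential d N p v = 0" for v
      using u ex by (simp add: induced_metric_def inner_diff_left)
    from this[of "u - w'"] have "differential d N p u = differential d N p w'"
      by (simp add: linear_diff[OF lin])
    then show "u = w'" using injd by (auto dest: injD)
  qed
  then show ?thesis by (simp add: gauss_parametrization_def Let_def d_def[symmetric] Yw)
qed

subsection \<open>The hypersurface determined by a tube in local coordinates\<close>

text \<open>Dimension count; it turns membership in a tangent space into one orthogonality
  relation.\<close>

lemma range_eq_hyperplane: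
  fixes L :: "'a::euclidean_space \<Rightarrow> 'b::euclidean_space"
  assumes L: "linear L" "inj L" and dim: "DIM('b) = DIM('a) + 1"
    and n: "n \<noteq> 0" "\<And>v. n \<bullet> L v = 0"
  shows "range L = {y. n \<bullet> y = 0}"
proof (rule subspace_dim_equal)
  show "subspace (range L)" by (rule linear_subspace_image[OF L(1) subspace_UNIV])
  show "subspace {y. n \<bullet> y = 0}" by (rule subspace_hyperplane)
  show "range L \<subseteq> {y. n \<bullet> y = 0}" using n by auto
  have "dim (range L) = DIM('a)" using dim_image_eq[OF L(1), of UNIV] L(2) by (simp add: dim_UNIV)
  then show "dim (range L) \<ge> dim {y. n \<bullet> y = 0}" using dim_hyperplane[OF n(1)] dim by simp
qed

lemma differentiable_linear: "bounded_linear L \<Longrightarrow> f differentiable F \<Longrightarrow> (\<lambda>x. L (f x)) differentiable F"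
  unfolding differentiable_def using bounded_linear.has_derivative by blast

lemma dd_slice:
  fixes F :: "'a::real_normed_vector \<times> real \<Rightarrow> 'b::real_normed_vector"
  assumes "F differentiable (at (z, s))"
  shows "dd (u, 0) F (z, s) = dd u (\<lambda>z. F (z, s)) z" "(\<lambda>z. F (z, s)) differentiable (at z)"
proof -
  have "((\<lambda>z. F (z, s)) has_derivative (\<lambda>u. dd (u, 0) F (z, s))) (at z)"
    by (rule has_derivative_compose[of "\<lambda>z. (z, s)" "\<lambda>u. (u, 0)" z UNIV F, OF _ dd_has_derivative[OF assms]])
       (auto intro!: derivative_eq_intros)
  then show "dd (u, 0) F (z, s) = dd u (\<lambda>z. F (z, s)) z" "(\<lambda>z. F (z, s)) differentiable (at z)"
    using dd_eq by (auto simp: differentiable_def dd_eq)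
qed

lemma dd_slice_snd:
  fixes F :: "'a::real_normed_vector \<times> real \<Rightarrow> 'b::real_normed_vector"
  assumes "F differentiable (at (z, s))"
  shows "dd (0, 1) F (z, s) = dd 1 (\<lambda>s. F (z, s)) s" "(\<lambda>s. F (z, s)) differentiable (at s)"
proof -
  have "((\<lambda>s. F (z, s)) has_derivative (\<lambda>a. dd (0, a) F (z, s))) (at s)"
    by (rule has_derivative_compose[of "\<lambda>s. (z, s)" "\<lambda>a. (0, a)" s UNIV F, OF _ dd_has_derivative[OF assms]])
       (auto intro!: derivative_eq_intros)
  then show "dd (0, 1) F (z, s) = dd 1 (\<lambda>s. F (z, s)) s" "(\<lambda>s. F (z, s)) differentiable (at s)"
    using dd_eq by (auto simp: differentiable_def dd_eq)
qed

lemma dd_slice_const: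
  fixes F :: "'a::real_normed_vector \<times> real \<Rightarrow> 'b::real_normed_vector"
  assumes "F differentiable (at (z, s))" "open D" "z \<in> D" "\<And>z'. z' \<in> D \<Longrightarrow> F (z', s) = k"
  shows "dd (u, 0) F (z, s) = 0"
  unfolding dd_slice(1)[OF assms(1)] using dd_cong[OF assms(2,3), of "\<lambda>z. F (z, s)" "\<lambda>_. k"] assms(4) by simp

lemma dd_snd: "dd (u, a) (\<lambda>p. h (snd p)) p = dd a h (snd p)" if "h differentiable (at (snd p))"
  using dd_compose[of snd p h "(u, a)"] that
  by (simp add: bounded_linear_imp_differentiable bounded_linear_snd dd_eq[OF bounded_linear.has_derivative[OF bounded_linear_snd has_derivative_ident]])

lemma dd_fst: "dd (u, a) (\<lambda>p. h (fst p)) p = dd u h (fst p)" if "h differentiable (at (fst p))"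
  using dd_compose[of fst p h "(u, a)"] that
  by (simp add: bounded_linear_imp_differentiable bounded_linear_fst dd_eq[OF bounded_linear.has_derivative[OF bounded_linear_fst has_derivative_ident]])

lemma smooth_on_comp_fst: "open D \<Longrightarrow> open I \<Longrightarrow> smooth_on D h \<Longrightarrow> smooth_on (D \<times> I) (\<lambda>p. h (fst p))"
  for h :: "'a::euclidean_space \<Rightarrow> 'b::real_normed_vector" and I :: "'c::real_normed_vector set"
  by (rule smooth_on_compose[of "D \<times> I" D fst]) (auto intro!: smooth_on_fst smooth_on_ident open_Times)

lemma smooth_on_comp_snd: "open D \<Longrightarrow> open I \<Longrightarrow> smooth_on I h \<Longrightarrow> smooth_on (D \<times> I) (\<lambda>p. h (snd p))"
  for h :: "'a::euclidean_space \<Rightarrow> 'b::real_normed_vector" and D :: "'c::real_normed_vector set"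
  by (rule smooth_on_compose[of "D \<times> I" I snd]) (auto intro!: smooth_on_snd smooth_on_ident open_Times)

lemma smooth_on_slice: "open D \<Longrightarrow> open I \<Longrightarrow> s \<in> I \<Longrightarrow> smooth_on (D \<times> I) h \<Longrightarrow> smooth_on D (\<lambda>z. h (z, s))"
  for h :: "'a::euclidean_space \<times> real \<Rightarrow> 'b::real_normed_vector"
  by (rule smooth_on_compose[of D "D \<times> I" "\<lambda>z. (z, s)"]) (auto intro!: smooth_intros open_Times)

lemma smooth_on_slice_snd: "open D \<Longrightarrow> open I \<Longrightarrow> z \<in> D \<Longrightarrow> smooth_on (D \<times> I) h \<Longrightarrow> smooth_on I (\<lambda>s. h (z, s))"
  for h :: "'a::euclidean_space \<times> real \<Rightarrow> 'b::real_normed_vector"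
  by (rule smooth_on_compose[of I "D \<times> I" "\<lambda>s. (z, s)"]) (auto intro!: smooth_intros open_Times)

text \<open>The substitution \<open>\<tau> = s t\<close> moves the variable upper limit into the
  integrand, so smoothness reduces to an integral over \<open>{0..1}\<close>; the
  \<open>s\<close>-derivative is the fundamental theorem of calculus.\<close>

lemma partial_integral:
  fixes h :: "'v::euclidean_space \<times> real \<Rightarrow> real"
  assumes D: "open D" and I: "open I" "is_interval I" "0 \<in> I" and h: "smooth_on (D \<times> I) h"
  shows "smooth_on (D \<times> I) (\<lambda>p. LBINT \<tau>=0..ereal (snd p). h (fst p, \<tau>))"
    "\<And>z s. z \<in> D \<Longrightarrow> s \<in> I \<Longrightarrow> dd (0, 1) (\<lambda>p. LBINT \<tau>=0..ereal (snd p). h (fst p, \<tau>)) (z, s) = h (z, s)"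
proof -
  have DI: "open (D \<times> I)" using D I by (simp add: open_Times)
  have inI: "s * t \<in> I" if "s \<in> I" "0 \<le> t" "t \<le> 1" for s t
  proof -
    have "convex I" using I(2) by (simp add: is_interval_convex_1)
    then have "(1 - t) *\<^sub>R 0 + t *\<^sub>R s \<in> I" using that I(3) by (intro convexD) auto
    then show ?thesis by (simp add: mult.commute)
  qed
  have contz: "continuous_on I (\<lambda>t. h (z, t))" if "z \<in> D" for z
    by (rule smooth_on_continuous[OF smooth_on_slice_snd[OF D I(1) that h]])
  have eq: "(LBINT \<tau>=0..ereal (snd p). h (fst p, \<tau>)) = snd p * integral {0..1} (\<lambda>t. h (fst p, snd p * t))"
    if p: "p \<in> D \<times> I" for p
  proof -
    define z s where "z = fst p" "s = snd p"
    have zs: "z \<in> D" "s \<in> I" using p by (auto simp: z_s_def)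
    have "(LBINT x=ereal 0..ereal 1. s *\<^sub>R h (z, s * x)) = (LBINT y=ereal (s * 0)..ereal (s * 1). h (z, y))"
    proof (rule interval_integral_substitution_finite)
      show "((\<lambda>x. s * x) has_real_derivative s) (at x within {0..1})" for x
        by (auto intro!: derivative_eq_intros)
      show "continuous_on ((\<lambda>x. s * x) ` {0..1}) (\<lambda>y. h (z, y))"
        using contz[OF zs(1)] by (rule continuous_on_subset) (use inI[OF zs(2)] in auto)
    qed auto
    moreover have "(LBINT x=ereal 0..ereal 1. s *\<^sub>R h (z, s * x)) = integral {0..1} (\<lambda>x. s *\<^sub>R h (z, s * x))"
    proof (rule interval_integral_eq_integral)
      have "continuous_on {0..1} (\<lambda>x. s *\<^sub>R h (z, s * x))"
        by (intro continuous_intros continuous_on_compose2[OF contz[OF zs(1)]]) (use inI[OF zs(2)] in auto)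
      then show "set_integrable lborel {0..1} (\<lambda>x. s *\<^sub>R h (z, s * x))"
        by (rule borel_integrable_atLeastAtMost')
    qed auto
    ultimately show ?thesis by (simp add: z_s_def zero_ereal_def)
  qed
  define m where "m q = (fst (fst q), snd (fst q) * snd q)" for q :: "('v \<times> real) \<times> real"
  \<comment> \<open>Open set of all \<open>((z, s), t)\<close> with \<open>(z, s t)\<close> in the
    domain of \<open>h\<close>; it contains \<open>(D \<times> I) \<times> {0..1}\<close> because
    \<open>I\<close> is an interval around 0.\<close>
  define \<Omega> where "\<Omega> = m -` (D \<times> I)"
  have ms: "smooth_on UNIV m" unfolding m_def[abs_def] by (intro smooth_intros) auto
  have O: "open \<Omega>" unfolding \<Omega>_def using smooth_on_continuous[OF ms] DI by (metis open_vimage)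
  have "smooth_on \<Omega> (\<lambda>q. h (m q))"
    by (rule smooth_on_compose[OF O DI _ smooth_on_subset[OF ms] h]) (auto simp: \<Omega>_def)
  then have "smooth_on (D \<times> I) (\<lambda>p. integral {0..1} (\<lambda>t. h (m (p, t))))"
    by (intro smooth_on_integral_param[OF O DI, of "\<lambda>q. h (m q)"]) (auto simp: \<Omega>_def m_def inI)
  then have "smooth_on (D \<times> I) (\<lambda>p. snd p * integral {0..1} (\<lambda>t. h (fst p, snd p * t)))"
    unfolding m_def fst_conv snd_conv by (intro smooth_intros DI) auto
  then show sm: "smooth_on (D \<times> I) (\<lambda>p. LBINT \<tau>=0..ereal (snd p). h (fst p, \<tau>))"
    using smooth_on_cong[OF DI eq] by simp
  fix z s assume zs: "z \<in> D" "s \<in> I"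
  obtain e where e: "e > 0" "ball s e \<subseteq> I" using I(1) zs(2) openE by blast
  \<comment> \<open>A compact interval in \<open>I\<close> that contains the base point 0 and has
    \<open>s\<close> in its interior.\<close>
  define a b where "a = min 0 (s - e / 2)" "b = max 0 (s + e / 2)"
  have "s - e / 2 \<in> I" "s + e / 2 \<in> I" using e by (auto intro!: subsetD[OF e(2)] simp: dist_real_def)
  then have "a \<in> I" "b \<in> I" using I(3) by (auto simp: a_b_def min_def max_def)
  then have sub: "{a..b} \<subseteq> I" using mem_is_interval_1_I[OF I(2)] by (meson atLeastAtMost_iff subsetI)
  have ab: "a \<le> 0" "0 \<le> b" "a < s" "s < b" using e by (auto simp: a_b_def)
  have "((\<lambda>u. LBINT y=ereal 0..ereal u. h (z, y)) has_vector_derivative h (z, s)) (at s within {a..b})"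
    by (rule interval_integral_FTC2) (use ab continuous_on_subset[OF contz[OF zs(1)] sub] in auto)
  moreover have "at s within {a..b} = at s" using ab by (intro at_within_interior) auto
  ultimately have "((\<lambda>u. LBINT y=ereal 0..ereal u. h (z, y)) has_derivative (\<lambda>x. x *\<^sub>R h (z, s))) (at s)"
    by (simp add: has_vector_derivative_def)
  then show "dd (0, 1) (\<lambda>p. LBINT \<tau>=0..ereal (snd p). h (fst p, \<tau>)) (z, s) = h (z, s)"
    using dd_slice_snd(1)[OF smooth_on_differentiable[OF sm, of "(z, s)"]] zs
    by (simp add: zero_ereal_def dd_eq)
qed

text \<open>For \<open>u\<close> tangent to the leaf, everything rests on
  \<open>\<partial>\<^sub>u f \<bullet> \<partial>\<^sub>s N = 0\<close> and its mirror image
  \<open>\<partial>\<^sub>s f \<bullet> \<partial>\<^sub>u N = 0\<close>. By the product rule the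
  former is \<open>\<partial>\<^sub>u \<partial>\<^sub>s \<gamma> - f \<bullet> \<partial>\<^sub>u
  \<partial>\<^sub>s N\<close>, which works out to
  \<open>\<nu> \<gamma> \<partial>\<^sub>u r\<close>; the hyperplanes given by \<open>C\<close> and
  \<open>k\<close> serve to show that \<open>r\<close> is constant on leaves.\<close>

lemma tube_hypersurface_local:
  fixes N :: "'v::euclidean_space \<times> real \<Rightarrow> 'b::euclidean_space"
    and \<gamma> v0 \<nu> :: "'v \<times> real \<Rightarrow> real"
  assumes dim: "DIM('b) = DIM('v) + 2"
    and D: "open D" and I: "open I"
    and sm: "smooth_on (D \<times> I) N" "smooth_on (D \<times> I) \<gamma>" "smooth_on (D \<times> I) v0" "smooth_on (D \<times> I) \<nu>"
      "smooth_on (D \<times> I) f" "smooth_on I V" "\<And>u v. smooth_on D (\<lambda>z. g0 z u v)"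
    and pos: "\<And>p. p \<in> D \<times> I \<Longrightarrow> v0 p > 0" "\<And>p. p \<in> D \<times> I \<Longrightarrow> \<nu> p > 0"
    and g0: "\<And>z u. z \<in> D \<Longrightarrow> g0 z u 0 = 0" "\<And>z u. z \<in> D \<Longrightarrow> g0 z 0 u = 0" "\<And>z u. z \<in> D \<Longrightarrow> u \<noteq> 0 \<Longrightarrow> g0 z u u > 0"
    and metric: "\<And>z s u v a b. z \<in> D \<Longrightarrow> s \<in> I \<Longrightarrow> dd (u, a) N (z, s) \<bullet> dd (v, b) N (z, s)
        = (v0 (z, s))\<^sup>2 * g0 z u v + (\<nu> (z, s))\<^sup>2 * (a * b)"
    and N1: "\<And>p. p \<in> D \<times> I \<Longrightarrow> N p \<bullet> N p = 1"
    and C: "\<And>s. s \<in> I \<Longrightarrow> C s \<noteq> 0" "\<And>z s. z \<in> D \<Longrightarrow> s \<in> I \<Longrightarrow> N (z, s) \<bullet> C s = k s"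
    and \<gamma>s: "\<And>p. p \<in> D \<times> I \<Longrightarrow> dd (0, 1) \<gamma> p = dd (0, 1) v0 p / v0 p * \<gamma> p + V (snd p) * \<nu> p"
    and f: "\<And>p. p \<in> D \<times> I \<Longrightarrow> f p \<bullet> N p = \<gamma> p" "\<And>p w. p \<in> D \<times> I \<Longrightarrow> f p \<bullet> dd w N p = dd w \<gamma> p"
    and zs: "z \<in> D" "s \<in> I"
  shows "dd (u, 0) f (z, s) \<bullet> dd (0, a) f (z, s) = 0" (is ?orth)
    "inj (\<lambda>w. dd w f (z, s)) \<Longrightarrow> dd (u, 0) (dd (0, a) f) (z, s) \<in> range (\<lambda>w. dd w f (z, s))"
    "dd (u, 0) f (z, s) \<bullet> C s = 0" (is ?leaf)
proof -
  let ?S = "D \<times> I"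
  have S: "open ?S" using D I by (simp add: open_Times)
  have zsS: "(z, s) \<in> ?S" using zs by simp
  note df = smooth_on_differentiable
  note ddf = smooth_on_differentiable[OF smooth_on_dd]
  have bd: "DIM('b) = DIM('v \<times> real) + 1" using dim by simp
  have Nw: "N p \<bullet> dd w N p = 0" if p: "p \<in> ?S" for p w
  proof -
    have "dd w (\<lambda>p. N p \<bullet> N p) p = dd w (\<lambda>p. 1) p" by (rule dd_cong[OF S p N1])
    then show ?thesis using dd_inner[OF df[OF sm(1) p] df[OF sm(1) p], of w] by (simp add: inner_commute)
  qed
  have Nnz: "N p \<noteq> 0" if "p \<in> ?S" for p using N1[OF that] by auto
  have Np: "dd (u, a) N p \<bullet> dd (v, b) N p = (v0 p)\<^sup>2 * g0 (fst p) u v + (\<nu> p)\<^sup>2 * (a * b)" if "p \<in> ?S" for p u v a b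
    using metric[of "fst p" "snd p"] that by auto
  have injN: "inj (\<lambda>w. dd w N p)" if p: "p \<in> ?S" for p
  proof (subst linear_injective_0[OF linear_dd[OF df[OF sm(1) p]]], intro allI impI)
    fix w assume "dd w N p = 0"
    then have 0: "(v0 p)\<^sup>2 * g0 (fst p) (fst w) (fst w) + (\<nu> p)\<^sup>2 * (snd w * snd w) = 0"
      using Np[OF p, of "fst w" "snd w" "fst w" "snd w"] by simp
    have "g0 (fst p) (fst w) (fst w) \<ge> 0" using g0(1,3)[of "fst p" "fst w"] p by (cases "fst w = 0") (auto intro: less_imp_le)
    then have "(v0 p)\<^sup>2 * g0 (fst p) (fst w) (fst w) = 0" "(\<nu> p)\<^sup>2 * (snd w * snd w) = 0"
      using 0 add_nonneg_eq_0_iff[of "(v0 p)\<^sup>2 * g0 (fst p) (fst w) (fst w)" "(\<nu> p)\<^sup>2 * (snd w * snd w)"] by auto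
    then have "g0 (fst p) (fst w) (fst w) = 0" "snd w = 0" using pos(1,2)[OF p] by auto
    moreover from this have "fst w = 0" using g0(3)[of "fst p" "fst w"] p by fastforce
    ultimately show "w = 0" by (simp add: prod_eq_iff)
  qed
  have rangeN: "range (\<lambda>w. dd w N p) = {y. N p \<bullet> y = 0}" if p: "p \<in> ?S" for p
    by (rule range_eq_hyperplane[OF linear_dd[OF df[OF sm(1) p]] injN[OF p] bd Nnz[OF p] Nw[OF p]])
  have split: "dd (u, a) F p = dd (u, 0) F p + a *\<^sub>R dd (0, 1) F p" if "F differentiable (at p)"
    for F :: "'v \<times> real \<Rightarrow> 'x::real_normed_vector" and p u a
    using dd_add_dir[OF that, of "(u, 0)" "a *\<^sub>R (0, 1)"] dd_scaleR_dir[OF that, of a "(0, 1)"] by simp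
  have zero: "y = 0" if p: "p \<in> ?S" and "y \<bullet> N p = 0" "y \<bullet> dd (0, 1) N p = 0" "\<And>u. y \<bullet> dd (u, 0) N p = 0" for y p
  proof -
    have "y \<in> range (\<lambda>w. dd w N p)" using that(2) rangeN[OF p] by (simp add: inner_commute)
    then obtain w where w: "y = dd w N p" by auto
    have "y \<bullet> dd w N p = 0"
      using split[OF df[OF sm(1) p], of "fst w" "snd w"] that(3,4) by (simp add: inner_add_right)
    then show ?thesis using w by simp
  qed
  have E: "dd (u, 0) N p \<bullet> dd (v, 0) N p = (v0 p)\<^sup>2 * g0 (fst p) u v" if "p \<in> ?S" for p u v
    using Np[OF that, of u 0 v 0] by simp
  have Es: "dd (u, 0) N p \<bullet> dd (0, 1) N p = 0" if "p \<in> ?S" for p u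
    using Np[OF that, of u 0 0 1] g0(1)[of "fst p"] that by auto
  have Es': "dd (0, 1) N p \<bullet> dd (u, 0) N p = 0" and Nw': "dd w N p \<bullet> N p = 0" if "p \<in> ?S" for p u w
    using Es[OF that] Nw[OF that] by (metis inner_commute)+
  have Ess: "dd (0, 1) N p \<bullet> dd (0, 1) N p = (\<nu> p)\<^sup>2" if "p \<in> ?S" for p
    using Np[OF that, of 0 1 0 1] g0(1)[of "fst p"] that by auto
  \<comment> \<open>\<open>\<rho>\<close> will be the coefficient of
    \<open>\<partial>\<^sub>u N\<close> in \<open>\<partial>\<^sub>u \<partial>\<^sub>s N\<close>;
    dividing by the speed \<open>\<nu>\<close> gives the umbilic curvature of the leaf in the
    sphere, up to sign.\<close>
  define \<rho> where "\<rho> p = dd (0, 1) v0 p / v0 p" for p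
  define r where "r p = \<rho> p / \<nu> p" for p
  define T where "T u p = dd (u, 0) (dd (0, 1) N) p" for u p
  have Tsym: "dd (0, 1) (dd (u, 0) N) p = T u p" if "p \<in> ?S" for u p
    unfolding T_def by (rule dd_symmetric[OF S that sm(1)])
  have TN: "T u p \<bullet> N p = 0" if p: "p \<in> ?S" for u p
  proof -
    have "dd (u, 0) (\<lambda>p. dd (0, 1) N p \<bullet> N p) p = dd (u, 0) (\<lambda>p. 0) p"
      by (rule dd_cong[OF S p trans[OF inner_commute Nw]])
    then show ?thesis using dd_inner[OF ddf[OF sm(1) p] df[OF sm(1) p], of "(u, 0)" "(0, 1)"] Es[OF p, of u]
      by (simp add: T_def inner_commute)
  qed
  have TNs: "T u p \<bullet> dd (0, 1) N p = \<nu> p * dd (u, 0) \<nu> p" if p: "p \<in> ?S" for u p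
  proof -
    have "dd (u, 0) (\<lambda>p. dd (0, 1) N p \<bullet> dd (0, 1) N p) p = dd (u, 0) (\<lambda>p. \<nu> p * \<nu> p) p"
      by (rule dd_cong[OF S p]) (use Ess in \<open>simp add: power2_eq_square\<close>)
    then show ?thesis
      using dd_inner[OF ddf[OF sm(1) p] ddf[OF sm(1) p], of "(u, 0)" "(0, 1)" "(0, 1)"]
        dd_mult[OF df[OF sm(4) p] df[OF sm(4) p], of "(u, 0)"]
      by (simp add: T_def inner_commute)
  qed
  have TNv': "dd (0, 1) N p \<bullet> dd (u, 0) (dd (v, 0) N) p = - (T u p \<bullet> dd (v, 0) N p)" if p: "p \<in> ?S" for u v p
  proof -
    have "dd (u, 0) (\<lambda>p. dd (0, 1) N p \<bullet> dd (v, 0) N p) p = dd (u, 0) (\<lambda>p. 0) p"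
      by (rule dd_cong[OF S p trans[OF inner_commute Es]])
    then show ?thesis
      using dd_inner[OF ddf[OF sm(1) p] ddf[OF sm(1) p], of "(u, 0)" "(0, 1)" "(v, 0)"]
      by (simp add: T_def)
  qed
  have Tsymm: "T u p \<bullet> dd (v, 0) N p = T v p \<bullet> dd (u, 0) N p" if p: "p \<in> ?S" for u v p
    using TNv'[OF p, of u v] TNv'[OF p, of v u] dd_symmetric[OF S p sm(1), of "(u, 0)" "(v, 0)"] by simp
  \<comment> \<open>Differentiate \<open>\<partial>\<^sub>u N \<bullet> \<partial>\<^sub>v N =
    v0\<^sup>2 g0\<close> in \<open>s\<close>, where \<open>g0\<close> does not depend on
    \<open>s\<close>; by \<open>Tsymm\<close> the two terms on the left agree.\<close>
  have TNv: "T u p \<bullet> dd (v, 0) N p = \<rho> p * (dd (u, 0) N p \<bullet> dd (v, 0) N p)" if p: "p \<in> ?S" for u v p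
  proof -
    have g: "(\<lambda>p. g0 (fst p) u v) differentiable (at p)" "dd (0, 1) (\<lambda>p. g0 (fst p) u v) p = 0"
    proof -
      have "smooth_on ?S (\<lambda>p. g0 (fst p) u v)" by (rule smooth_on_comp_fst[OF D I sm(7)])
      then show "(\<lambda>p. g0 (fst p) u v) differentiable (at p)" using p by (rule df)
      have d: "(\<lambda>z. g0 z u v) differentiable (at (fst p))" using df[OF sm(7)] p by auto
      show "dd (0, 1) (\<lambda>p. g0 (fst p) u v) p = 0" unfolding dd_fst[of "\<lambda>z. g0 z u v", OF d] by (rule dd_zero_dir[OF d])
    qed
    have v2: "(\<lambda>p. v0 p * v0 p) differentiable (at p)" by (rule df[of ?S, OF _ p]) (intro smooth_intros S sm)
    have "dd (0, 1) (\<lambda>p. dd (u, 0) N p \<bullet> dd (v, 0) N p) p = dd (0, 1) (\<lambda>p. (v0 p * v0 p) * g0 (fst p) u v) p"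
      by (rule dd_cong[OF S p]) (use E in \<open>simp add: power2_eq_square\<close>)
    also have "\<dots> = 2 * v0 p * dd (0, 1) v0 p * g0 (fst p) u v"
      using dd_mult[OF v2 g(1), of "(0, 1)"] g(2) dd_mult[OF df[OF sm(3) p] df[OF sm(3) p], of "(0, 1)"]
      by (simp add: algebra_simps)
    also have "\<dots> = 2 * \<rho> p * ((v0 p)\<^sup>2 * g0 (fst p) u v)" using pos(1)[OF p] by (simp add: \<rho>_def power2_eq_square)
    also have "\<dots> = 2 * \<rho> p * (dd (u, 0) N p \<bullet> dd (v, 0) N p)" using E[OF p] by simp
    finally show ?thesis
      using dd_inner[OF ddf[OF sm(1) p] ddf[OF sm(1) p], of "(0, 1)" "(u, 0)" "(v, 0)"] Tsymm[OF p, of u v]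
      by (simp add: Tsym[OF p] inner_commute)
  qed
  \<comment> \<open>The mixed derivative has no component along \<open>N\<close>, because the net is
    orthogonal for \<open>N\<close>.\<close>
  have Teq: "T u p = \<rho> p *\<^sub>R dd (u, 0) N p + (dd (u, 0) \<nu> p / \<nu> p) *\<^sub>R dd (0, 1) N p" if p: "p \<in> ?S" for u p
  proof -
    let ?Z = "T u p - (\<rho> p *\<^sub>R dd (u, 0) N p + (dd (u, 0) \<nu> p / \<nu> p) *\<^sub>R dd (0, 1) N p)"
    have "?Z = 0"
    proof (rule zero[OF p])
      show "?Z \<bullet> N p = 0" using TN[OF p] Nw'[OF p] by (simp add: inner_diff_left inner_add_left)
      show "?Z \<bullet> dd (0, 1) N p = 0"
        using TNs[OF p] Es[OF p] Ess[OF p] pos(2)[OF p]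
        by (simp add: inner_diff_left inner_add_left power2_eq_square)
      show "?Z \<bullet> dd (v, 0) N p = 0" for v
        using TNv[OF p] Es'[OF p] by (simp add: inner_diff_left inner_add_left)
    qed
    then show ?thesis by simp
  qed
  have \<gamma>s': "dd (0, 1) \<gamma> p = \<nu> p * (r p * \<gamma> p + V (snd p))" if "p \<in> ?S" for p
    using \<gamma>s[OF that] pos(2)[OF that] by (simp add: r_def \<rho>_def field_simps)
  have rsm: "smooth_on ?S r" unfolding r_def[abs_def] \<rho>_def[abs_def]
    by (intro smooth_intros S sm) (use pos in force)+
  \<comment> \<open>The hyperplane with normal \<open>C s\<close> makes the leaf through \<open>s\<close> an extrinsic sphere; its constant mean curvature is \<open>r\<close>.\<close>
  define c where "c = C s"
  have slice: "(z', s) \<in> ?S" if "z' \<in> D" for z' using that zs by simp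
  have cN: "c \<bullet> dd (u, 0) N (z', s) = 0" if z': "z' \<in> D" for z' u
  proof -
    have d: "N differentiable (at (z', s))" by (rule df[OF sm(1) slice[OF z']])
    have "dd (u, 0) (\<lambda>p. N p \<bullet> c) (z', s) = 0"
      by (rule dd_slice_const[OF _ D z', of _ _ "k s"])
         (use C(2) zs(2) d in \<open>auto simp: c_def intro!: differentiable_linear[OF bounded_linear_inner_left]\<close>)
    then show ?thesis using dd_linear[OF bounded_linear_inner_left d] by (simp add: inner_commute)
  qed
  \<comment> \<open>The component of \<open>c\<close> along the unit normal
    \<open>\<partial>\<^sub>s N / \<nu>\<close> of the leaf within the sphere.\<close>
  define P where "P p = c \<bullet> dd (0, 1) N p / \<nu> p" for p
  have Psm: "smooth_on ?S P" unfolding P_def[abs_def]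
    by (intro smooth_intros S sm) (use pos in force)+
  have ceq: "c = k s *\<^sub>R N (z', s) + (P (z', s) / \<nu> (z', s)) *\<^sub>R dd (0, 1) N (z', s)" if z': "z' \<in> D" for z'
  proof -
    note p = slice[OF z']
    let ?Z = "c - (k s *\<^sub>R N (z', s) + (P (z', s) / \<nu> (z', s)) *\<^sub>R dd (0, 1) N (z', s))"
    have "?Z = 0"
    proof (rule zero[OF p])
      show "?Z \<bullet> N (z', s) = 0" using C(2)[OF z' zs(2)] Nw'[OF p] N1[OF p]
        by (simp add: inner_diff_left inner_add_left c_def inner_commute[of "C s"])
      show "?Z \<bullet> dd (0, 1) N (z', s) = 0"
        using Nw[OF p] Ess[OF p] pos(2)[OF p]
        by (simp add: inner_diff_left inner_add_left power2_eq_square P_def)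
      show "?Z \<bullet> dd (v, 0) N (z', s) = 0" for v
        using Nw[OF p] Es'[OF p] cN[OF z'] by (simp add: inner_diff_left inner_add_left)
    qed
    then show ?thesis by simp
  qed
  \<comment> \<open>One more differentiation along the leaf: pair the decomposition
    \<open>ceq\<close> of the fixed vector \<open>c\<close> with
    \<open>\<partial>\<^sub>v \<partial>\<^sub>v N\<close>, which is orthogonal to
    \<open>c\<close>.\<close>
  have qPr: "P (z', s) * r (z', s) = - k s" if z': "z' \<in> D" for z'
  proof -
    note p = slice[OF z']
    obtain v :: 'v where v: "v \<noteq> 0" using nonempty_Basis nonzero_Basis by blast
    let ?E = "dd (v, 0) N (z', s) \<bullet> dd (v, 0) N (z', s)"
    have Epos: "?E > 0" using E[OF p, of v v] g0(3)[OF z' v] pos(1)[OF p] by simp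
    have d: "dd (v, 0) N differentiable (at (z', s))" by (rule ddf[OF sm(1) p])
    have "dd (v, 0) (\<lambda>p. dd (v, 0) N p \<bullet> c) (z', s) = 0"
      by (rule dd_slice_const[OF _ D z', of _ _ 0])
         (use cN d in \<open>auto simp: inner_commute intro!: differentiable_linear[OF bounded_linear_inner_left]\<close>)
    then have "dd (v, 0) (dd (v, 0) N) (z', s) \<bullet> c = 0" using dd_linear[OF bounded_linear_inner_left d] by simp
    moreover have "N (z', s) \<bullet> dd (v, 0) (dd (v, 0) N) (z', s) = - ?E"
    proof -
      have "dd (v, 0) (\<lambda>p. N p \<bullet> dd (v, 0) N p) (z', s) = dd (v, 0) (\<lambda>p. 0) (z', s)"
        by (rule dd_cong[OF S p Nw])
      then show ?thesis using dd_inner[OF df[OF sm(1) p] d] by simp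
    qed
    moreover have "dd (0, 1) N (z', s) \<bullet> dd (v, 0) (dd (v, 0) N) (z', s) = - \<rho> (z', s) * ?E"
      using TNv'[OF p] TNv[OF p] by simp
    ultimately have "k s * ?E + (P (z', s) / \<nu> (z', s)) * (\<rho> (z', s) * ?E) = 0"
      using arg_cong[OF ceq[OF z'], of "\<lambda>y. y \<bullet> dd (v, 0) (dd (v, 0) N) (z', s)"]
      by (simp add: inner_add_left inner_commute inner_diff_right inner_add_right)
    then have "(k s + P (z', s) * r (z', s)) * ?E = 0" by (simp add: r_def algebra_simps)
    then show ?thesis using Epos by simp
  qed
  have Pnz: "P (z, s) \<noteq> 0"
  proof
    assume "P (z, s) = 0"
    then show False using qPr[OF zs(1)] ceq[OF zs(1)] C(1)[OF zs(2)] by (simp add: c_def)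
  qed
  \<comment> \<open>By \<open>Teq\<close> the numerator of \<open>P\<close> and its denominator
    \<open>\<nu>\<close> vary along the leaf by the same factor
    \<open>\<partial>\<^sub>u \<nu> / \<nu>\<close>. With \<open>P r = - k s\<close> and
    \<open>P \<noteq> 0\<close> the constancy of \<open>P\<close> forces that of
    \<open>r\<close>.\<close>
  have Pu: "dd (u, 0) P (z, s) = 0" for u
  proof -
    let ?n = "\<lambda>p. c \<bullet> dd (0, 1) N p"
    have dn: "?n differentiable (at (z, s))"
      by (rule df[of ?S, OF _ zsS]) (intro smooth_intros S sm)
    have n1: "dd (u, 0) ?n (z, s) = c \<bullet> T u (z, s)"
      unfolding T_def by (rule dd_linear[OF bounded_linear_inner_right ddf[OF sm(1) zsS]])
    have n2: "c \<bullet> T u (z, s) = (dd (u, 0) \<nu> (z, s) / \<nu> (z, s)) * ?n (z, s)"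
      unfolding Teq[OF zsS] using cN[OF zs(1)] by (simp add: inner_add_right)
    show ?thesis unfolding P_def[abs_def]
      using dd_divide[OF dn df[OF sm(4) zsS], of "(u, 0)"] pos(2)[OF zsS] unfolding n1 n2 by simp
  qed
  have ru: "dd (u, 0) r (z, s) = 0" for u
  proof -
    have d: "P differentiable (at (z, s))" "r differentiable (at (z, s))"
      using df[OF Psm zsS] df[OF rsm zsS] by auto
    have "(\<lambda>p. P p * r p) differentiable (at (z, s))" by (rule differentiable_mult[OF d])
    then have "dd (u, 0) (\<lambda>p. P p * r p) (z, s) = 0"
      by (rule dd_slice_const[OF _ D zs(1), of "\<lambda>p. P p * r p", OF _ qPr])
    then show ?thesis using dd_mult[OF d, of "(u, 0)"] Pu Pnz by simp
  qed
  \<comment> \<open>The term \<open>\<nu> \<gamma> \<partial>\<^sub>u r\<close> that would separate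
    the two sides drops out by \<open>ru\<close>.\<close>
  have \<gamma>us: "dd (u, 0) (dd (0, 1) \<gamma>) (z, s) = f (z, s) \<bullet> T u (z, s)" for u
  proof -
    have dV: "(\<lambda>p. V (snd p)) differentiable (at (z, s))" "dd (u, 0) (\<lambda>p. V (snd p)) (z, s) = 0"
    proof -
      have V: "V differentiable (at s)" using df[OF sm(6) zs(2)] .
      show "(\<lambda>p. V (snd p)) differentiable (at (z, s))"
        by (rule df[OF smooth_on_comp_snd[OF D I sm(6)] zsS])
      show "dd (u, 0) (\<lambda>p. V (snd p)) (z, s) = 0"
        using dd_snd[of V "(z, s)" u 0] dd_zero_dir[OF V] V by simp
    qed
    note d\<gamma> = df[OF sm(2) zsS] and d\<nu> = df[OF sm(4) zsS] and dr = df[OF rsm zsS]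
    have "dd (u, 0) (dd (0, 1) \<gamma>) (z, s) = dd (u, 0) (\<lambda>p. \<nu> p * (r p * \<gamma> p + V (snd p))) (z, s)"
      by (rule dd_cong[OF S zsS \<gamma>s'])
    also have "\<dots> = \<nu> (z, s) * dd (u, 0) (\<lambda>p. r p * \<gamma> p + V (snd p)) (z, s)
        + dd (u, 0) \<nu> (z, s) * (r (z, s) * \<gamma> (z, s) + V s)"
      using dd_mult[OF d\<nu> differentiable_add[OF differentiable_mult[OF dr d\<gamma>] dV(1)], of "(u, 0)"] by simp
    also have "dd (u, 0) (\<lambda>p. r p * \<gamma> p + V (snd p)) (z, s) = r (z, s) * dd (u, 0) \<gamma> (z, s)"
      using dd_add[OF differentiable_mult[OF dr d\<gamma>] dV(1)] dd_mult[OF dr d\<gamma>, of "(u, 0)"] ru dV(2) by simp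
    finally have 1: "dd (u, 0) (dd (0, 1) \<gamma>) (z, s) = \<nu> (z, s) * (r (z, s) * dd (u, 0) \<gamma> (z, s))
        + dd (u, 0) \<nu> (z, s) * (r (z, s) * \<gamma> (z, s) + V s)" .
    have "f (z, s) \<bullet> T u (z, s) = \<rho> (z, s) * dd (u, 0) \<gamma> (z, s) + dd (u, 0) \<nu> (z, s) / \<nu> (z, s) * dd (0, 1) \<gamma> (z, s)"
      unfolding Teq[OF zsS] using f(2)[OF zsS] by (simp add: inner_add_right)
    then show ?thesis unfolding 1 using \<gamma>s'[OF zsS] pos(2)[OF zsS] by (simp add: r_def)
  qed
  have fN: "dd w f p \<bullet> N p = 0" if p: "p \<in> ?S" for w p
  proof -
    have "dd w (\<lambda>p. f p \<bullet> N p) p = dd w \<gamma> p" by (rule dd_cong[OF S p f(1)])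
    then show ?thesis using dd_inner[OF df[OF sm(5) p] df[OF sm(1) p], of w] f(2)[OF p, of w] by simp
  qed
  have fuNs: "dd (u, 0) f (z, s) \<bullet> dd (0, 1) N (z, s) = 0" for u
  proof -
    have "dd (u, 0) (\<lambda>p. f p \<bullet> dd (0, 1) N p) (z, s) = dd (u, 0) (dd (0, 1) \<gamma>) (z, s)" by (rule dd_cong[OF S zsS f(2)])
    then show ?thesis using dd_inner[OF df[OF sm(5) zsS] ddf[OF sm(1) zsS], of "(u, 0)" "(0, 1)"] \<gamma>us
      by (simp add: T_def)
  qed
  have fsNu: "dd (0, 1) f (z, s) \<bullet> dd (u, 0) N (z, s) = 0" for u
  proof -
    have "dd (0, 1) (\<lambda>p. f p \<bullet> dd (u, 0) N p) (z, s) = dd (0, 1) (dd (u, 0) \<gamma>) (z, s)" by (rule dd_cong[OF S zsS f(2)])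
    then show ?thesis using dd_inner[OF df[OF sm(5) zsS] ddf[OF sm(1) zsS], of "(0, 1)" "(u, 0)"] \<gamma>us[of u]
        dd_symmetric[OF S zsS sm(2), of "(0, 1)" "(u, 0)"]
      by (simp add: Tsym[OF zsS])
  qed
  \<comment> \<open>\<open>c\<close> is a combination of \<open>N\<close> and
    \<open>\<partial>\<^sub>s N\<close>, and \<open>\<partial>\<^sub>u f\<close> is orthogonal to
    both.\<close>
  show ?leaf
    unfolding c_def[symmetric] ceq[OF zs(1)] using fN[OF zsS] fuNs by (simp add: inner_add_right)
  \<comment> \<open>\<open>\<partial>\<^sub>s f\<close> is parallel to
    \<open>\<partial>\<^sub>s N\<close>, so
    \<open>\<partial>\<^sub>u f \<bullet> \<partial>\<^sub>s N = 0\<close> becomes orthogonality of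
    the net for \<open>f\<close>.\<close>
  have fs: "dd (0, 1) f (z, s) = (dd (0, 1) f (z, s) \<bullet> dd (0, 1) N (z, s) / (\<nu> (z, s))\<^sup>2) *\<^sub>R dd (0, 1) N (z, s)"
  proof -
    let ?Z = "dd (0, 1) f (z, s) - (dd (0, 1) f (z, s) \<bullet> dd (0, 1) N (z, s) / (\<nu> (z, s))\<^sup>2) *\<^sub>R dd (0, 1) N (z, s)"
    have "?Z = 0"
    proof (rule zero[OF zsS])
      show "?Z \<bullet> N (z, s) = 0" using fN[OF zsS] Nw'[OF zsS] by (simp add: inner_diff_left)
      show "?Z \<bullet> dd (0, 1) N (z, s) = 0" using Ess[OF zsS] pos(2)[OF zsS] by (simp add: inner_diff_left)
      show "?Z \<bullet> dd (u, 0) N (z, s) = 0" for u using fsNu Es'[OF zsS] by (simp add: inner_diff_left)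
    qed
    then show ?thesis by simp
  qed
  have fa: "dd (0, a) f p = a *\<^sub>R dd (0, 1) f p" if "p \<in> ?S" for p
    using dd_scaleR_dir[OF df[OF sm(5) that], of a "(0, 1)"] by simp
  have "dd (u, 0) f (z, s) \<bullet> dd (0, 1) f (z, s) = 0"
    by (subst fs) (simp add: fuNs)
  then show ?orth using fa[OF zsS] by simp
  assume inj: "inj (\<lambda>w. dd w f (z, s))"
  have "range (\<lambda>w. dd w f (z, s)) = {y. N (z, s) \<bullet> y = 0}"
    by (rule range_eq_hyperplane[OF linear_dd[OF df[OF sm(5) zsS]] inj bd Nnz[OF zsS]])
       (use fN[OF zsS] in \<open>simp add: inner_commute\<close>)
  \<comment> \<open>Move the derivative onto \<open>N\<close>: the normal part of
    \<open>\<partial>\<^sub>u \<partial>\<^sub>s f\<close> is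
    \<open>- \<partial>\<^sub>s f \<bullet> \<partial>\<^sub>u N\<close>, which is zero by
    \<open>fsNu\<close>.\<close>
  moreover have "N (z, s) \<bullet> dd (u, 0) (dd (0, a) f) (z, s) = 0"
  proof -
    have "dd (u, 0) (\<lambda>p. dd (0, a) f p \<bullet> N p) (z, s) = dd (u, 0) (\<lambda>p. 0) (z, s)" by (rule dd_cong[OF S zsS fN])
    then show ?thesis
      using dd_inner[OF ddf[OF sm(5) zsS] df[OF sm(1) zsS], of "(u, 0)" "(0, a)"] fa[OF zsS] fsNu[of u]
      by (simp add: inner_commute)
  qed
  ultimately show "dd (u, 0) (dd (0, a) f) (z, s) \<in> range (\<lambda>w. dd w f (z, s))" by simp
qed

subsection \<open>The direct statement\<close>

text \<open>Coordinate expression in a product chart, with the inverse chart applied to the first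
  component only. It agrees with composition by \<open>chart_inv (prod_chart c I)\<close> on the
  image of the product chart, which is all that derivatives on this open set see.\<close>

abbreviation rep :: "('q, 'v) chart \<Rightarrow> ('q \<times> real \<Rightarrow> 'b) \<Rightarrow> 'v \<times> real \<Rightarrow> 'b" where
  "rep c F \<equiv> \<lambda>p. F (chart_inv c (fst p), snd p)"

lemma smooth_map_prod:
  assumes A: "smooth_atlas A" and I: "open I"
  shows "smooth_map (prod_atlas A I) F \<longleftrightarrow> (\<forall>c\<in>A. smooth_on (snd c ` fst c \<times> I) (rep c F))"
proof -
  have "smooth_on (snd c ` fst c \<times> I) (F \<circ> chart_inv (prod_chart c I)) = smooth_on (snd c ` fst c \<times> I) (rep c F)"
    if "c \<in> A" for c
    by (rule smooth_on_cong) (use prod_rep[OF smooth_atlas_chart[OF A that] I] in auto)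
  then show ?thesis by (auto simp: smooth_map_def prod_atlas_def prod_chart_simps(3))
qed

lemma differential_prod:
  assumes c: "is_chart c" and I: "open I" and x: "x \<in> fst c" "s \<in> I"
  shows "differential (prod_chart c I) F (x, s) w = dd w (rep c F) (snd c x, s)"
  unfolding differential_eq_dd prod_chart_simps(2)
  by (rule dd_cong[OF prod_rep(1)[OF c I] _ prod_rep(2)[OF c I]]) (use x in auto)

lemma dd2_cong:
  assumes S: "open S" "x \<in> S" and eq: "\<And>y. y \<in> S \<Longrightarrow> f y = g y"
  shows "dd u (dd v f) x = dd u (dd v g) x"
  by (rule dd_cong[OF S], rule dd_cong[OF S(1)]) (use eq in auto)

text \<open>Locally constant on a connected set. It provides one constant for a whole leaf, which
  several charts may be needed to cover.\<close>

lemma zero_differential_constant: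
  fixes F :: "'q::{t2_space, second_countable_topology} \<Rightarrow> 'b::euclidean_space"
    and A :: "('q, 'v::euclidean_space) chart set"
  assumes A: "smooth_atlas A" and con: "connected (points A)" and F: "smooth_map A F"
    and zero: "\<And>c x u. c \<in> A \<Longrightarrow> x \<in> fst c \<Longrightarrow> differential c F x u = 0"
    and xy: "x \<in> points A" "y \<in> points A"
  shows "F x = F y"
proof (rule connected_local_const[OF con xy], intro ballI)
  fix a assume "a \<in> points A"
  then obtain c where c: "c \<in> A" "a \<in> fst c" by (auto simp: points_def)
  note ch = smooth_atlas_chart[OF A c(1)]
  obtain e where e: "e > 0" "ball (snd c a) e \<subseteq> snd c ` fst c"
    using is_chart_open(2)[OF ch] c(2) openE by blast
  have "\<exists>k. \<forall>z\<in>ball (snd c a) e. (F \<circ> chart_inv c) z = k"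
  proof (rule has_derivative_zero_constant[OF convex_ball])
    fix z assume "z \<in> ball (snd c a) e"
    then have z: "z \<in> snd c ` fst c" using e by auto
    have "((F \<circ> chart_inv c) has_derivative (\<lambda>u. dd u (F \<circ> chart_inv c) z)) (at z)"
      by (rule dd_has_derivative) (use F c z in \<open>auto simp: smooth_map_def intro: smooth_on_differentiable\<close>)
    moreover have "dd u (F \<circ> chart_inv c) z = 0" for u
      using zero[OF c(1), of "chart_inv c z" u] chart_inv_right[OF z] by (simp add: differential_eq_dd)
    ultimately show "((F \<circ> chart_inv c) has_derivative (\<lambda>h. 0)) (at z within ball (snd c a) e)"
      by (simp add: has_derivative_at_withinI)
  qed
  then obtain k where k: "\<And>z. z \<in> ball (snd c a) e \<Longrightarrow> (F \<circ> chart_inv c) z = k" by blast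
  define W where "W = chart_inv c ` ball (snd c a) e"
  have W: "open W" unfolding W_def by (rule open_chart_preimage[OF ch _ e(2)]) simp
  have aW: "a \<in> W" using chart_inv_left[OF ch c(2)] e(1) unfolding W_def by (metis centre_in_ball imageI)
  have "F b = k" if "b \<in> W" for b using that k by (auto simp: W_def)
  then have "\<forall>b\<in>W. F a = F b" using aW by simp
  then have "\<forall>\<^sub>F b in nhds a. F a = F b" using W aW unfolding eventually_nhds by blast
  then show "\<forall>\<^sub>F b in at a within points A. F a = F b"
    unfolding eventually_at_filter by (rule eventually_mono) simp
qed

text \<open>In coordinates the pushed-forward gradient is the sum of
  \<open>\<partial>\<^sub>b \<gamma>\<close> times the dual frame vector \<open>E b\<close>, hence
  smooth. Since \<open>N\<close> is a unit vector, \<open>N\<close> and \<open>dN\<close> are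
  orthogonal, so the two summands of \<open>f\<close> give the two pairings separately.\<close>

lemma gauss_parametrization_smooth:
  fixes N :: "'q::{t2_space, second_countable_topology} \<Rightarrow> 'b::euclidean_space"
    and B :: "('q, 'v::euclidean_space) chart set"
  assumes B: "smooth_atlas B" and N: "immersion B N" and N1: "\<And>p. p \<in> points B \<Longrightarrow> N p \<bullet> N p = 1"
    and \<gamma>: "smooth_map B \<gamma>"
  shows "smooth_map B (gauss_parametrization B N \<gamma>)"
    "\<And>c p. c \<in> B \<Longrightarrow> p \<in> fst c \<Longrightarrow> gauss_parametrization B N \<gamma> p \<bullet> N p = \<gamma> p"
    "\<And>c p w. c \<in> B \<Longrightarrow> p \<in> fst c \<Longrightarrow>
      gauss_parametrization B N \<gamma> p \<bullet> differential c N p w = differential c \<gamma> p w"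
proof -
  let ?f = "gauss_parametrization B N \<gamma>"
  have Ns: "smooth_map B N" using N by (simp add: immersion_def)
  have main: "smooth_on (snd c ` fst c) (?f \<circ> chart_inv c) \<and>
    (\<forall>p\<in>fst c. ?f p \<bullet> N p = \<gamma> p \<and> (\<forall>w. ?f p \<bullet> differential c N p w = differential c \<gamma> p w))" if c: "c \<in> B" for c
  proof -
    let ?N = "N \<circ> chart_inv c" and ?g = "\<gamma> \<circ> chart_inv c" and ?S = "snd c ` fst c"
    note ch = smooth_atlas_chart[OF B c]
    have S: "open ?S" by (rule is_chart_open(2)[OF ch])
    have sN: "smooth_on ?S ?N" and sg: "smooth_on ?S ?g" using Ns \<gamma> c by (auto simp: smooth_map_def)
    have inv: "chart_inv c z \<in> fst c" "snd c (chart_inv c z) = z" if "z \<in> ?S" for z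
      using chart_inv_right[OF that] by auto
    have inj: "inj (\<lambda>v. dd v ?N z)" if z: "z \<in> ?S" for z
    proof -
      have "chart_inv c z \<in> points B" using inv(1)[OF z] c by (auto simp: points_def)
      then have "inj (differential c N (chart_inv c z))"
        using N c inv(1)[OF z] by (auto simp: immersion_def regular_point_def)
      then show ?thesis by (simp add: differential_eq_dd[abs_def] inv(2)[OF z])
    qed
    obtain E where E: "\<And>b. b \<in> Basis \<Longrightarrow> smooth_on ?S (E b)"
      "\<And>b z. b \<in> Basis \<Longrightarrow> z \<in> ?S \<Longrightarrow> E b z \<in> range (\<lambda>v. dd v ?N z)"
      "\<And>b z v. b \<in> Basis \<Longrightarrow> z \<in> ?S \<Longrightarrow> E b z \<bullet> dd v ?N z = v \<bullet> b"
      using immersion_dual_frame[OF S sN inj] by blast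
    define Y where "Y z = (\<Sum>b\<in>Basis. dd b ?g z *\<^sub>R E b z)" for z
    have Y1: "Y z \<in> range (\<lambda>v. dd v ?N z)" if z: "z \<in> ?S" for z
      unfolding Y_def
      by (intro subspace_sum subspace_scale E(2) z linear_subspace_image[OF linear_dd[OF smooth_on_differentiable[OF sN z]] subspace_UNIV])
    have Y2: "Y z \<bullet> dd v ?N z = dd v ?g z" if z: "z \<in> ?S" for z v
      unfolding Y_def using dd_basis[OF smooth_on_differentiable[OF sg z], of v]
      by (simp add: inner_sum_left E(3)[OF _ z] mult.commute)
    have Ysm: "smooth_on ?S Y" unfolding Y_def[abs_def] by (intro smooth_intros S sg E)
    have feq: "?f (chart_inv c z) = ?g z *\<^sub>R ?N z + Y z" if z: "z \<in> ?S" for z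
    proof -
      have "?f (chart_inv c z) = \<gamma> (chart_inv c z) *\<^sub>R N (chart_inv c z) + Y z"
        by (rule gauss_parametrization_eq[OF B c inv(1)[OF z] N \<gamma>])
           (use Y1[OF z] Y2[OF z] in \<open>simp_all add: differential_eq_dd[abs_def] inv(2)[OF z]\<close>)
      then show ?thesis by simp
    qed
    have "smooth_on ?S (\<lambda>z. ?g z *\<^sub>R ?N z + Y z)" by (intro smooth_intros S sg sN Ysm)
    then have 1: "smooth_on ?S (?f \<circ> chart_inv c)"
      using smooth_on_cong[OF S, of "?f \<circ> chart_inv c" "\<lambda>z. ?g z *\<^sub>R ?N z + Y z"] feq by simp
    have "?f p \<bullet> N p = \<gamma> p \<and> (\<forall>w. ?f p \<bullet> differential c N p w = differential c \<gamma> p w)" if p: "p \<in> fst c" for p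
    proof -
      define z where "z = snd c p"
      have z: "z \<in> ?S" and pz: "chart_inv c z = p" using p chart_inv_left[OF ch p] by (auto simp: z_def)
      have Nw: "?N z \<bullet> dd w ?N z = 0" for w
      proof -
        have "dd w (\<lambda>z. ?N z \<bullet> ?N z) z = dd w (\<lambda>z. 1) z"
          by (rule dd_cong[OF S z]) (use N1 inv(1) c in \<open>auto simp: points_def\<close>)
        then show ?thesis
          using dd_inner[OF smooth_on_differentiable[OF sN z] smooth_on_differentiable[OF sN z], of w]
          by (simp add: inner_commute)
      qed
      have YN: "Y z \<bullet> ?N z = 0" using Y1[OF z] Nw by (auto simp: inner_commute)
      have NN: "?N z \<bullet> ?N z = 1" using N1[of p] p c pz by (auto simp: points_def)
      have "?f p \<bullet> N p = \<gamma> p" using feq[OF z] YN NN by (simp add: pz inner_add_left)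
      moreover have "?f p \<bullet> differential c N p w = differential c \<gamma> p w" for w
        using feq[OF z] Nw[of w] Y2[OF z, of w]
        by (simp add: pz inner_add_left differential_eq_dd z_def[symmetric])
      ultimately show ?thesis by blast
    qed
    with 1 show ?thesis by blast
  qed
  then show "smooth_map B ?f" by (auto simp: smooth_map_def)
  show "?f p \<bullet> N p = \<gamma> p" if "c \<in> B" "p \<in> fst c" for c p using main[OF that(1)] that(2) by blast
  show "?f p \<bullet> differential c N p w = differential c \<gamma> p w" if "c \<in> B" "p \<in> fst c" for c p w
    using main[OF that(1)] that(2) by blast
qed

lemma unit_speed_inner:
  assumes I: "open I" and \<beta>: "unit_speed_in_sphere I \<beta>" and s: "s \<in> I"
  shows "\<beta> s \<bullet> \<beta> s = 1" "velocity \<beta> s \<bullet> velocity \<beta> s = 1" "\<beta> s \<bullet> velocity \<beta> s = 0"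
proof -
  have sm: "smooth_on I \<beta>" using \<beta> by (simp add: unit_speed_in_sphere_def)
  have 1: "\<beta> s \<bullet> \<beta> s = 1" if "s \<in> I" for s
    using \<beta> that by (auto simp: unit_speed_in_sphere_def dot_square_norm)
  show "\<beta> s \<bullet> \<beta> s = 1" using 1 s .
  show "velocity \<beta> s \<bullet> velocity \<beta> s = 1"
    using \<beta> s by (auto simp: unit_speed_in_sphere_def dot_square_norm)
  have d: "\<beta> differentiable (at s)" by (rule smooth_on_differentiable[OF sm s])
  have "dd 1 (\<lambda>s. \<beta> s \<bullet> \<beta> s) s = dd 1 (\<lambda>s. 1) s" by (rule dd_cong[OF I s 1])
  then show "\<beta> s \<bullet> velocity \<beta> s = 0"
    using dd_inner[OF d d, of 1] velocity_eq_dd[OF d] by (simp add: inner_commute)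
qed

lemma tube_in_hyperplanes:
  fixes A :: "('p::{t2_space, second_countable_topology}, real^'m) chart set"
    and N :: "'p \<times> real \<Rightarrow> 'a::euclidean_space"
  assumes A: "smooth_atlas A" and I: "open I" and tube: "ribaucour_partial_tube A I \<beta> N"
  shows "\<exists>C k. \<forall>x\<in>points A. \<forall>s\<in>I. N (x, s) \<bullet> N (x, s) = 1 \<and> C s \<noteq> 0 \<and> N (x, s) \<bullet> C s = k s"
proof -
  obtain \<xi> :: "'m \<Rightarrow> real \<Rightarrow> 'a" and f0 :: "'p \<Rightarrow> real^'m" and \<phi> :: "real \<Rightarrow> real" and \<omega> :: "real \<Rightarrow> 'a" where fr: "parallel_normal_frame I \<beta> \<xi>" and rp: "ribaucour_pair I \<beta> \<phi> \<omega>"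
    and Neq: "\<And>x s. x \<in> points A \<Longrightarrow> s \<in> I \<Longrightarrow> N (x, s) =
       \<beta> s - (2 * \<phi> s / (norm (tube_vector \<beta> \<xi> f0 \<phi> \<omega> x s))\<^sup>2) *\<^sub>R tube_vector \<beta> \<xi> f0 \<phi> \<omega> x s"
    and us: "unit_speed_in_sphere I \<beta>" and im: "immersion (prod_atlas A I) N"
    using tube unfolding ribaucour_partial_tube_def by blast
  \<comment> \<open>The part of \<open>G\<close> in the plane of \<open>\<beta>\<close> and
    \<open>\<beta>'\<close> is \<open>\<phi> \<beta> + \<phi>' \<beta>'\<close>; \<open>C\<close> is
    that vector turned by a right angle, hence orthogonal to \<open>G\<close>, so
    \<open>N \<bullet> C = \<beta> \<bullet> C\<close>.\<close>
  define C where "C s = \<phi> s *\<^sub>R velocity \<beta> s - deriv \<phi> s *\<^sub>R \<beta> s" for s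
  have "N (x, s) \<bullet> N (x, s) = 1 \<and> C s \<noteq> 0 \<and> N (x, s) \<bullet> C s = - deriv \<phi> s" if x: "x \<in> points A" and s: "s \<in> I" for x s
  proof -
    note b = unit_speed_inner[OF I us s]
    have perp: "\<omega> s \<bullet> \<beta> s = 0" "\<omega> s \<bullet> velocity \<beta> s = 0" "\<xi> j s \<bullet> \<beta> s = 0" "\<xi> j s \<bullet> velocity \<beta> s = 0" for j
      using fr rp s by (auto simp: parallel_normal_frame_def ribaucour_pair_def normal_field_def)
    define G where "G = tube_vector \<beta> \<xi> f0 \<phi> \<omega> x s"
    have G1: "G \<bullet> \<beta> s = \<phi> s" "G \<bullet> velocity \<beta> s = deriv \<phi> s"
      using b perp by (simp_all add: G_def tube_vector_def inner_add_left inner_sum_left inner_commute[of "velocity \<beta> s" "\<beta> s"])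
    have "\<phi> s \<noteq> 0"
    proof
      assume 0: "\<phi> s = 0"
      obtain c where c: "c \<in> A" "x \<in> fst c" using x by (auto simp: points_def)
      note ch = smooth_atlas_chart[OF A c(1)]
      let ?p = "prod_chart c I"
      have p: "?p \<in> prod_atlas A I" "(x, s) \<in> fst ?p" using c s by (auto simp: prod_atlas_def prod_chart_simps)
      have "regular_point (prod_atlas A I) N (x, s)"
        using im p by (auto simp: immersion_def points_def)
      then have inj: "inj (differential ?p N (x, s))" using p by (auto simp: regular_point_def)
      have "smooth_on (snd c ` fst c \<times> I) (rep c N)"
        using im smooth_map_prod[OF A I] c by (auto simp: immersion_def)
      then have dN: "rep c N differentiable (at (snd c x, s))" by (rule smooth_on_differentiable) (use c s in auto)
      obtain v :: "real^'m" where v: "v \<noteq> 0" using nonempty_Basis nonzero_Basis by blast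
      have "dd (v, 0) (rep c N) (snd c x, s) = 0"
      proof (rule dd_slice_const[OF dN is_chart_open(2)[OF ch], where k = "\<beta> s"])
        fix z assume "z \<in> snd c ` fst c"
        then have "chart_inv c z \<in> points A" using chart_inv_right[of z c] c(1) unfolding points_def by blast
        then show "rep c N (z, s) = \<beta> s" using Neq[of "chart_inv c z" s] s 0 by simp
      qed (use c in auto)
      moreover have "dd (0, 0) (rep c N) (snd c x, s) = 0"
        using dd_zero_dir[OF dN] by (simp add: zero_prod_def)
      ultimately have "(v, 0) = (0 :: real^'m, 0 :: real)"
        using differential_prod[OF ch I c(2) s, of N] inj by (metis injD)
      then show False using v by simp
    qed
    then have "G \<noteq> 0" using G1 by auto
    then have n: "(norm G)\<^sup>2 \<noteq> 0" "G \<bullet> G = (norm G)\<^sup>2" by (auto simp: dot_square_norm)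
    have NG: "N (x, s) = \<beta> s - (2 * \<phi> s / (norm G)\<^sup>2) *\<^sub>R G" using Neq[OF x s] by (simp add: G_def)
    have "N (x, s) \<bullet> N (x, s) = 1"
      unfolding NG using n G1 b
      by (simp add: inner_diff_left inner_diff_right inner_commute[of "\<beta> s" G] power2_eq_square field_simps)
    moreover have "C s \<bullet> C s = (\<phi> s)\<^sup>2 + (deriv \<phi> s)\<^sup>2"
      using b by (simp add: C_def inner_diff_left inner_diff_right inner_commute[of "velocity \<beta> s" "\<beta> s"] power2_eq_square)
    then have "C s \<noteq> 0" using \<open>\<phi> s \<noteq> 0\<close> by (auto simp: add_nonneg_eq_0_iff)
    moreover have "N (x, s) \<bullet> C s = - deriv \<phi> s"
      unfolding NG C_def using b G1 by (simp add: inner_diff_left inner_diff_right inner_commute[of "velocity \<beta> s" "\<beta> s"] algebra_simps)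
    ultimately show ?thesis by blast
  qed
  then show ?thesis by (intro exI[of _ C] exI[of _ "\<lambda>s. - deriv \<phi> s"]) blast
qed

text \<open>\<open>\<gamma> / v0\<close> is \<open>U\<close> plus an integral whose
  \<open>s\<close>-derivative is its integrand \<open>V \<nu> / v0\<close>. This linear equation is
  the form in which the direct part uses the formula for \<open>\<gamma>\<close>.\<close>

lemma gamma_fun_smooth:
  fixes A :: "('p::{t2_space, second_countable_topology}, 'v::euclidean_space) chart set"
  assumes A: "smooth_atlas A" and I: "open I" "is_interval I" "0 \<in> I"
    and v0: "smooth_map (prod_atlas A I) v0" "\<And>x s. x \<in> points A \<Longrightarrow> s \<in> I \<Longrightarrow> v0 (x, s) > 0"
    and \<nu>: "smooth_map (prod_atlas A I) \<nu>" and V: "smooth_on I V" and U: "smooth_map A U"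
  shows "smooth_map (prod_atlas A I) (gamma_fun v0 \<nu> U V)"
    "\<And>c p. c \<in> A \<Longrightarrow> p \<in> snd c ` fst c \<times> I \<Longrightarrow> dd (0, 1) (rep c (gamma_fun v0 \<nu> U V)) p =
      dd (0, 1) (rep c v0) p / rep c v0 p * rep c (gamma_fun v0 \<nu> U V) p + V (snd p) * rep c \<nu> p"
proof -
  have main: "smooth_on (snd c ` fst c \<times> I) (rep c (gamma_fun v0 \<nu> U V)) \<and>
    (\<forall>p\<in>snd c ` fst c \<times> I. dd (0, 1) (rep c (gamma_fun v0 \<nu> U V)) p =
      dd (0, 1) (rep c v0) p / rep c v0 p * rep c (gamma_fun v0 \<nu> U V) p + V (snd p) * rep c \<nu> p)" if c: "c \<in> A" for c
  proof -
    let ?D = "snd c ` fst c" and ?\<gamma> = "rep c (gamma_fun v0 \<nu> U V)"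
    note ch = smooth_atlas_chart[OF A c]
    have D: "open ?D" by (rule is_chart_open(2)[OF ch])
    have S: "open (?D \<times> I)" using D I by (simp add: open_Times)
    have sv: "smooth_on (?D \<times> I) (rep c v0)" "smooth_on (?D \<times> I) (rep c \<nu>)"
      using v0(1) \<nu> c smooth_map_prod[OF A I(1)] by auto
    have vp: "rep c v0 p > 0" if "p \<in> ?D \<times> I" for p
    proof -
      have "chart_inv c (fst p) \<in> fst c" using chart_inv_right[of "fst p" c] that by auto
      then have "chart_inv c (fst p) \<in> points A" using c by (auto simp: points_def)
      then show ?thesis using v0(2) that by auto
    qed
    define h where "h p = V (snd p) * rep c \<nu> p / rep c v0 p" for p
    have hsm: "smooth_on (?D \<times> I) h" unfolding h_def[abs_def]
      by (intro smooth_intros S sv smooth_on_comp_snd[OF D I(1) V]) (use vp in force)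
    define L where "L p = (LBINT \<tau>=0..ereal (snd p). h (fst p, \<tau>))" for p
    note L = partial_integral[OF D I hsm, folded L_def]
    have Lsm: "smooth_on (?D \<times> I) L" using L(1) by (simp add: L_def[abs_def])
    have dL: "dd (0, 1) L p = h p" if "p \<in> ?D \<times> I" for p
      using L(2)[of "fst p" "snd p"] that by (auto simp: L_def[abs_def])
    have Usm: "smooth_on ?D (U \<circ> chart_inv c)" using U c by (auto simp: smooth_map_def)
    have Us: "smooth_on (?D \<times> I) (\<lambda>p. (U \<circ> chart_inv c) (fst p))" by (rule smooth_on_comp_fst[OF D I(1) Usm])
    have eq: "?\<gamma> = (\<lambda>p. rep c v0 p * ((U \<circ> chart_inv c) (fst p) + L p))"
      by (auto simp: gamma_fun_def L_def h_def)
    have sm: "smooth_on (?D \<times> I) ?\<gamma>" unfolding eq by (intro smooth_intros S sv Us Lsm)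
    have "dd (0, 1) ?\<gamma> p = dd (0, 1) (rep c v0) p / rep c v0 p * ?\<gamma> p + V (snd p) * rep c \<nu> p"
      if p: "p \<in> ?D \<times> I" for p
    proof -
      note d = smooth_on_differentiable[OF _ p]
      have dU: "dd (0, 1) (\<lambda>p. (U \<circ> chart_inv c) (fst p)) p = 0"
      proof -
        have d: "(U \<circ> chart_inv c) differentiable (at (fst p))" using smooth_on_differentiable[OF Usm] p by auto
        show ?thesis using dd_fst[OF d] dd_zero_dir[OF d] by simp
      qed
      have ds: "(\<lambda>p. (U \<circ> chart_inv c) (fst p) + L p) differentiable (at p)"
        by (rule d) (intro smooth_intros S Us Lsm)
      have "dd (0, 1) ?\<gamma> p = rep c v0 p * h p + dd (0, 1) (rep c v0) p * ((U \<circ> chart_inv c) (fst p) + L p)"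
        unfolding eq using dd_mult[OF d[OF sv(1)] ds, of "(0, 1)"] dd_add[OF d[OF Us] d[OF Lsm], of "(0, 1)"] dU dL[OF p]
        by simp
      then show ?thesis using vp[OF p] fun_cong[OF eq, of p] by (simp add: h_def)
    qed
    with sm show ?thesis by blast
  qed
  then show "smooth_map (prod_atlas A I) (gamma_fun v0 \<nu> U V)" using smooth_map_prod[OF A I(1)] by blast
  show "dd (0, 1) (rep c (gamma_fun v0 \<nu> U V)) p =
      dd (0, 1) (rep c v0) p / rep c v0 p * rep c (gamma_fun v0 \<nu> U V) p + V (snd p) * rep c \<nu> p"
    if "c \<in> A" "p \<in> snd c ` fst c \<times> I" for c p
    using main[OF that(1)] that(2) by blast
qed

lemma tube_hypersurface:
  fixes A :: "('p::{t2_space, second_countable_topology}, real^'m) chart set" and N :: "'p \<times> real \<Rightarrow> real^'k"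
  assumes dim: "CARD('k) = CARD('m) + 2"
    and A: "smooth_atlas A" "connected (points A)"
    and I: "open I" "is_interval I" "0 \<in> I"
    and tube: "ribaucour_partial_tube A I \<beta> N" and md: "metric_decomposition A I N g0 v0 \<nu>"
    and V: "smooth_on I V" and U: "smooth_map A U"
    and \<gamma>_def: "\<gamma> = gamma_fun v0 \<nu> U V"
    and f_def: "f = gauss_parametrization (prod_atlas A I) N \<gamma>"
    and R_def: "R = {p \<in> points (prod_atlas A I). regular_point (prod_atlas A I) f p}"
  shows "smooth_map (prod_atlas A I) \<gamma> \<and> smooth_map (prod_atlas A I) f \<and> open R \<and>
        immersion (restrict_atlas (prod_atlas A I) R) f \<and>
        net_orthogonal (restrict_atlas (prod_atlas A I) R) f \<and>
        second_form_adapted (restrict_atlas (prod_atlas A I) R) f \<and>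
        leaves_in_hyperplanes (restrict_atlas (prod_atlas A I) R) f"
proof -
  let ?B = "prod_atlas A I"
  note B = prod_smooth_atlas[OF A(1) I(1)]
  have imN: "immersion ?B N" using tube by (simp add: ribaucour_partial_tube_def)
  obtain C k where Ck: "\<And>x s. x \<in> points A \<Longrightarrow> s \<in> I \<Longrightarrow> N (x, s) \<bullet> N (x, s) = 1"
    "\<And>x s. x \<in> points A \<Longrightarrow> s \<in> I \<Longrightarrow> C s \<noteq> 0" "\<And>x s. x \<in> points A \<Longrightarrow> s \<in> I \<Longrightarrow> N (x, s) \<bullet> C s = k s"
    using tube_in_hyperplanes[OF A(1) I(1) tube] by blast
  have md': "smooth_map ?B v0" "smooth_map ?B \<nu>" "\<And>x s. x \<in> points A \<Longrightarrow> s \<in> I \<Longrightarrow> v0 (x, s) > 0"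
    "\<And>x s. x \<in> points A \<Longrightarrow> s \<in> I \<Longrightarrow> \<nu> (x, s) > 0" "riemannian_metric A g0"
    and metric: "\<And>c x s u v a b. c \<in> A \<Longrightarrow> x \<in> fst c \<Longrightarrow> s \<in> I \<Longrightarrow>
        differential (prod_chart c I) N (x, s) (u, a) \<bullet> differential (prod_chart c I) N (x, s) (v, b) =
          (v0 (x, s))\<^sup>2 * g0 c x u v + (\<nu> (x, s))\<^sup>2 * (a * b)"
    using md by (auto simp: metric_decomposition_def induced_metric_def)
  have gam1: "smooth_map ?B \<gamma>"
    unfolding \<gamma>_def by (rule gamma_fun_smooth(1)[OF A(1) I md'(1) _ md'(2) V U]) (rule md'(3))
  have gam2: "dd (0, 1) (rep c \<gamma>) p = dd (0, 1) (rep c v0) p / rep c v0 p * rep c \<gamma> p + V (snd p) * rep c \<nu> p"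
    if "c \<in> A" "p \<in> snd c ` fst c \<times> I" for c p
    unfolding \<gamma>_def by (rule gamma_fun_smooth(2)[OF A(1) I md'(1) _ md'(2) V U]) (use md'(3) that in auto)
  note par = gauss_parametrization_smooth[OF B imN _ gam1, folded f_def]
  have N1: "N p \<bullet> N p = 1" if "p \<in> points ?B" for p using that Ck(1) by (auto simp: points_prod)
  have fsm: "smooth_map ?B f" using par(1) N1 by blast
  have fN: "f p \<bullet> N p = \<gamma> p" if "c \<in> ?B" "p \<in> fst c" for c p using par(2) N1 that by blast
  have fw: "f p \<bullet> differential c N p w = differential c \<gamma> p w" if "c \<in> ?B" "p \<in> fst c" for c p w
    using par(3) N1 that by blast
  have R: "open R" unfolding R_def by (rule open_regular_set[OF B fsm])
  \<comment> \<open>The local statement holds at every point of the product; regularity enters only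
    in the second line, where the tangent space must be a hyperplane.\<close>
  have loc: "dd (u, 0) (rep c f) (z, s) \<bullet> dd (0, a) (rep c f) (z, s) = 0"
    "inj (\<lambda>w. dd w (rep c f) (z, s)) \<Longrightarrow> dd (u, 0) (dd (0, a) (rep c f)) (z, s) \<in> range (\<lambda>w. dd w (rep c f) (z, s))"
    "dd (u, 0) (rep c f) (z, s) \<bullet> C s = 0"
    if c: "c \<in> A" and zs: "z \<in> snd c ` fst c" "s \<in> I" for c z s u a
  proof -
    let ?D = "snd c ` fst c"
    note ch = smooth_atlas_chart[OF A(1) c]
    have D: "open ?D" by (rule is_chart_open(2)[OF ch])
    have sm: "smooth_on (?D \<times> I) (rep c F)" if "smooth_map ?B F" for F :: "_ \<Rightarrow> 'x::real_normed_vector"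
      using that smooth_map_prod[OF A(1) I(1)] c by blast
    have Nsm: "smooth_map ?B N" using imN by (simp add: immersion_def)
    have inv: "chart_inv c z \<in> fst c" "snd c (chart_inv c z) = z" "chart_inv c z \<in> points A" if "z \<in> ?D" for z
      using chart_inv_right[OF that] c by (auto simp: points_def)
    have pc: "prod_chart c I \<in> ?B" using c by (simp add: prod_atlas_def)
    have dp: "differential (prod_chart c I) F (chart_inv c z, s) w = dd w (rep c F) (z, s)" if "z \<in> ?D" "s \<in> I"
      for F :: "_ \<Rightarrow> 'x::real_normed_vector" and z s w
      using differential_prod[OF ch I(1) inv(1)[OF that(1)] that(2), of F w] inv(2)[OF that(1)] by simp
    define h where "h z u v = g0 c (chart_inv c z) u v" for z u v
    have rm: "bilinear (g0 c (chart_inv c z))" "u \<noteq> 0 \<Longrightarrow> g0 c (chart_inv c z) u u > 0" if "z \<in> ?D" for z u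
      using md'(5) c inv(1)[OF that] unfolding riemannian_metric_def by blast+
    have h: "smooth_on ?D (\<lambda>z. h z u v)" for u v
      using md'(5) c unfolding riemannian_metric_def h_def by blast
    have h0: "h z u 0 = 0" "h z 0 u = 0" "u \<noteq> 0 \<Longrightarrow> h z u u > 0" if "z \<in> ?D" for z u
      using rm[OF that] unfolding h_def by (auto simp: bilinear_lzero bilinear_rzero)
    have dim': "DIM(real^'k) = DIM(real^'m) + 2" using dim by simp
    note main = tube_hypersurface_local[OF dim' D I(1) sm[OF Nsm] sm[OF gam1] sm[OF md'(1)] sm[OF md'(2)] sm[OF fsm] V h,
        where C = C and k = k]
    have p1: "rep c v0 p > 0" "rep c \<nu> p > 0" "rep c N p \<bullet> rep c N p = 1" "rep c f p \<bullet> rep c N p = rep c \<gamma> p"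
      "rep c f p \<bullet> dd w (rep c N) p = dd w (rep c \<gamma>) p" if "p \<in> ?D \<times> I" for p w
    proof -
      have zs: "fst p \<in> ?D" "snd p \<in> I" using that by auto
      note i = inv[OF zs(1)]
      have q: "(chart_inv c (fst p), snd p) \<in> fst (prod_chart c I)" using i zs by (simp add: prod_chart_simps)
      show "rep c v0 p > 0" "rep c \<nu> p > 0" "rep c N p \<bullet> rep c N p = 1"
        using md'(3,4)[OF i(3) zs(2)] Ck(1)[OF i(3) zs(2)] by auto
      show "rep c f p \<bullet> rep c N p = rep c \<gamma> p" using fN[OF pc q] .
      show "rep c f p \<bullet> dd w (rep c N) p = dd w (rep c \<gamma>) p"
        using fw[OF pc q, of w] dp[OF zs, of N w] dp[OF zs, of \<gamma> w] by simp
    qed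
    have p2: "dd (u, a) (rep c N) (z, s) \<bullet> dd (v, b) (rep c N) (z, s)
        = (rep c v0 (z, s))\<^sup>2 * h z u v + (rep c \<nu> (z, s))\<^sup>2 * (a * b)" if "z \<in> ?D" "s \<in> I" for z s u v a b
      using metric[OF c inv(1)[OF that(1)] that(2), of u a v b] by (simp add: dp[OF that] h_def)
    have p3: "C s \<noteq> 0" if "s \<in> I" for s using Ck(2)[OF inv(3)[OF zs(1)] that] .
    have p4: "rep c N (z, s) \<bullet> C s = k s" if "z \<in> ?D" "s \<in> I" for z s
      using Ck(3)[OF inv(3)[OF that(1)] that(2)] by simp
    note res = main[OF p1(1,2) h0 p2 p1(3) p3 p4 gam2[OF c] p1(4,5) zs]
    show "dd (u, 0) (rep c f) (z, s) \<bullet> dd (0, a) (rep c f) (z, s) = 0" by (rule res(1))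
    show "inj (\<lambda>w. dd w (rep c f) (z, s)) \<Longrightarrow> dd (u, 0) (dd (0, a) (rep c f)) (z, s) \<in> range (\<lambda>w. dd w (rep c f) (z, s))"
      by (rule res(2))
    show "dd (u, 0) (rep c f) (z, s) \<bullet> C s = 0" by (rule res(3))
  qed
  note RB = restrict_smooth_atlas[OF B R]
  have rf: "smooth_map (restrict_atlas ?B R) f" by (rule restrict_smooth_mapI[OF B R fsm])
  have rchart: "\<exists>c\<in>A. d = (fst (prod_chart c I) \<inter> R, snd (prod_chart c I)) \<and> prod_chart c I \<in> ?B"
    if "d \<in> restrict_atlas ?B R" for d
    using that by (auto simp: restrict_atlas_def prod_atlas_def)
  have rd: "differential (fst (prod_chart c I) \<inter> R, snd (prod_chart c I)) f p = differential (prod_chart c I) f p"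
    if "c \<in> A" "p \<in> fst (prod_chart c I) \<inter> R" for c p
    by (rule restrict_differential[OF prod_is_chart[OF smooth_atlas_chart[OF A(1) that(1)] I(1)] R that(2)])
  have reg: "inj (differential (prod_chart c I) f p)" if "c \<in> A" "p \<in> fst (prod_chart c I) \<inter> R" for c p
    using that by (auto simp: R_def regular_point_def prod_atlas_def)
  have 1: "immersion (restrict_atlas ?B R) f"
    unfolding immersion_def
  proof (intro conjI ballI rf)
    fix p assume "p \<in> points (restrict_atlas ?B R)"
    then obtain d where d: "d \<in> restrict_atlas ?B R" "p \<in> fst d" by (auto simp: points_def)
    then obtain c where c: "c \<in> A" "d = (fst (prod_chart c I) \<inter> R, snd (prod_chart c I))" using rchart by blast
    have p: "p \<in> fst (prod_chart c I) \<inter> R" using d(2) c(2) by simp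
    show "regular_point (restrict_atlas ?B R) f p"
      using regular_point_chart[OF RB d rf] reg[OF c(1) p] rd[OF c(1) p] by (simp add: c(2))
  qed
  have 2: "net_orthogonal (restrict_atlas ?B R) f"
    unfolding net_orthogonal_def
  proof (intro ballI)
    fix d p and X0 X1 :: "(real^'m) \<times> real"
    assume d: "d \<in> restrict_atlas ?B R" "p \<in> fst d" and X: "X0 \<in> E0" "X1 \<in> E1"
    then obtain c where c: "c \<in> A" "d = (fst (prod_chart c I) \<inter> R, snd (prod_chart c I))" using rchart by blast
    have p: "p \<in> fst (prod_chart c I) \<inter> R" using d(2) c(2) by simp
    obtain x s where xs: "p = (x, s)" "x \<in> fst c" "s \<in> I" using p by (auto simp: prod_chart_simps)
    note ch = smooth_atlas_chart[OF A(1) c(1)]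
    have "differential d f p w = dd w (rep c f) (snd c x, s)" for w
      unfolding c(2) rd[OF c(1) p] unfolding xs(1) by (rule differential_prod[OF ch I(1) xs(2,3)])
    then show "induced_metric f d p X0 X1 = 0"
      using loc(1)[OF c(1) _ xs(3), of "snd c x" "fst X0" "snd X1"] xs(2) X
      by (auto simp: induced_metric_def E0_def E1_def)
  qed
  have 3: "second_form_adapted (restrict_atlas ?B R) f"
    unfolding second_form_adapted_def
  proof (intro ballI)
    fix d p and X0 X1 :: "(real^'m) \<times> real"
    assume d: "d \<in> restrict_atlas ?B R" "p \<in> fst d" and X: "X0 \<in> E0" "X1 \<in> E1"
    then obtain c where c: "c \<in> A" "d = (fst (prod_chart c I) \<inter> R, snd (prod_chart c I))" using rchart by blast
    have p: "p \<in> fst (prod_chart c I) \<inter> R" using d(2) c(2) by simp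
    obtain x s where xs: "p = (x, s)" "x \<in> fst c" "s \<in> I" using p by (auto simp: prod_chart_simps)
    note ch = smooth_atlas_chart[OF A(1) c(1)]
    note pch = prod_is_chart[OF ch I(1)]
    have eq: "(f \<circ> chart_inv d) q = rep c f q" if "q \<in> snd d ` fst d" for q
    proof -
      have "(f \<circ> chart_inv d) q = (f \<circ> chart_inv (prod_chart c I)) q"
        using restrict_rep(2)[OF pch R] that unfolding c(2) by simp
      also have "\<dots> = rep c f q"
        by (rule prod_rep(2)[OF ch I(1)]) (use that in \<open>auto simp: c(2) prod_chart_simps\<close>)
      finally show ?thesis .
    qed
    have od: "open (snd d ` fst d)" "snd d p \<in> snd d ` fst d"
      using is_chart_open(2)[OF smooth_atlas_chart[OF RB d(1)]] d(2) by auto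
    have sp: "snd d p = (snd c x, s)" by (simp add: c(2) xs(1) prod_chart_simps)
    have "differential d (\<lambda>y. differential d f y X1) p X0 = dd X0 (dd X1 (f \<circ> chart_inv d)) (snd d p)"
      by (rule second_differential_eq_dd[OF smooth_atlas_chart[OF RB d(1)] d(2)])
    also have "\<dots> = dd X0 (dd X1 (rep c f)) (snd c x, s)" unfolding sp[symmetric] by (rule dd2_cong[OF od eq])
    finally have w: "differential d (\<lambda>y. differential d f y X1) p X0 = dd X0 (dd X1 (rep c f)) (snd c x, s)" .
    have D: "differential d f p = (\<lambda>w. dd w (rep c f) (snd c x, s))"
      unfolding c(2) rd[OF c(1) p] unfolding xs(1) using differential_prod[OF ch I(1) xs(2,3)] by blast
    have "inj (\<lambda>w. dd w (rep c f) (snd c x, s))" using reg[OF c(1) p] D rd[OF c(1) p] c(2) by simp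
    then have "dd X0 (dd X1 (rep c f)) (snd c x, s) \<in> range (\<lambda>w. dd w (rep c f) (snd c x, s))"
      using loc(2)[OF c(1) _ xs(3), of "snd c x" "fst X0" "snd X1"] xs(2) X by (auto simp: E0_def E1_def)
    then show "second_fundamental_form f d p X0 X1 = 0"
      unfolding second_fundamental_form_def Let_def w D by (simp add: closest_point_self)
  qed
  have 4: "leaves_in_hyperplanes (restrict_atlas ?B R) f"
    unfolding leaves_in_hyperplanes_def
  proof
    fix s
    show "\<exists>a b. a \<noteq> 0 \<and> f ` (points (restrict_atlas ?B R) \<inter> UNIV \<times> {s}) \<subseteq> {y. a \<bullet> y = b}"
    proof (cases "s \<in> I \<and> points A \<noteq> {}")
      case False
      \<comment> \<open>Empty leaf: any hyperplane will do.\<close>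
      obtain a :: "real^'k" where "a \<noteq> 0" using nonempty_Basis nonzero_Basis by blast
      moreover have "points (restrict_atlas ?B R) \<inter> UNIV \<times> {s} = {}" using False by (auto simp: points_restrict points_prod)
      ultimately show ?thesis by (intro exI[of _ a]) auto
    next
      case True
      then obtain x0 where s: "s \<in> I" and x0: "x0 \<in> points A" by auto
      \<comment> \<open>Considered on all of \<open>points A\<close> and not only on the regular
        part of the leaf: the latter may be disconnected, while \<open>points A\<close> is
        connected.\<close>
      let ?F = "\<lambda>x. f (x, s) \<bullet> C s"
      have Fc: "smooth_on (snd c ` fst c) (?F \<circ> chart_inv c)" and F0: "\<And>x u. x \<in> fst c \<Longrightarrow> differential c ?F x u = 0"
        if c: "c \<in> A" for c
      proof -
        note ch = smooth_atlas_chart[OF A(1) c] and D = is_chart_open(2)[OF smooth_atlas_chart[OF A(1) c]]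
        have fs: "smooth_on (snd c ` fst c \<times> I) (rep c f)" using fsm smooth_map_prod[OF A(1) I(1)] c by blast
        have "smooth_on (snd c ` fst c) (\<lambda>z. rep c f (z, s))" by (rule smooth_on_slice[OF D I(1) s fs])
        from smooth_on_inner[OF D this smooth_on_const[of _ "C s"]]
        show "smooth_on (snd c ` fst c) (?F \<circ> chart_inv c)" by (simp add: o_def)
        fix x u assume x: "x \<in> fst c"
        have df: "rep c f differentiable (at (snd c x, s))" by (rule smooth_on_differentiable[OF fs]) (use x s in auto)
        have "differential c ?F x u = dd u (\<lambda>z. rep c f (z, s) \<bullet> C s) (snd c x)" by (simp add: differential_eq_dd o_def)
        also have "\<dots> = dd u (\<lambda>z. rep c f (z, s)) (snd c x) \<bullet> C s"
          by (rule dd_linear[OF bounded_linear_inner_left dd_slice(2)[OF df]])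
        also have "\<dots> = 0" using dd_slice(1)[OF df, of u] loc(3)[OF c _ s, of "snd c x" u] x by simp
        finally show "differential c ?F x u = 0" .
      qed
      have "smooth_map A ?F" using Fc by (auto simp: smooth_map_def)
      then have const: "?F x = ?F x0" if "x \<in> points A" for x
        using zero_differential_constant[OF A _ F0 that x0] by blast
      then show ?thesis using Ck(2)[OF x0 s]
        by (intro exI[of _ "C s"] exI[of _ "?F x0"]) (auto simp: points_restrict points_prod inner_commute)
    qed
  qed
  show ?thesis using gam1 fsm R 1 2 3 4 by blast
qed

subsection \<open>Curvature, unit normals and global charts\<close>

text \<open>Adjoining \<open>n2\<close> as one more image direction reduces this to codimension
  one.\<close>

lemma range_eq_codim2:
  fixes L :: "'a::euclidean_space \<Rightarrow> 'b::euclidean_space"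
  assumes L: "linear L" "inj L" and dim: "DIM('b) = DIM('a) + 2"
    and n: "n1 \<noteq> 0" "n2 \<noteq> 0" "n1 \<bullet> n2 = 0" "\<And>v. n1 \<bullet> L v = 0" "\<And>v. n2 \<bullet> L v = 0"
    and y: "n1 \<bullet> y = 0" "n2 \<bullet> y = 0"
  shows "y \<in> range L"
proof -
  define M where "M p = L (fst p) + snd p *\<^sub>R n2" for p
  have linM: "linear M"
    by (rule linearI) (auto simp: M_def linear_add[OF L(1)] linear_scale[OF L(1)] algebra_simps)
  have n2M: "n2 \<bullet> M p = snd p * (n2 \<bullet> n2)" for p using n(5) by (simp add: M_def inner_add_right)
  have "inj M"
    unfolding linear_injective_0[OF linM]
  proof (intro allI impI)
    fix p assume "M p = 0"
    then have "snd p = 0" using n2M[of p] n(2) by simp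
    then have "L (fst p) = 0" using \<open>M p = 0\<close> by (simp add: M_def)
    then show "p = 0" using \<open>snd p = 0\<close> linear_injective_0[OF L(1)] L(2) by (metis prod_eq_iff fst_zero snd_zero)
  qed
  then have "range M = {y. n1 \<bullet> y = 0}"
    by (rule range_eq_hyperplane[OF linM]) (use dim n in \<open>auto simp: M_def inner_add_right\<close>)
  then obtain p where p: "y = M p" using y(1) by blast
  then have "snd p = 0" using n2M[of p] n(2) y(2) by simp
  then show ?thesis using p by (simp add: M_def)
qed

text \<open>Product rule for \<open>d\<tau>(X)\<close>: expanding \<open>X\<close> in the constant
  basis separates the derivative of the field from the derivative with the field frozen at
  \<open>z\<close>.\<close>

lemma dd_along_field:
  fixes \<tau> :: "'a::euclidean_space \<Rightarrow> 'b::euclidean_space"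
  assumes D: "open D" "z \<in> D" and \<tau>: "smooth_on D \<tau>" and X: "smooth_on D X"
  shows "dd u (\<lambda>z. dd (X z) \<tau> z) z = dd (dd u X z) \<tau> z + dd u (dd (X z) \<tau>) z"
proof -
  note d\<tau> = smooth_on_differentiable[OF \<tau>] and dX = smooth_on_differentiable[OF X D(2)]
  have dd\<tau>: "dd b \<tau> differentiable (at z)" for b by (rule smooth_on_differentiable[OF smooth_on_dd[OF \<tau>] D(2)])
  have sum: "dd u (\<lambda>z. \<Sum>b\<in>Basis. (Y z \<bullet> b) *\<^sub>R dd b \<tau> z) z =
     (\<Sum>b\<in>Basis. (Y z \<bullet> b) *\<^sub>R dd u (dd b \<tau>) z + (dd u Y z \<bullet> b) *\<^sub>R dd b \<tau> z)"
    if Y: "Y differentiable (at z)" for Y :: "'a \<Rightarrow> 'a"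
  proof (rule dd_eq)
    have "((\<lambda>z. (Y z \<bullet> b) *\<^sub>R dd b \<tau> z) has_derivative
        (\<lambda>u. (Y z \<bullet> b) *\<^sub>R dd u (dd b \<tau>) z + (dd u Y z \<bullet> b) *\<^sub>R dd b \<tau> z)) (at z)" for b
      by (rule bounded_bilinear.FDERIV[OF bounded_bilinear_scaleR
          bounded_linear.has_derivative[OF bounded_linear_inner_left dd_has_derivative[OF Y]] dd_has_derivative[OF dd\<tau>]])
    then show "((\<lambda>z. \<Sum>b\<in>Basis. (Y z \<bullet> b) *\<^sub>R dd b \<tau> z) has_derivative
        (\<lambda>u. \<Sum>b\<in>Basis. (Y z \<bullet> b) *\<^sub>R dd u (dd b \<tau>) z + (dd u Y z \<bullet> b) *\<^sub>R dd b \<tau> z)) (at z)"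
      by (intro has_derivative_sum)
  qed
  have "dd u (\<lambda>z. dd (X z) \<tau> z) z = dd u (\<lambda>z. \<Sum>b\<in>Basis. (X z \<bullet> b) *\<^sub>R dd b \<tau> z) z"
    by (rule dd_cong[OF D]) (rule dd_basis[OF d\<tau>])
  moreover have "dd u (dd (X z) \<tau>) z = dd u (\<lambda>y. \<Sum>b\<in>Basis. (X z \<bullet> b) *\<^sub>R dd b \<tau> y) z"
    by (rule dd_cong[OF D]) (rule dd_basis[OF d\<tau>])
  moreover have "dd (dd u X z) \<tau> z = (\<Sum>b\<in>Basis. (dd u X z \<bullet> b) *\<^sub>R dd b \<tau> z)"
    by (rule dd_basis[OF d\<tau>[OF D(2)]])
  ultimately show ?thesis
    using sum[OF dX] sum[of "\<lambda>_. X z"] by (simp add: sum.distrib)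
qed

text \<open>The curvature is read off by differentiating the Gauss formula
  \<open>d\<tau>(\<Gamma>(a, b)) = \<partial>\<^sub>a \<partial>\<^sub>b \<tau> + (\<partial>\<^sub>a \<tau> \<bullet> \<partial>\<^sub>b \<tau>) \<tau>\<close> for \<open>\<tau> = \<sigma> \<circ> c\<^sup>-\<^sup>1\<close> once more.\<close>

lemma curvature_sphere:
  fixes \<sigma> :: "'q::topological_space \<Rightarrow> 'b::euclidean_space" and c :: "('q, 'v::euclidean_space) chart"
  assumes ch: "is_chart c" and dim: "DIM('b) = DIM('v) + 2"
    and sm: "smooth_on (snd c ` fst c) (\<sigma> \<circ> chart_inv c)"
    and inj: "\<And>x. x \<in> fst c \<Longrightarrow> inj (differential c \<sigma> x)"
    and sph: "\<And>x. x \<in> fst c \<Longrightarrow> \<sigma> x \<bullet> \<sigma> x = 1"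
    and hyp: "e \<noteq> 0" "\<And>x. x \<in> fst c \<Longrightarrow> \<sigma> x \<bullet> e = 0"
    and x: "x \<in> fst c" and uv: "u \<noteq> v" "independent {u, v}"
  shows "sectional_curvature (induced_metric \<sigma>) c x u v = 1"
proof -
  define \<tau> where "\<tau> = \<sigma> \<circ> chart_inv c"
  let ?D = "snd c ` fst c"
  have D: "open ?D" by (rule is_chart_open(2)[OF ch])
  have t: "smooth_on ?D \<tau>" using sm by (simp add: \<tau>_def)
  have inv: "chart_inv c z \<in> fst c" "snd c (chart_inv c z) = z" if "z \<in> ?D" for z using chart_inv_right[OF that] by auto
  have g: "induced_metric \<sigma> c y u v = dd u \<tau> (snd c y) \<bullet> dd v \<tau> (snd c y)" for y u v
    by (simp add: induced_metric_def differential_eq_dd \<tau>_def)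
  have injt: "inj (\<lambda>w. dd w \<tau> z)" if z: "z \<in> ?D" for z
    using inj[OF inv(1)[OF z]] by (simp add: differential_eq_dd[abs_def] inv(2)[OF z] \<tau>_def)
  have t1: "\<tau> z \<bullet> \<tau> z = 1" "\<tau> z \<bullet> e = 0" if "z \<in> ?D" for z using sph hyp(2) inv(1)[OF that] by (auto simp: \<tau>_def)
  note d = smooth_on_differentiable
  have d1: "\<tau> differentiable (at z)" "dd a \<tau> differentiable (at z)" "dd a (dd b \<tau>) differentiable (at z)" if "z \<in> ?D" for a b z
    using d[OF t that] d[OF smooth_on_dd[OF t] that] d[OF smooth_on_dd[OF smooth_on_dd[OF t]] that] by auto
  have tw: "\<tau> z \<bullet> dd w \<tau> z = 0" "e \<bullet> dd w \<tau> z = 0" if z: "z \<in> ?D" for z w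
  proof -
    have "dd w (\<lambda>z. \<tau> z \<bullet> \<tau> z) z = dd w (\<lambda>z. 1) z" by (rule dd_cong[OF D z t1(1)])
    then show "\<tau> z \<bullet> dd w \<tau> z = 0" using dd_inner[OF d1(1)[OF z] d1(1)[OF z], of w] by (simp add: inner_commute)
    have "dd w (\<lambda>z. \<tau> z \<bullet> e) z = dd w (\<lambda>z. 0) z" by (rule dd_cong[OF D z t1(2)])
    then show "e \<bullet> dd w \<tau> z = 0" using dd_linear[OF bounded_linear_inner_left d1(1)[OF z], of w] by (simp add: inner_commute)
  qed
  have tww: "\<tau> z \<bullet> dd a (dd b \<tau>) z = - (dd a \<tau> z \<bullet> dd b \<tau> z)" "e \<bullet> dd a (dd b \<tau>) z = 0" if z: "z \<in> ?D" for z a b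
  proof -
    have "dd a (\<lambda>z. \<tau> z \<bullet> dd b \<tau> z) z = dd a (\<lambda>z. 0) z" by (rule dd_cong[OF D z tw(1)])
    then show "\<tau> z \<bullet> dd a (dd b \<tau>) z = - (dd a \<tau> z \<bullet> dd b \<tau> z)" using dd_inner[OF d1(1,2)[OF z], of a] by simp
    have "dd a (\<lambda>z. e \<bullet> dd b \<tau> z) z = dd a (\<lambda>z. 0) z" by (rule dd_cong[OF D z tw(2)])
    then show "e \<bullet> dd a (dd b \<tau>) z = 0" using dd_linear[OF bounded_linear_inner_right d1(2)[OF z], of a] by simp
  qed
  obtain E where E: "\<And>b. b \<in> Basis \<Longrightarrow> smooth_on ?D (E b)"
    "\<And>b z. b \<in> Basis \<Longrightarrow> z \<in> ?D \<Longrightarrow> E b z \<in> range (\<lambda>v. dd v \<tau> z)"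
    "\<And>b z v. b \<in> Basis \<Longrightarrow> z \<in> ?D \<Longrightarrow> E b z \<bullet> dd v \<tau> z = v \<bullet> b"
    using immersion_dual_frame[OF D t injt] by blast
  \<comment> \<open>Coordinates of the tangential part of
    \<open>\<partial>\<^sub>a \<partial>\<^sub>b \<tau>\<close>; \<open>LC\<close> below identifies
    them with the Christoffel symbols.\<close>
  define \<Gamma> where "\<Gamma> a b z = (\<Sum>i\<in>Basis. (E i z \<bullet> dd a (dd b \<tau>) z) *\<^sub>R i)" for a b z
  have Gs: "smooth_on ?D (\<Gamma> a b)" for a b unfolding \<Gamma>_def[abs_def] by (intro smooth_intros D E(1) t)
  have Gt: "dd (\<Gamma> a b z) \<tau> z = dd a (dd b \<tau>) z + (dd a \<tau> z \<bullet> dd b \<tau> z) *\<^sub>R \<tau> z" if z: "z \<in> ?D" for a b z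
  proof -
    let ?Z = "dd a (dd b \<tau>) z + (dd a \<tau> z \<bullet> dd b \<tau> z) *\<^sub>R \<tau> z"
    \<comment> \<open>The second derivative is orthogonal to \<open>e\<close>, and adding
      \<open>(\<partial>\<^sub>a \<tau> \<bullet> \<partial>\<^sub>b \<tau>) \<tau>\<close> removes
      its \<open>\<tau>\<close>-component; what is left is tangent by dimension.\<close>
    have Z: "?Z \<in> range (\<lambda>v. dd v \<tau> z)"
    proof (rule range_eq_codim2[OF linear_dd[OF d1(1)[OF z]] injt[OF z] dim, of "\<tau> z" e])
      show "\<tau> z \<noteq> 0" using t1(1)[OF z] by auto
    qed (use t1[OF z] tw[OF z] tww[OF z] hyp(1) in \<open>auto simp: inner_add_right inner_commute[of e "\<tau> z"]\<close>)
    have Et: "E i z \<bullet> \<tau> z = 0" if "i \<in> Basis" for i using E(2)[OF that z] tw(1)[OF z] by (auto simp: inner_commute)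
    have "?Z = dd (\<Sum>i\<in>Basis. (E i z \<bullet> ?Z) *\<^sub>R i) \<tau> z"
      by (rule range_dd_recover[OF d1(1)[OF z] _ Z]) (use E(3) z in auto)
    also have "(\<Sum>i\<in>Basis. (E i z \<bullet> ?Z) *\<^sub>R i) = \<Gamma> a b z"
      unfolding \<Gamma>_def by (rule sum.cong) (use Et in \<open>auto simp: inner_add_right\<close>)
    finally show ?thesis by simp
  qed
  have dg: "differential c (\<lambda>y. induced_metric \<sigma> c y a b) y w
      = dd w (dd a \<tau>) (snd c y) \<bullet> dd b \<tau> (snd c y) + dd a \<tau> (snd c y) \<bullet> dd w (dd b \<tau>) (snd c y)"
    if y: "y \<in> fst c" for y a b w
  proof -
    have z: "snd c y \<in> ?D" using y by auto
    have "differential c (\<lambda>y. induced_metric \<sigma> c y a b) y w = dd w (\<lambda>z. dd a \<tau> z \<bullet> dd b \<tau> z) (snd c y)"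
      unfolding differential_eq_dd by (rule dd_cong[OF D z]) (simp add: g inv(2))
    then show ?thesis using dd_inner[OF d1(2)[OF z] d1(2)[OF z], of w] by (simp add: add.commute)
  qed
  have LC: "levi_civita (induced_metric \<sigma>) c y a b = \<Gamma> a b (snd c y)" if y: "y \<in> fst c" for y a b
  proof -
    have z: "snd c y \<in> ?D" using y by auto
    let ?z = "snd c y"
    have sym: "dd p (dd q \<tau>) ?z = dd q (dd p \<tau>) ?z" for p q by (rule dd_symmetric[OF D z t])
    \<comment> \<open>By symmetry of second derivatives the six terms of the Koszul sum cancel down
      to twice \<open>\<partial>\<^sub>a \<partial>\<^sub>b \<tau> \<bullet> \<partial>\<^sub>w
      \<tau>\<close>.\<close>
    have kos: "(differential c (\<lambda>x. induced_metric \<sigma> c x b w) y a + differential c (\<lambda>x. induced_metric \<sigma> c x a w) y b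
        - differential c (\<lambda>x. induced_metric \<sigma> c x a b) y w) / 2 = dd a (dd b \<tau>) ?z \<bullet> dd w \<tau> ?z" for w
      using sym[of w a] sym[of w b] sym[of b a] by (simp add: dg[OF y] inner_commute)
    have G: "dd (\<Gamma> a b ?z) \<tau> ?z \<bullet> dd w \<tau> ?z = dd a (dd b \<tau>) ?z \<bullet> dd w \<tau> ?z" for w
      unfolding Gt[OF z] using tw(1)[OF z] by (simp add: inner_add_left)
    show ?thesis unfolding levi_civita_def kos unfolding g
    proof (rule the_equality)
      show "\<forall>w. dd (\<Gamma> a b ?z) \<tau> ?z \<bullet> dd w \<tau> ?z = dd a (dd b \<tau>) ?z \<bullet> dd w \<tau> ?z" using G by blast
      fix w assume w: "\<forall>v. dd w \<tau> ?z \<bullet> dd v \<tau> ?z = dd a (dd b \<tau>) ?z \<bullet> dd v \<tau> ?z"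
      have "(dd w \<tau> ?z - dd (\<Gamma> a b ?z) \<tau> ?z) \<bullet> dd v \<tau> ?z = 0" for v using w G by (simp add: inner_diff_left)
      from this[of "w - \<Gamma> a b ?z"] have "dd w \<tau> ?z = dd (\<Gamma> a b ?z) \<tau> ?z"
        using linear_diff[OF linear_dd[OF d1(1)[OF z]], of w "\<Gamma> a b ?z"] by simp
      then show "w = \<Gamma> a b ?z" using injt[OF z] by (auto dest: injD)
    qed
  qed
  define z where "z = snd c x"
  have z: "z \<in> ?D" using x by (auto simp: z_def)
  \<comment> \<open>\<open>Q a b w\<close> is the iterated covariant derivative
    \<open>\<nabla>\<^sub>a \<nabla>\<^sub>b w\<close>. In its pairing \<open>Qy\<close> with
    tangent vectors the third derivative of \<open>\<tau>\<close> is symmetric in \<open>a\<close>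
    and \<open>b\<close>, so it drops out of the curvature.\<close>
  define Q where "Q a b w = dd a (\<Gamma> b w) z + \<Gamma> a (\<Gamma> b w z) z" for a b w
  have Qy: "dd (Q a b w) \<tau> z \<bullet> dd y \<tau> z
      = dd a (dd b (dd w \<tau>)) z \<bullet> dd y \<tau> z + (dd b \<tau> z \<bullet> dd w \<tau> z) * (dd a \<tau> z \<bullet> dd y \<tau> z)" for a b w y
  proof -
    have dt: "dd b \<tau> differentiable (at z)" for b using d1(2)[OF z] .
    have din: "(\<lambda>z. dd b \<tau> z \<bullet> dd w \<tau> z) differentiable (at z)"
      by (rule d[OF smooth_on_inner[OF D smooth_on_dd[OF t] smooth_on_dd[OF t]] z])
    have dsc: "(\<lambda>z. (dd b \<tau> z \<bullet> dd w \<tau> z) *\<^sub>R \<tau> z) differentiable (at z)"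
      by (rule d[OF smooth_on_scaleR[OF D smooth_on_inner[OF D smooth_on_dd[OF t] smooth_on_dd[OF t]] t] z])
    have "dd a (\<lambda>z. dd (\<Gamma> b w z) \<tau> z) z = dd a (\<lambda>z. dd b (dd w \<tau>) z + (dd b \<tau> z \<bullet> dd w \<tau> z) *\<^sub>R \<tau> z) z"
      by (rule dd_cong[OF D z Gt])
    also have "\<dots> = dd a (dd b (dd w \<tau>)) z + ((dd b \<tau> z \<bullet> dd w \<tau> z) *\<^sub>R dd a \<tau> z
        + dd a (\<lambda>z. dd b \<tau> z \<bullet> dd w \<tau> z) z *\<^sub>R \<tau> z)"
      using dd_add[OF d1(3)[OF z] dsc, of a] dd_scaleR[OF din d1(1)[OF z], of a] by simp
    finally have "dd (dd a (\<Gamma> b w) z) \<tau> z = dd a (dd b (dd w \<tau>)) z + ((dd b \<tau> z \<bullet> dd w \<tau> z) *\<^sub>R dd a \<tau> z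
        + dd a (\<lambda>z. dd b \<tau> z \<bullet> dd w \<tau> z) z *\<^sub>R \<tau> z) - dd a (dd (\<Gamma> b w z) \<tau>) z"
      using dd_along_field[OF D z t Gs, of a b w] by (simp add: eq_diff_eq)
    then show ?thesis
      unfolding Q_def dd_add_dir[OF d1(1)[OF z]] Gt[OF z] using tw(1)[OF z, of y]
      by (simp add: inner_add_left inner_diff_left)
  qed
  have LCd: "differential c (\<lambda>y. levi_civita (induced_metric \<sigma>) c y a b) x w = dd w (\<Gamma> a b) z" for a b w
    unfolding differential_eq_dd z_def[symmetric]
    by (rule dd_cong[OF D z]) (simp add: LC inv)
  have curv: "curvature (induced_metric \<sigma>) c x a b w = Q a b w - Q b a w" for a b w
    unfolding curvature_def LCd LC[OF x] Q_def z_def[symmetric] by simp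
  have sym3: "dd u (dd v (dd v \<tau>)) z = dd v (dd u (dd v \<tau>)) z"
    by (rule dd_symmetric[OF D z smooth_on_dd[OF t]])
  have num: "induced_metric \<sigma> c x (curvature (induced_metric \<sigma>) c x u v v) u
      = (dd v \<tau> z \<bullet> dd v \<tau> z) * (dd u \<tau> z \<bullet> dd u \<tau> z) - (dd u \<tau> z \<bullet> dd v \<tau> z)\<^sup>2"
    unfolding curv g z_def[symmetric] linear_diff[OF linear_dd[OF d1(1)[OF z]]] inner_diff_left Qy sym3
    by (simp add: inner_commute power2_eq_square)
  \<comment> \<open>Strict Cauchy-Schwarz: with equality, \<open>d\<tau>\<close> would annihilate
    the vector \<open>?w\<close> below, which is nonzero by independence of \<open>u\<close> and
    \<open>v\<close>.\<close>
  have "(dd u \<tau> z \<bullet> dd v \<tau> z)\<^sup>2 \<noteq> (dd u \<tau> z \<bullet> dd u \<tau> z) * (dd v \<tau> z \<bullet> dd v \<tau> z)"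
  proof
    assume eq: "(dd u \<tau> z \<bullet> dd v \<tau> z)\<^sup>2 = (dd u \<tau> z \<bullet> dd u \<tau> z) * (dd v \<tau> z \<bullet> dd v \<tau> z)"
    let ?a = "dd v \<tau> z \<bullet> dd v \<tau> z" and ?b = "dd u \<tau> z \<bullet> dd v \<tau> z"
    let ?w = "?a *\<^sub>R u - ?b *\<^sub>R v"
    have lin: "linear (\<lambda>w. dd w \<tau> z)" by (rule linear_dd[OF d1(1)[OF z]])
    have wd: "dd ?w \<tau> z = ?a *\<^sub>R dd u \<tau> z - ?b *\<^sub>R dd v \<tau> z"
      using linear_diff[OF lin] linear_scale[OF lin] by simp
    have "dd ?w \<tau> z \<bullet> dd ?w \<tau> z = ?a * (?a * (dd u \<tau> z \<bullet> dd u \<tau> z) - ?b\<^sup>2)"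
      unfolding wd by (simp add: inner_diff_left inner_diff_right inner_commute[of "dd v \<tau> z" "dd u \<tau> z"] power2_eq_square algebra_simps)
    then have "dd ?w \<tau> z = dd 0 \<tau> z" using eq dd_zero_dir[OF d1(1)[OF z]] by (simp add: mult.commute)
    then have w0: "?a *\<^sub>R u = ?b *\<^sub>R v" using injt[OF z] by (auto dest: injD)
    have ind: "v \<noteq> 0" "u \<notin> span {v}" using uv by (auto simp: independent_insert)
    have "dd v \<tau> z \<noteq> 0" using injt[OF z] ind(1) dd_zero_dir[OF d1(1)[OF z]] by (metis injD)
    then have "u = (?b / ?a) *\<^sub>R v" using arg_cong[OF w0, of "\<lambda>y. inverse ?a *\<^sub>R y"] by (simp add: divide_inverse mult.commute)
    then show False using ind(2) by (auto simp: span_singleton)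
  qed
  then show ?thesis
    unfolding sectional_curvature_def num unfolding g z_def[symmetric] by (simp add: mult.commute)
qed

text \<open>A vector \<open>n0\<close> normal at \<open>p\<close> is made normal nearby by
  subtracting its tangential part, computed with the dual frame; the result stays nonzero on a
  smaller open set, where it is normalized.\<close>

lemma unit_normal_exists:
  fixes F :: "'a::euclidean_space \<Rightarrow> 'b::euclidean_space"
  assumes dim: "DIM('b) = DIM('a) + 1"
    and S: "open S" and F: "smooth_on S F" and inj: "\<And>x. x \<in> S \<Longrightarrow> inj (\<lambda>v. dd v F x)" and p: "p \<in> S"
  obtains S' n where "open S'" "p \<in> S'" "S' \<subseteq> S" "smooth_on S' n"
    "\<And>x. x \<in> S' \<Longrightarrow> n x \<bullet> n x = 1" "\<And>x v. x \<in> S' \<Longrightarrow> n x \<bullet> dd v F x = 0"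
proof -
  note d = smooth_on_differentiable[OF F]
  obtain E where E: "\<And>b. b \<in> Basis \<Longrightarrow> smooth_on S (E b)"
    "\<And>b z v. b \<in> Basis \<Longrightarrow> z \<in> S \<Longrightarrow> E b z \<bullet> dd v F z = v \<bullet> b"
    using immersion_dual_frame[OF S F inj] by blast
  have "dim (range (\<lambda>v. dd v F p)) \<le> DIM('a)"
    using dim_image_le[OF linear_dd[OF d[OF p]], of UNIV] by (simp add: dim_UNIV)
  then have "dim (range (\<lambda>v. dd v F p)) < DIM('b)" using dim by simp
  then obtain n0 where n0: "n0 \<noteq> 0" "\<And>y. y \<in> span (range (\<lambda>v. dd v F p)) \<Longrightarrow> orthogonal n0 y"
    using orthogonal_to_subspace_exists by blast
  have n0': "n0 \<bullet> dd v F p = 0" for v using n0(2)[of "dd v F p"] by (auto simp: orthogonal_def intro: span_base)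
  define m where "m x = n0 - (\<Sum>b\<in>Basis. (n0 \<bullet> dd b F x) *\<^sub>R E b x)" for x
  have ms: "smooth_on S m" unfolding m_def[abs_def] by (intro smooth_intros S F E)
  have m: "m x \<bullet> dd v F x = 0" if x: "x \<in> S" for x v
  proof -
    have "(\<Sum>b\<in>Basis. (n0 \<bullet> dd b F x) *\<^sub>R E b x) \<bullet> dd v F x = (\<Sum>b\<in>Basis. (n0 \<bullet> dd b F x) * (v \<bullet> b))"
      by (simp add: inner_sum_left E(2)[OF _ x])
    also have "\<dots> = n0 \<bullet> dd v F x"
      unfolding dd_basis[OF d[OF x], of v] by (simp add: inner_sum_right mult.commute)
    finally show ?thesis by (simp add: m_def inner_diff_left)
  qed
  have mp: "m p = n0" by (simp add: m_def n0')
  define S' where "S' = {x \<in> S. m x \<noteq> 0}"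
  have S': "open S'"
    using continuous_on_open_vimage[OF S, of m] smooth_on_continuous[OF ms]
    by (auto simp: S'_def Collect_conj_eq vimage_def Int_commute Compl_eq dest!: spec[of _ "- {0}"])
  have sub: "S' \<subseteq> S" by (auto simp: S'_def)
  show ?thesis
  proof
    show "smooth_on S' (\<lambda>x. inverse (norm (m x)) *\<^sub>R m x)"
      by (intro smooth_intros S' smooth_on_subset[OF ms sub]) (auto simp: S'_def)
    show "(inverse (norm (m x)) *\<^sub>R m x) \<bullet> (inverse (norm (m x)) *\<^sub>R m x) = 1" if "x \<in> S'" for x
      using that by (simp add: S'_def dot_square_norm power2_eq_square)
    show "(inverse (norm (m x)) *\<^sub>R m x) \<bullet> dd v F x = 0" if "x \<in> S'" for x v
      using m that sub by auto
  qed (use S' sub p mp n0 in \<open>auto simp: S'_def\<close>)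
qed

lemma smooth_on_local:
  assumes "\<And>x. x \<in> S \<Longrightarrow> \<exists>T. open T \<and> x \<in> T \<and> smooth_on T f"
  shows "smooth_on S f"
proof -
  have "Ck_on k S g" if "\<And>x. x \<in> S \<Longrightarrow> \<exists>T. open T \<and> x \<in> T \<and> Ck_on k T g" for k and g :: "'a \<Rightarrow> 'b"
    using that
  proof (induction k arbitrary: g)
    case 0
    have "isCont g x" if "x \<in> S" for x
      using 0[OF that] continuous_on_interior by (metis Ck_on.simps(1) interior_open)
    then show ?case by (simp add: continuous_at_imp_continuous_on)
  next
    case (Suc k)
    show ?case unfolding Ck_on_Suc
    proof (intro conjI ballI allI)
      show "g differentiable (at x)" if "x \<in> S" for x using Suc.prems[OF that] by (auto simp: Ck_on_Suc)
      show "Ck_on k S (dd v g)" for v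
        by (rule Suc.IH) (use Suc.prems in \<open>force simp: Ck_on_Suc\<close>)
    qed
  qed
  then show ?thesis using assms unfolding smooth_on_def by meson
qed

text \<open>On a neighbourhood covered by one chart \<open>c\<close>, objects are built in
  coordinates and carried over by \<open>snd c\<close>. The atlas may contain further charts, so
  smoothness is checked against them through the transition maps.\<close>

lemma global_chart_smooth:
  fixes A :: "('q::{t2_space, second_countable_topology}, 'v::euclidean_space) chart set"
  assumes A: "smooth_atlas A" "c \<in> A" "fst c = points A" and F: "smooth_on (snd c ` fst c) F"
  shows "smooth_map A (\<lambda>x. F (snd c x))"
  unfolding smooth_map_def
proof
  fix d assume d: "d \<in> A"
  have sub: "fst d \<inter> fst c = fst d" using d A(3) by (auto simp: points_def)
  have "smooth_on (snd d ` fst d) (\<lambda>z. F ((snd c \<circ> chart_inv d) z))"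
  proof (rule smooth_on_compose[OF is_chart_open(2)[OF smooth_atlas_chart[OF A(1) d]]
        is_chart_open(2)[OF smooth_atlas_chart[OF A(1,2)]] _ _ F])
    show "(snd c \<circ> chart_inv d) ` snd d ` fst d \<subseteq> snd c ` fst c"
    proof
      fix y assume "y \<in> (snd c \<circ> chart_inv d) ` snd d ` fst d"
      then obtain x where x: "x \<in> fst d" "y = snd c (chart_inv d (snd d x))" by auto
      then show "y \<in> snd c ` fst c"
        using chart_inv_left[OF smooth_atlas_chart[OF A(1) d] x(1)] sub by auto
    qed
    show "smooth_on (snd d ` fst d) (snd c \<circ> chart_inv d)"
      using smooth_atlas_transition[OF A(1) d A(2)] by (simp add: sub)
  qed
  then show "smooth_on (snd d ` fst d) ((\<lambda>x. F (snd c x)) \<circ> chart_inv d)" by (simp add: o_def)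
qed

lemma global_chart_differential:
  fixes A :: "('q::{t2_space, second_countable_topology}, 'v::euclidean_space) chart set"
  assumes A: "smooth_atlas A" "c \<in> A" "fst c = points A" and F: "smooth_on (snd c ` fst c) F"
    and d: "d \<in> A" "x \<in> fst d"
  shows "differential d (\<lambda>x. F (snd c x)) x u = dd (differential d (snd c) x u) F (snd c x)"
proof -
  have xc: "x \<in> fst c" using d A(3) by (auto simp: points_def)
  have "differential d (\<lambda>x. F (snd c x)) x u = differential c (\<lambda>x. F (snd c x)) x (differential d (snd c) x u)"
    by (rule chart_change_smooth[OF A(1) d(1) A(2) d(2) xc global_chart_smooth[OF A F]])
  also have "\<dots> = dd (differential d (snd c) x u) F (snd c x)"
    unfolding differential_eq_dd[of c]
  proof (rule dd_cong[OF is_chart_open(2)[OF smooth_atlas_chart[OF A(1,2)]]])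
    fix y assume "y \<in> snd c ` fst c"
    then show "((\<lambda>x. F (snd c x)) \<circ> chart_inv c) y = F y" using chart_inv_right[of y c] by simp
  qed (use xc in auto)
  finally show ?thesis .
qed

lemma prod_global_chart:
  assumes "c \<in> A" "fst c = points A"
  shows "prod_chart c J \<in> prod_atlas A J" "fst (prod_chart c J) = points (prod_atlas A J)"
  by (simp_all only: prod_chart_simps(1) points_prod assms) (simp add: prod_atlas_def assms(1))

text \<open>\<open>metric_decomposition\<close> quantifies over all charts; the transition between
  product charts acts in blocks, by the chart change on the first factor and the identity on the
  interval.\<close>

lemma prod_differential_transition:
  assumes A: "smooth_atlas A" "c \<in> A" "d \<in> A" and J: "open J" and x: "x \<in> fst c" "x \<in> fst d" "t \<in> J"
  shows "differential (prod_chart d J) (snd (prod_chart c J)) (x, t) (u, a) = (differential d (snd c) x u, a)"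
proof -
  note ch = smooth_atlas_chart[OF A(1,3)]
  let ?t = "snd c \<circ> chart_inv d"
  let ?S = "snd d ` (fst d \<inter> fst c)"
  have S: "open ?S" by (rule overlap_open(2)[OF A(1,3,2)])
  have ts: "smooth_on ?S ?t" by (rule smooth_atlas_transition[OF A(1,3,2)])
  have z: "snd d x \<in> ?S" using x by auto
  have dt: "?t differentiable (at (snd d x))" by (rule smooth_on_differentiable[OF ts z])
  have "differential (prod_chart d J) (snd (prod_chart c J)) (x, t) (u, a)
      = dd (u, a) (rep d (snd (prod_chart c J))) (snd d x, t)"
    by (rule differential_prod[OF ch J x(2,3)])
  also have "rep d (snd (prod_chart c J)) = (\<lambda>p. (?t (fst p), snd p))" by (auto simp: prod_chart_simps)
  also have "dd (u, a) (\<lambda>p. (?t (fst p), snd p)) (snd d x, t) = (dd u ?t (snd d x), a)"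
  proof -
    have "((\<lambda>p. ?t (fst p)) has_derivative (\<lambda>w. dd (fst w) ?t (snd d x))) (at (snd d x, t))"
    proof (rule has_derivative_compose[of fst fst "(snd d x, t)" UNIV ?t "\<lambda>u. dd u ?t (snd d x)"])
      show "(fst has_derivative fst) (at (snd d x, t))"
        by (rule bounded_linear_imp_has_derivative[OF bounded_linear_fst])
      show "(?t has_derivative (\<lambda>u. dd u ?t (snd d x))) (at (fst (snd d x, t)))"
        unfolding fst_conv by (rule dd_has_derivative[OF dt])
    qed
    then have "((\<lambda>p. (?t (fst p), snd p)) has_derivative (\<lambda>w. (dd (fst w) ?t (snd d x), snd w))) (at (snd d x, t))"
      by (intro has_derivative_Pair) (auto intro!: bounded_linear_imp_has_derivative bounded_linear_snd)
    from dd_eq[OF this, of "(u, a)"] show ?thesis by simp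
  qed
  finally show ?thesis by (simp add: differential_eq_dd)
qed

lemma induced_metric_riemannian:
  fixes \<sigma> :: "'q::{t2_space, second_countable_topology} \<Rightarrow> 'b::euclidean_space"
    and A :: "('q, 'v::euclidean_space) chart set"
  assumes A: "smooth_atlas A" and im: "immersion A \<sigma>"
  shows "riemannian_metric A (induced_metric \<sigma>)"
  unfolding riemannian_metric_def
proof (intro conjI ballI allI impI)
  have sm: "smooth_map A \<sigma>" using im by (simp add: immersion_def)
  fix c assume c: "c \<in> A"
  note ch = smooth_atlas_chart[OF A c]
  have sc: "smooth_on (snd c ` fst c) (\<sigma> \<circ> chart_inv c)" using sm c by (auto simp: smooth_map_def)
  note D = is_chart_open(2)[OF ch]
  show "smooth_on (snd c ` fst c) (\<lambda>z. induced_metric \<sigma> c (chart_inv c z) u v)" for u v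
  proof -
    have "smooth_on (snd c ` fst c) (\<lambda>z. dd u (\<sigma> \<circ> chart_inv c) z \<bullet> dd v (\<sigma> \<circ> chart_inv c) z)"
      by (intro smooth_intros D sc)
    moreover have "induced_metric \<sigma> c (chart_inv c z) u v = dd u (\<sigma> \<circ> chart_inv c) z \<bullet> dd v (\<sigma> \<circ> chart_inv c) z"
      if "z \<in> snd c ` fst c" for z
      using chart_inv_right[OF that] by (simp add: induced_metric_def differential_eq_dd)
    ultimately show ?thesis
      using smooth_on_cong[OF D, of "\<lambda>z. induced_metric \<sigma> c (chart_inv c z) u v"
          "\<lambda>z. dd u (\<sigma> \<circ> chart_inv c) z \<bullet> dd v (\<sigma> \<circ> chart_inv c) z"] by simp
  qed
  {
    fix x assume x: "x \<in> fst c"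
    have lin: "linear (differential c \<sigma> x)" by (rule smooth_map_linear[OF sm c x])
    show "bilinear (induced_metric \<sigma> c x)"
      unfolding bilinear_def induced_metric_def
      by (auto intro!: linearI simp: linear_add[OF lin] linear_scale[OF lin] inner_add_left inner_add_right)
    show "induced_metric \<sigma> c x u v = induced_metric \<sigma> c x v u" for u v
      by (simp add: induced_metric_def inner_commute)
    show "induced_metric \<sigma> c x u u > 0" if "u \<noteq> 0" for u
    proof -
      have "inj (differential c \<sigma> x)" using im c x by (auto simp: immersion_def regular_point_def points_def)
      then have "differential c \<sigma> x u \<noteq> 0" using that lin linear_injective_0 by blast
      then show ?thesis by (simp add: induced_metric_def)
    qed
  }
  fix c' x u v assume c': "c' \<in> A" and x: "x \<in> fst c \<inter> fst c'"
  show "induced_metric \<sigma> c x u v = induced_metric \<sigma> c' x (differential c (snd c') x u) (differential c (snd c') x v)"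
    using chart_change_smooth[OF A c c' _ _ sm] x by (simp add: induced_metric_def)
qed

subsection \<open>The leaves of the Gauss map\<close>

lemma slice_constant:
  fixes F :: "'v::euclidean_space \<times> real \<Rightarrow> 'b::euclidean_space"
  assumes D: "convex D" and F: "\<And>z. z \<in> D \<Longrightarrow> F differentiable (at (z, s))"
    and zero: "\<And>z u. z \<in> D \<Longrightarrow> dd (u, 0) F (z, s) = 0" and z: "z \<in> D" "z' \<in> D"
  shows "F (z, s) = F (z', s)"
proof -
  have "\<exists>k. \<forall>z\<in>D. F (z, s) = k"
  proof (rule has_derivative_zero_constant[OF D])
    fix z assume z: "z \<in> D"
    have "((\<lambda>z. F (z, s)) has_derivative (\<lambda>u. dd u (\<lambda>z. F (z, s)) z)) (at z)"
      by (rule dd_has_derivative[OF dd_slice(2)[OF F[OF z]]])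
    moreover have "dd u (\<lambda>z. F (z, s)) z = 0" for u using dd_slice(1)[OF F[OF z], of u] zero[OF z] by simp
    ultimately show "((\<lambda>z. F (z, s)) has_derivative (\<lambda>h. 0)) (at z within D)" by (simp add: has_derivative_at_withinI)
  qed
  then show ?thesis using z by auto
qed

text \<open>Takes the place of uniqueness for linear equations along the trajectories: it is applied
  to a quotient and to a difference whose derivatives cancel.\<close>

lemma slice_constant_snd:
  fixes F :: "'v::euclidean_space \<times> real \<Rightarrow> 'b::euclidean_space"
  assumes J: "is_interval J" and F: "\<And>t. t \<in> J \<Longrightarrow> F differentiable (at (z, t))"
    and zero: "\<And>t. t \<in> J \<Longrightarrow> dd (0, 1) F (z, t) = 0" and t: "t \<in> J" "t' \<in> J"
  shows "F (z, t) = F (z, t')"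
proof -
  have "\<exists>k. \<forall>t\<in>J. F (z, t) = k"
  proof (rule has_derivative_zero_constant)
    show "convex J" using J by (simp add: is_interval_convex_1)
    fix t assume t: "t \<in> J"
    have df: "(\<lambda>t. F (z, t)) differentiable (at t)" by (rule dd_slice_snd(2)[OF F[OF t]])
    have "dd a (\<lambda>t. F (z, t)) t = 0" for a
      using dd_scaleR_dir[OF df, of a 1] dd_slice_snd(1)[OF F[OF t]] zero[OF t] by simp
    then show "((\<lambda>t. F (z, t)) has_derivative (\<lambda>h. 0)) (at t within J)"
      using dd_has_derivative[OF df] by (simp add: has_derivative_at_withinI)
  qed
  then show ?thesis using t by auto
qed

lemma dd_prod_split:
  "F differentiable (at p) \<Longrightarrow> dd (u, a) F p = dd (u, 0) F p + a *\<^sub>R dd (0, 1) F p"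
  for F :: "'v::real_normed_vector \<times> real \<Rightarrow> 'b::real_normed_vector"
  using dd_add_dir[of F p "(u, 0)" "a *\<^sub>R (0, 1)"] dd_scaleR_dir[of F p a "(0, 1)"] by simp

text \<open>The Weingarten formula, by differentiating the orthogonality relation.\<close>

lemma normal_derivative:
  fixes F n :: "'a::euclidean_space \<Rightarrow> 'b::euclidean_space"
  assumes S: "open S" and sm: "smooth_on S F" "smooth_on S n"
    and n: "\<And>p w. p \<in> S \<Longrightarrow> n p \<bullet> dd w F p = 0" and p: "p \<in> S"
  shows "n p \<bullet> dd u (dd v F) p = - (dd u n p \<bullet> dd v F p)"
proof -
  have "dd u (\<lambda>p. n p \<bullet> dd v F p) p = dd u (\<lambda>p. 0) p" by (rule dd_cong[OF S p n])
  then show ?thesis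
    using dd_inner[OF smooth_on_differentiable[OF sm(2) p] smooth_on_differentiable[OF smooth_on_dd[OF sm(1)] p], of u v]
    by simp
qed

lemma unit_derivative:
  fixes n :: "'a::euclidean_space \<Rightarrow> 'b::euclidean_space"
  assumes S: "open S" and sm: "smooth_on S n" and n: "\<And>p. p \<in> S \<Longrightarrow> n p \<bullet> n p = 1" and p: "p \<in> S"
  shows "n p \<bullet> dd w n p = 0"
proof -
  have "dd w (\<lambda>p. n p \<bullet> n p) p = dd w (\<lambda>p. 1) p" by (rule dd_cong[OF S p n])
  then show ?thesis
    using dd_inner[OF smooth_on_differentiable[OF sm p] smooth_on_differentiable[OF sm p], of w] by (simp add: inner_commute)
qed

text \<open>\<open>dF\<close> maps the image of \<open>u\<close> under the shape operator to
  \<open>- dn u\<close>. Full rank makes the shape operator injective, hence \<open>dn\<close>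
  too.\<close>

lemma normal_immersion:
  fixes F :: "'q::topological_space \<Rightarrow> 'b::euclidean_space" and c :: "('q, 'v::euclidean_space) chart"
  assumes ch: "is_chart c" and x: "x \<in> fst c" and dim: "DIM('b) = DIM('v) + 1"
    and S: "open S" "S \<subseteq> snd c ` fst c" "snd c x \<in> S"
    and F: "smooth_on S (F \<circ> chart_inv c)" and inj: "inj (differential c F x)"
    and n: "smooth_on S n" "\<And>z. z \<in> S \<Longrightarrow> n z \<bullet> n z = 1"
      "\<And>z v. z \<in> S \<Longrightarrow> n z \<bullet> dd v (F \<circ> chart_inv c) z = 0"
    and rank: "dim (range (shape_operator F c x (n (snd c x)))) = DIM('v)"
  shows "inj (\<lambda>v. dd v n (snd c x))"
proof -
  let ?t = "F \<circ> chart_inv c"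
  define z where "z = snd c x"
  have z: "z \<in> S" using S by (simp add: z_def)
  have dt: "?t differentiable (at z)" by (rule smooth_on_differentiable[OF F z])
  have lin: "linear (\<lambda>v. dd v ?t z)" by (rule linear_dd[OF dt])
  have dn: "n differentiable (at z)" by (rule smooth_on_differentiable[OF n(1) z])
  have injt: "inj (\<lambda>v. dd v ?t z)" using inj by (simp add: differential_eq_dd[abs_def] z_def)
  have rng: "range (\<lambda>v. dd v ?t z) = {y. n z \<bullet> y = 0}"
    by (rule range_eq_hyperplane[OF lin injt dim]) (use n(2,3)[OF z] in auto)
  have D: "differential c F x = (\<lambda>v. dd v ?t z)" by (simp add: differential_eq_dd[abs_def] z_def)
  have II: "second_fundamental_form F c x u v \<bullet> n z = - (dd u n z \<bullet> dd v ?t z)" for u v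
  proof -
    have w: "differential c (\<lambda>y. differential c F y v) x u = dd u (dd v ?t) z"
      unfolding z_def by (rule second_differential_eq_dd[OF ch x])
    have "closed (range (\<lambda>v. dd v ?t z))" by (rule closed_subspace[OF linear_subspace_image[OF lin subspace_UNIV]])
    then have "closest_point (range (\<lambda>v. dd v ?t z)) (dd u (dd v ?t) z) \<in> range (\<lambda>v. dd v ?t z)"
      by (rule closest_point_in_set) auto
    then have "closest_point (range (\<lambda>v. dd v ?t z)) (dd u (dd v ?t) z) \<bullet> n z = 0"
      using rng by (simp add: inner_commute)
    then show ?thesis
      using normal_derivative[OF S(1) F n(1,3) z, of u v]
      by (simp add: second_fundamental_form_def Let_def w D inner_diff_right inner_commute[of _ "n z"])
  qed
  \<comment> \<open>\<open>dn u\<close> is tangent because \<open>n\<close> is a unit field; the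
    vector \<open>W\<close> with image \<open>- dn u\<close> is then the unique solution that
    \<open>THE\<close> asks for.\<close>
  have so: "\<exists>W. dd W ?t z = - dd u n z \<and> shape_operator F c x (n z) u = W" for u
  proof -
    have "- dd u n z \<in> range (\<lambda>v. dd v ?t z)" using rng unit_derivative[OF S(1) n(1,2) z, of u] by simp
    then obtain W where "- dd u n z = dd W ?t z" by (rule rangeE)
    then have W: "dd W ?t z = - dd u n z" by simp
    have "shape_operator F c x (n z) u = W"
      unfolding shape_operator_def induced_metric_def D II
    proof (rule the_equality)
      show "\<forall>v. dd W ?t z \<bullet> dd v ?t z = - (dd u n z \<bullet> dd v ?t z)" by (simp add: W)
      fix w assume w: "\<forall>v. dd w ?t z \<bullet> dd v ?t z = - (dd u n z \<bullet> dd v ?t z)"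
      have "(dd w ?t z - dd W ?t z) \<bullet> dd v ?t z = 0" for v using w by (simp add: W inner_add_left)
      from this[of "w - W"] have "dd w ?t z = dd W ?t z" using linear_diff[OF lin, of w W] by simp
      then show "w = W" using injt by (auto dest: injD)
    qed
    then show ?thesis using W by blast
  qed
  let ?S = "shape_operator F c x (n z)"
  have St: "dd (?S u) ?t z = - dd u n z" for u using so[of u] by blast
  have linS: "linear ?S"
  proof (rule linearI)
    fix a b show "?S (a + b) = ?S a + ?S b"
    proof -
      have "dd (?S (a + b)) ?t z = dd (?S a + ?S b) ?t z"
        unfolding linear_add[OF lin] St using linear_add[OF linear_dd[OF dn], of a b] by simp
      then show ?thesis using injt by (auto dest: injD)
    qed
  next
    fix r a show "?S (r *\<^sub>R a) = r *\<^sub>R ?S a"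
    proof -
      have "dd (?S (r *\<^sub>R a)) ?t z = dd (r *\<^sub>R ?S a) ?t z"
        unfolding linear_scale[OF lin] St using linear_scale[OF linear_dd[OF dn], of r a] by simp
      then show ?thesis using injt by (auto dest: injD)
    qed
  qed
  have "range ?S = UNIV"
  proof (rule subspace_dim_equal)
    show "subspace (range ?S)" by (rule linear_subspace_image[OF linS subspace_UNIV])
  qed (use rank in \<open>auto simp: z_def dim_UNIV\<close>)
  then have injS: "inj ?S" using linear_surjective_imp_injective[OF linS] by simp
  show ?thesis unfolding z_def[symmetric] linear_injective_0[OF linear_dd[OF dn]]
  proof (intro allI impI)
    fix u assume "dd u n z = 0"
    then have "dd (?S u) ?t z = dd 0 ?t z" using St[of u] dd_zero_dir[OF dt] by simp
    then have "?S u = 0" using injt by (auto dest: injD)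
    then show "u = 0" using injS linear_injective_0[OF linS] by blast
  qed
qed

text \<open>Let \<open>\<eta>\<close> be the unit vector along \<open>\<partial>\<^sub>s n\<close>.
  The normal \<open>a\<close> of the hyperplane through a leaf is \<open>q n + r \<eta>\<close> with
  \<open>q\<close> and \<open>r\<close> constant on the leaf and \<open>r \<noteq> 0\<close>, so
  \<open>\<eta> = a / r - (q / r) n\<close>; thus \<open>c = a / r\<close> and
  \<open>\<mu> = q / r\<close>.\<close>

lemma leaf_spheres:
  fixes f n :: "'v::euclidean_space \<times> real \<Rightarrow> 'b::euclidean_space"
  assumes dim: "DIM('b) = DIM('v) + 2"
    and D: "open D" "convex D" "D \<noteq> {}" and K: "open K"
    and f: "smooth_on (D \<times> K) f" "\<And>p. p \<in> D \<times> K \<Longrightarrow> inj (\<lambda>w. dd w f p)"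
    and n: "smooth_on (D \<times> K) n" "\<And>p. p \<in> D \<times> K \<Longrightarrow> inj (\<lambda>w. dd w n p)"
      "\<And>p. p \<in> D \<times> K \<Longrightarrow> n p \<bullet> n p = 1" "\<And>p w. p \<in> D \<times> K \<Longrightarrow> n p \<bullet> dd w f p = 0"
    and orth: "\<And>p u. p \<in> D \<times> K \<Longrightarrow> dd (u, 0) f p \<bullet> dd (0, 1) f p = 0"
    and adapted: "\<And>p u. p \<in> D \<times> K \<Longrightarrow> n p \<bullet> dd (u, 0) (dd (0, 1) f) p = 0"
    and leaves: "\<And>s. s \<in> K \<Longrightarrow> \<exists>a b. a \<noteq> 0 \<and> (\<forall>z\<in>D. a \<bullet> f (z, s) = b)"
  shows "\<exists>c \<mu> \<nu>. smooth_on K c \<and> smooth_on K \<mu> \<and> smooth_on (D \<times> K) \<nu> \<and>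
    (\<forall>p\<in>D \<times> K. \<nu> p > 0 \<and> dd (0, 1) n p = \<nu> p *\<^sub>R (c (snd p) - \<mu> (snd p) *\<^sub>R n p) \<and>
      (\<nu> p)\<^sup>2 = dd (0, 1) n p \<bullet> dd (0, 1) n p \<and>
      (\<forall>u. dd (u, 0) n p \<bullet> dd (0, 1) n p = 0 \<and> dd (u, 0) f p \<bullet> dd (0, 1) n p = 0))"
proof -
  let ?S = "D \<times> K"
  have S: "open ?S" using D K by (simp add: open_Times)
  have bd: "DIM('b) = DIM('v \<times> real) + 1" using dim by simp
  have df: "f differentiable (at p)" "dd w f differentiable (at p)" "n differentiable (at p)" "dd w n differentiable (at p)"
    if "p \<in> ?S" for p w
    using smooth_on_differentiable[OF f(1) that] smooth_on_differentiable[OF smooth_on_dd[OF f(1)] that]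
      smooth_on_differentiable[OF n(1) that] smooth_on_differentiable[OF smooth_on_dd[OF n(1)] that] by auto
  have nnz: "n p \<noteq> 0" if "p \<in> ?S" for p using n(3)[OF that] by auto
  have nw: "n p \<bullet> dd w n p = 0" if "p \<in> ?S" for p w by (rule unit_derivative[OF S n(1,3) that])
  have rng: "range (\<lambda>w. dd w f p) = {y. n p \<bullet> y = 0}" if p: "p \<in> ?S" for p
    by (rule range_eq_hyperplane[OF linear_dd[OF df(1)[OF p]] f(2)[OF p] bd nnz[OF p] n(4)[OF p]])
  have zero: "y = 0" if p: "p \<in> ?S" and y: "n p \<bullet> y = 0" "y \<bullet> dd (0, 1) f p = 0" "\<And>u. y \<bullet> dd (u, 0) f p = 0" for y p
  proof -
    obtain w where w: "y = dd w f p" using rng[OF p] y(1) by blast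
    have "y \<bullet> dd w f p = 0"
      using dd_prod_split[OF df(1)[OF p], of "fst w" "snd w"] y(2,3) by (simp add: inner_add_right)
    then show ?thesis using w by simp
  qed
  \<comment> \<open>Adaptedness and the Weingarten formula together kill the mixed pairings of
    \<open>dn\<close> and \<open>df\<close>.\<close>
  have nu_fs: "dd (u, 0) n p \<bullet> dd (0, 1) f p = 0" if p: "p \<in> ?S" for p u
    using normal_derivative[OF S f(1) n(1,4) p, of "(u, 0)" "(0, 1)"] adapted[OF p] by simp
  have ns_fu: "dd (0, 1) n p \<bullet> dd (u, 0) f p = 0" if p: "p \<in> ?S" for p u
    using normal_derivative[OF S f(1) n(1,4) p, of "(0, 1)" "(u, 0)"] adapted[OF p, of u]
      dd_symmetric[OF S p f(1), of "(0, 1)" "(u, 0)"] by simp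
  have ns_nz: "dd (0, 1) n p \<noteq> 0" if p: "p \<in> ?S" for p
  proof
    assume "dd (0, 1) n p = 0"
    then have "dd (0, 1) n p = dd 0 n p" using dd_zero_dir[OF df(3)[OF p]] by simp
    then have "(0 :: 'v, 1 :: real) = 0" using n(2)[OF p] by (metis injD)
    then show False by (simp add: zero_prod_def)
  qed
  \<comment> \<open>\<open>\<partial>\<^sub>s n\<close> and \<open>\<partial>\<^sub>s f\<close> are
    both tangent to \<open>f\<close> and orthogonal to the leaf, which leaves only one
    direction.\<close>
  have ns_fs: "\<exists>k. k \<noteq> 0 \<and> dd (0, 1) f p = k *\<^sub>R dd (0, 1) n p" if p: "p \<in> ?S" for p
  proof -
    let ?y = "dd (0, 1) n p" and ?e = "dd (0, 1) f p"
    have enz: "?e \<noteq> 0"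
    proof
      assume "?e = 0"
      then have "dd (0, 1) f p = dd 0 f p" using dd_zero_dir[OF df(1)[OF p]] by simp
      then have "(0 :: 'v, 1 :: real) = 0" using f(2)[OF p] by (metis injD)
      then show False by (simp add: zero_prod_def)
    qed
    let ?Z = "?y - (?y \<bullet> ?e / (?e \<bullet> ?e)) *\<^sub>R ?e"
    have "?Z = 0"
    proof (rule zero[OF p])
      show "n p \<bullet> ?Z = 0" using nw[OF p] n(4)[OF p] by (simp add: inner_diff_right)
      show "?Z \<bullet> ?e = 0" using enz by (simp add: inner_diff_left)
      show "?Z \<bullet> dd (u, 0) f p = 0" for u
        using ns_fu[OF p] orth[OF p, of u, unfolded inner_commute[of "dd (u, 0) f p"]] by (simp add: inner_diff_left)
    qed
    then obtain k where y: "?y = k *\<^sub>R ?e" by (metis right_minus_eq)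
    then have k: "k \<noteq> 0" using ns_nz[OF p] by auto
    then have "inverse k *\<^sub>R ?y = ?e" using arg_cong[OF y, of "\<lambda>v. inverse k *\<^sub>R v"] by simp
    then show ?thesis using k by (intro exI[of _ "inverse k"]) simp
  qed
  have nu_ns: "dd (u, 0) n p \<bullet> dd (0, 1) n p = 0" if p: "p \<in> ?S" for p u
    using ns_fs[OF p] nu_fs[OF p, of u] by auto
  define \<nu> where "\<nu> p = norm (dd (0, 1) n p)" for p
  have \<nu>s: "smooth_on ?S \<nu>" unfolding \<nu>_def[abs_def] by (intro smooth_intros S n(1) ns_nz)
  have \<nu>p: "\<nu> p > 0" if "p \<in> ?S" for p using ns_nz[OF that] by (simp add: \<nu>_def)
  define \<eta> where "\<eta> p = inverse (\<nu> p) *\<^sub>R dd (0, 1) n p" for p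
  have \<eta>s: "smooth_on ?S \<eta>" unfolding \<eta>_def[abs_def] by (intro smooth_intros S n(1) \<nu>s) (use \<nu>p in force)
  have d\<eta>: "\<eta> differentiable (at p)" if "p \<in> ?S" for p by (rule smooth_on_differentiable[OF \<eta>s that])
  have ns: "dd (0, 1) n p = \<nu> p *\<^sub>R \<eta> p" if "p \<in> ?S" for p using \<nu>p[OF that] by (simp add: \<eta>_def)
  have \<eta>1: "\<eta> p \<bullet> \<eta> p = 1" if "p \<in> ?S" for p
    using \<nu>p[OF that] by (simp add: \<eta>_def \<nu>_def dot_square_norm power2_eq_square field_simps)
  have \<eta>n: "n p \<bullet> \<eta> p = 0" "\<eta> p \<bullet> dd (u, 0) n p = 0" "\<eta> p \<bullet> dd (u, 0) f p = 0" if "p \<in> ?S" for p u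
    using nw[OF that] nu_ns[OF that, of u] ns_fu[OF that] by (simp_all add: \<eta>_def inner_commute[of "dd (u, 0) n p"])
  have \<eta>u: "\<eta> p \<bullet> dd (u, 0) \<eta> p = 0" "n p \<bullet> dd (u, 0) \<eta> p = 0" if p: "p \<in> ?S" for p u
  proof -
    show "\<eta> p \<bullet> dd (u, 0) \<eta> p = 0" by (rule unit_derivative[OF S \<eta>s \<eta>1 p])
    have "dd (u, 0) (\<lambda>p. n p \<bullet> \<eta> p) p = dd (u, 0) (\<lambda>p. 0) p" by (rule dd_cong[OF S p \<eta>n(1)])
    then show "n p \<bullet> dd (u, 0) \<eta> p = 0"
      using dd_inner[OF df(3)[OF p] d\<eta>[OF p], of "(u, 0)"] \<eta>n(2)[OF p, of u] by (simp add: inner_commute)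
  qed
  obtain z1 where z1: "z1 \<in> D" using D(3) by blast
  obtain u1 :: 'v where u1: "u1 \<noteq> 0" using nonempty_Basis nonzero_Basis by blast
  have n1: "dd (u1, 0) n p \<noteq> 0" if p: "p \<in> ?S" for p
  proof
    assume "dd (u1, 0) n p = 0"
    then have "dd (u1, 0) n p = dd 0 n p" using dd_zero_dir[OF df(3)[OF p]] by simp
    then have "(u1, 0 :: real) = 0" using n(2)[OF p] by (metis injD)
    then show False using u1 by (simp add: zero_prod_def)
  qed
  \<comment> \<open>\<open>a\<close> and \<open>b\<close> are chosen separately for each
    \<open>s\<close> and need not be smooth. So \<open>q / r\<close> is expressed by
    \<open>n\<close> and \<open>\<eta>\<close> alone, by differentiating
    \<open>q n + r \<eta> = a\<close> at \<open>z1\<close> in a fixed leaf direction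
    \<open>u1\<close>.\<close>
  define \<mu> where "\<mu> s = - (dd (u1, 0) \<eta> (z1, s) \<bullet> dd (u1, 0) n (z1, s)) / (dd (u1, 0) n (z1, s) \<bullet> dd (u1, 0) n (z1, s))" for s
  define c where "c s = \<eta> (z1, s) + \<mu> s *\<^sub>R n (z1, s)" for s
  have sl: "smooth_on K (\<lambda>s. g (z1, s))" if "smooth_on ?S g" for g :: "'v \<times> real \<Rightarrow> 'b"
    by (rule smooth_on_slice_snd[OF D(1) K z1 that])
  have \<mu>s: "smooth_on K \<mu>" unfolding \<mu>_def[abs_def]
    by (intro smooth_on_divide smooth_on_minus smooth_on_inner K sl smooth_on_dd \<eta>s n(1)) (use n1 z1 in auto)
  have cs: "smooth_on K c" unfolding c_def[abs_def]
    by (intro smooth_on_add smooth_on_scaleR K \<mu>s sl \<eta>s n(1))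
  have key: "\<eta> (z, s) + \<mu> s *\<^sub>R n (z, s) = c s" if z: "z \<in> D" and s: "s \<in> K" for z s
  proof -
    have slS: "(z, s) \<in> ?S" if "z \<in> D" for z using that s by simp
    obtain a b where ab: "a \<noteq> 0" "\<And>z. z \<in> D \<Longrightarrow> a \<bullet> f (z, s) = b" using leaves[OF s] by blast
    have afu: "a \<bullet> dd (u, 0) f (z, s) = 0" if z: "z \<in> D" for z u
    proof -
      have "dd (u, 0) (\<lambda>p. a \<bullet> f p) (z, s) = 0"
        by (rule dd_slice_const[OF differentiable_linear[OF bounded_linear_inner_right df(1)[OF slS[OF z]]] D(1) z ab(2)])
      then show ?thesis using dd_linear[OF bounded_linear_inner_right df(1)[OF slS[OF z]]] by simp
    qed
    have a: "a = (a \<bullet> n (z, s)) *\<^sub>R n (z, s) + (a \<bullet> \<eta> (z, s)) *\<^sub>R \<eta> (z, s)" if z: "z \<in> D" for z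
    proof -
      note p = slS[OF z]
      let ?Z = "a - ((a \<bullet> n (z, s)) *\<^sub>R n (z, s) + (a \<bullet> \<eta> (z, s)) *\<^sub>R \<eta> (z, s))"
      have "?Z = 0"
      proof (rule zero[OF p])
        show "n (z, s) \<bullet> ?Z = 0"
          using n(3)[OF p] \<eta>n(1)[OF p] by (simp add: inner_diff_right inner_add_right inner_commute)
        have "?Z \<bullet> \<eta> (z, s) = 0"
          using \<eta>1[OF p] \<eta>n(1)[OF p] by (simp add: inner_diff_left inner_add_left)
        then show "?Z \<bullet> dd (0, 1) f (z, s) = 0" using ns_fs[OF p] ns[OF p] by auto
        show "?Z \<bullet> dd (u, 0) f (z, s) = 0" for u
          using afu[OF z] \<eta>n(3)[OF p] n(4)[OF p] by (simp add: inner_diff_left inner_add_left)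
      qed
      then show ?thesis by simp
    qed
    define q where "q = a \<bullet> n (z1, s)"
    define r where "r = a \<bullet> \<eta> (z1, s)"
    have qc: "a \<bullet> n (z, s) = q" if z: "z \<in> D" for z
      unfolding q_def
    proof (rule slice_constant[OF D(2) _ _ z z1, of "\<lambda>p. a \<bullet> n p"])
      fix z' assume z': "z' \<in> D"
      note p = slS[OF z']
      show "(\<lambda>p. a \<bullet> n p) differentiable (at (z', s))" by (rule differentiable_linear[OF bounded_linear_inner_right df(3)[OF p]])
      fix u
      have "a \<bullet> dd (u, 0) n (z', s) = 0"
        by (subst a[OF z']) (use nw[OF p] \<eta>n(2)[OF p] in \<open>simp add: inner_add_left\<close>)
      then show "dd (u, 0) (\<lambda>p. a \<bullet> n p) (z', s) = 0" using dd_linear[OF bounded_linear_inner_right df(3)[OF p]] by simp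
    qed
    have rc: "a \<bullet> \<eta> (z, s) = r" if z: "z \<in> D" for z
      unfolding r_def
    proof (rule slice_constant[OF D(2) _ _ z z1, of "\<lambda>p. a \<bullet> \<eta> p"])
      fix z' assume z': "z' \<in> D"
      note p = slS[OF z']
      show "(\<lambda>p. a \<bullet> \<eta> p) differentiable (at (z', s))" by (rule differentiable_linear[OF bounded_linear_inner_right d\<eta>[OF p]])
      fix u
      have "a \<bullet> dd (u, 0) \<eta> (z', s) = 0"
        by (subst a[OF z']) (use \<eta>u[OF p] in \<open>simp add: inner_add_left\<close>)
      then show "dd (u, 0) (\<lambda>p. a \<bullet> \<eta> p) (z', s) = 0" using dd_linear[OF bounded_linear_inner_right d\<eta>[OF p]] by simp
    qed
    have a': "a = q *\<^sub>R n (z, s) + r *\<^sub>R \<eta> (z, s)" if "z \<in> D" for z using a[OF that] qc[OF that] rc[OF that] by simp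
    note p1 = slS[OF z1]
    have du: "q *\<^sub>R dd (u1, 0) n (z1, s) + r *\<^sub>R dd (u1, 0) \<eta> (z1, s) = 0"
    proof -
      have d1: "(\<lambda>p. q *\<^sub>R n p) differentiable (at (z1, s))" "(\<lambda>p. r *\<^sub>R \<eta> p) differentiable (at (z1, s))"
        using differentiable_linear[OF bounded_linear_scaleR_right] df(3)[OF p1] d\<eta>[OF p1] by auto
      have "dd (u1, 0) (\<lambda>p. q *\<^sub>R n p + r *\<^sub>R \<eta> p) (z1, s) = 0"
        by (rule dd_slice_const[OF differentiable_add[OF d1] D(1) z1]) (rule a'[symmetric])
      then show ?thesis
        using dd_add[OF d1] dd_linear[OF bounded_linear_scaleR_right df(3)[OF p1]]
          dd_linear[OF bounded_linear_scaleR_right d\<eta>[OF p1]] by simp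
    qed
    \<comment> \<open>If \<open>r\<close> vanished, \<open>q n\<close> would be constant on the leaf
      although \<open>n\<close> is an immersion; so \<open>q\<close> and then \<open>a\<close> would
      be zero.\<close>
    have rnz: "r \<noteq> 0"
    proof
      assume r: "r = 0"
      then have "q = 0" using du n1[OF p1] by simp
      then show False using a'[OF z1] r ab(1) by simp
    qed
    have "q * (dd (u1, 0) n (z1, s) \<bullet> dd (u1, 0) n (z1, s)) + r * (dd (u1, 0) \<eta> (z1, s) \<bullet> dd (u1, 0) n (z1, s)) = 0"
      using arg_cong[OF du, of "\<lambda>y. y \<bullet> dd (u1, 0) n (z1, s)"] by (simp add: inner_add_left)
    then have \<mu>: "\<mu> s = q / r" using rnz n1[OF p1] by (simp add: \<mu>_def field_simps)
    have eq: "\<eta> (z, s) + \<mu> s *\<^sub>R n (z, s) = inverse r *\<^sub>R a" if "z \<in> D" for z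
      unfolding \<mu> a'[OF that] using rnz by (simp add: scaleR_add_right divide_inverse mult.commute)
    show ?thesis unfolding c_def eq[OF z] eq[OF z1] ..
  qed
  have "dd (0, 1) n p = \<nu> p *\<^sub>R (c (snd p) - \<mu> (snd p) *\<^sub>R n p)" if p: "p \<in> ?S" for p
  proof -
    have "c (snd p) - \<mu> (snd p) *\<^sub>R n p = \<eta> p"
      using key[of "fst p" "snd p", symmetric] p by auto
    then show ?thesis using ns[OF p] by simp
  qed
  moreover have "(\<nu> p)\<^sup>2 = dd (0, 1) n p \<bullet> dd (0, 1) n p" for p by (simp add: \<nu>_def dot_square_norm)
  ultimately show ?thesis
    using cs \<mu>s \<nu>s \<nu>p nu_ns ns_fu by (intro exI[of _ c] exI[of _ \<mu>] exI[of _ \<nu>]) (auto simp: inner_commute)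
qed

text \<open>\<open>h\<close> inverts the antiderivative \<open>L\<close> of \<open>\<rho>\<close>
  with \<open>L s0 = 0\<close>; this puts 0, the lower limit of the integral in
  \<open>gamma_fun\<close>, into \<open>J\<close>. Smoothness of the inverse is local and is glued
  by \<open>smooth_on_local\<close>.\<close>

lemma arclength_reparametrization:
  fixes \<rho> :: "real \<Rightarrow> real"
  assumes r: "r > 0" and K: "K = {s0 - r<..<s0 + r}" and \<rho>: "smooth_on K \<rho>" "\<And>s. s \<in> K \<Longrightarrow> \<rho> s > 0"
  shows "\<exists>J h. open J \<and> is_interval J \<and> 0 \<in> J \<and> interval_diffeo J K h \<and>
    (\<forall>t\<in>J. h t \<in> K \<and> dd 1 h t > 0 \<and> dd 1 h t * \<rho> (h t) = 1)"
proof -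
  have oK: "open K" and iK: "is_interval K" and s0: "s0 \<in> K" using K r by (auto simp: is_interval_oo)
  have "\<exists>F. \<forall>x. ereal (s0 - r) < ereal x \<longrightarrow> ereal x < ereal (s0 + r) \<longrightarrow> (F has_vector_derivative \<rho> x) (at x)"
  proof (rule einterval_antiderivative)
    show "isCont \<rho> x" if "ereal (s0 - r) < ereal x" "ereal x < ereal (s0 + r)" for x
      using smooth_on_continuous[OF \<rho>(1)] oK that K by (auto simp: continuous_on_eq_continuous_at)
  qed (use r in auto)
  then obtain F where F: "\<And>x. x \<in> K \<Longrightarrow> (F has_vector_derivative \<rho> x) (at x)" by (auto simp: K)
  define L where "L s = F s - F s0" for s
  have L: "(L has_derivative (\<lambda>v. v * \<rho> s)) (at s)" if "s \<in> K" for s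
    using has_derivative_diff[OF F[OF that, unfolded has_vector_derivative_def] has_derivative_const[of "F s0"]]
    by (simp add: L_def[abs_def])
  have Lr: "(L has_real_derivative \<rho> s) (at s)" if "s \<in> K" for s
    using L[OF that] by (simp add: has_field_derivative_def mult_commute_abs)
  have dL: "dd v L s = v * \<rho> s" if "s \<in> K" for s v by (rule dd_eq[OF L[OF that]])
  have Ls: "smooth_on K L"
  proof (rule smooth_onI_dd)
    show "L differentiable (at s)" if "s \<in> K" for s using L[OF that] by (auto simp: differentiable_def)
    fix v
    have "smooth_on K (\<lambda>s. v * \<rho> s)" by (intro smooth_intros oK \<rho>)
    then show "smooth_on K (dd v L)" using smooth_on_cong[OF oK, of "dd v L" "\<lambda>s. v * \<rho> s"] dL by simp
  qed
  have mono: "L a < L b" if "a \<in> K" "b \<in> K" "a < b" for a b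
  proof (rule DERIV_pos_imp_increasing[OF that(3)])
    fix x assume "a \<le> x" "x \<le> b"
    then have "x \<in> K" using mem_is_interval_1_I[OF iK that(1,2)] by blast
    then show "\<exists>y. (L has_real_derivative y) (at x) \<and> y > 0" using Lr \<rho>(2) by blast
  qed
  have inj: "inj_on L K" by (rule linorder_inj_onI) (use mono in force)+
  define J where "J = L ` K"
  define h where "h = inv_into K L"
  have hL: "h (L s) = s" if "s \<in> K" for s using inj that by (simp add: h_def)
  have hK: "h t \<in> K" "L (h t) = t" if "t \<in> J" for t
    using that by (auto simp: J_def h_def inv_into_into f_inv_into_f)
  have injd: "inj (\<lambda>v. dd v L s)" if "s \<in> K" for s
    using \<rho>(2)[OF that] by (auto simp: dL[OF that] inj_def)
  have loc: "\<exists>T. open T \<and> t \<in> T \<and> T \<subseteq> J \<and> smooth_on T h" if t: "t \<in> J" for t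
  proof -
    obtain W where W: "open W" "h t \<in> W" "W \<subseteq> K" "open (L ` W)" "inj_on L W" "smooth_on (L ` W) (inv_into W L)"
      using inverse_function_smooth[OF oK Ls injd hK(1)[OF t]] by blast
    have "h y = inv_into W L y" if "y \<in> L ` W" for y
      using that hL W(3) inv_into_f_f[OF W(5)] by auto
    then have "smooth_on (L ` W) h" using W(4,6) smooth_on_cong[OF W(4), of h "inv_into W L"] by simp
    moreover have "t \<in> L ` W" using W(2) hK(2)[OF t] by (metis imageI)
    ultimately show ?thesis using W by (intro exI[of _ "L ` W"]) (auto simp: J_def)
  qed
  have oJ: "open J" using loc by (subst open_subopen) blast
  have sh: "smooth_on J h" by (rule smooth_on_local) (use loc in blast)
  have iJ: "is_interval J"
    unfolding J_def is_interval_connected_1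
    by (rule connected_continuous_image[OF smooth_on_continuous[OF Ls]]) (use iK in \<open>simp add: is_interval_connected_1\<close>)
  have J0: "0 \<in> J" using s0 by (auto simp: J_def L_def intro!: image_eqI[of _ _ s0])
  have bij: "bij_betw h J K"
    unfolding bij_betw_def
  proof
    show "inj_on h J" using hK(2) by (metis inj_on_inverseI)
    show "h ` J = K" using hK(1) hL by (force simp: J_def)
  qed
  have "inv_into J h s = L s" if s: "s \<in> K" for s
    using hL[OF s] bij s by (metis J_def bij_betw_imp_inj_on imageI inv_into_f_f)
  then have "smooth_on K (inv_into J h)" using Ls smooth_on_cong[OF oK, of "inv_into J h" L] by simp
  then have id: "interval_diffeo J K h" using bij sh by (simp add: interval_diffeo_def)
  have "dd 1 h t > 0 \<and> dd 1 h t * \<rho> (h t) = 1" if t: "t \<in> J" for t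
  proof -
    have dh: "h differentiable (at t)" by (rule smooth_on_differentiable[OF sh t])
    have dl: "L differentiable (at (h t))" by (rule smooth_on_differentiable[OF Ls hK(1)[OF t]])
    have "dd 1 (\<lambda>t. L (h t)) t = dd 1 (\<lambda>t. t) t" by (rule dd_cong[OF oJ t hK(2)])
    then have 1: "dd 1 h t * \<rho> (h t) = 1"
      using dd_compose[OF dh dl, of 1] dL[OF hK(1)[OF t], of "dd 1 h t"] by (simp add: dd_def)
    then show ?thesis using \<rho>(2)[OF hK(1)[OF t]] zero_less_mult_pos2[of "dd 1 h t" "\<rho> (h t)"] by simp
  qed
  then show ?thesis using oJ iJ J0 id hK(1) by blast
qed

lemma reparametrize:
  fixes F :: "'v::euclidean_space \<times> real \<Rightarrow> 'b::euclidean_space"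
  assumes D: "open D" and J: "open J" and K: "open K" and h: "smooth_on J h" "h ` J \<subseteq> K"
    and F: "smooth_on (D \<times> K) F"
  shows "smooth_on (D \<times> J) (\<lambda>p. F (fst p, h (snd p)))"
    "\<And>z t u a. z \<in> D \<Longrightarrow> t \<in> J \<Longrightarrow>
      dd (u, a) (\<lambda>p. F (fst p, h (snd p))) (z, t) = dd (u, 0) F (z, h t) + (a * dd 1 h t) *\<^sub>R dd (0, 1) F (z, h t)"
proof -
  have DJ: "open (D \<times> J)" "open (D \<times> K)" using D J K by (auto simp: open_Times)
  have hs: "smooth_on (D \<times> J) (\<lambda>p. h (snd p))" by (rule smooth_on_comp_snd[OF D J h(1)])
  have ks: "smooth_on (D \<times> J) (\<lambda>p. (fst p, h (snd p)))" by (intro smooth_intros DJ hs)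
  show "smooth_on (D \<times> J) (\<lambda>p. F (fst p, h (snd p)))"
    by (rule smooth_on_compose[OF DJ _ ks F]) (use h(2) in auto)
  fix z t u a assume zt: "z \<in> D" "t \<in> J"
  have dF: "F differentiable (at (z, h t))" by (rule smooth_on_differentiable[OF F]) (use zt h in auto)
  have dh: "h differentiable (at t)" by (rule smooth_on_differentiable[OF h(1) zt(2)])
  have "((\<lambda>p. (fst p, h (snd p))) has_derivative (\<lambda>w. (fst w, dd (snd w) h t))) (at (z, t))"
  proof (intro has_derivative_Pair)
    show "(fst has_derivative fst) (at (z, t))" by (rule bounded_linear_imp_has_derivative[OF bounded_linear_fst])
    show "((\<lambda>p. h (snd p)) has_derivative (\<lambda>w. dd (snd w) h t)) (at (z, t))"
    proof (rule has_derivative_compose[of snd snd "(z, t)" UNIV h "\<lambda>v. dd v h t"])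
      show "(snd has_derivative snd) (at (z, t))" by (rule bounded_linear_imp_has_derivative[OF bounded_linear_snd])
      show "(h has_derivative (\<lambda>v. dd v h t)) (at (snd (z, t)))" unfolding snd_conv by (rule dd_has_derivative[OF dh])
    qed
  qed
  then have k: "dd (u, a) (\<lambda>p. (fst p, h (snd p))) (z, t) = (u, a * dd 1 h t)"
    using dd_eq[of _ _ "(z, t)" "(u, a)"] dd_scaleR_dir[OF dh, of a 1] by fastforce
  have dk: "(\<lambda>p. (fst p, h (snd p))) differentiable (at (z, t))"
    by (rule smooth_on_differentiable[OF ks]) (use zt in auto)
  have "dd (u, a) (\<lambda>p. F (fst p, h (snd p))) (z, t) = dd (u, a * dd 1 h t) F (z, h t)"
    using dd_compose[OF dk, of F "(u, a)"] dF k by simp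
  then show "dd (u, a) (\<lambda>p. F (fst p, h (snd p))) (z, t) = dd (u, 0) F (z, h t) + (a * dd 1 h t) *\<^sub>R dd (0, 1) F (z, h t)"
    using dd_prod_split[OF dF, of u "a * dd 1 h t"] by simp
qed

subsection \<open>Construction of the tube\<close>

lemma interval_constant:
  fixes F :: "real \<Rightarrow> 'b::euclidean_space"
  assumes J: "is_interval J" and F: "\<And>t. t \<in> J \<Longrightarrow> F differentiable (at t)"
    and zero: "\<And>t. t \<in> J \<Longrightarrow> dd 1 F t = 0" and t: "t \<in> J" "t' \<in> J"
  shows "F t = F t'"
proof -
  have "\<exists>k. \<forall>t\<in>J. F t = k"
  proof (rule has_derivative_zero_constant)
    show "convex J" using J by (simp add: is_interval_convex_1)
    fix t assume t: "t \<in> J"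
    have "dd a F t = 0" for a using dd_scaleR_dir[OF F[OF t], of a 1] zero[OF t] by simp
    then show "(F has_derivative (\<lambda>h. 0)) (at t within J)"
      using dd_has_derivative[OF F[OF t]] by (simp add: has_derivative_at_withinI)
  qed
  then show ?thesis using t by auto
qed

text \<open>The leaf vectors \<open>e j\<close> along \<open>\<beta>\<close> all satisfy
  \<open>e' = r \<beta>' - \<mu> e\<close>: the term along \<open>\<beta>'\<close> is invisible to
  the normal connection and the factor \<open>- \<mu>\<close> is common to all \<open>j\<close>.
  Dividing by the common length \<open>\<phi>\<close> therefore gives a parallel orthonormal frame,
  and \<open>\<phi>' = - \<mu> \<phi>\<close> is exactly what makes
  \<open>G \<bullet> \<beta>' = \<phi>'\<close>.\<close>

lemma tube_data:
  fixes N :: "(real^'m) \<times> real \<Rightarrow> 'b::euclidean_space"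
  assumes dim: "DIM('b) = CARD('m) + 2"
    and D: "open D" and J: "open J" "is_interval J" "0 \<in> J"
    and N: "smooth_on (D \<times> J) N" "\<And>p. p \<in> D \<times> J \<Longrightarrow> inj (\<lambda>w. dd w N p)" "\<And>p. p \<in> D \<times> J \<Longrightarrow> N p \<bullet> N p = 1"
    and sm: "smooth_on J c" "smooth_on J \<mu>" "smooth_on (D \<times> J) \<nu>"
    and \<nu>: "\<And>p. p \<in> D \<times> J \<Longrightarrow> \<nu> p > 0" "\<And>p. p \<in> D \<times> J \<Longrightarrow> (\<nu> p)\<^sup>2 = dd (0, 1) N p \<bullet> dd (0, 1) N p"
    and Ns: "\<And>p. p \<in> D \<times> J \<Longrightarrow> dd (0, 1) N p = \<nu> p *\<^sub>R (c (snd p) - \<mu> (snd p) *\<^sub>R N p)"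
    and orth: "\<And>p u. p \<in> D \<times> J \<Longrightarrow> dd (u, 0) N p \<bullet> dd (0, 1) N p = 0"
    and zs: "zs \<in> D" "\<And>t. t \<in> J \<Longrightarrow> \<nu> (zs, t) = 1"
    and D0: "open D0" "D0 \<subseteq> D" "z1 \<in> D0" "\<And>z t. z \<in> D0 \<Longrightarrow> t \<in> J \<Longrightarrow> N (z, t) \<noteq> N (zs, t)"
    and \<beta>_def: "\<beta> = (\<lambda>t. N (zs, t))"
  shows "\<exists>(\<xi> :: 'm \<Rightarrow> real \<Rightarrow> 'b) f0 \<phi> \<omega>. unit_speed_in_sphere J \<beta> \<and> parallel_normal_frame J \<beta> \<xi> \<and>
    ribaucour_pair J \<beta> \<phi> \<omega> \<and> smooth_on D0 f0 \<and> (\<forall>z\<in>D0. inj (\<lambda>u. dd u f0 z)) \<and>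
    (\<forall>z\<in>D0. \<forall>t\<in>J. N (z, t) = \<beta> t - (2 * \<phi> t / (norm (tube_vector \<beta> \<xi> f0 \<phi> \<omega> z t))\<^sup>2) *\<^sub>R tube_vector \<beta> \<xi> f0 \<phi> \<omega> z t) \<and>
    smooth_on J \<phi> \<and> (\<forall>t\<in>J. \<phi> t > 0 \<and> dd 1 \<phi> t = - \<mu> t * \<phi> t)"
proof -
  let ?S = "D \<times> J"
  have S: "open ?S" using D J by (simp add: open_Times)
  note d = smooth_on_differentiable
  have inS: "(z, t) \<in> ?S" if "z \<in> D" "t \<in> J" for z t using that by simp
  have dN: "N differentiable (at p)" "dd w N differentiable (at p)" if "p \<in> ?S" for p w
    using d[OF N(1) that] d[OF smooth_on_dd[OF N(1)] that] by auto
  have Nw: "N p \<bullet> dd w N p = 0" if "p \<in> ?S" for p w by (rule unit_derivative[OF S N(1,3) that])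
  \<comment> \<open>From \<open>Ns\<close> and \<open>N \<bullet> \<partial>\<^sub>t N = 0\<close>:
    the leaf at \<open>t\<close> lies in a hyperplane with normal \<open>c t\<close>.\<close>
  have Nc: "N (z, t) \<bullet> c t = \<mu> t" if "z \<in> D" "t \<in> J" for z t
    using Nw[OF inS[OF that], of "(0, 1)"] Ns[OF inS[OF that]] \<nu>(1)[OF inS[OF that]] N(3)[OF inS[OF that]]
    by (simp add: inner_diff_right)
  have \<beta>s: "smooth_on J \<beta>" unfolding \<beta>_def by (rule smooth_on_slice_snd[OF D J(1) zs(1) N(1)])
  have d\<beta>: "\<beta> differentiable (at t)" if "t \<in> J" for t by (rule d[OF \<beta>s that])
  have \<beta>1: "dd 1 \<beta> t = c t - \<mu> t *\<^sub>R \<beta> t" if t: "t \<in> J" for t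
    using dd_slice_snd(1)[OF dN(1)[OF inS[OF zs(1) t]]] Ns[OF inS[OF zs(1) t]] zs(2)[OF t] by (simp add: \<beta>_def)
  have bb: "\<beta> t \<bullet> \<beta> t = 1" "\<beta> t \<bullet> dd 1 \<beta> t = 0" "dd 1 \<beta> t \<bullet> dd 1 \<beta> t = 1" if t: "t \<in> J" for t
  proof -
    note p = inS[OF zs(1) t]
    have e: "dd 1 \<beta> t = dd (0, 1) N (zs, t)" using dd_slice_snd(1)[OF dN(1)[OF p]] by (simp add: \<beta>_def)
    show "\<beta> t \<bullet> \<beta> t = 1" using N(3)[OF p] by (simp add: \<beta>_def)
    show "\<beta> t \<bullet> dd 1 \<beta> t = 0" unfolding e using Nw[OF p] by (simp add: \<beta>_def)
    show "dd 1 \<beta> t \<bullet> dd 1 \<beta> t = 1" unfolding e using \<nu>(2)[OF p] zs(2)[OF t] by simp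
  qed
  have vel: "velocity \<beta> t = dd 1 \<beta> t" if "t \<in> J" for t by (rule velocity_eq_dd[OF d\<beta>[OF that]])
  have us: "unit_speed_in_sphere J \<beta>"
    using \<beta>s bb by (auto simp: unit_speed_in_sphere_def vel norm_eq_sqrt_inner)
  \<comment> \<open>an orthonormal frame of the leaf through \<open>(zs, 0)\<close>, transported by the flow of \<open>\<partial>\<^sub>t\<close>\<close>
  define g where "g u = dd (u, 0) N (zs, 0)" for u
  note p0 = inS[OF zs(1) J(3)]
  have lg: "linear g"
  proof (rule linearI)
    show "g (u + v) = g u + g v" for u v using dd_add_dir[OF dN(1)[OF p0], of "(u, 0)" "(v, 0)"] by (simp add: g_def)
    show "g (r *\<^sub>R u) = r *\<^sub>R g u" for r u using dd_scaleR_dir[OF dN(1)[OF p0], of r "(u, 0)"] by (simp add: g_def)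
  qed
  have ig: "inj g"
  proof (rule injI)
    fix u v assume "g u = g v"
    then have "(u, 0 :: real) = (v, 0)" using N(2)[OF p0] unfolding g_def by (metis injD)
    then show "u = v" by simp
  qed
  have "dim (range g) = CARD('m)" using dim_image_eq[OF lg, of UNIV] ig by (simp add: dim_UNIV)
  then obtain B where B: "B \<subseteq> range g" "pairwise orthogonal B" "\<And>x. x \<in> B \<Longrightarrow> norm x = 1" "independent B" "card B = CARD('m)"
    using orthonormal_basis_subspace[OF linear_subspace_image[OF lg subspace_UNIV]] by metis
  have "finite B" using B(4) independent_imp_finite by blast
  then obtain b where b: "bij_betw b (UNIV :: 'm set) B" using B(5) finite_same_card_bij[of "UNIV :: 'm set" B] by auto
  have "\<forall>j. \<exists>x. g x = b j" using b B(1) by (metis bij_betwE UNIV_I imageE subsetD)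
  then obtain X where X: "\<And>j. g (X j) = b j" by metis
  have gX: "g (X i) \<bullet> g (X j) = (if i = j then 1 else 0)" for i j
  proof (cases "i = j")
    case True
    have "b j \<in> B" using b by (auto simp: bij_betw_def)
    then show ?thesis using True B(3) by (simp add: X dot_square_norm)
  next
    case False
    have "b i \<in> B" "b j \<in> B" "b i \<noteq> b j" using b False by (auto simp: bij_betw_def inj_def)
    then show ?thesis using B(2) False by (auto simp: X pairwise_def orthogonal_def)
  qed
  define e where "e j t = dd (X j, 0) N (zs, t)" for j t
  have es: "smooth_on J (e j)" for j unfolding e_def[abs_def] by (rule smooth_on_slice_snd[OF D J(1) zs(1) smooth_on_dd[OF N(1)]])
  have de: "e j differentiable (at t)" if "t \<in> J" for j t by (rule d[OF es that])
  define r where "r j t = dd (X j, 0) \<nu> (zs, t)" for j t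
  \<comment> \<open>Differentiate \<open>Ns\<close> along \<open>X j\<close>; \<open>c\<close> and
    \<open>\<mu>\<close> depend on \<open>t\<close> only, so just \<open>\<nu>\<close> and
    \<open>N\<close> contribute.\<close>
  have e1: "dd 1 (e j) t = r j t *\<^sub>R dd 1 \<beta> t - \<mu> t *\<^sub>R e j t" if t: "t \<in> J" for j t
  proof -
    note p = inS[OF zs(1) t]
    have ds: "\<mu> differentiable (at t)" "c differentiable (at t)" using d[OF sm(2) t] d[OF sm(1) t] by auto
    have cs: "(\<lambda>p. c (snd p)) differentiable (at (zs, t))" "(\<lambda>p. \<mu> (snd p)) differentiable (at (zs, t))"
      using d[OF smooth_on_comp_snd[OF D J(1) sm(1)] p] d[OF smooth_on_comp_snd[OF D J(1) sm(2)] p] by auto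
    have c0: "dd (X j, 0) (\<lambda>p. c (snd p)) (zs, t) = 0" "dd (X j, 0) (\<lambda>p. \<mu> (snd p)) (zs, t) = 0"
      using dd_snd[of c "(zs, t)" "X j" 0] dd_snd[of \<mu> "(zs, t)" "X j" 0] ds dd_zero_dir by auto
    have d\<nu>: "\<nu> differentiable (at (zs, t))" by (rule d[OF sm(3) p])
    have dmN: "(\<lambda>p. \<mu> (snd p) *\<^sub>R N p) differentiable (at (zs, t))"
      by (rule d[OF smooth_on_scaleR[OF S smooth_on_comp_snd[OF D J(1) sm(2)] N(1)] p])
    have dcm: "(\<lambda>p. c (snd p) - \<mu> (snd p) *\<^sub>R N p) differentiable (at (zs, t))"
      by (rule differentiable_diff[OF cs(1) dmN])
    have "dd 1 (e j) t = dd (0, 1) (dd (X j, 0) N) (zs, t)"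
      unfolding e_def[abs_def] using dd_slice_snd(1)[OF dN(2)[OF p]] by simp
    also have "\<dots> = dd (X j, 0) (dd (0, 1) N) (zs, t)" by (rule dd_symmetric[OF S p N(1)])
    also have "\<dots> = dd (X j, 0) (\<lambda>p. \<nu> p *\<^sub>R (c (snd p) - \<mu> (snd p) *\<^sub>R N p)) (zs, t)" by (rule dd_cong[OF S p Ns])
    also have "\<dots> = \<nu> (zs, t) *\<^sub>R dd (X j, 0) (\<lambda>p. c (snd p) - \<mu> (snd p) *\<^sub>R N p) (zs, t) + r j t *\<^sub>R (c t - \<mu> t *\<^sub>R N (zs, t))"
      using dd_scaleR[OF d\<nu> dcm, of "(X j, 0)"] by (simp add: r_def)
    also have "dd (X j, 0) (\<lambda>p. c (snd p) - \<mu> (snd p) *\<^sub>R N p) (zs, t) = - (\<mu> t *\<^sub>R e j t)"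
      using dd_diff[OF cs(1) dmN, of "(X j, 0)"] dd_scaleR[OF cs(2) dN(1)[OF p], of "(X j, 0)"] c0 by (simp add: e_def)
    finally show ?thesis using zs(2)[OF t] \<beta>1[OF t] by (simp add: \<beta>_def)
  qed
  have eb: "e j t \<bullet> \<beta> t = 0" "e j t \<bullet> dd 1 \<beta> t = 0" if t: "t \<in> J" for j t
    using Nw[OF inS[OF zs(1) t], of "(X j, 0)"] orth[OF inS[OF zs(1) t], of "X j"]
      dd_slice_snd(1)[OF dN(1)[OF inS[OF zs(1) t]]] by (auto simp: e_def \<beta>_def inner_commute)
  \<comment> \<open>Any index serves: all the \<open>e j\<close> have the same length, since their
    squared lengths start at 1 and obey one linear equation.\<close>
  define j0 :: 'm where "j0 = undefined"
  define \<phi> where "\<phi> t = norm (e j0 t)" for t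
  have enz: "e j0 t \<noteq> 0" if t: "t \<in> J" for t
  proof
    assume "e j0 t = 0"
    then have "dd (X j0, 0) N (zs, t) = dd 0 N (zs, t)" using dd_zero_dir[OF dN(1)[OF inS[OF zs(1) t]]] by (simp add: e_def)
    then have "(X j0, 0 :: real) = 0" using N(2)[OF inS[OF zs(1) t]] by (metis injD)
    then have "X j0 = 0" by (simp add: zero_prod_def)
    then show False using gX[of j0 j0] linear_0[OF lg] by simp
  qed
  have \<phi>p: "\<phi> t > 0" if "t \<in> J" for t using enz[OF that] by (simp add: \<phi>_def)
  have \<phi>s: "smooth_on J \<phi>" unfolding \<phi>_def[abs_def] by (intro smooth_intros J es enz)
  have d\<phi>: "\<phi> differentiable (at t)" if "t \<in> J" for t by (rule d[OF \<phi>s that])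
  have \<phi>1: "dd 1 \<phi> t = - \<mu> t * \<phi> t" if t: "t \<in> J" for t
  proof -
    have "dd 1 (\<lambda>t. \<phi> t * \<phi> t) t = dd 1 (\<lambda>t. e j0 t \<bullet> e j0 t) t"
      by (rule dd_cong[OF J(1) t]) (simp add: \<phi>_def dot_square_norm power2_eq_square)
    then have "2 * \<phi> t * dd 1 \<phi> t = 2 * (e j0 t \<bullet> dd 1 (e j0) t)"
      using dd_mult[OF d\<phi>[OF t] d\<phi>[OF t], of 1] dd_inner[OF de[OF t] de[OF t], of 1] by (simp add: inner_commute)
    also have "\<dots> = - 2 * \<mu> t * (\<phi> t * \<phi> t)"
      using eb[OF t, of j0] by (simp add: e1[OF t] inner_diff_right \<phi>_def dot_square_norm power2_eq_square)
    finally have "\<phi> t * dd 1 \<phi> t = \<phi> t * (- \<mu> t * \<phi> t)" by (simp add: mult_ac)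
    then show ?thesis using \<phi>p[OF t] by (subst (asm) mult_cancel_left) simp
  qed
  define \<xi> where "\<xi> j t = inverse (\<phi> t) *\<^sub>R e j t" for j t
  have \<xi>s: "smooth_on J (\<xi> j)" for j unfolding \<xi>_def[abs_def]
    by (intro smooth_intros J \<phi>s es) (use \<phi>p in force)
  have d\<xi>: "\<xi> j differentiable (at t)" if "t \<in> J" for j t by (rule d[OF \<xi>s that])
  have \<xi>b: "\<xi> j t \<bullet> \<beta> t = 0" "\<xi> j t \<bullet> dd 1 \<beta> t = 0" if "t \<in> J" for j t using eb[OF that] by (auto simp: \<xi>_def)
  have \<xi>b': "\<beta> t \<bullet> \<xi> j t = 0" "dd 1 \<beta> t \<bullet> \<xi> j t = 0" if "t \<in> J" for j t
    using \<xi>b[OF that] by (simp_all add: inner_commute)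
  have \<xi>1: "dd 1 (\<xi> j) t = (r j t / \<phi> t) *\<^sub>R dd 1 \<beta> t" if t: "t \<in> J" for j t
  proof -
    have nz: "\<phi> t \<noteq> 0" using \<phi>p[OF t] by simp
    have di: "(\<lambda>t. inverse (\<phi> t)) differentiable (at t)"
      by (rule d[of J, OF _ t]) (intro smooth_intros J \<phi>s, use \<phi>p in force)
    have "dd 1 (\<xi> j) t = inverse (\<phi> t) *\<^sub>R dd 1 (e j) t + dd 1 (\<lambda>t. inverse (\<phi> t)) t *\<^sub>R e j t"
      unfolding \<xi>_def[abs_def] by (rule dd_scaleR[OF di de[OF t]])
    also have "dd 1 (\<lambda>t. inverse (\<phi> t)) t = \<mu> t * inverse (\<phi> t)"
      using dd_inverse[OF d\<phi>[OF t] nz, of 1] nz \<phi>1[OF t] by simp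
    finally show ?thesis by (simp add: e1[OF t] divide_inverse algebra_simps)
  qed
  \<comment> \<open>Orthonormal at \<open>t = 0\<close> by the choice of \<open>X\<close>, where
    \<open>\<phi> 0 = 1\<close>; the products are constant because \<open>\<xi>'\<close> is parallel
    to \<open>\<beta>'\<close>.\<close>
  have \<xi>\<xi>: "\<xi> i t \<bullet> \<xi> j t = (if i = j then 1 else 0)" if t: "t \<in> J" for i j t
  proof -
    have "\<xi> i t \<bullet> \<xi> j t = \<xi> i 0 \<bullet> \<xi> j 0"
    proof (rule interval_constant[OF J(2) _ _ t J(3), of "\<lambda>t. \<xi> i t \<bullet> \<xi> j t"])
      fix t assume t: "t \<in> J"
      show "(\<lambda>t. \<xi> i t \<bullet> \<xi> j t) differentiable (at t)" by (rule d[OF smooth_on_inner[OF J(1) \<xi>s \<xi>s] t])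
      show "dd 1 (\<lambda>t. \<xi> i t \<bullet> \<xi> j t) t = 0"
        using dd_inner[OF d\<xi>[OF t] d\<xi>[OF t], of 1 i j] \<xi>b[OF t] by (simp add: \<xi>1[OF t] inner_commute)
    qed
    moreover have "\<phi> 0 = 1" using gX[of j0 j0] by (simp add: \<phi>_def e_def g_def norm_eq_sqrt_inner)
    ultimately show ?thesis using gX[of i j] by (simp add: \<xi>_def e_def g_def)
  qed
  have \<xi>sum: "(\<Sum>j\<in>UNIV. x j * (\<xi> j t \<bullet> \<xi> i t)) = x i" if t: "t \<in> J" for x i t
  proof -
    have "(\<Sum>j\<in>UNIV. x j * (\<xi> j t \<bullet> \<xi> i t)) = (\<Sum>j\<in>UNIV. if j = i then x j else 0)"
      by (rule sum.cong) (auto simp: \<xi>\<xi>[OF t])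
    then show ?thesis by simp
  qed
  \<comment> \<open>\<open>\<beta>\<close>, \<open>\<beta>'\<close> and the \<open>\<xi> j\<close>
    are \<open>CARD('m) + 2\<close> orthonormal vectors, hence a basis; vectors along the curve can
    be compared componentwise.\<close>
  have expand: "y = (y \<bullet> \<beta> t) *\<^sub>R \<beta> t + (y \<bullet> dd 1 \<beta> t) *\<^sub>R dd 1 \<beta> t + (\<Sum>j\<in>UNIV. (y \<bullet> \<xi> j t) *\<^sub>R \<xi> j t)"
    if t: "t \<in> J" for y t
  proof -
    define L where "L u = (\<Sum>j\<in>UNIV. (u $ j) *\<^sub>R \<xi> j t)" for u :: "real^'m"
    have Lx: "L u \<bullet> \<xi> i t = u $ i" for u i
      by (simp add: L_def inner_sum_left \<xi>sum[OF t])
    have linL: "linear L"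
      by (rule linearI) (simp_all add: L_def scaleR_add_left sum.distrib scaleR_sum_right)
    have injL: "inj L" by (rule injI) (metis Lx vec_eq_iff)
    have Lb: "\<beta> t \<bullet> L u = 0" "dd 1 \<beta> t \<bullet> L u = 0" for u
      using \<xi>b[OF t] by (simp_all add: L_def inner_sum_right inner_commute)
    let ?y = "y - (y \<bullet> \<beta> t) *\<^sub>R \<beta> t - (y \<bullet> dd 1 \<beta> t) *\<^sub>R dd 1 \<beta> t"
    have "?y \<in> range L"
    proof (rule range_eq_codim2[OF linL injL _ _ _ bb(2)[OF t] Lb])
      show "\<beta> t \<noteq> 0" "dd 1 \<beta> t \<noteq> 0" using bb[OF t] by auto
      show "\<beta> t \<bullet> ?y = 0" "dd 1 \<beta> t \<bullet> ?y = 0"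
        using bb[OF t] by (simp_all add: inner_diff_right inner_commute)
    qed (use dim in simp)
    then obtain u where u: "?y = L u" by (rule rangeE)
    have "u $ j = y \<bullet> \<xi> j t" for j
      using arg_cong[OF u, of "\<lambda>v. v \<bullet> \<xi> j t"] \<xi>b'[OF t, of j] by (simp add: Lx inner_diff_left)
    then have "?y = (\<Sum>j\<in>UNIV. (y \<bullet> \<xi> j t) *\<^sub>R \<xi> j t)" by (simp add: u L_def)
    then show ?thesis by (simp add: algebra_simps)
  qed
  have eqI: "y = y'" if t: "t \<in> J" and "y \<bullet> \<beta> t = y' \<bullet> \<beta> t" "y \<bullet> dd 1 \<beta> t = y' \<bullet> dd 1 \<beta> t" "\<And>j. y \<bullet> \<xi> j t = y' \<bullet> \<xi> j t" for y y' t
    using expand[OF t, of y] expand[OF t, of y'] that(2-4) by simp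
  have npart: "normal_part \<beta> t y \<bullet> \<beta> t = 0" "normal_part \<beta> t y \<bullet> dd 1 \<beta> t = 0" "normal_part \<beta> t y \<bullet> \<xi> j t = y \<bullet> \<xi> j t"
    if t: "t \<in> J" for t y j
    using bb[OF t] \<xi>b'[OF t, of j]
    by (simp_all add: normal_part_def vel[OF t] inner_diff_left inner_commute[of "dd 1 \<beta> t" "\<beta> t"])
  have frame: "parallel_normal_frame J \<beta> \<xi>"
    unfolding parallel_normal_frame_def normal_field_def
  proof (intro conjI allI ballI \<xi>s)
    fix t assume t: "t \<in> J"
    show "\<xi> j t \<bullet> \<beta> t = 0" "\<xi> j t \<bullet> velocity \<beta> t = 0" for j using \<xi>b[OF t] vel[OF t] by auto
    show "\<xi> i t \<bullet> \<xi> j t = (if i = j then 1 else 0)" for i j by (rule \<xi>\<xi>[OF t])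
    show "normal_connection \<beta> (\<xi> j) t a = 0" for j a
      unfolding normal_connection_def velocity_eq_dd[OF d\<xi>[OF t]] \<xi>1[OF t]
      using bb[OF t] by (simp add: normal_part_def vel[OF t] inner_commute)
  qed
  define q where "q p = 1 - N p \<bullet> \<beta> (snd p)" for p
  have \<beta>snd: "smooth_on ?S (\<lambda>p. \<beta> (snd p))" by (rule smooth_on_comp_snd[OF D J(1) \<beta>s])
  have qs: "smooth_on ?S q" unfolding q_def[abs_def] by (intro smooth_intros S N \<beta>snd)
  have D0J: "open (D0 \<times> J)" "D0 \<times> J \<subseteq> ?S" using D0 J by (auto simp: open_Times)
  have qp: "q (z, t) > 0" if z: "z \<in> D0" and t: "t \<in> J" for z t
  proof -
    have "(N (z, t) - \<beta> t) \<bullet> (N (z, t) - \<beta> t) = 2 * q (z, t)"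
      using N(3)[OF inS[of z t]] bb(1)[OF t] z t D0(2)
      by (auto simp: q_def inner_diff_left inner_diff_right inner_commute)
    moreover have "N (z, t) - \<beta> t \<noteq> 0" using D0(4)[OF z t] by (simp add: \<beta>_def)
    ultimately show ?thesis by (metis inner_gt_zero_iff zero_less_mult_pos zero_less_numeral)
  qed
  \<comment> \<open>The tube formula forces \<open>G\<close> to be the multiple of
    \<open>\<beta> - N\<close> with \<open>G \<bullet> \<beta> = \<phi>\<close>, and
    \<open>(\<beta> - N) \<bullet> \<beta> = q\<close>.\<close>
  define G where "G p = (\<phi> (snd p) / q p) *\<^sub>R (\<beta> (snd p) - N p)" for p
  have Gs: "smooth_on (D0 \<times> J) G"
    unfolding G_def[abs_def]
    by (intro smooth_intros D0J smooth_on_subset[OF qs D0J(2)] smooth_on_subset[OF N(1) D0J(2)]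
        smooth_on_subset[OF \<beta>snd D0J(2)] smooth_on_comp_snd[OF D0(1) J(1) \<phi>s]) (use qp in force)
  have Nb: "N (z, t) \<bullet> \<beta> t = 1 - q (z, t)" for z t by (simp add: q_def)
  have Nb1: "N (z, t) \<bullet> dd 1 \<beta> t = \<mu> t * q (z, t)" if "z \<in> D" "t \<in> J" for z t
    by (simp add: \<beta>1[OF that(2)] inner_diff_right Nc[OF that] Nb right_diff_distrib)
  have Gb: "G (z, t) \<bullet> \<beta> t = \<phi> t" "G (z, t) \<bullet> dd 1 \<beta> t = dd 1 \<phi> t" if z: "z \<in> D0" and t: "t \<in> J" for z t
    using bb[OF t] Nb[of z t] Nb1[of z t] qp[OF z t] z t D0(2) \<phi>1[OF t]
    by (auto simp: G_def inner_diff_left)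
  have dG: "(\<lambda>t. G (z, t)) differentiable (at t)" if "z \<in> D0" "t \<in> J" for z t
    by (rule d[OF smooth_on_slice_snd[OF D0(1) J(1) that(1) Gs] that(2)])
  \<comment> \<open>The terms with \<open>c\<close> combine into \<open>\<beta>'\<close>:
    \<open>\<beta>' - \<partial>\<^sub>t N + \<nu> \<mu> (\<beta> - N) = (1 - \<nu>)
    \<beta>'\<close>.\<close>
  have G1: "dd 1 (\<lambda>t. G (z, t)) t = (\<phi> t / q (z, t) * (1 - \<nu> (z, t))) *\<^sub>R dd 1 \<beta> t" if z: "z \<in> D0" and t: "t \<in> J" for z t
  proof -
    have zD: "z \<in> D" using z D0 by auto
    note p = inS[OF zD t]
    let ?q = "\<lambda>t. q (z, t)" and ?N = "\<lambda>t. N (z, t)"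
    have N1: "dd 1 ?N t = \<nu> (z, t) *\<^sub>R (c t - \<mu> t *\<^sub>R N (z, t))" "?N differentiable (at t)"
      using dd_slice_snd[OF dN(1)[OF p]] Ns[OF p] by auto
    have dq: "?q differentiable (at t)" by (rule d[OF smooth_on_slice_snd[OF D J(1) zD qs] t])
    have bc: "\<beta> t \<bullet> c t = \<mu> t" using Nc[OF zs(1) t] by (simp add: \<beta>_def)
    have "dd 1 ?q t = - (N (z, t) \<bullet> dd 1 \<beta> t + dd 1 ?N t \<bullet> \<beta> t)"
    proof -
      have "dd 1 ?q t = dd 1 (\<lambda>t. 1 - ?N t \<bullet> \<beta> t) t" by (simp add: q_def)
      also have "\<dots> = - dd 1 (\<lambda>t. ?N t \<bullet> \<beta> t) t"
        using dd_diff[of "\<lambda>t. 1" t "\<lambda>t. ?N t \<bullet> \<beta> t" 1]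
          d[OF smooth_on_inner[OF J(1) smooth_on_slice_snd[OF D J(1) zD N(1)] \<beta>s] t] by simp
      finally show ?thesis using dd_inner[OF N1(2) d\<beta>[OF t], of 1] by simp
    qed
    also have "dd 1 ?N t \<bullet> \<beta> t = \<nu> (z, t) * \<mu> t * q (z, t)"
      unfolding N1 by (simp add: inner_diff_left Nb bc[unfolded inner_commute[of "\<beta> t"]] right_diff_distrib mult.assoc)
    also have "N (z, t) \<bullet> dd 1 \<beta> t = \<mu> t * q (z, t)" by (rule Nb1[OF zD t])
    finally have q1: "dd 1 ?q t = - (\<mu> t * q (z, t) + \<nu> (z, t) * \<mu> t * q (z, t))" .
    have qnz: "q (z, t) \<noteq> 0" using qp[OF z t] by simp
    have f1: "dd 1 (\<lambda>t. \<phi> t / ?q t) t = \<phi> t / q (z, t) * (\<nu> (z, t) * \<mu> t)"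
      unfolding dd_divide[OF d\<phi>[OF t] dq qnz, of 1] q1 \<phi>1[OF t] using qnz by (simp add: field_simps power2_eq_square)
    have df: "(\<lambda>t. \<phi> t / ?q t) differentiable (at t)" by (rule differentiable_divide[OF d\<phi>[OF t] dq qnz])
    have db: "(\<lambda>t. \<beta> t - ?N t) differentiable (at t)" by (rule differentiable_diff[OF d\<beta>[OF t] N1(2)])
    have "dd 1 (\<lambda>t. G (z, t)) t = (\<phi> t / q (z, t)) *\<^sub>R (dd 1 \<beta> t - dd 1 ?N t)
        + (\<phi> t / q (z, t) * (\<nu> (z, t) * \<mu> t)) *\<^sub>R (\<beta> t - N (z, t))"
      unfolding G_def fst_conv snd_conv using dd_scaleR[OF df db, of 1] dd_diff[OF d\<beta>[OF t] N1(2), of 1] by (simp add: f1)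
    also have "\<dots> = (\<phi> t / q (z, t)) *\<^sub>R (dd 1 \<beta> t - dd 1 ?N t + (\<nu> (z, t) * \<mu> t) *\<^sub>R (\<beta> t - N (z, t)))"
      by (simp add: scaleR_add_right)
    also have "dd 1 \<beta> t - dd 1 ?N t + (\<nu> (z, t) * \<mu> t) *\<^sub>R (\<beta> t - N (z, t)) = (1 - \<nu> (z, t)) *\<^sub>R dd 1 \<beta> t"
      unfolding N1(1) \<beta>1[OF t] by (simp add: algebra_simps)
    finally show ?thesis by simp
  qed
  \<comment> \<open>The derivative does not involve \<open>z\<close>:
    \<open>G' \<bullet> \<xi>\<close> vanishes and \<open>G \<bullet> \<xi>'\<close> only sees
    \<open>G \<bullet> \<beta>' = \<phi>'\<close>.\<close>
  have gj: "dd 1 (\<lambda>t. G (z, t) \<bullet> \<xi> j t) t = r j t / \<phi> t * dd 1 \<phi> t"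
    "(\<lambda>t. G (z, t) \<bullet> \<xi> j t) differentiable (at t)" if z: "z \<in> D0" and t: "t \<in> J" for z t j
  proof -
    show "dd 1 (\<lambda>t. G (z, t) \<bullet> \<xi> j t) t = r j t / \<phi> t * dd 1 \<phi> t"
      using dd_inner[OF dG[OF z t] d\<xi>[OF t], of 1 j] Gb(2)[OF z t] \<xi>b(2)[OF t, of j]
      by (simp add: G1[OF z t] \<xi>1[OF t] inner_commute)
    show "(\<lambda>t. G (z, t) \<bullet> \<xi> j t) differentiable (at t)"
      by (rule d[OF smooth_on_inner[OF J(1) smooth_on_slice_snd[OF D0(1) J(1) z Gs] \<xi>s] t])
  qed
  \<comment> \<open>Normal part of \<open>G\<close> over the reference point \<open>z1\<close>; by
    \<open>gj\<close> its frame components differ from those over \<open>z\<close> by constants in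
    \<open>t\<close>, which become the components of \<open>f0 z\<close>.\<close>
  define \<omega> where "\<omega> t = (\<Sum>j\<in>UNIV. (G (z1, t) \<bullet> \<xi> j t) *\<^sub>R \<xi> j t)" for t
  have \<omega>s: "smooth_on J \<omega>" unfolding \<omega>_def[abs_def]
    by (intro smooth_on_sum smooth_on_scaleR smooth_on_inner J \<xi>s smooth_on_slice_snd[OF D0(1) J(1) D0(3) Gs])
  have \<omega>b: "\<omega> t \<bullet> \<beta> t = 0" "\<omega> t \<bullet> dd 1 \<beta> t = 0" "\<omega> t \<bullet> \<xi> j t = G (z1, t) \<bullet> \<xi> j t" if t: "t \<in> J" for t j
    using \<xi>b[OF t] by (simp_all add: \<omega>_def inner_sum_left \<xi>sum[OF t])
  have d\<omega>: "\<omega> differentiable (at t)" if "t \<in> J" for t by (rule d[OF \<omega>s that])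
  have rp: "ribaucour_pair J \<beta> \<phi> \<omega>"
    unfolding ribaucour_pair_def normal_field_def
  proof (intro conjI ballI allI \<phi>s \<omega>s)
    fix t assume t: "t \<in> J"
    show "\<omega> t \<bullet> \<beta> t = 0" "\<omega> t \<bullet> velocity \<beta> t = 0" using \<omega>b[OF t] vel[OF t] by auto
    fix a
    have db1: "dd 1 \<beta> differentiable (at t)" by (rule d[OF smooth_on_dd[OF \<beta>s] t])
    have "velocity \<beta> differentiable (at t)"
      using differentiable_cong_open[of J t "velocity \<beta>" "dd 1 \<beta>", OF J(1) t vel] db1 by simp
    then have vv: "velocity (velocity \<beta>) t = dd 1 (dd 1 \<beta>) t"
      using velocity_eq_dd[of "velocity \<beta>" t] dd_cong[of J t "velocity \<beta>" "dd 1 \<beta>" 1, OF J(1) t vel] by simp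
    \<comment> \<open>\<open>\<beta>'' \<bullet> \<xi> = - \<beta>' \<bullet> \<xi>'\<close>;
      multiplied by \<open>\<phi>'\<close> this is the negative of \<open>w1\<close>.\<close>
    have b2: "dd 1 (dd 1 \<beta>) t \<bullet> \<xi> j t = - (r j t / \<phi> t)" for j
    proof -
      have "dd 1 (\<lambda>t. \<xi> j t \<bullet> dd 1 \<beta> t) t = dd 1 (\<lambda>t. 0) t" by (rule dd_cong[OF J(1) t \<xi>b(2)])
      then show ?thesis using dd_inner[OF d\<xi>[OF t] db1, of 1 j] bb(3)[OF t] by (simp add: \<xi>1[OF t] inner_commute)
    qed
    have w1: "dd 1 \<omega> t \<bullet> \<xi> j t = r j t / \<phi> t * dd 1 \<phi> t" for j
    proof -
      have "dd 1 (\<lambda>t. \<omega> t \<bullet> \<xi> j t) t = dd 1 (\<lambda>t. G (z1, t) \<bullet> \<xi> j t) t" by (rule dd_cong[OF J(1) t \<omega>b(3)])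
      then show ?thesis
        using dd_inner[OF d\<omega>[OF t] d\<xi>[OF t], of 1 j] \<omega>b(2)[OF t] gj(1)[OF D0(3) t] by (simp add: \<xi>1[OF t])
    qed
    show "curve_second_form \<beta> t (deriv \<phi> t) a + normal_connection \<beta> \<omega> t a = 0"
      unfolding curve_second_form_def normal_connection_def vv velocity_eq_dd[OF d\<omega>[OF t]] deriv_eq_dd[OF d\<phi>[OF t]]
      by (rule eqI[OF t]) (simp_all add: inner_add_left npart[OF t] b2 w1)
  qed
  define hj where "hj j z = G (z, 0) \<bullet> \<xi> j 0 - G (z1, 0) \<bullet> \<xi> j 0" for j z
  define f0 where "f0 z = (\<Sum>j\<in>UNIV. hj j z *\<^sub>R (axis j 1 :: real^'m))" for z
  have f0j: "f0 z $ i = hj i z" for z i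
    by (simp add: f0_def axis_def if_distrib cong: if_cong)
  have G0s: "smooth_on D0 (\<lambda>z. G (z, 0))" by (rule smooth_on_slice[OF D0(1) J(1) J(3) Gs])
  have hjs: "smooth_on D0 (hj j)" for j unfolding hj_def[abs_def]
    by (intro smooth_on_diff smooth_on_inner smooth_on_const D0 G0s)
  have f0s: "smooth_on D0 f0" unfolding f0_def[abs_def] by (intro smooth_on_sum smooth_on_scaleR smooth_on_const D0 hjs)
  \<comment> \<open>On a leaf the components of \<open>G\<close> along \<open>\<beta>\<close> and
    \<open>\<beta>'\<close> are constant, so \<open>df0 u = 0\<close> gives \<open>dG u = 0\<close>.
    Then \<open>dN u\<close> is a multiple of \<open>G\<close>; but
    \<open>N \<bullet> dN u = 0\<close> while \<open>N \<bullet> G = - \<phi>\<close> is nonzero, so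
    \<open>dN u = 0\<close>.\<close>
  have f0inj: "inj (\<lambda>u. dd u f0 z)" if z: "z \<in> D0" for z
    unfolding linear_injective_0[OF linear_dd[OF d[OF f0s z]]]
  proof (intro allI impI)
    fix u assume u: "dd u f0 z = 0"
    let ?G = "\<lambda>z. G (z, 0)"
    have dG0: "?G differentiable (at z)" by (rule d[OF G0s z])
    have zD: "z \<in> D" using z D0 by auto
    note p = inS[OF zD J(3)]
    have Gu: "dd u ?G z = 0"
    proof (rule eqI[OF J(3)])
      have "dd u (\<lambda>z. ?G z \<bullet> \<beta> 0) z = dd u (\<lambda>z. \<phi> 0) z" by (rule dd_cong[OF D0(1) z]) (rule Gb(1)[OF _ J(3)])
      then show "dd u ?G z \<bullet> \<beta> 0 = 0 \<bullet> \<beta> 0" using dd_linear[OF bounded_linear_inner_left dG0, of u "\<beta> 0"] by simp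
      have "dd u (\<lambda>z. ?G z \<bullet> dd 1 \<beta> 0) z = dd u (\<lambda>z. dd 1 \<phi> 0) z" by (rule dd_cong[OF D0(1) z]) (rule Gb(2)[OF _ J(3)])
      then show "dd u ?G z \<bullet> dd 1 \<beta> 0 = 0 \<bullet> dd 1 \<beta> 0" using dd_linear[OF bounded_linear_inner_left dG0, of u "dd 1 \<beta> 0"] by simp
      fix j
      have "dd u (\<lambda>z. f0 z $ j) z = 0" using dd_linear[OF bounded_linear_vec_nth d[OF f0s z], of u j] u by simp
      moreover have "dd u (\<lambda>z. f0 z $ j) z = dd u ?G z \<bullet> \<xi> j 0"
      proof -
        have "dd u (hj j) z = dd u (\<lambda>z. ?G z \<bullet> \<xi> j 0) z - dd u (\<lambda>z. G (z1, 0) \<bullet> \<xi> j 0) z"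
          unfolding hj_def[abs_def] by (rule dd_diff[OF differentiable_linear[OF bounded_linear_inner_left dG0] differentiable_const])
        then show ?thesis using dd_linear[OF bounded_linear_inner_left dG0, of u "\<xi> j 0"] by (simp add: f0j)
      qed
      ultimately show "dd u ?G z \<bullet> \<xi> j 0 = 0 \<bullet> \<xi> j 0" by simp
    qed
    let ?k = "\<lambda>z. \<phi> 0 / q (z, 0)" and ?N = "\<lambda>z. N (z, 0)"
    have Neq: "?N y = \<beta> 0 - inverse (?k y) *\<^sub>R ?G y" if "y \<in> D0" for y
      using qp[OF that J(3)] \<phi>p[OF J(3)] by (simp add: G_def)
    have ks: "smooth_on D0 (\<lambda>y. inverse (?k y))"
      by (intro smooth_intros D0 smooth_on_slice[OF D0(1) J(1) J(3) smooth_on_subset[OF qs D0J(2)]])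
         (use qp[OF _ J(3)] \<phi>p[OF J(3)] in force)+
    note dk = d[OF ks z]
    have Nd: "dd u ?N z = - (dd u (\<lambda>y. inverse (?k y)) z *\<^sub>R ?G z)"
    proof -
      have "dd u ?N z = dd u (\<lambda>y. \<beta> 0 - inverse (?k y) *\<^sub>R ?G y) z" by (rule dd_cong[OF D0(1) z Neq])
      also have "\<dots> = - dd u (\<lambda>y. inverse (?k y) *\<^sub>R ?G y) z"
        using dd_diff[OF differentiable_const[of "\<beta> 0"] d[OF smooth_on_scaleR[OF D0(1) ks G0s] z], of u] by simp
      also have "dd u (\<lambda>y. inverse (?k y) *\<^sub>R ?G y) z = dd u (\<lambda>y. inverse (?k y)) z *\<^sub>R ?G z"
        using dd_scaleR[OF dk dG0, of u] Gu by simp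
      finally show ?thesis .
    qed
    have Nu: "dd (u, 0) N (z, 0) = dd u ?N z" by (rule dd_slice(1)[OF dN(1)[OF p]])
    have "?N z \<bullet> dd u ?N z = 0" using Nw[OF p, of "(u, 0)"] Nu by simp
    moreover have "?N z \<bullet> ?G z = - \<phi> 0"
      using N(3)[OF p] Nb[of z 0] qp[OF z J(3)] by (simp add: G_def inner_diff_right)
    ultimately have "dd u (\<lambda>y. inverse (?k y)) z = 0" using \<phi>p[OF J(3)] by (simp add: Nd)
    then have "dd (u, 0) N (z, 0) = dd 0 N (z, 0)" using Nu Nd dd_zero_dir[OF dN(1)[OF p]] by simp
    then have "(u, 0 :: real) = 0" using N(2)[OF p] by (metis injD)
    then show "u = 0" by (simp add: zero_prod_def)
  qed
  have tube: "tube_vector \<beta> \<xi> f0 \<phi> \<omega> z t = G (z, t)" if z: "z \<in> D0" and t: "t \<in> J" for z t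
  proof (rule eqI[OF t])
    have dv: "deriv \<phi> t = dd 1 \<phi> t" by (rule deriv_eq_dd[OF d\<phi>[OF t]])
    note tv = tube_vector_def dv vel[OF t]
    show "tube_vector \<beta> \<xi> f0 \<phi> \<omega> z t \<bullet> \<beta> t = G (z, t) \<bullet> \<beta> t"
      using \<omega>b[OF t] \<xi>b[OF t] bb[OF t] Gb(1)[OF z t] by (simp add: tv inner_add_left inner_sum_left inner_commute[of "dd 1 \<beta> t" "\<beta> t"])
    show "tube_vector \<beta> \<xi> f0 \<phi> \<omega> z t \<bullet> dd 1 \<beta> t = G (z, t) \<bullet> dd 1 \<beta> t"
      using \<omega>b[OF t] \<xi>b[OF t] bb[OF t] Gb(2)[OF z t] by (simp add: tv inner_add_left inner_sum_left)
    fix j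
    have "G (z, t) \<bullet> \<xi> j t - G (z1, t) \<bullet> \<xi> j t = G (z, 0) \<bullet> \<xi> j 0 - G (z1, 0) \<bullet> \<xi> j 0"
    proof (rule interval_constant[OF J(2) _ _ t J(3), of "\<lambda>t. G (z, t) \<bullet> \<xi> j t - G (z1, t) \<bullet> \<xi> j t"])
      fix t assume t: "t \<in> J"
      show "(\<lambda>t. G (z, t) \<bullet> \<xi> j t - G (z1, t) \<bullet> \<xi> j t) differentiable (at t)"
        by (rule differentiable_diff[OF gj(2)[OF z t] gj(2)[OF D0(3) t]])
      show "dd 1 (\<lambda>t. G (z, t) \<bullet> \<xi> j t - G (z1, t) \<bullet> \<xi> j t) t = 0"
        using dd_diff[OF gj(2)[OF z t] gj(2)[OF D0(3) t], of 1 j j] gj(1)[OF z t] gj(1)[OF D0(3) t] by simp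
    qed
    moreover have "tube_vector \<beta> \<xi> f0 \<phi> \<omega> z t \<bullet> \<xi> j t = G (z1, t) \<bullet> \<xi> j t + f0 z $ j"
      using \<omega>b[OF t] \<xi>b'[OF t, of j]
      by (simp add: tv inner_add_left inner_sum_left \<xi>sum[OF t])
    ultimately show "tube_vector \<beta> \<xi> f0 \<phi> \<omega> z t \<bullet> \<xi> j t = G (z, t) \<bullet> \<xi> j t"
      by (simp add: f0j hj_def)
  qed
  \<comment> \<open>The squared norm of \<open>G\<close> is \<open>2 \<phi>\<^sup>2 / q\<close>, so
    the subtracted multiple of \<open>G\<close> is just \<open>\<beta> - N\<close>.\<close>
  have Neq: "N (z, t) = \<beta> t - (2 * \<phi> t / (norm (tube_vector \<beta> \<xi> f0 \<phi> \<omega> z t))\<^sup>2) *\<^sub>R tube_vector \<beta> \<xi> f0 \<phi> \<omega> z t"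
    if z: "z \<in> D0" and t: "t \<in> J" for z t
  proof -
    have zD: "z \<in> D" using z D0 by auto
    have nz: "q (z, t) \<noteq> 0" "\<phi> t \<noteq> 0" using qp[OF z t] \<phi>p[OF t] by auto
    have "(\<beta> t - N (z, t)) \<bullet> (\<beta> t - N (z, t)) = 2 * q (z, t)"
      using N(3)[OF inS[OF zD t]] bb(1)[OF t] by (simp add: q_def inner_diff_left inner_diff_right inner_commute)
    then have "(norm (G (z, t)))\<^sup>2 = (\<phi> t / q (z, t))\<^sup>2 * (2 * q (z, t))"
      unfolding power2_norm_eq_inner G_def fst_conv snd_conv inner_scaleR_left inner_scaleR_right
      by (simp only: power2_eq_square mult.assoc)
    then have "2 * \<phi> t / (norm (G (z, t)))\<^sup>2 * (\<phi> t / q (z, t)) = 1"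
      using nz by (simp add: field_simps power2_eq_square)
    then have "(2 * \<phi> t / (norm (G (z, t)))\<^sup>2) *\<^sub>R G (z, t) = \<beta> t - N (z, t)"
      by (simp add: G_def)
    then show ?thesis unfolding tube[OF z t] by simp
  qed
  show ?thesis
    using us frame rp f0s f0inj Neq \<phi>s \<phi>p \<phi>1 by (intro exI[of _ \<xi>] exI[of _ f0] exI[of _ \<phi>] exI[of _ \<omega>]) blast
qed

text \<open>With \<open>w = (1 - N \<bullet> \<beta>) / \<phi>\<close> the products \<open>E\<close>
  of leaf vectors obey \<open>E' = - 2 \<nu> \<mu> E\<close> and
  \<open>w' = - \<nu> \<mu> w\<close>, so \<open>E / w\<^sup>2\<close> does not depend on
  \<open>t\<close>. This explicit \<open>w\<close>, divided by its value at \<open>t = 0\<close>, is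
  the conformal factor between the leaves.\<close>

lemma tube_metric:
  fixes N :: "'v::euclidean_space \<times> real \<Rightarrow> 'b::euclidean_space"
  assumes D: "open D" and J: "open J" "is_interval J" "0 \<in> J"
    and N: "smooth_on (D \<times> J) N" "\<And>p. p \<in> D \<times> J \<Longrightarrow> inj (\<lambda>w. dd w N p)" "\<And>p. p \<in> D \<times> J \<Longrightarrow> N p \<bullet> N p = 1"
    and sm: "smooth_on J c" "smooth_on J \<mu>" "smooth_on (D \<times> J) \<nu>"
    and \<nu>: "\<And>p. p \<in> D \<times> J \<Longrightarrow> \<nu> p > 0" "\<And>p. p \<in> D \<times> J \<Longrightarrow> (\<nu> p)\<^sup>2 = dd (0, 1) N p \<bullet> dd (0, 1) N p"
    and Ns: "\<And>p. p \<in> D \<times> J \<Longrightarrow> dd (0, 1) N p = \<nu> p *\<^sub>R (c (snd p) - \<mu> (snd p) *\<^sub>R N p)"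
    and orth: "\<And>p u. p \<in> D \<times> J \<Longrightarrow> dd (u, 0) N p \<bullet> dd (0, 1) N p = 0"
    and zs: "zs \<in> D" "\<And>t. t \<in> J \<Longrightarrow> \<nu> (zs, t) = 1"
    and D0: "open D0" "D0 \<subseteq> D" "\<And>z t. z \<in> D0 \<Longrightarrow> t \<in> J \<Longrightarrow> N (z, t) \<noteq> N (zs, t)"
    and \<phi>: "smooth_on J \<phi>" "\<And>t. t \<in> J \<Longrightarrow> \<phi> t > 0" "\<And>t. t \<in> J \<Longrightarrow> dd 1 \<phi> t = - \<mu> t * \<phi> t"
  shows "\<exists>v0 \<sigma>. smooth_on (D0 \<times> J) v0 \<and> (\<forall>p\<in>D0 \<times> J. v0 p > 0 \<and> dd (0, 1) v0 p = - \<nu> p * \<mu> (snd p) * v0 p) \<and>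
    smooth_on D0 \<sigma> \<and> (\<forall>z\<in>D0. inj (\<lambda>u. dd u \<sigma> z) \<and> \<sigma> z \<bullet> \<sigma> z = 1 \<and> \<sigma> z \<bullet> c 0 = 0) \<and> c 0 \<noteq> 0 \<and>
    (\<forall>z\<in>D0. \<forall>t\<in>J. \<forall>u v a b. dd (u, a) N (z, t) \<bullet> dd (v, b) N (z, t) =
      (v0 (z, t))\<^sup>2 * (dd u \<sigma> z \<bullet> dd v \<sigma> z) + (\<nu> (z, t))\<^sup>2 * (a * b))"
proof -
  let ?S = "D \<times> J"
  have S: "open ?S" using D J by (simp add: open_Times)
  note d = smooth_on_differentiable
  have inS: "(z, t) \<in> ?S" if "z \<in> D" "t \<in> J" for z t using that by simp
  have dN: "N differentiable (at p)" "dd w N differentiable (at p)" if "p \<in> ?S" for p w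
    using d[OF N(1) that] d[OF smooth_on_dd[OF N(1)] that] by auto
  have Nw: "N p \<bullet> dd w N p = 0" if "p \<in> ?S" for p w by (rule unit_derivative[OF S N(1,3) that])
  have Nc: "N (z, t) \<bullet> c t = \<mu> t" if "z \<in> D" "t \<in> J" for z t
    using Nw[OF inS[OF that], of "(0, 1)"] Ns[OF inS[OF that]] \<nu>(1)[OF inS[OF that]] N(3)[OF inS[OF that]]
    by (simp add: inner_diff_right)
  \<comment> \<open>Since \<open>\<nu> = 1\<close> at \<open>zs\<close>, the vector
    \<open>c - \<mu> N\<close> is there the unit vector \<open>\<partial>\<^sub>t N\<close>,
    orthogonal to \<open>N\<close>.\<close>
  have cc: "c t \<bullet> c t = 1 + (\<mu> t)\<^sup>2" if t: "t \<in> J" for t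
  proof -
    note p = inS[OF zs(1) t]
    have "(c t - \<mu> t *\<^sub>R N (zs, t)) \<bullet> (c t - \<mu> t *\<^sub>R N (zs, t)) = 1"
      using \<nu>(2)[OF p] Ns[OF p] zs(2)[OF t] by simp
    then show ?thesis using Nc[OF zs(1) t] N(3)[OF p]
      by (simp add: inner_diff_left inner_diff_right inner_commute power2_eq_square)
  qed
  have cnz: "c 0 \<noteq> 0" using cc[OF J(3)] by (metis add_pos_nonneg inner_zero_left less_irrefl zero_le_power2 zero_less_one)
  define \<beta> where "\<beta> t = N (zs, t)" for t
  have \<beta>s: "smooth_on J \<beta>" unfolding \<beta>_def[abs_def] by (rule smooth_on_slice_snd[OF D J(1) zs(1) N(1)])
  have d\<beta>: "\<beta> differentiable (at t)" if "t \<in> J" for t by (rule d[OF \<beta>s that])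
  have \<beta>1: "dd 1 \<beta> t = c t - \<mu> t *\<^sub>R \<beta> t" if t: "t \<in> J" for t
    using dd_slice_snd(1)[OF dN(1)[OF inS[OF zs(1) t]]] Ns[OF inS[OF zs(1) t]] zs(2)[OF t] by (simp add: \<beta>_def[abs_def])
  have bb: "\<beta> t \<bullet> \<beta> t = 1" if t: "t \<in> J" for t using N(3)[OF inS[OF zs(1) t]] by (simp add: \<beta>_def)
  have bc: "\<beta> t \<bullet> c t = \<mu> t" if "t \<in> J" for t using Nc[OF zs(1) that] by (simp add: \<beta>_def)
  define w where "w p = (1 - N p \<bullet> \<beta> (snd p)) / \<phi> (snd p)" for p
  have \<beta>snd: "smooth_on ?S (\<lambda>p. \<beta> (snd p))" by (rule smooth_on_comp_snd[OF D J(1) \<beta>s])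
  have \<phi>snd: "smooth_on ?S (\<lambda>p. \<phi> (snd p))" by (rule smooth_on_comp_snd[OF D J(1) \<phi>(1)])
  have ws: "smooth_on ?S w" unfolding w_def[abs_def] by (intro smooth_intros S N \<beta>snd \<phi>snd) (use \<phi>(2) in force)
  have wp: "w (z, t) > 0" if z: "z \<in> D0" and t: "t \<in> J" for z t
  proof -
    have zD: "z \<in> D" using z D0 by auto
    have "(N (z, t) - \<beta> t) \<bullet> (N (z, t) - \<beta> t) = 2 * (1 - N (z, t) \<bullet> \<beta> t)"
      using N(3)[OF inS[OF zD t]] bb[OF t] by (simp add: inner_diff_left inner_diff_right inner_commute)
    moreover have "N (z, t) - \<beta> t \<noteq> 0" using D0(3)[OF z t] by (simp add: \<beta>_def)
    ultimately have "1 - N (z, t) \<bullet> \<beta> t > 0" by (metis inner_gt_zero_iff zero_less_mult_pos zero_less_numeral)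
    then show ?thesis using \<phi>(2)[OF t] by (simp add: w_def)
  qed
  have w1: "dd (0, 1) w p = - \<nu> p * \<mu> (snd p) * w p" if p: "p \<in> ?S" for p
  proof -
    obtain z t where zt: "p = (z, t)" "z \<in> D" "t \<in> J" using p by auto
    have d1: "(\<lambda>p. \<beta> (snd p)) differentiable (at p)" "(\<lambda>p. \<phi> (snd p)) differentiable (at p)"
      using d[OF \<beta>snd p] d[OF \<phi>snd p] by auto
    have b: "dd (0, 1) (\<lambda>p. \<beta> (snd p)) p = c t - \<mu> t *\<^sub>R \<beta> t" "dd (0, 1) (\<lambda>p. \<phi> (snd p)) p = - \<mu> t * \<phi> t"
      using dd_snd[of \<beta> p 0 1] dd_snd[of \<phi> p 0 1] d\<beta>[OF zt(3)] d[OF \<phi>(1) zt(3)] \<beta>1[OF zt(3)] \<phi>(3)[OF zt(3)] zt by auto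
    have di: "(\<lambda>p. N p \<bullet> \<beta> (snd p)) differentiable (at p)" by (rule d[OF smooth_on_inner[OF S N(1) \<beta>snd] p])
    have dq: "(\<lambda>p. 1 - N p \<bullet> \<beta> (snd p)) differentiable (at p)" by (rule differentiable_diff[OF differentiable_const di])
    have "dd (0, 1) (\<lambda>p. 1 - N p \<bullet> \<beta> (snd p)) p = - (N p \<bullet> (c t - \<mu> t *\<^sub>R \<beta> t) + dd (0, 1) N p \<bullet> \<beta> t)"
      using dd_diff[OF differentiable_const[of "1 :: real"] di, of "(0, 1)"] dd_inner[OF dN(1)[OF p] d1(1), of "(0, 1)"] b(1) zt(1)
      by simp
    also have "\<dots> = - (1 + \<nu> p) * \<mu> t * (1 - N p \<bullet> \<beta> t)"
      unfolding Ns[OF p] using Nc[OF zt(2,3)] bc[OF zt(3)] zt(1)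
      by (simp add: inner_diff_left inner_diff_right inner_commute[of "c t"] algebra_simps)
    finally have q1: "dd (0, 1) (\<lambda>p. 1 - N p \<bullet> \<beta> (snd p)) p = - (1 + \<nu> p) * \<mu> t * (1 - N p \<bullet> \<beta> t)" .
    have nz: "\<phi> (snd p) \<noteq> 0" using \<phi>(2) zt by force
    have "dd (0, 1) w p = (- (1 + \<nu> p) * \<mu> t * (1 - N p \<bullet> \<beta> t) * \<phi> t - (1 - N p \<bullet> \<beta> t) * (- \<mu> t * \<phi> t)) / (\<phi> t)\<^sup>2"
      unfolding w_def[abs_def] dd_divide[OF dq d1(2) nz, of "(0, 1)"] q1 b by (simp add: zt(1))
    also have "\<dots> = - \<nu> p * \<mu> (snd p) * w p"
      using nz zt(1) by (simp add: w_def field_simps power2_eq_square)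
    finally show ?thesis .
  qed
  have Nu1: "dd (0, 1) (dd (u, 0) N) p = (dd (u, 0) \<nu> p / \<nu> p) *\<^sub>R dd (0, 1) N p - (\<nu> p * \<mu> (snd p)) *\<^sub>R dd (u, 0) N p"
    if p: "p \<in> ?S" for u p
  proof -
    have ps: "snd p \<in> J" using p by auto
    have cs: "(\<lambda>p. c (snd p)) differentiable (at p)" "(\<lambda>p. \<mu> (snd p)) differentiable (at p)"
      using d[OF smooth_on_comp_snd[OF D J(1) sm(1)] p] d[OF smooth_on_comp_snd[OF D J(1) sm(2)] p] by auto
    have c0: "dd (u, 0) (\<lambda>p. c (snd p)) p = 0" "dd (u, 0) (\<lambda>p. \<mu> (snd p)) p = 0"
      using dd_snd[of c p u 0] dd_snd[of \<mu> p u 0] d[OF sm(1) ps] d[OF sm(2) ps] dd_zero_dir by auto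
    have dmN: "(\<lambda>p. \<mu> (snd p) *\<^sub>R N p) differentiable (at p)"
      by (rule d[OF smooth_on_scaleR[OF S smooth_on_comp_snd[OF D J(1) sm(2)] N(1)] p])
    have "dd (0, 1) (dd (u, 0) N) p = dd (u, 0) (dd (0, 1) N) p" by (rule dd_symmetric[OF S p N(1)])
    also have "\<dots> = dd (u, 0) (\<lambda>p. \<nu> p *\<^sub>R (c (snd p) - \<mu> (snd p) *\<^sub>R N p)) p" by (rule dd_cong[OF S p Ns])
    also have "\<dots> = \<nu> p *\<^sub>R dd (u, 0) (\<lambda>p. c (snd p) - \<mu> (snd p) *\<^sub>R N p) p + dd (u, 0) \<nu> p *\<^sub>R (c (snd p) - \<mu> (snd p) *\<^sub>R N p)"
      by (rule dd_scaleR[OF d[OF sm(3) p] differentiable_diff[OF cs(1) dmN]])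
    also have "dd (u, 0) (\<lambda>p. c (snd p) - \<mu> (snd p) *\<^sub>R N p) p = - (\<mu> (snd p) *\<^sub>R dd (u, 0) N p)"
      using dd_diff[OF cs(1) dmN, of "(u, 0)"] dd_scaleR[OF cs(2) dN(1)[OF p], of "(u, 0)"] c0 by simp
    finally show ?thesis unfolding Ns[OF p] using \<nu>(1)[OF p] by simp
  qed
  define E where "E u v p = dd (u, 0) N p \<bullet> dd (v, 0) N p" for u v p
  have E1: "dd (0, 1) (E u v) p = - 2 * \<nu> p * \<mu> (snd p) * E u v p" if p: "p \<in> ?S" for u v p
    unfolding E_def[abs_def]
    using dd_inner[OF dN(2)[OF p] dN(2)[OF p], of "(0, 1)" "(u, 0)" "(v, 0)"] orth[OF p, of u] orth[OF p, of v, unfolded inner_commute[of "dd (v, 0) N p"]]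
    by (simp add: Nu1[OF p] inner_diff_left inner_diff_right)
  have Es: "smooth_on ?S (E u v)" for u v unfolding E_def[abs_def] by (intro smooth_intros S N)
  have Ew: "E u v (z, t) / (w (z, t))\<^sup>2 = E u v (z, 0) / (w (z, 0))\<^sup>2" if z: "z \<in> D0" and t: "t \<in> J" for u v z t
  proof (rule slice_constant_snd[OF J(2) _ _ t J(3), of "\<lambda>p. E u v p / (w p)\<^sup>2"])
    fix t assume t: "t \<in> J"
    have p: "(z, t) \<in> ?S" using z t D0 by auto
    have nz: "w (z, t) \<noteq> 0" using wp[OF z t] by simp
    have dw: "(\<lambda>p. (w p)\<^sup>2) differentiable (at (z, t))" by (rule d[OF smooth_on_power[OF S ws] p])
    have dww: "dd (0, 1) (\<lambda>p. (w p)\<^sup>2) (z, t) = - 2 * \<nu> (z, t) * \<mu> t * (w (z, t))\<^sup>2"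
      unfolding power2_eq_square using dd_mult[OF d[OF ws p] d[OF ws p], of "(0, 1)"] w1[OF p] by simp
    show "(\<lambda>p. E u v p / (w p)\<^sup>2) differentiable (at (z, t))"
      by (rule differentiable_divide[OF d[OF Es p] dw]) (use nz in simp)
    show "dd (0, 1) (\<lambda>p. E u v p / (w p)\<^sup>2) (z, t) = 0"
      using dd_divide[OF d[OF Es p] dw, of "(0, 1)"] nz E1[OF p] dww by simp
  qed
  \<comment> \<open>\<open>m\<close> is the squared length of \<open>c 0\<close>. The leaf at
    \<open>t = 0\<close> lies in a sphere with centre \<open>(\<mu> 0 / m) c 0\<close> and squared
    radius \<open>1 - (\<mu> 0)\<^sup>2 / m = 1 / m\<close>; \<open>\<sigma>\<close> recentres and
    rescales it into the unit sphere of the hyperplane orthogonal to \<open>c 0\<close>.\<close>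
  define m where "m = 1 + (\<mu> 0)\<^sup>2"
  have m: "m > 0" by (simp add: m_def add_pos_nonneg)
  define \<sigma> where "\<sigma> z = sqrt m *\<^sub>R (N (z, 0) - (\<mu> 0 / m) *\<^sub>R c 0)" for z
  \<comment> \<open>The factor \<open>inverse (sqrt m)\<close> undoes the rescaling in
    \<open>\<sigma>\<close>; dividing by the value of \<open>w\<close> at \<open>t = 0\<close> makes
    that leaf the reference.\<close>
  define v0 where "v0 p = inverse (sqrt m) * (w p / w (fst p, 0))" for p
  have D0J: "open (D0 \<times> J)" "D0 \<times> J \<subseteq> ?S" using D0 J by (auto simp: open_Times)
  have w0s: "smooth_on (D0 \<times> J) (\<lambda>p. w (fst p, 0))"
    by (rule smooth_on_comp_fst[OF D0(1) J(1)]) (rule smooth_on_slice[OF D0(1) J(1) J(3) smooth_on_subset[OF ws D0J(2)]])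
  have v0s: "smooth_on (D0 \<times> J) v0" unfolding v0_def[abs_def]
    by (intro smooth_intros D0J smooth_on_subset[OF ws D0J(2)] w0s) (use wp[OF _ J(3)] in force)
  have v0p: "v0 p > 0" if "p \<in> D0 \<times> J" for p using that wp[of "fst p" "snd p"] wp[OF _ J(3), of "fst p"] m by (auto simp: v0_def)
  have v01: "dd (0, 1) v0 p = - \<nu> p * \<mu> (snd p) * v0 p" if p: "p \<in> D0 \<times> J" for p
  proof -
    have pS: "p \<in> ?S" using p D0J by auto
    have nz: "w (fst p, 0) \<noteq> 0" using wp[OF _ J(3), of "fst p"] p by force
    have ds: "(\<lambda>z. w (z, 0)) differentiable (at (fst p))"
      by (rule d[OF smooth_on_slice[OF D J(1) J(3) ws]]) (use pS in auto)
    have "dd (0, 1) (\<lambda>p. w (fst p, 0)) p = 0"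
      using dd_fst[of "\<lambda>z. w (z, 0)" p 0 1] ds dd_zero_dir[OF ds] by simp
    then have "dd (0, 1) (\<lambda>p. w p / w (fst p, 0)) p = - \<nu> p * \<mu> (snd p) * (w p / w (fst p, 0))"
      using dd_divide[OF d[OF ws pS] d[OF w0s p] nz, of "(0, 1)"] w1[OF pS] nz by (simp add: power2_eq_square)
    moreover have "(\<lambda>p. w p / w (fst p, 0)) differentiable (at p)"
      by (rule differentiable_divide[OF d[OF ws pS] d[OF w0s p] nz])
    ultimately show ?thesis
      unfolding v0_def[abs_def] using dd_linear[OF bounded_linear_mult_right, of "\<lambda>p. w p / w (fst p, 0)" p "(0, 1)"] by simp
  qed
  have N0s: "smooth_on D0 (\<lambda>z. N (z, 0))" by (rule smooth_on_slice[OF D0(1) J(1) J(3) smooth_on_subset[OF N(1) D0J(2)]])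
  have \<sigma>s: "smooth_on D0 \<sigma>" unfolding \<sigma>_def[abs_def] by (intro smooth_on_scaleR smooth_on_diff smooth_on_const D0 N0s)
  have \<sigma>1: "dd u \<sigma> z = sqrt m *\<^sub>R dd (u, 0) N (z, 0)" if z: "z \<in> D0" for u z
  proof -
    have p: "(z, 0) \<in> ?S" using z D0 J by auto
    note dn = dd_slice[OF dN(1)[OF p]]
    have "dd u (\<lambda>z. N (z, 0) - (\<mu> 0 / m) *\<^sub>R c 0) z = dd (u, 0) N (z, 0)"
      using dd_diff[OF dn(2) differentiable_const[of "(\<mu> 0 / m) *\<^sub>R c 0"], of u] dn(1) by simp
    then show ?thesis
      unfolding \<sigma>_def[abs_def]
      using dd_linear[OF bounded_linear_scaleR_right differentiable_diff[OF dn(2) differentiable_const[of "(\<mu> 0 / m) *\<^sub>R c 0"]], of u "sqrt m"] by simp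
  qed
  have \<sigma>inj: "inj (\<lambda>u. dd u \<sigma> z)" if z: "z \<in> D0" for z
  proof (rule injI)
    fix u v assume "dd u \<sigma> z = dd v \<sigma> z"
    then have "dd (u, 0) N (z, 0) = dd (v, 0) N (z, 0)" using m by (simp add: \<sigma>1[OF z])
    moreover have "inj (\<lambda>w. dd w N (z, 0))" using N(2)[of "(z, 0)"] z D0 J by auto
    ultimately have "(u, 0 :: real) = (v, 0)" by (metis injD)
    then show "u = v" by simp
  qed
  have \<sigma>\<sigma>: "\<sigma> z \<bullet> \<sigma> z = 1" "\<sigma> z \<bullet> c 0 = 0" if z: "z \<in> D0" for z
  proof -
    have zD: "z \<in> D" using z D0 by auto
    note f = Nc[OF zD J(3)] N(3)[OF inS[OF zD J(3)]] cc[OF J(3), folded m_def]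
    have "(N (z, 0) - (\<mu> 0 / m) *\<^sub>R c 0) \<bullet> (N (z, 0) - (\<mu> 0 / m) *\<^sub>R c 0) = 1 - (\<mu> 0)\<^sup>2 / m"
      using f m by (simp add: inner_diff_left inner_diff_right inner_commute[of "c 0" "N (z, 0)"] power2_eq_square)
    also have "\<dots> = 1 / m" using m by (simp add: m_def field_simps)
    finally have k: "(N (z, 0) - (\<mu> 0 / m) *\<^sub>R c 0) \<bullet> (N (z, 0) - (\<mu> 0 / m) *\<^sub>R c 0) = 1 / m" .
    have "\<sigma> z \<bullet> \<sigma> z = (sqrt m * sqrt m) * ((N (z, 0) - (\<mu> 0 / m) *\<^sub>R c 0) \<bullet> (N (z, 0) - (\<mu> 0 / m) *\<^sub>R c 0))"
      unfolding \<sigma>_def inner_scaleR_left inner_scaleR_right by simp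
    then show "\<sigma> z \<bullet> \<sigma> z = 1" unfolding k using m by simp
    show "\<sigma> z \<bullet> c 0 = 0" unfolding \<sigma>_def using f m by (simp add: inner_diff_left)
  qed
  have met: "dd (u, a) N (z, t) \<bullet> dd (v, b) N (z, t) = (v0 (z, t))\<^sup>2 * (dd u \<sigma> z \<bullet> dd v \<sigma> z) + (\<nu> (z, t))\<^sup>2 * (a * b)"
    if z: "z \<in> D0" and t: "t \<in> J" for z t u v a b
  proof -
    have p: "(z, t) \<in> ?S" using z t D0 by auto
    have "dd (u, a) N (z, t) \<bullet> dd (v, b) N (z, t) = E u v (z, t) + (\<nu> (z, t))\<^sup>2 * (a * b)"
      unfolding dd_prod_split[OF dN(1)[OF p], of u a] dd_prod_split[OF dN(1)[OF p], of v b]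
      using orth[OF p, of u] orth[OF p, of v, unfolded inner_commute[of "dd (v, 0) N (z, t)"]] \<nu>(2)[OF p]
      by (simp add: inner_add_left inner_add_right E_def)
    also have "E u v (z, t) = (w (z, t))\<^sup>2 / (w (z, 0))\<^sup>2 * E u v (z, 0)"
      using Ew[OF z t, of u v] wp[OF z t] wp[OF z J(3)] by (simp add: field_simps)
    also have "\<dots> = (v0 (z, t))\<^sup>2 * (dd u \<sigma> z \<bullet> dd v \<sigma> z)"
      using m wp[OF z J(3)] by (simp add: v0_def \<sigma>1[OF z] E_def power_mult_distrib power_divide power_inverse field_simps)
    finally show ?thesis .
  qed
  show ?thesis
    using v0s v0p v01 \<sigma>s \<sigma>inj \<sigma>\<sigma> cnz met by (intro exI[of _ v0] exI[of _ \<sigma>]) blast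
qed

subsection \<open>From local to global charts\<close>

lemma chart_self_differential:
  assumes ch: "is_chart c" and x: "x \<in> fst c"
  shows "differential c (\<lambda>x. F (snd c x)) x u = dd u F (snd c x)"
  unfolding differential_eq_dd
proof (rule dd_cong[OF is_chart_open(2)[OF ch]])
  fix y assume "y \<in> snd c ` fst c"
  then show "((\<lambda>x. F (snd c x)) \<circ> chart_inv c) y = F y" using chart_inv_right[of y c] by simp
qed (use x in auto)

lemma global_chart_immersion:
  fixes A :: "('q::{t2_space, second_countable_topology}, 'v::euclidean_space) chart set"
  assumes A: "smooth_atlas A" "c \<in> A" "fst c = points A"
    and F: "smooth_on (snd c ` fst c) F" "\<And>z. z \<in> snd c ` fst c \<Longrightarrow> inj (\<lambda>u. dd u F z)"
  shows "immersion A (\<lambda>x. F (snd c x))"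
  unfolding immersion_def
proof (intro conjI ballI)
  show sm: "smooth_map A (\<lambda>x. F (snd c x))" by (rule global_chart_smooth[OF A F(1)])
  fix x assume "x \<in> points A"
  then have x: "x \<in> fst c" using A(3) by simp
  have "differential c (\<lambda>x. F (snd c x)) x = (\<lambda>u. dd u F (snd c x))"
    by (rule ext) (rule chart_self_differential[OF smooth_atlas_chart[OF A(1,2)] x])
  then show "regular_point A (\<lambda>x. F (snd c x)) x"
    using regular_point_chart[OF A(1,2) x sm] F(2) x by simp
qed

text \<open>The local inverse in coordinates comes from \<open>inverse_function_smooth\<close>;
  composed with the chart inverse it gives the one on the manifold, tested against every other chart
  by its transition map.\<close>

lemma global_chart_local_diffeo:
  fixes A :: "('q::{t2_space, second_countable_topology}, 'v::euclidean_space) chart set"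
  assumes A: "smooth_atlas A" "c \<in> A" "fst c = points A"
    and F: "smooth_on (snd c ` fst c) F" "\<And>z. z \<in> snd c ` fst c \<Longrightarrow> inj (\<lambda>u. dd u F z)"
  shows "local_diffeo A (\<lambda>x. F (snd c x))"
  unfolding local_diffeo_def
proof (intro conjI ballI)
  let ?F = "\<lambda>x. F (snd c x)"
  show "smooth_map A ?F" by (rule global_chart_smooth[OF A F(1)])
  fix x assume "x \<in> points A"
  then have x: "x \<in> fst c" using A(3) by simp
  note ch = smooth_atlas_chart[OF A(1,2)]
  have xz: "snd c x \<in> snd c ` fst c" using x by simp
  obtain V where V: "open V" "snd c x \<in> V" "V \<subseteq> snd c ` fst c" "open (F ` V)" "inj_on F V"
    "smooth_on (F ` V) (inv_into V F)"
    using inverse_function_smooth[OF is_chart_open(2)[OF ch] F xz] by blast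
  define W where "W = chart_inv c ` V"
  have cz: "chart_inv c z \<in> fst c" "snd c (chart_inv c z) = z" if "z \<in> V" for z
    using chart_inv_right[of z c] V(3) that by auto
  have FW: "?F ` W' = F ` (snd c ` W')" for W' by (simp add: image_image)
  have sW: "snd c ` W = V" using cz by (force simp: W_def image_image)
  have Wc: "W \<subseteq> fst c" using cz by (auto simp: W_def)
  have Wo: "open W" unfolding W_def by (rule open_chart_preimage[OF ch V(1,3)])
  have injW: "inj_on ?F W"
  proof (rule inj_onI)
    fix x y assume xy: "x \<in> W" "y \<in> W" "F (snd c x) = F (snd c y)"
    then have "snd c x = snd c y" using V(5) sW by (metis imageI inj_onD)
    then show "x = y" using is_chart_inj[OF ch] xy Wc by (metis inj_onD subsetD)
  qed
  have inv: "inv_into W ?F y = chart_inv c (inv_into V F y)" if y: "y \<in> F ` V" for y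
  proof -
    obtain z where z: "z \<in> V" "y = F z" using y by auto
    have "inv_into V F y = z" using V(5) z by simp
    moreover have "inv_into W ?F (?F (chart_inv c z)) = chart_inv c z"
      by (rule inv_into_f_f[OF injW]) (use z in \<open>auto simp: W_def\<close>)
    ultimately show ?thesis using cz(2)[OF z(1)] z(2) by simp
  qed
  have "smooth_on (?F ` (W \<inter> fst d)) (snd d \<circ> inv_into W ?F)" if d: "d \<in> A" for d
  proof -
    let ?V = "snd c ` (W \<inter> fst d)"
    have VV: "?V \<subseteq> V" using sW by auto
    have oV: "open ?V" using Wo is_chart_open(1)[OF smooth_atlas_chart[OF A(1) d]] Wc
      by (intro open_chart_image[OF ch]) auto
    have FV: "F ` ?V = F ` V \<inter> inv_into V F -` ?V"
    proof (intro set_eqI iffI)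
      fix y assume "y \<in> F ` ?V"
      then obtain z where z: "z \<in> ?V" "y = F z" by blast
      then have "inv_into V F y = z" using inv_into_f_f[OF V(5)] VV by blast
      then show "y \<in> F ` V \<inter> inv_into V F -` ?V" using z VV by blast
    next
      fix y assume y: "y \<in> F ` V \<inter> inv_into V F -` ?V"
      then have "F (inv_into V F y) = y" by (simp add: f_inv_into_f)
      moreover have "inv_into V F y \<in> ?V" using y by blast
      ultimately show "y \<in> F ` ?V" by (metis imageI)
    qed
    have "continuous_on (F ` V) (inv_into V F)" by (rule smooth_on_continuous[OF V(6)])
    then have oF: "open (F ` ?V)" unfolding FV
      using continuous_on_open_vimage[OF V(4), of "inv_into V F"] oV by (simp add: Int_commute)
    have "smooth_on (F ` ?V) (\<lambda>y. (snd d \<circ> chart_inv c) (inv_into V F y))"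
    proof (rule smooth_on_compose[OF oF overlap_open(2)[OF A(1,2) d] _ _ smooth_atlas_transition[OF A(1,2) d]])
      show "inv_into V F ` F ` ?V \<subseteq> snd c ` (fst c \<inter> fst d)"
      proof
        fix y assume "y \<in> inv_into V F ` F ` ?V"
        then obtain z where z: "z \<in> ?V" "y = inv_into V F (F z)" by auto
        have "y = z" using z VV by (simp add: inv_into_f_f[OF V(5)] subsetD)
        then show "y \<in> snd c ` (fst c \<inter> fst d)" using z(1) Wc by auto
      qed
      show "smooth_on (F ` ?V) (inv_into V F)" by (rule smooth_on_subset[OF V(6)]) (use VV in auto)
    qed
    moreover have "(snd d \<circ> inv_into W ?F) y = (snd d \<circ> chart_inv c) (inv_into V F y)" if "y \<in> F ` ?V" for y
    proof -
      have "y \<in> F ` V" using that VV by auto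
      then show ?thesis by (simp add: inv)
    qed
    ultimately show ?thesis unfolding FW
      using smooth_on_cong[OF oF, of "snd d \<circ> inv_into W ?F" "\<lambda>y. (snd d \<circ> chart_inv c) (inv_into V F y)"] by simp
  qed
  moreover have "x \<in> W" using chart_inv_left[OF ch x] V(2) unfolding W_def by (metis imageI)
  moreover have "open (?F ` W)" using V(4) FW[of W] sW by simp
  ultimately show "\<exists>W. open W \<and> x \<in> W \<and> W \<subseteq> points A \<and> open (?F ` W) \<and> inj_on ?F W \<and>
      (\<forall>c\<in>A. smooth_on (?F ` (W \<inter> fst c)) (snd c \<circ> inv_into W ?F))"
    using Wo Wc A(3) injW by (intro exI[of _ W]) blast
qed

text \<open>\<open>V = f \<bullet> c\<close> is constant on leaves, since \<open>c\<close> is a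
  combination of \<open>N\<close> and \<open>\<partial>\<^sub>s N\<close>, both orthogonal to
  \<open>\<partial>\<^sub>u f\<close>. For \<open>\<gamma> = f \<bullet> N\<close> this gives
  \<open>\<gamma>' = \<nu> (V - \<mu> \<gamma>)\<close>; as \<open>v0' = - \<nu> \<mu> v0\<close>,
  the quotient \<open>\<gamma> / v0\<close> has derivative \<open>V \<nu> / v0\<close>.\<close>

lemma support_function_integral:
  fixes f N :: "'v::euclidean_space \<times> real \<Rightarrow> 'b::euclidean_space"
  assumes D: "open D" "convex D" and J: "open J" "is_interval J" "0 \<in> J"
    and f: "smooth_on (D \<times> J) f" and N: "smooth_on (D \<times> J) N"
    and sm: "smooth_on J c" "smooth_on J \<mu>" "smooth_on (D \<times> J) \<nu>" and \<nu>: "\<And>p. p \<in> D \<times> J \<Longrightarrow> \<nu> p > 0"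
    and Ns: "\<And>p. p \<in> D \<times> J \<Longrightarrow> dd (0, 1) N p = \<nu> p *\<^sub>R (c (snd p) - \<mu> (snd p) *\<^sub>R N p)"
    and fN: "\<And>p w. p \<in> D \<times> J \<Longrightarrow> dd w f p \<bullet> N p = 0"
    and fNs: "\<And>p u. p \<in> D \<times> J \<Longrightarrow> dd (u, 0) f p \<bullet> dd (0, 1) N p = 0"
    and v0: "smooth_on (D \<times> J) v0" "\<And>p. p \<in> D \<times> J \<Longrightarrow> v0 p > 0"
      "\<And>p. p \<in> D \<times> J \<Longrightarrow> dd (0, 1) v0 p = - \<nu> p * \<mu> (snd p) * v0 p"
    and z1: "z1 \<in> D" and zt: "z \<in> D" "t \<in> J"
  shows "f (z, t) \<bullet> N (z, t) = v0 (z, t) * (f (z, 0) \<bullet> N (z, 0) / v0 (z, 0)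
    + (LBINT \<tau>=0..ereal t. (f (z1, \<tau>) \<bullet> c \<tau>) * \<nu> (z, \<tau>) / v0 (z, \<tau>)))"
proof -
  let ?S = "D \<times> J"
  have S: "open ?S" using D J by (simp add: open_Times)
  note d = smooth_on_differentiable
  define V where "V t = f (z1, t) \<bullet> c t" for t
  have Vs: "smooth_on J V" unfolding V_def[abs_def]
    by (intro smooth_on_inner J sm smooth_on_slice_snd[OF D(1) J(1) z1 f])
  have fc: "f (z, t) \<bullet> c t = V t" if z: "z \<in> D" and t: "t \<in> J" for z t
    unfolding V_def
  proof (rule slice_constant[OF D(2) _ _ z z1, of "\<lambda>p. f p \<bullet> c t" t])
    fix z' assume z': "z' \<in> D"
    have p: "(z', t) \<in> ?S" using z' t by simp
    show "(\<lambda>p. f p \<bullet> c t) differentiable (at (z', t))" by (rule differentiable_linear[OF bounded_linear_inner_left d[OF f p]])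
    fix u
    have "\<nu> (z', t) * (dd (u, 0) f (z', t) \<bullet> c t) = 0"
      using fNs[OF p, of u] fN[OF p, of "(u, 0)"] Ns[OF p] by (simp add: inner_diff_right)
    then show "dd (u, 0) (\<lambda>p. f p \<bullet> c t) (z', t) = 0"
      using dd_linear[OF bounded_linear_inner_left d[OF f p]] \<nu>[OF p] by simp
  qed
  define \<gamma> where "\<gamma> p = f p \<bullet> N p" for p
  have \<gamma>s: "smooth_on ?S \<gamma>" unfolding \<gamma>_def[abs_def] by (intro smooth_intros S f N)
  have \<gamma>1: "dd (0, 1) \<gamma> p = \<nu> p * (V (snd p) - \<mu> (snd p) * \<gamma> p)" if p: "p \<in> ?S" for p
    unfolding \<gamma>_def[abs_def] dd_inner[OF d[OF f p] d[OF N p]] Ns[OF p] fN[OF p]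
    using fc[of "fst p" "snd p"] p by (auto simp: inner_diff_right)
  define h where "h p = V (snd p) * \<nu> p / v0 p" for p
  have hs: "smooth_on ?S h" unfolding h_def[abs_def]
    by (intro smooth_intros S smooth_on_comp_snd[OF D(1) J(1) Vs] sm v0) (use v0(2) in force)
  define L where "L p = (LBINT \<tau>=0..ereal (snd p). h (fst p, \<tau>))" for p
  have Ls: "smooth_on ?S L" unfolding L_def[abs_def] by (rule partial_integral(1)[OF D(1) J hs])
  have L1: "dd (0, 1) L (z, t) = h (z, t)" if "z \<in> D" "t \<in> J" for z t
    unfolding L_def[abs_def] by (rule partial_integral(2)[OF D(1) J hs that])
  have "\<gamma> (z, t) / v0 (z, t) - L (z, t) = \<gamma> (z, 0) / v0 (z, 0) - L (z, 0)"
  proof (rule slice_constant_snd[OF J(2) _ _ zt(2) J(3), of "\<lambda>p. \<gamma> p / v0 p - L p"])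
    fix t assume t: "t \<in> J"
    have p: "(z, t) \<in> ?S" using zt t by simp
    have nz: "v0 (z, t) \<noteq> 0" using v0(2)[OF p] by simp
    have dq: "(\<lambda>p. \<gamma> p / v0 p) differentiable (at (z, t))" by (rule differentiable_divide[OF d[OF \<gamma>s p] d[OF v0(1) p] nz])
    show "(\<lambda>p. \<gamma> p / v0 p - L p) differentiable (at (z, t))" by (rule differentiable_diff[OF dq d[OF Ls p]])
    have "dd (0, 1) (\<lambda>p. \<gamma> p / v0 p) (z, t) = h (z, t)"
      unfolding dd_divide[OF d[OF \<gamma>s p] d[OF v0(1) p] nz, of "(0, 1)"] \<gamma>1[OF p] v0(3)[OF p]
      using nz by (simp add: h_def field_simps power2_eq_square)
    then show "dd (0, 1) (\<lambda>p. \<gamma> p / v0 p - L p) (z, t) = 0"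
      using dd_diff[OF dq d[OF Ls p], of "(0, 1)"] L1[OF zt(1) t] by simp
  qed
  moreover have "L (z, 0) = 0" by (simp add: L_def zero_ereal_def[symmetric])
  ultimately have "\<gamma> (z, t) = v0 (z, t) * (\<gamma> (z, 0) / v0 (z, 0) + L (z, t))"
    using v0(2)[of "(z, t)"] zt by (simp add: field_simps)
  then show ?thesis by (simp add: \<gamma>_def L_def h_def V_def)
qed

text \<open>Everything is constructed in the coordinates of the covering chart \<open>c0\<close> and
  lifted. The data live on a set \<open>D\<close> larger than the chart image \<open>D0\<close>,
  because the base point \<open>zs\<close> of the tube lies outside \<open>D0\<close>.\<close>

lemma tube_from_chart:
  fixes A :: "('p::{t2_space, second_countable_topology}, real^'m) chart set"
    and f N :: "(real^'m) \<times> real \<Rightarrow> 'b::euclidean_space"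
  assumes dim: "DIM('b) = CARD('m) + 2"
    and A: "smooth_atlas A" "c0 \<in> A" "fst c0 = points A"
    and D: "open D" and J: "open J" "is_interval J" "0 \<in> J"
    and N: "smooth_on (D \<times> J) N" "\<And>p. p \<in> D \<times> J \<Longrightarrow> inj (\<lambda>w. dd w N p)" "\<And>p. p \<in> D \<times> J \<Longrightarrow> N p \<bullet> N p = 1"
    and sm: "smooth_on J c" "smooth_on J \<mu>" "smooth_on (D \<times> J) \<nu>"
    and \<nu>: "\<And>p. p \<in> D \<times> J \<Longrightarrow> \<nu> p > 0" "\<And>p. p \<in> D \<times> J \<Longrightarrow> (\<nu> p)\<^sup>2 = dd (0, 1) N p \<bullet> dd (0, 1) N p"
    and Ns: "\<And>p. p \<in> D \<times> J \<Longrightarrow> dd (0, 1) N p = \<nu> p *\<^sub>R (c (snd p) - \<mu> (snd p) *\<^sub>R N p)"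
    and orth: "\<And>p u. p \<in> D \<times> J \<Longrightarrow> dd (u, 0) N p \<bullet> dd (0, 1) N p = 0"
    and zs: "zs \<in> D" "\<And>t. t \<in> J \<Longrightarrow> \<nu> (zs, t) = 1"
    and D0: "D0 = snd c0 ` fst c0" "convex D0" "D0 \<subseteq> D" "z1 \<in> D0" "\<And>z t. z \<in> D0 \<Longrightarrow> t \<in> J \<Longrightarrow> N (z, t) \<noteq> N (zs, t)"
    and f: "smooth_on (D \<times> J) f" "\<And>p w. p \<in> D \<times> J \<Longrightarrow> dd w f p \<bullet> N p = 0"
      "\<And>p u. p \<in> D \<times> J \<Longrightarrow> dd (u, 0) f p \<bullet> dd (0, 1) N p = 0"
  shows "\<exists>\<beta> N' g0 v0 \<nu>' U V. ribaucour_partial_tube A J \<beta> N' \<and> metric_decomposition A J N' g0 v0 \<nu>' \<and>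
    smooth_on J V \<and> smooth_map A U \<and>
    (\<forall>x\<in>points A. \<forall>t\<in>J. f (snd c0 x, t) = gauss_parametrization (prod_atlas A J) N' (gamma_fun v0 \<nu>' U V) (x, t))"
proof -
  note ch = smooth_atlas_chart[OF A(1,2)]
  have oD0: "open D0" unfolding D0(1) by (rule is_chart_open(2)[OF ch])
  let ?S = "D0 \<times> J" and ?B = "prod_atlas A J" and ?pc = "prod_chart c0 J"
  have S: "open ?S" using oD0 J by (simp add: open_Times)
  have sub: "?S \<subseteq> D \<times> J" using D0(3) by auto
  note d = smooth_on_differentiable
  define \<beta> where "\<beta> = (\<lambda>t. N (zs, t))"
  obtain \<xi> :: "'m \<Rightarrow> real \<Rightarrow> 'b" and f0 and \<phi> :: "real \<Rightarrow> real" and \<omega> :: "real \<Rightarrow> 'b" where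
    td: "unit_speed_in_sphere J \<beta>" "parallel_normal_frame J \<beta> \<xi>" "ribaucour_pair J \<beta> \<phi> \<omega>" "smooth_on D0 f0"
      "\<And>z. z \<in> D0 \<Longrightarrow> inj (\<lambda>u. dd u f0 z)"
      "\<And>z t. z \<in> D0 \<Longrightarrow> t \<in> J \<Longrightarrow> N (z, t) = \<beta> t - (2 * \<phi> t / (norm (tube_vector \<beta> \<xi> f0 \<phi> \<omega> z t))\<^sup>2) *\<^sub>R tube_vector \<beta> \<xi> f0 \<phi> \<omega> z t"
      "smooth_on J \<phi>" "\<And>t. t \<in> J \<Longrightarrow> \<phi> t > 0" "\<And>t. t \<in> J \<Longrightarrow> dd 1 \<phi> t = - \<mu> t * \<phi> t"
    using tube_data[OF dim D J N sm \<nu> Ns orth zs oD0 D0(3,4,5) \<beta>_def] by blast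
  obtain v0 \<sigma> where tm: "smooth_on ?S v0" "\<And>p. p \<in> ?S \<Longrightarrow> v0 p > 0" "\<And>p. p \<in> ?S \<Longrightarrow> dd (0, 1) v0 p = - \<nu> p * \<mu> (snd p) * v0 p"
      "smooth_on D0 \<sigma>" "\<And>z. z \<in> D0 \<Longrightarrow> inj (\<lambda>u. dd u \<sigma> z)" "\<And>z. z \<in> D0 \<Longrightarrow> \<sigma> z \<bullet> \<sigma> z = 1"
      "\<And>z. z \<in> D0 \<Longrightarrow> \<sigma> z \<bullet> c 0 = 0" "c 0 \<noteq> 0"
      "\<And>z t u v a b. z \<in> D0 \<Longrightarrow> t \<in> J \<Longrightarrow> dd (u, a) N (z, t) \<bullet> dd (v, b) N (z, t) =
      (v0 (z, t))\<^sup>2 * (dd u \<sigma> z \<bullet> dd v \<sigma> z) + (\<nu> (z, t))\<^sup>2 * (a * b)"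
    using tube_metric[OF D J N sm \<nu> Ns orth zs oD0 D0(3,5) td(7,8,9)] by blast
  note B = prod_smooth_atlas[OF A(1) J(1)]
  note pc = prod_global_chart[OF A(2,3), of J]
  have pim: "snd ?pc ` fst ?pc = ?S" by (simp add: prod_chart_simps(3) D0(1))
  have pch: "is_chart ?pc" by (rule smooth_atlas_chart[OF B pc(1)])
  define lift :: "((real^'m) \<times> real \<Rightarrow> real) \<Rightarrow> 'p \<times> real \<Rightarrow> real" where "lift F p = F (snd ?pc p)" for F p
  have lift: "lift F (x, t) = F (snd c0 x, t)" for F x t by (simp add: lift_def prod_chart_simps)
  have lift_smooth: "smooth_map ?B (lift F)" if "smooth_on ?S F" for F
    unfolding lift_def[abs_def] using global_chart_smooth[OF B pc] that by (simp add: pim)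
  define N' where "N' p = N (snd ?pc p)" for p
  have N': "N' (x, t) = N (snd c0 x, t)" for x t by (simp add: N'_def prod_chart_simps)
  have NS: "smooth_on ?S N" "\<And>p. p \<in> ?S \<Longrightarrow> inj (\<lambda>w. dd w N p)"
    using smooth_on_subset[OF N(1) sub] N(2) sub by auto
  have imN: "immersion ?B N'" unfolding N'_def[abs_def]
    by (rule global_chart_immersion[OF B pc]) (use NS in \<open>auto simp: pim\<close>)
  have xD: "snd c0 x \<in> D0" if "x \<in> points A" for x using that A(3) D0(1) by auto
  define f0' where "f0' x = f0 (snd c0 x)" for x
  have ld: "local_diffeo A f0'" unfolding f0'_def[abs_def]
    by (rule global_chart_local_diffeo[OF A]) (use td(4,5) in \<open>auto simp: D0(1)\<close>)
  have tube: "ribaucour_partial_tube A J \<beta> N'"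
    unfolding ribaucour_partial_tube_def
  proof (intro conjI exI[of _ \<xi>] exI[of _ f0'] exI[of _ \<phi>] exI[of _ \<omega>] ballI td(1-3) ld imN)
    fix x s assume x: "x \<in> points A" and s: "s \<in> J"
    have "tube_vector \<beta> \<xi> f0' \<phi> \<omega> x s = tube_vector \<beta> \<xi> f0 \<phi> \<omega> (snd c0 x) s" by (simp add: tube_vector_def f0'_def)
    then show "N' (x, s) = \<beta> s - (2 * \<phi> s / (norm (tube_vector \<beta> \<xi> f0' \<phi> \<omega> x s))\<^sup>2) *\<^sub>R tube_vector \<beta> \<xi> f0' \<phi> \<omega> x s"
      using td(6)[OF xD[OF x] s] by (simp add: N')
  qed
  define \<sigma>' where "\<sigma>' x = \<sigma> (snd c0 x)" for x
  have im\<sigma>: "immersion A \<sigma>'" unfolding \<sigma>'_def[abs_def]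
    by (rule global_chart_immersion[OF A]) (use tm(4,5) in \<open>auto simp: D0(1)\<close>)
  have \<nu>s: "smooth_on ?S \<nu>" by (rule smooth_on_subset[OF sm(3) sub])
  have dim': "DIM('b) = DIM(real^'m) + 2" using dim by simp
  have md: "metric_decomposition A J N' (induced_metric \<sigma>') (lift v0) (lift \<nu>)"
    unfolding metric_decomposition_def
  proof (intro conjI ballI allI)
    show "riemannian_metric A (induced_metric \<sigma>')" by (rule induced_metric_riemannian[OF A(1) im\<sigma>])
    show "constant_curvature A (induced_metric \<sigma>') 1"
      unfolding constant_curvature_def
    proof (intro ballI allI impI)
      fix e x and u v :: "real^'m" assume e: "e \<in> A" and x: "x \<in> fst e" and uv: "u \<noteq> v \<and> independent {u, v}"
      have sub: "y \<in> points A" if "y \<in> fst e" for y using that e by (auto simp: points_def)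
      show "sectional_curvature (induced_metric \<sigma>') e x u v = 1"
      proof (rule curvature_sphere[OF smooth_atlas_chart[OF A(1) e] dim' _ _ _ tm(8) _ x])
        show "smooth_on (snd e ` fst e) (\<sigma>' \<circ> chart_inv e)"
          using im\<sigma> e by (auto simp: immersion_def smooth_map_def)
        show "inj (differential e \<sigma>' y)" if "y \<in> fst e" for y
          using im\<sigma> e that sub[OF that] by (auto simp: immersion_def regular_point_def)
        show "\<sigma>' y \<bullet> \<sigma>' y = 1" "\<sigma>' y \<bullet> c 0 = 0" if "y \<in> fst e" for y
          using tm(6,7) xD[OF sub[OF that]] by (auto simp: \<sigma>'_def)
      qed (use uv in auto)
    qed
    show "smooth_map ?B (lift v0)" "smooth_map ?B (lift \<nu>)" by (intro lift_smooth tm(1) \<nu>s)+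
    show "lift v0 (x, s) > 0" "lift \<nu> (x, s) > 0" if "x \<in> points A" "s \<in> J" for x s
      using tm(2) \<nu>(1) xD[OF that(1)] that(2) sub by (auto simp: lift)
    fix e x s and u v :: "real^'m" and a b :: real
    assume e: "e \<in> A" and x: "x \<in> fst e" and s: "s \<in> J"
    have xA: "x \<in> points A" using e x by (auto simp: points_def)
    then have xc: "x \<in> fst c0" using A(3) by simp
    have pe: "prod_chart e J \<in> ?B" "(x, s) \<in> fst (prod_chart e J)"
      using e x s by (auto simp: prod_atlas_def prod_chart_simps)
    let ?L = "differential e (snd c0) x"
    have dN: "differential (prod_chart e J) N' (x, s) (u, a) = dd (?L u, a) N (snd c0 x, s)" for u a
    proof -
      have "differential (prod_chart e J) N' (x, s) (u, a)
          = dd (differential (prod_chart e J) (snd ?pc) (x, s) (u, a)) N (snd ?pc (x, s))"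
        unfolding N'_def[abs_def] by (rule global_chart_differential[OF B pc _ pe]) (use NS in \<open>simp add: pim\<close>)
      then show ?thesis
        using prod_differential_transition[OF A(1,2) e J(1) xc x s, of u a] by (simp add: prod_chart_simps)
    qed
    have d\<sigma>: "differential e \<sigma>' x u = dd (?L u) \<sigma> (snd c0 x)" for u
      unfolding \<sigma>'_def[abs_def] by (rule global_chart_differential[OF A _ e x]) (use tm(4) in \<open>simp add: D0(1)\<close>)
    show "induced_metric N' (prod_chart e J) (x, s) (u, a) (v, b) =
        (lift v0 (x, s))\<^sup>2 * induced_metric \<sigma>' e x u v + (lift \<nu> (x, s))\<^sup>2 * (a * b)"
      unfolding induced_metric_def dN d\<sigma> lift by (rule tm(9)[OF xD[OF xA] s])
  qed
  define V where "V t = f (z1, t) \<bullet> c t" for t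
  have z1D: "z1 \<in> D" using D0 by auto
  have Vs: "smooth_on J V" unfolding V_def[abs_def]
    by (intro smooth_on_inner J sm smooth_on_slice_snd[OF D J(1) z1D f(1)])
  define U where "U z = f (z, 0) \<bullet> N (z, 0) / v0 (z, 0)" for z
  have fS: "smooth_on ?S f" by (rule smooth_on_subset[OF f(1) sub])
  have Us: "smooth_on D0 U" unfolding U_def[abs_def]
    by (intro smooth_on_divide smooth_on_inner oD0 smooth_on_slice[OF oD0 J(1) J(3)] fS NS tm(1)) (use tm(2) J(3) in force)
  have U's: "smooth_map A (\<lambda>x. U (snd c0 x))" by (rule global_chart_smooth[OF A]) (use Us D0(1) in simp)
  let ?g = "gamma_fun (lift v0) (lift \<nu>) (\<lambda>x. U (snd c0 x)) V"
  have supp: "f (z, t) \<bullet> N (z, t) = v0 (z, t) * (U z + (LBINT \<tau>=0..ereal t. V \<tau> * \<nu> (z, \<tau>) / v0 (z, \<tau>)))"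
    if zt: "z \<in> D0" "t \<in> J" for z t
    unfolding U_def V_def
    by (rule support_function_integral[OF oD0 D0(2) J fS NS(1) sm(1,2) \<nu>s _ _ _ _ tm(1) _ _ D0(4) zt])
       (use \<nu>(1) Ns f(2,3) tm(2,3) sub in auto)
  have g: "?g (x, t) = f (snd c0 x, t) \<bullet> N (snd c0 x, t)" if "x \<in> points A" "t \<in> J" for x t
    using supp[OF xD[OF that(1)] that(2)] by (simp add: gamma_fun_def lift)
  have gs: "smooth_map ?B ?g"
  proof -
    have "smooth_on ?S (\<lambda>p. f p \<bullet> N p)" by (intro smooth_intros S fS NS)
    from lift_smooth[OF this] show ?thesis
      using smooth_map_cong[of ?B ?g "lift (\<lambda>p. f p \<bullet> N p)"] smooth_atlas_chart[OF B] g
      by (auto simp: points_prod lift)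
  qed
  have "f (snd c0 x, t) = gauss_parametrization ?B N' ?g (x, t)" if x: "x \<in> points A" and t: "t \<in> J" for x t
  proof -
    let ?p = "(snd c0 x, t)"
    have p: "?p \<in> ?S" "?p \<in> D \<times> J" using xD[OF x] t sub by auto
    have pp: "(x, t) \<in> fst ?pc" using x t A(3) by (simp add: prod_chart_simps)
    have Nw: "N ?p \<bullet> dd w N ?p = 0" for w by (rule unit_derivative[OF S NS(1) _ p(1)]) (use N(3) sub in auto)
    have spc: "snd ?pc (x, t) = ?p" by (simp add: prod_chart_simps)
    have dN: "differential ?pc N' (x, t) w = dd w N ?p" for w
      using chart_self_differential[OF pch pp, of N w] by (simp add: N'_def[abs_def] spc)
    have dg: "differential ?pc ?g (x, t) w = f ?p \<bullet> dd w N ?p" for w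
    proof -
      have "differential ?pc ?g (x, t) w = differential ?pc (\<lambda>p. (\<lambda>p. f p \<bullet> N p) (snd ?pc p)) (x, t) w"
      proof (rule differential_cong[OF pch is_chart_open(1)[OF pch] _ pp])
        fix y assume "y \<in> fst ?pc"
        then show "?g y = (\<lambda>p. f p \<bullet> N p) (snd ?pc y)"
          using g A(3) by (auto simp: prod_chart_simps)
      qed simp
      also have "\<dots> = dd w (\<lambda>p. f p \<bullet> N p) ?p" using chart_self_differential[OF pch pp, of "\<lambda>p. f p \<bullet> N p" w] by (simp add: spc)
      also have "\<dots> = f ?p \<bullet> dd w N ?p" using dd_inner[OF d[OF fS p(1)] d[OF NS(1) p(1)], of w] f(2)[OF p(2)] by simp
      finally show ?thesis .
    qed
    \<comment> \<open>The tangential part of \<open>f\<close>. Because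
      \<open>df \<bullet> N = 0\<close>, the differential of \<open>\<gamma> = f \<bullet> N\<close>
      is \<open>f \<bullet> dN\<close>, so this part is the pushed-forward gradient.\<close>
    let ?Y = "f ?p - (f ?p \<bullet> N ?p) *\<^sub>R N ?p"
    have NN: "N ?p \<bullet> N ?p = 1" by (rule N(3)[OF p(2)])
    have dimp: "DIM('b) = DIM((real^'m) \<times> real) + 1" using dim by simp
    have "range (\<lambda>w. dd w N ?p) = {y. N ?p \<bullet> y = 0}"
      by (rule range_eq_hyperplane[OF linear_dd[OF d[OF NS(1) p(1)]] NS(2)[OF p(1)] dimp _ Nw]) (use NN in auto)
    moreover have "N ?p \<bullet> ?Y = 0" using NN by (simp add: inner_diff_right inner_commute)
    ultimately have Yr: "?Y \<in> range (differential ?pc N' (x, t))" using dN by auto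
    have "gauss_parametrization ?B N' ?g (x, t) = ?g (x, t) *\<^sub>R N' (x, t) + ?Y"
      by (rule gauss_parametrization_eq[OF B pc(1) pp imN gs Yr]) (simp add: dN dg inner_diff_left Nw)
    then show ?thesis by (simp add: g[OF x t] N')
  qed
  then show ?thesis using tube md Vs U's
    by (intro exI[of _ \<beta>] exI[of _ N'] exI[of _ "induced_metric \<sigma>'"] exI[of _ "lift v0"] exI[of _ "lift \<nu>"]
        exI[of _ "\<lambda>x. U (snd c0 x)"] exI[of _ V]) blast
qed

subsection \<open>The converse\<close>

text \<open>Near the given point the Gauss map \<open>n\<close> is an immersion by the rank
  condition and is injective on a ball; inside it \<open>leaf_spheres\<close> applies, and the
  trajectory through \<open>zs\<close>, parametrized by arc length of its Gauss image, provides the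
  base curve.\<close>

lemma hypersurface_is_tube:
  fixes A :: "('p::{t2_space, second_countable_topology}, real^'m) chart set" and f :: "'p \<times> real \<Rightarrow> real^'k"
  assumes dim: "CARD('k) = CARD('m) + 2"
    and A: "smooth_atlas A" and I: "open I"
    and im: "immersion (prod_atlas A I) f"
    and no: "net_orthogonal (prod_atlas A I) f"
    and sa: "second_form_adapted (prod_atlas A I) f"
    and lh: "leaves_in_hyperplanes (prod_atlas A I) f"
    and rk: "shape_operator_rank (prod_atlas A I) f (CARD('m) + 1)"
    and x0: "x0 \<in> points A" and s0: "s0 \<in> I"
  shows "\<exists>W J K h (\<beta> :: real \<Rightarrow> real^'k) N g0 v0 \<nu> U V.
             open W \<and> connected W \<and> x0 \<in> W \<and> W \<subseteq> points A \<and>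
             open J \<and> is_interval J \<and> 0 \<in> J \<and>
             open K \<and> is_interval K \<and> s0 \<in> K \<and> K \<subseteq> I \<and> interval_diffeo J K h \<and>
             ribaucour_partial_tube (restrict_atlas A W) J \<beta> N \<and>
             metric_decomposition (restrict_atlas A W) J N g0 v0 \<nu> \<and>
             smooth_on J V \<and> smooth_map (restrict_atlas A W) U \<and>
             (\<forall>x\<in>W. \<forall>t\<in>J. f (x, h t) =
                gauss_parametrization (prod_atlas (restrict_atlas A W) J) N (gamma_fun v0 \<nu> U V) (x, t))"
proof -
  let ?B = "prod_atlas A I"
  obtain c where c: "c \<in> A" "x0 \<in> fst c" using x0 by (auto simp: points_def)
  note ch = smooth_atlas_chart[OF A c(1)]
  let ?pc = "prod_chart c I" and ?Dc = "snd c ` fst c"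
  note B = prod_smooth_atlas[OF A I]
  have pcB: "?pc \<in> ?B" using c by (simp add: prod_atlas_def)
  have pch: "is_chart ?pc" by (rule smooth_atlas_chart[OF B pcB])
  have pim: "snd ?pc ` fst ?pc = ?Dc \<times> I" by (rule prod_chart_simps(3))
  note oDc = is_chart_open(2)[OF ch]
  have oP: "open (?Dc \<times> I)" using oDc I by (simp add: open_Times)
  define F where "F = f \<circ> chart_inv ?pc"
  have Fs: "smooth_on (?Dc \<times> I) F" using im pcB pim by (auto simp: immersion_def smooth_map_def F_def)
  have pt: "(chart_inv c z, s) \<in> fst ?pc" "snd ?pc (chart_inv c z, s) = (z, s)" "F (z, s) = f (chart_inv c z, s)"
    if "z \<in> ?Dc" "s \<in> I" for z s
    using chart_inv_right[OF that(1)] prod_chart_inv[OF ch that] that(2)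
    by (auto simp: prod_chart_simps F_def)
  have dF: "differential ?pc f (chart_inv c z, s) w = dd w F (z, s)" if "z \<in> ?Dc" "s \<in> I" for z s w
    using pt(2)[OF that] by (simp add: differential_eq_dd F_def)
  have dF': "differential ?pc f (chart_inv c z, s) = (\<lambda>w. dd w F (z, s))" if "z \<in> ?Dc" "s \<in> I" for z s
    by (rule ext) (rule dF[OF that])
  have injF: "inj (\<lambda>w. dd w F p)" if p: "p \<in> ?Dc \<times> I" for p
  proof -
    have zs: "fst p \<in> ?Dc" "snd p \<in> I" using p by auto
    have "regular_point ?B f (chart_inv c (fst p), snd p)"
      using im pt(1)[OF zs] pcB unfolding immersion_def points_def by blast
    then have "inj (differential ?pc f (chart_inv c (fst p), snd p))"
      using pt(1)[OF zs] pcB unfolding regular_point_def by blast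
    then show ?thesis unfolding dF'[OF zs] by simp
  qed
  define z0 where "z0 = snd c x0"
  have z0: "z0 \<in> ?Dc" using c(2) by (simp add: z0_def)
  have dimb: "DIM(real^'k) = DIM((real^'m) \<times> real) + 1" using dim by simp
  have p0: "(z0, s0) \<in> ?Dc \<times> I" using z0 s0 by simp
  obtain S n where S: "open S" "(z0, s0) \<in> S" "S \<subseteq> ?Dc \<times> I" and ns: "smooth_on S n"
    and n1: "\<And>p. p \<in> S \<Longrightarrow> n p \<bullet> n p = 1" and nF: "\<And>p v. p \<in> S \<Longrightarrow> n p \<bullet> dd v F p = 0"
    using unit_normal_exists[OF dimb oP Fs injF p0] by blast
  have injn: "inj (\<lambda>w. dd w n p)" if p: "p \<in> S" for p
  proof -
    have zs: "fst p \<in> ?Dc" "snd p \<in> I" using p S(3) by auto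
    let ?x = "(chart_inv c (fst p), snd p)"
    note x = pt(1,2)[OF zs]
    have un: "unit_normal f ?pc ?x (n p)"
      using n1[OF p] nF[OF p] dF[OF zs] by (simp add: unit_normal_def norm_eq_sqrt_inner)
    have "inj (\<lambda>v. dd v n (snd ?pc ?x))"
    proof (rule normal_immersion[OF pch x(1) dimb S(1)])
      show "S \<subseteq> snd ?pc ` fst ?pc" using S(3) pim by simp
      show "snd ?pc ?x \<in> S" using x(2) p by simp
      show "smooth_on S (f \<circ> chart_inv ?pc)" using smooth_on_subset[OF Fs S(3)] by (simp add: F_def)
      show "inj (differential ?pc f ?x)" using injF[of p] p S(3) unfolding dF'[OF zs] by auto
      show "n z \<bullet> dd v (f \<circ> chart_inv ?pc) z = 0" if "z \<in> S" for z v using nF[OF that] by (simp add: F_def)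
      have "dim (range (shape_operator f ?pc ?x (n p))) = CARD('m) + 1"
        using rk pcB x(1) un unfolding shape_operator_rank_def by blast
      then show "dim (range (shape_operator f ?pc ?x (n (snd ?pc ?x)))) = DIM((real^'m) \<times> real)"
        using x(2) by simp
    qed (use ns n1 in auto)
    then show ?thesis using x(2) by simp
  qed
  obtain r where r: "r > 0" "ball (z0, s0) r \<subseteq> S" "inj_on n (ball (z0, s0) r)"
    using immersion_locally_injective[OF S(1) ns injn S(2)] by blast
  \<comment> \<open>Half the radius, since a distance in the product is at most the sum of the
    distances in the factors.\<close>
  define e where "e = r / 2"
  have e: "e > 0" using r by (simp add: e_def)
  define D where "D = ball z0 e"
  define K where "K = {s0 - e<..<s0 + e}"
  have DK: "D \<times> K \<subseteq> ball (z0, s0) r"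
  proof
    fix p assume "p \<in> D \<times> K"
    then have "dist z0 (fst p) < e" "dist s0 (snd p) < e" by (auto simp: D_def K_def dist_real_def)
    then have "dist (z0, s0) p < e + e"
      using sqrt_sum_squares_le_sum_abs[of "dist z0 (fst p)" "dist s0 (snd p)"] by (simp add: dist_prod_def)
    then show "p \<in> ball (z0, s0) r" by (simp add: e_def)
  qed
  have DKS: "D \<times> K \<subseteq> S" "D \<times> K \<subseteq> ?Dc \<times> I" using DK r(2) S(3) by blast+
  have oD: "open D" "convex D" "D \<noteq> {}" using e by (auto simp: D_def)
  have oK: "open K" "is_interval K" "s0 \<in> K" using e by (auto simp: K_def is_interval_oo)
  have z0D: "z0 \<in> D" using e by (simp add: D_def)
  have DDc: "D \<subseteq> ?Dc" "K \<subseteq> I" using DKS(2) oD(3) oK(3) by auto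
  have orth: "dd (u, 0) F p \<bullet> dd (0, 1) F p = 0" if p: "p \<in> D \<times> K" for p u
  proof -
    have zs: "fst p \<in> ?Dc" "snd p \<in> I" using p DDc by auto
    have "induced_metric f ?pc (chart_inv c (fst p), snd p) (u, 0) (0, 1) = 0"
      using no pcB pt(1)[OF zs] unfolding net_orthogonal_def E0_def E1_def by blast
    then show ?thesis using dF[OF zs] by (simp add: induced_metric_def)
  qed
  \<comment> \<open>A vanishing second fundamental form says that the second derivative equals its
    projection to the tangent space, so it is orthogonal to \<open>n\<close>.\<close>
  have adapted: "n p \<bullet> dd (u, 0) (dd (0, 1) F) p = 0" if p: "p \<in> D \<times> K" for p u
  proof -
    have zs: "fst p \<in> ?Dc" "snd p \<in> I" using p DDc by auto
    have pS: "p \<in> S" using p DKS by auto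
    let ?x = "(chart_inv c (fst p), snd p)"
    let ?w = "dd (u, 0) (dd (0, 1) F) p"
    have "differential ?pc (\<lambda>y. differential ?pc f y (0, 1)) ?x (u, 0) = ?w"
      using second_differential_eq_dd[OF pch pt(1)[OF zs], of f "(0, 1)" "(u, 0)"] pt(2)[OF zs] by (simp add: F_def)
    moreover have R: "range (differential ?pc f ?x) = range (\<lambda>w. dd w F p)" unfolding dF'[OF zs] by simp
    moreover have "second_fundamental_form f ?pc ?x (u, 0) (0, 1) = 0"
      using sa pcB pt(1)[OF zs] unfolding second_form_adapted_def E0_def E1_def by blast
    ultimately have w: "?w = closest_point (range (\<lambda>w. dd w F p)) ?w"
      by (simp add: second_fundamental_form_def Let_def)
    have lin: "linear (\<lambda>w. dd w F p)" by (rule linear_dd[OF smooth_on_differentiable[OF Fs]]) (use zs in \<open>auto simp: mem_Times_iff\<close>)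
    have "closed (range (\<lambda>w. dd w F p))" by (rule closed_subspace[OF linear_subspace_image[OF lin subspace_UNIV]])
    then have "closest_point (range (\<lambda>w. dd w F p)) ?w \<in> range (\<lambda>w. dd w F p)" by (rule closest_point_in_set) auto
    then have "?w \<in> range (\<lambda>w. dd w F p)" using w by simp
    then show ?thesis using nF[OF pS] by auto
  qed
  have leaves: "\<exists>a b. a \<noteq> 0 \<and> (\<forall>z\<in>D. a \<bullet> F (z, s) = b)" if s: "s \<in> K" for s
  proof -
    obtain a b where ab: "a \<noteq> 0" "f ` (points ?B \<inter> UNIV \<times> {s}) \<subseteq> {y. a \<bullet> y = b}"
      using lh unfolding leaves_in_hyperplanes_def by blast
    have "a \<bullet> F (z, s) = b" if z: "z \<in> D" for z
    proof -
      have zs: "z \<in> ?Dc" "s \<in> I" using z s DDc by auto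
      have "chart_inv c z \<in> points A" using chart_inv_right[OF zs(1)] c(1) by (auto simp: points_def)
      then have "(chart_inv c z, s) \<in> points ?B \<inter> UNIV \<times> {s}" using zs(2) by (simp add: points_prod)
      then show ?thesis using ab(2) pt(3)[OF zs] by auto
    qed
    then show ?thesis using ab(1) by blast
  qed
  have dimb': "DIM(real^'k) = DIM(real^'m) + 2" "DIM(real^'k) = CARD('m) + 2" using dim by auto
  have sDK: "smooth_on (D \<times> K) F" "smooth_on (D \<times> K) n" using smooth_on_subset[OF Fs DKS(2)] smooth_on_subset[OF ns DKS(1)] by auto
  have iDK: "inj (\<lambda>w. dd w F p)" "inj (\<lambda>w. dd w n p)" "n p \<bullet> n p = 1" "n p \<bullet> dd w F p = 0" if "p \<in> D \<times> K" for p w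
    using injF[OF subsetD[OF DKS(2) that]] injn[OF subsetD[OF DKS(1) that]] n1[OF subsetD[OF DKS(1) that]]
      nF[OF subsetD[OF DKS(1) that]] by auto
  obtain cc \<mu> \<nu> where ls: "smooth_on K cc" "smooth_on K \<mu>" "smooth_on (D \<times> K) \<nu>"
    "\<And>p. p \<in> D \<times> K \<Longrightarrow> \<nu> p > 0"
    "\<And>p. p \<in> D \<times> K \<Longrightarrow> dd (0, 1) n p = \<nu> p *\<^sub>R (cc (snd p) - \<mu> (snd p) *\<^sub>R n p)"
    "\<And>p. p \<in> D \<times> K \<Longrightarrow> (\<nu> p)\<^sup>2 = dd (0, 1) n p \<bullet> dd (0, 1) n p"
    "\<And>p u. p \<in> D \<times> K \<Longrightarrow> dd (u, 0) n p \<bullet> dd (0, 1) n p = 0"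
    "\<And>p u. p \<in> D \<times> K \<Longrightarrow> dd (u, 0) F p \<bullet> dd (0, 1) n p = 0"
    using leaf_spheres[OF dimb'(1) oD oK(1) sDK(1) iDK(1) sDK(2) iDK(2,3,4) orth adapted leaves] by blast
  \<comment> \<open>the base curve is an orthogonal trajectory of the leaves outside the final neighbourhood \<open>D0\<close>\<close>
  obtain b :: "real^'m" where b: "b \<in> Basis" using nonempty_Basis by blast
  define zs where "zs = z0 + (e / 2) *\<^sub>R b"
  define D0 where "D0 = ball z0 (e / 2)"
  have dz: "dist z0 zs = e / 2" using e b by (simp add: zs_def dist_norm)
  have zsD: "zs \<in> D" "zs \<notin> D0" using dz e by (auto simp: D_def D0_def)
  have D0: "open D0" "convex D0" "z0 \<in> D0" "D0 \<subseteq> D" using e by (auto simp: D0_def D_def)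
  have \<rho>: "smooth_on K (\<lambda>s. \<nu> (zs, s))" "\<And>s. s \<in> K \<Longrightarrow> \<nu> (zs, s) > 0"
    using smooth_on_slice_snd[OF oD(1) oK(1) zsD(1) ls(3)] ls(4) zsD(1) by auto
  obtain J h where J: "open J" "is_interval J" "0 \<in> J" "interval_diffeo J K h"
    and h: "\<And>t. t \<in> J \<Longrightarrow> h t \<in> K" "\<And>t. t \<in> J \<Longrightarrow> dd 1 h t > 0" "\<And>t. t \<in> J \<Longrightarrow> dd 1 h t * \<nu> (zs, h t) = 1"
    using arclength_reparametrization[OF e K_def \<rho>] by blast
  have hs: "smooth_on J h" using J(4) by (simp add: interval_diffeo_def)
  have hK: "h ` J \<subseteq> K" using h(1) by auto
  have DJ: "open (D \<times> J)" using oD J by (simp add: open_Times)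
  define N where "N = (\<lambda>p. n (fst p, h (snd p)))"
  define G where "G = (\<lambda>p. F (fst p, h (snd p)))"
  note rN = reparametrize[OF oD(1) J(1) oK(1) hs hK sDK(2), folded N_def]
  note rG = reparametrize[OF oD(1) J(1) oK(1) hs hK sDK(1), folded G_def]
  have q: "(fst p, h (snd p)) \<in> D \<times> K" "fst p \<in> D" "snd p \<in> J" if "p \<in> D \<times> J" for p using that h(1) by auto
  have dn: "n differentiable (at (fst p, h (snd p)))" "F differentiable (at (fst p, h (snd p)))" if "p \<in> D \<times> J" for p
    using smooth_on_differentiable[OF sDK(2) q(1)[OF that]] smooth_on_differentiable[OF sDK(1) q(1)[OF that]] by auto
  have dNp: "dd (u, a) N p = dd (u, 0) n (fst p, h (snd p)) + (a * dd 1 h (snd p)) *\<^sub>R dd (0, 1) n (fst p, h (snd p))"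
    and dGp: "dd (u, a) G p = dd (u, 0) F (fst p, h (snd p)) + (a * dd 1 h (snd p)) *\<^sub>R dd (0, 1) F (fst p, h (snd p))"
    if "p \<in> D \<times> J" for p u a
    using rN(2)[OF q(2,3)[OF that]] rG(2)[OF q(2,3)[OF that]] by auto
  have n00: "dd (0, 0) n (fst p, h (snd p)) = 0" if "p \<in> D \<times> J" for p
    using dd_zero_dir[OF dn(1)[OF that]] by (simp add: zero_prod_def)
  have N01: "dd (0, 1) N p = dd 1 h (snd p) *\<^sub>R dd (0, 1) n (fst p, h (snd p))" "dd (u, 0) N p = dd (u, 0) n (fst p, h (snd p))"
    if "p \<in> D \<times> J" for p u
    using dNp[OF that, of 0 1] dNp[OF that, of u 0] n00[OF that] by auto
  \<comment> \<open>The factor \<open>h'\<close> goes entirely into \<open>\<nu>'\<close>, while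
    \<open>c'\<close> and \<open>\<mu>'\<close> are plain reparametrizations; so \<open>Ns\<close>
    keeps its form and \<open>\<nu>' = 1\<close> along \<open>zs\<close>.\<close>
  define \<nu>' where "\<nu>' p = dd 1 h (snd p) * \<nu> (fst p, h (snd p))" for p
  define c' where "c' t = cc (h t)" for t
  define \<mu>' where "\<mu>' t = \<mu> (h t)" for t
  have cs: "smooth_on J c'" unfolding c'_def[abs_def] by (rule smooth_on_compose[OF J(1) oK(1) hK hs ls(1)])
  have \<mu>s: "smooth_on J \<mu>'" unfolding \<mu>'_def[abs_def] by (rule smooth_on_compose[OF J(1) oK(1) hK hs ls(2)])
  have \<nu>s: "smooth_on (D \<times> J) \<nu>'" unfolding \<nu>'_def[abs_def]
    by (intro smooth_on_mult DJ smooth_on_comp_snd[OF oD(1) J(1) smooth_on_dd[OF hs]] reparametrize(1)[OF oD(1) J(1) oK(1) hs hK ls(3)])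
  have injN: "inj (\<lambda>w. dd w N p)" if p: "p \<in> D \<times> J" for p
  proof -
    have dN: "N differentiable (at p)" by (rule smooth_on_differentiable[OF rN(1) p])
    show ?thesis unfolding linear_injective_0[OF linear_dd[OF dN]]
    proof (intro allI impI)
      fix w assume "dd w N p = 0"
      then have "dd (fst w, snd w * dd 1 h (snd p)) n (fst p, h (snd p)) = dd 0 n (fst p, h (snd p))"
        using dNp[OF p, of "fst w" "snd w"] dd_prod_split[OF dn(1)[OF p], of "fst w" "snd w * dd 1 h (snd p)"]
          dd_zero_dir[OF dn(1)[OF p]] by simp
      then have "(fst w, snd w * dd 1 h (snd p)) = 0" using iDK(2)[OF q(1)[OF p]] by (metis injD)
      then show "w = 0" using h(2)[OF q(3)[OF p]] by (simp add: zero_prod_def prod_eq_iff)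
    qed
  qed
  define W where "W = chart_inv c ` D0"
  have D0c: "D0 \<subseteq> ?Dc" using D0(4) DDc(1) by blast
  have cz: "chart_inv c z \<in> fst c" "snd c (chart_inv c z) = z" if "z \<in> D0" for z
    using chart_inv_right[of z c] D0c that by auto
  have W: "open W" "W \<subseteq> fst c" "snd c ` W = D0"
    unfolding W_def using open_chart_preimage[OF ch D0(1) D0c] cz by (force simp: image_image)+
  have WA: "W \<subseteq> points A" using W(2) c(1) by (auto simp: points_def)
  have x0W: "x0 \<in> W" using chart_inv_left[OF ch c(2)] D0(3) unfolding W_def z0_def by (metis imageI)
  have conW: "connected W" unfolding W_def
    by (rule connected_continuous_image[OF continuous_on_subset[OF is_chart_continuous(2)[OF ch] D0c]])
       (rule convex_connected[OF D0(2)])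
  let ?A = "restrict_atlas A W" and ?c0 = "(fst c \<inter> W, snd c)"
  have A': "smooth_atlas ?A" by (rule restrict_smooth_atlas[OF A W(1)])
  have c0: "?c0 \<in> ?A" using c(1) by (auto simp: restrict_atlas_def)
  have pA: "points ?A = W" using WA by (auto simp: points_restrict)
  have fc0: "fst c \<inter> W = W" using W(2) by auto
  have "\<exists>\<beta> N' g0 v0 \<nu>'' U V. ribaucour_partial_tube ?A J \<beta> N' \<and> metric_decomposition ?A J N' g0 v0 \<nu>'' \<and>
    smooth_on J V \<and> smooth_map ?A U \<and>
    (\<forall>x\<in>points ?A. \<forall>t\<in>J. G (snd ?c0 x, t) = gauss_parametrization (prod_atlas ?A J) N' (gamma_fun v0 \<nu>'' U V) (x, t))"
  proof (rule tube_from_chart[where N = N and c = c' and \<mu> = \<mu>' and \<nu> = \<nu>' and zs = zs and ?z1.0 = z0 and D = D and ?D0.0 = D0,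
        OF dimb'(2) A' c0 _ oD(1) J(1-3) rN(1) injN _ cs \<mu>s \<nu>s])
    show "fst ?c0 = points ?A" using pA fc0 by simp
    show "D0 = snd ?c0 ` fst ?c0" using W(3) fc0 by simp
    fix p :: "(real^'m) \<times> real" and u :: "real^'m" assume p: "p \<in> D \<times> J"
    note P = q(1)[OF p]
    have hp: "dd 1 h (snd p) > 0" by (rule h(2)[OF q(3)[OF p]])
    show "N p \<bullet> N p = 1" using iDK(3)[OF P] by (simp add: N_def)
    show "\<nu>' p > 0" unfolding \<nu>'_def using ls(4)[OF P] hp by simp
    show "(\<nu>' p)\<^sup>2 = dd (0, 1) N p \<bullet> dd (0, 1) N p"
      unfolding \<nu>'_def N01[OF p] using ls(6)[OF P] by (simp add: power_mult_distrib power2_eq_square)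
    show "dd (0, 1) N p = \<nu>' p *\<^sub>R (c' (snd p) - \<mu>' (snd p) *\<^sub>R N p)"
      unfolding N01[OF p] ls(5)[OF P] by (simp add: \<nu>'_def c'_def \<mu>'_def N_def)
    show "dd (u, 0) N p \<bullet> dd (0, 1) N p = 0" unfolding N01[OF p] using ls(7)[OF P] by simp
    show "dd w G p \<bullet> N p = 0" for w
      using dGp[OF p, of "fst w" "snd w"] iDK(4)[OF P] by (simp add: N_def inner_add_right inner_commute[of _ "n (fst p, h (snd p))"])
    show "dd (u, 0) G p \<bullet> dd (0, 1) N p = 0" unfolding N01[OF p] dGp[OF p] using ls(8)[OF P] by simp
  next
    show "zs \<in> D" "convex D0" "D0 \<subseteq> D" "z0 \<in> D0" using zsD D0 by auto
    show "\<nu>' (zs, t) = 1" if "t \<in> J" for t using h(3)[OF that] by (simp add: \<nu>'_def)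
    \<comment> \<open>Injectivity of \<open>n\<close> on the ball, combined with \<open>zs\<close>
      lying outside \<open>D0\<close>.\<close>
    show "N (z, t) \<noteq> N (zs, t)" if "z \<in> D0" "t \<in> J" for z t
    proof
      assume "N (z, t) = N (zs, t)"
      then have "n (z, h t) = n (zs, h t)" by (simp add: N_def)
      moreover have "(z, h t) \<in> ball (z0, s0) r" "(zs, h t) \<in> ball (z0, s0) r"
        using DK D0(4) zsD(1) h(1)[OF that(2)] that(1) by blast+
      ultimately have "z = zs" using r(3) by (auto dest: inj_onD)
      then show False using that(1) zsD(2) by simp
    qed
    show "smooth_on (D \<times> J) G" by (rule rG(1))
  qed
  then obtain \<beta> N' g0 v0 \<nu>'' U V where res: "ribaucour_partial_tube ?A J \<beta> N'" "metric_decomposition ?A J N' g0 v0 \<nu>''"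
    "smooth_on J V" "smooth_map ?A U"
    "\<And>x t. x \<in> W \<Longrightarrow> t \<in> J \<Longrightarrow> G (snd c x, t) = gauss_parametrization (prod_atlas ?A J) N' (gamma_fun v0 \<nu>'' U V) (x, t)"
    unfolding pA snd_conv by blast
  have fin: "f (x, h t) = gauss_parametrization (prod_atlas ?A J) N' (gamma_fun v0 \<nu>'' U V) (x, t)" if x: "x \<in> W" and t: "t \<in> J" for x t
  proof -
    have "snd c x \<in> ?Dc" "h t \<in> I" "chart_inv c (snd c x) = x"
      using x W(2) h(1)[OF t] DDc(2) chart_inv_left[OF ch] by auto
    then have "G (snd c x, t) = f (x, h t)" using pt(3)[of "snd c x" "h t"] by (simp add: G_def)
    then show ?thesis using res(5)[OF x t] by simp
  qed
  show ?thesis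
    by (rule exI[of _ W], rule exI[of _ J], rule exI[of _ K], rule exI[of _ h], rule exI[of _ \<beta>], rule exI[of _ N'],
        rule exI[of _ g0], rule exI[of _ v0], rule exI[of _ \<nu>''], rule exI[of _ U], rule exI[of _ V])
       (intro conjI ballI W(1) conW x0W WA J oK DDc(2) res(1-4) fin)
qed

text \<open>Here n is \<open>CARD('m) + 1\<close> and the ambient dimension n + 1 is
  \<open>CARD('k)\<close>. In the converse \<open>h\<close> changes the parameter of the second
  factor, since the base curve must have unit speed and its interval must contain 0; this does not
  affect the product net.\<close>

theorem theorem24:
  fixes A :: "('p::{t2_space, second_countable_topology}, real^'m) chart set"
    and I :: "real set"
  assumes dim: "CARD('k) = CARD('m) + 2"
    and M0: "smooth_atlas A" "connected (points A)"
    and I: "open I" "is_interval I" "0 \<in> I"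
  shows
    "(\<forall>(\<beta> :: real \<Rightarrow> real^'k) N g0 v0 \<nu> U V \<gamma> f R.
        ribaucour_partial_tube A I \<beta> N \<and> metric_decomposition A I N g0 v0 \<nu> \<and>
        smooth_on I V \<and> smooth_map A U \<and>
        \<gamma> = gamma_fun v0 \<nu> U V \<and>
        f = gauss_parametrization (prod_atlas A I) N \<gamma> \<and>
        R = {p \<in> points (prod_atlas A I). regular_point (prod_atlas A I) f p}
        \<longrightarrow>
        smooth_map (prod_atlas A I) \<gamma> \<and> smooth_map (prod_atlas A I) f \<and> open R \<and>
        immersion (restrict_atlas (prod_atlas A I) R) f \<and>
        net_orthogonal (restrict_atlas (prod_atlas A I) R) f \<and>
        second_form_adapted (restrict_atlas (prod_atlas A I) R) f \<and>
        leaves_in_hyperplanes (restrict_atlas (prod_atlas A I) R) f)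
     \<and>
     (\<forall>f :: 'p \<times> real \<Rightarrow> real^'k.
        immersion (prod_atlas A I) f \<and>
        net_orthogonal (prod_atlas A I) f \<and>
        second_form_adapted (prod_atlas A I) f \<and>
        leaves_in_hyperplanes (prod_atlas A I) f \<and>
        shape_operator_rank (prod_atlas A I) f (CARD('m) + 1)
        \<longrightarrow>
        (\<forall>x0\<in>points A. \<forall>s0\<in>I.
           \<exists>W J K h (\<beta> :: real \<Rightarrow> real^'k) N g0 v0 \<nu> U V.
             open W \<and> connected W \<and> x0 \<in> W \<and> W \<subseteq> points A \<and>
             open J \<and> is_interval J \<and> 0 \<in> J \<and>
             open K \<and> is_interval K \<and> s0 \<in> K \<and> K \<subseteq> I \<and> interval_diffeo J K h \<and>
             ribaucour_partial_tube (restrict_atlas A W) J \<beta> N \<and>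
             metric_decomposition (restrict_atlas A W) J N g0 v0 \<nu> \<and>
             smooth_on J V \<and> smooth_map (restrict_atlas A W) U \<and>
             (\<forall>x\<in>W. \<forall>t\<in>J. f (x, h t) =
                gauss_parametrization (prod_atlas (restrict_atlas A W) J) N (gamma_fun v0 \<nu> U V) (x, t))))"
proof (intro conjI allI impI ballI)
  fix \<beta> :: "real \<Rightarrow> real^'k" and N g0 v0 \<nu> U V \<gamma> f R
  assume h: "ribaucour_partial_tube A I \<beta> N \<and> metric_decomposition A I N g0 v0 \<nu> \<and>
        smooth_on I V \<and> smooth_map A U \<and>
        \<gamma> = gamma_fun v0 \<nu> U V \<and>
        f = gauss_parametrization (prod_atlas A I) N \<gamma> \<and>
        R = {p \<in> points (prod_atlas A I). regular_point (prod_atlas A I) f p}"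
  show "smooth_map (prod_atlas A I) \<gamma>" "smooth_map (prod_atlas A I) f" "open R"
    "immersion (restrict_atlas (prod_atlas A I) R) f"
    "net_orthogonal (restrict_atlas (prod_atlas A I) R) f"
    "second_form_adapted (restrict_atlas (prod_atlas A I) R) f"
    "leaves_in_hyperplanes (restrict_atlas (prod_atlas A I) R) f"
    using tube_hypersurface[OF dim M0 I, of \<beta> N g0 v0 \<nu> V U \<gamma> f R] h by blast+
next
  fix f :: "'p \<times> real \<Rightarrow> real^'k" and x0 s0
  assume "immersion (prod_atlas A I) f \<and>
        net_orthogonal (prod_atlas A I) f \<and>
        second_form_adapted (prod_atlas A I) f \<and>
        leaves_in_hyperplanes (prod_atlas A I) f \<and>
        shape_operator_rank (prod_atlas A I) f (CARD('m) + 1)"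
    and "x0 \<in> points A" "s0 \<in> I"
  then show "\<exists>W J K h (\<beta> :: real \<Rightarrow> real^'k) N g0 v0 \<nu> U V.
             open W \<and> connected W \<and> x0 \<in> W \<and> W \<subseteq> points A \<and>
             open J \<and> is_interval J \<and> 0 \<in> J \<and>
             open K \<and> is_interval K \<and> s0 \<in> K \<and> K \<subseteq> I \<and> interval_diffeo J K h \<and>
             ribaucour_partial_tube (restrict_atlas A W) J \<beta> N \<and>
             metric_decomposition (restrict_atlas A W) J N g0 v0 \<nu> \<and>
             smooth_on J V \<and> smooth_map (restrict_atlas A W) U \<and>
             (\<forall>x\<in>W. \<forall>t\<in>J. f (x, h t) =
                gauss_parametrization (prod_atlas (restrict_atlas A W) J) N (gamma_fun v0 \<nu> U V) (x, t))"
    by (intro hypersurface_is_tube[OF dim M0(1) I(1)]) simp_all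
qed

end
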